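(* Let $\alpha\in(\frac12,1)$, $u_0\in\mathcal{B}_b(\mathbb{R}^N)$, $B_0\in C_b^{0,3}([0,T]\times\mathbb{R}^N;\mathbb{R}^N)$, $f\in C([0,T];\mathbb{R}^N)$, $B(t,x)=B_0(t,x)-f(t)$, and let $n\ge1$ be an integer. For every $x\in\mathbb{R}^N$ and $0\le s<t\le T$, one has $$v_s^{n+1}(t,x)=\int_s^tds_1\int_{s_1}^tds_2\cdots\int_{s_n}^tds_{n+1}\,(\mathbb{E}_0\otimes\mathbb{E}_1\otimes\cdots\otimes\mathbb{E}_{n+1})\Big[u_0(Y)\prod_{j=1}^{n+1}\Big\langle\big(I_j(\omega_{j-1})\big)^{-\frac12}e^{(s_{n-j+3}-s_{n-j+2})A}B(s_{n-j+2},Y_j),\,\Delta_j(\omega_{n+1})\Big\rangle\Big],$$ where $s_{n+2}=t$ and, for $j=1,\dots,n+1$, $$I_j=I^L_{s_{n-j+2},s_{n-j+3}},\qquad F_j=F_{s_{n-j+2},s_{n-j+3}},\qquad \Delta_j=I_j^{-\frac12}\big(Z^{s,x}_{s_{n-j+3}}-e^{(s_{n-j+3}-s_{n-j+2})A}Z^{s,x}_{s_{n-j+2}}-F_j\big),$$ $$Y=\sum_{j=1}^{n+1}e^{(t-s_{n-j+3})A}\Big[F_j+\big(I_j(\omega_{j-1})\big)^{\frac12}\Delta_j(\omega_{n+1})\Big]+e^{(t-s_1)A}Z^{s,x}_{s_1}(\omega_{n+1}),$$ $$Y_j=\sum_{k=j+1}^{n+1}e^{(s_{n-j+2}-s_{n-k+3})A}\Big[\big(I_k(\omega_{k-1})\big)^{\frac12}\Delta_k(\omega_{n+1})+F_k\Big]+e^{(s_{n-j+2}-s_1)A}Z^{s,x}_{s_1}(\omega_{n+1}),$$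 the empty sum being $0$.
   Context: Fix $N\in\mathbb{N}$, $T>0$ and a complete probability space $(\Omega,\mathcal{F},\mathbb{P})$. $W=(\beta^1,\dots,\beta^N)^\top$ is a standard $N$-dimensional Brownian motion and $L=(L_t)_{t\ge0}$ is a strictly $\alpha$-stable subordinator (increasing Lévy process) independent of $W$, with $\mathbb{E}[e^{iuL_1}]=\exp\{-\bar\gamma^\alpha|u|^\alpha(1-i\tan\frac{\pi\alpha}{2}\,\mathrm{sign}\,u)\}$, $u\in\mathbb{R}$, for some $\bar\gamma>0$. $W_L=(W_{L_t})_{t\ge0}$ is the subordinated Brownian motion. $A=-\mathrm{diag}[\lambda_1,\dots,\lambda_N]$ with $0<\lambda_1\le\dots\le\lambda_N$, $Q=\mathrm{diag}[\sigma_1^2,\dots,\sigma_N^2]$ with $\sigma_n^2>0$. $\mathcal{B}_b(\mathbb{R}^N)$ denotes the real-valued bounded Borel functions; $C_b^{0,n}([0,T]\times\mathbb{R}^N;\mathbb{R}^N)$ is the space of bounded continuous maps whose partial derivatives in the space variable up to order $n$ exist, are continuous and bounded. $Z^{s,x}=(Z^{s,x}_t)_{t\in[s,T]}$ is the unique solution of $dZ_t^{s,x}=(AZ_t^{s,x}+f(t))dt+\sqrt{Q}\,dW_{L_t}$, $Z_s^{s,x}=x$. For $0\le s\le t\le T$, $R_{s,t}\phi(x)=\mathbb{E}[\phi(Z_t^{s,x})]$, $\phi\in\mathcal{B}_b(\mathbb{R}^N)$. For $0\le s<t\le T$, $F_{s,t}=\int_s^te^{(t-r)A}f(r)\,dr\in\mathbb{R}^N$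 and $I^L_{s,t}=\int_s^te^{2(t-r)A}Q\,dL_r$ (a random diagonal matrix, a.s. positive definite). The functions $v^n_s(t,x)$ are defined recursively, for $t\in(0,T]$, $s\in[0,t]$, $u\in[0,t)$, $x\in\mathbb{R}^N$, $n\in\mathbb{N}\cup\{0\}$, by $$v^0_s(t,x)=R_{s,t}u_0(x),\qquad k^n_{u,t}(x)=\langle B(u,x),\nabla^\top v^n_u(t,x)\rangle,\qquad v^{n+1}_s(t,x)=\int_s^tR_{s,u}k^n_{u,t}(x)\,du,$$ where $\nabla^\top$ is the (column) gradient in $x$; these are well defined. $\Omega_0,\Omega_1,\dots,\Omega_{n+1}$ are copies of the probability space $\Omega$, with generic elements $\omega_0,\dots,\omega_{n+1}$; $\mathbb{E}_k$ is the expectation on $\Omega_k$ and $\mathbb{E}_0\otimes\cdots\otimes\mathbb{E}_{n+1}$ is the expectation on the product probability space. For a random variable $\xi$ on $\Omega$, $\xi(\omega_k)$ denotes its copy on $\Omega_k$. *)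

theory Defs
  imports "HOL-Probability.Probability"
begin

definition diag :: "real ^ 'n \<Rightarrow> real ^ 'n ^ 'n" where
  "diag d = (\<chi> i j. if i = j then d $ i else 0)"

definition mexp :: "real ^ 'n ^ 'n \<Rightarrow> real ^ 'n ^ 'n" where
  "mexp X = (\<Sum>k. (1 / fact k) *\<^sub>R (((**) X ^^ k) (mat 1)))"

definition pos_semidef :: "real ^ 'n ^ 'n \<Rightarrow> bool" where
  "pos_semidef S \<longleftrightarrow> transpose S = S \<and> (\<forall>x. 0 \<le> x \<bullet> (S *v x))"

definition msqrt :: "real ^ 'n ^ 'n \<Rightarrow> real ^ 'n ^ 'n" where
  "msqrt P = (THE S. pos_semidef S \<and> S ** S = P)"

abbreviation minvsqrt :: "real ^ 'n ^ 'n \<Rightarrow> real ^ 'n ^ 'n" where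
  "minvsqrt P \<equiv> matrix_inv (msqrt P)"

lemma diag_mult: "diag a ** diag b = diag (\<chi> i. a $ i * b $ i)"
  by (simp add: diag_def matrix_matrix_mult_def vec_eq_iff if_distrib[where f="\<lambda>x. x * _"]
      if_distrib[where f="\<lambda>x. _ * x"] cong: if_cong)

lemma mexp_diag: "mexp (diag d) = diag (\<chi> i. exp (d $ i))"
proof -
  have pow: "((**) (diag d) ^^ k) (mat 1) = diag (\<chi> i. d $ i ^ k)" for k
    by (induction k) (simp_all add: diag_mult, simp add: diag_def mat_def vec_eq_iff)
  have "(\<lambda>k. (1 / fact k) *\<^sub>R (((**) (diag d) ^^ k) (mat 1))) sums diag (\<chi> i. exp (d $ i))"
    unfolding sums_def pow
  proof (intro vec_tendstoI)
    fix i j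
    show "(\<lambda>n. (\<Sum>k<n. (1 / fact k) *\<^sub>R diag (\<chi> i. d $ i ^ k)) $ i $ j)
            \<longlonglongrightarrow> diag (\<chi> i. exp (d $ i)) $ i $ j"
      using exp_converges[of "d $ i"]
      by (cases "i = j") (simp_all add: diag_def sums_def divide_inverse)
  qed
  then show ?thesis
    unfolding mexp_def by (rule sums_unique[symmetric])
qed

lemma msqrt_diag:
  fixes d :: "real ^ 'n"
  assumes d: "\<And>i. 0 \<le> d $ i"
  shows "msqrt (diag d) = diag (\<chi> i. sqrt (d $ i))"
  unfolding msqrt_def
proof (rule the_equality)
  let ?T = "diag (\<chi> i. sqrt (d $ i))"
  have Tv: "?T *v x = (\<chi> i. sqrt (d $ i) * x $ i)" for x :: "real ^ 'n"
    by (simp add: diag_def matrix_vector_mult_def vec_eq_iff if_distrib[where f="\<lambda>x. x * _"]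
        cong: if_cong)
  have "0 \<le> x \<bullet> (?T *v x)" for x
    unfolding Tv inner_vec_def
    by (intro sum_nonneg) (use d in \<open>simp add: mult.left_commute[of _ "sqrt _"]\<close>)
  moreover have "transpose ?T = ?T"
    by (auto simp: diag_def transpose_def vec_eq_iff)
  moreover have "?T ** ?T = diag d"
    unfolding diag_mult using d by (simp add: diag_def vec_eq_iff)
  ultimately show T: "pos_semidef ?T \<and> ?T ** ?T = diag d"
    by (simp add: pos_semidef_def)
  fix S assume S: "pos_semidef S \<and> S ** S = diag d"
  have "S ** diag d = diag d ** S"
    using S by (metis matrix_mul_assoc)
  then have comm: "S $ i $ j * d $ j = d $ i * S $ i $ j" for i j
    by (simp add: vec_eq_iff diag_def matrix_matrix_mult_def if_distrib[where f="\<lambda>x. x * _"]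
        if_distrib[where f="\<lambda>x. _ * x"] cong: if_cong)
  have "S $ i $ j * sqrt (d $ j) = sqrt (d $ i) * S $ i $ j" for i j
    using comm[of i j] by (cases "S $ i $ j = 0") auto
  then have comm': "S ** ?T = ?T ** S"
    by (simp add: vec_eq_iff diag_def matrix_matrix_mult_def if_distrib[where f="\<lambda>x. x * _"]
        if_distrib[where f="\<lambda>x. _ * x"] cong: if_cong)
  have symS: "(S *v x) \<bullet> y = x \<bullet> (S *v y)" for x y
    using S by (metis dot_lmul_matrix pos_semidef_def vector_transpose_matrix)
  have psd0: "P *v x = 0" if P: "pos_semidef P" and 0: "x \<bullet> (P *v x) = 0" for P :: "real^'n^'n" and x
  proof -
    have sym: "y \<bullet> (P *v x) = x \<bullet> (P *v y)" for y
      using P by (metis dot_lmul_matrix pos_semidef_def vector_transpose_matrix inner_commute)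
    define y where "y = P *v x"
    have "0 \<le> 2 * c * (y \<bullet> y) + c\<^sup>2 * (y \<bullet> (P *v y))" for c
    proof -
      have "0 \<le> (x + c *\<^sub>R y) \<bullet> (P *v (x + c *\<^sub>R y))"
        using P by (simp add: pos_semidef_def)
      also have "\<dots> = x \<bullet> (P *v x) + c * (x \<bullet> (P *v y)) + c * (y \<bullet> (P *v x)) + c\<^sup>2 * (y \<bullet> (P *v y))"
        by (simp add: matrix_vector_right_distrib matrix_vector_mult_scaleR
            inner_add_left inner_add_right power2_eq_square algebra_simps)
      finally show ?thesis
        using 0 sym[of y] by (simp add: y_def)
    qed note * = this
    have a: "0 \<le> y \<bullet> (P *v y)" using P by (simp add: pos_semidef_def)
    define a where "a = y \<bullet> (P *v y)"
    have "y \<bullet> y \<le> 0"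
    proof (rule ccontr)
      assume "\<not> y \<bullet> y \<le> 0"
      then have yy: "0 < y \<bullet> y" by linarith
      have a1: "0 < a + 1" using a by (simp add: a_def)
      define c where "c = - (y \<bullet> y) / (a + 1)"
      have "2 * c * (y \<bullet> y) + c\<^sup>2 * a = (y \<bullet> y)\<^sup>2 / (a + 1) * (a / (a + 1) - 2)"
        by (simp add: c_def power2_eq_square divide_inverse algebra_simps)
      moreover have "a / (a + 1) - 2 < 0" using a1 by (simp add: field_simps)
      moreover have "0 < (y \<bullet> y)\<^sup>2 / (a + 1)" using yy a1 by simp
      ultimately show False
        using *[of c] mult_pos_neg[of "(y \<bullet> y)\<^sup>2 / (a + 1)" "a / (a + 1) - 2"] by (simp add: a_def)
    qed
    then show ?thesis unfolding y_def by (metis inner_gt_zero_iff not_le)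
  qed
  have "(S - ?T) *v y = 0" for y
  proof -
    define x where "x = S *v y - ?T *v y"
    have "(S *v x + ?T *v x) = 0"
    proof -
      have 1: "S *v (S *v y) = ?T *v (?T *v y)"
        using S T by (metis matrix_vector_mul_assoc)
      have 2: "S *v (?T *v y) = ?T *v (S *v y)"
        using comm' by (metis matrix_vector_mul_assoc)
      show ?thesis
        unfolding x_def matrix_vector_mult_diff_distrib 1 2 by simp
    qed
    then have "x \<bullet> (S *v x) + x \<bullet> (?T *v x) = 0"
      by (metis inner_add_right inner_zero_right)
    moreover have "0 \<le> x \<bullet> (S *v x)" "0 \<le> x \<bullet> (?T *v x)"
      using S T by (auto simp: pos_semidef_def)
    ultimately have "x \<bullet> (S *v x) = 0" "x \<bullet> (?T *v x) = 0" by linarith+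
    then have z: "S *v x = 0" "?T *v x = 0"
      using psd0 S T by blast+
    have "x \<bullet> x = (S *v y) \<bullet> x - (?T *v y) \<bullet> x"
      by (simp add: x_def inner_diff_left)
    also have "(S *v y) \<bullet> x = y \<bullet> (S *v x)" by (rule symS)
    also have "(?T *v y) \<bullet> x = y \<bullet> (?T *v x)"
      using T by (metis dot_lmul_matrix pos_semidef_def vector_transpose_matrix)
    finally have "x = 0" using z by simp
    then show ?thesis by (simp add: x_def matrix_vector_mult_diff_rdistrib)
  qed
  then have "S - ?T = 0"
    by (simp add: matrix_eq)
  then show "S = ?T" by simp
qed

definition bounded_borel :: "(real ^ 'n \<Rightarrow> real) \<Rightarrow> bool" where
  "bounded_borel \<phi> \<longleftrightarrow> \<phi> \<in> borel_measurable borel \<and> bounded (range \<phi>)"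

definition bounded_cont :: "real \<Rightarrow> (real \<Rightarrow> real ^ 'n \<Rightarrow> real ^ 'n) \<Rightarrow> bool" where
  "bounded_cont T g \<longleftrightarrow>
     continuous_on ({0..T} \<times> UNIV) (\<lambda>(t, x). g t x) \<and>
     bounded ((\<lambda>(t, x). g t x) ` ({0..T} \<times> UNIV))"

primrec Cb0 :: "nat \<Rightarrow> real \<Rightarrow> (real \<Rightarrow> real ^ 'n \<Rightarrow> real ^ 'n) \<Rightarrow> bool" where
  "Cb0 0 T g \<longleftrightarrow> bounded_cont T g"
| "Cb0 (Suc k) T g \<longleftrightarrow> bounded_cont T g \<and>
     (\<forall>i. \<exists>D. (\<forall>t\<in>{0..T}. \<forall>x. ((\<lambda>h. g t (x + h *\<^sub>R axis i 1)) has_vector_derivative D t x) (at 0)) \<and>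
              Cb0 k T D)"

definition gradient :: "(real ^ 'n \<Rightarrow> real) \<Rightarrow> real ^ 'n \<Rightarrow> real ^ 'n" where
  "gradient g x = (THE D. GDERIV g x :> D)"

text \<open>At an end point of \<open>I\<close> the corresponding one-sided filter is trivial, so only the
  meaningful one-sided limits are required.\<close>

definition cadlag_on :: "real set \<Rightarrow> (real \<Rightarrow> 'b::topological_space) \<Rightarrow> bool" where
  "cadlag_on I g \<longleftrightarrow>
     (\<forall>t\<in>I. (g \<longlongrightarrow> g t) (at t within I \<inter> {t<..}) \<and> (\<exists>l. (g \<longlongrightarrow> l) (at t within I \<inter> {..<t})))"

definition indep_increments :: "'a measure \<Rightarrow> (real \<Rightarrow> 'a \<Rightarrow> 'b::euclidean_space) \<Rightarrow> bool" where
  "indep_increments M X \<longleftrightarrow>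
     (\<forall>m \<tau>. mono_on {..m::nat} \<tau> \<longrightarrow> 0 \<le> \<tau> 0 \<longrightarrow>
        prob_space.indep_vars M (\<lambda>_. borel) (\<lambda>k \<omega>. X (\<tau> (Suc k)) \<omega> - X (\<tau> k) \<omega>) {..<m})"

definition brownian_motion :: "'a measure \<Rightarrow> (real \<Rightarrow> 'a \<Rightarrow> real ^ 'n) \<Rightarrow> bool" where
  "brownian_motion M W \<longleftrightarrow>
     (\<forall>t\<ge>0. W t \<in> borel_measurable M) \<and>
     (AE \<omega> in M. W 0 \<omega> = 0) \<and>
     indep_increments M W \<and>
     (\<forall>s t. 0 \<le> s \<longrightarrow> s < t \<longrightarrow>
        distributed M lborel (\<lambda>\<omega>. W t \<omega> - W s \<omega>)
          (\<lambda>x. ennreal (\<Prod>i\<in>UNIV. normal_density 0 (sqrt (t - s)) (x $ i)))) \<and>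
     (AE \<omega> in M. continuous_on {0..} (\<lambda>t. W t \<omega>))"

definition levy_process :: "'a measure \<Rightarrow> (real \<Rightarrow> 'a \<Rightarrow> real) \<Rightarrow> bool" where
  "levy_process M L \<longleftrightarrow>
     (\<forall>t\<ge>0. L t \<in> borel_measurable M) \<and>
     (AE \<omega> in M. L 0 \<omega> = 0) \<and>
     indep_increments M L \<and>
     (\<forall>s t. 0 \<le> s \<longrightarrow> s \<le> t \<longrightarrow>
        distr M borel (\<lambda>\<omega>. L t \<omega> - L s \<omega>) = distr M borel (L (t - s))) \<and>
     (AE \<omega> in M. cadlag_on {0..} (\<lambda>t. L t \<omega>))"

definition subordinator :: "'a measure \<Rightarrow> (real \<Rightarrow> 'a \<Rightarrow> real) \<Rightarrow> bool" where
  "subordinator M L \<longleftrightarrow> levy_process M L \<and> (AE \<omega> in M. mono_on {0..} (\<lambda>t. L t \<omega>))"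

text \<open>For a Levy process, strict \<open>\<alpha>\<close>-stability is a condition on one-dimensional laws.\<close>

definition strictly_stable :: "'a measure \<Rightarrow> real \<Rightarrow> (real \<Rightarrow> 'a \<Rightarrow> real) \<Rightarrow> bool" where
  "strictly_stable M \<alpha> L \<longleftrightarrow>
     (\<forall>c>0. distr M borel (L c) = distr M borel (\<lambda>\<omega>. c powr (1 / \<alpha>) * L 1 \<omega>))"

definition process_sigma :: "'a measure \<Rightarrow> (real \<Rightarrow> 'a \<Rightarrow> 'b::topological_space) \<Rightarrow> 'a set set" where
  "process_sigma M X =
     sigma_sets (space M) {X t -` S \<inter> space M | t S. 0 \<le> t \<and> S \<in> sets borel}"

text \<open>The noise of the equation is additive, so that the stochastic integral of the constant
  matrix \<open>msqrt Q\<close> is that matrix times the increment of the subordinated Brownian motion.\<close>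

definition sde_solution ::
  "'a measure \<Rightarrow> (real \<Rightarrow> 'a \<Rightarrow> real ^ 'n) \<Rightarrow> (real \<Rightarrow> 'a \<Rightarrow> real) \<Rightarrow> real ^ 'n ^ 'n \<Rightarrow> real ^ 'n ^ 'n \<Rightarrow>
   (real \<Rightarrow> real ^ 'n) \<Rightarrow> real \<Rightarrow> real \<Rightarrow> real ^ 'n \<Rightarrow> (real \<Rightarrow> 'a \<Rightarrow> real ^ 'n) \<Rightarrow> bool" where
  "sde_solution M W L A Q f T s x X \<longleftrightarrow>
     (\<forall>t\<in>{s..T}. X t \<in> borel_measurable M) \<and>
     (AE \<omega> in M. cadlag_on {s..T} (\<lambda>t. X t \<omega>) \<and>
        (\<forall>t\<in>{s..T}. X t \<omega> = x + (LINT r:{s..t}|lborel. A *v X r \<omega> + f r)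
                             + msqrt Q *v (W (L t \<omega>) \<omega> - W (L s \<omega>) \<omega>)))"

definition Fint :: "real ^ 'n ^ 'n \<Rightarrow> (real \<Rightarrow> real ^ 'n) \<Rightarrow> real \<Rightarrow> real \<Rightarrow> real ^ 'n" where
  "Fint A f s t = (LINT r:{s..t}|lborel. mexp ((t - r) *\<^sub>R A) *v f r)"

text \<open>Pathwise Lebesgue--Stieltjes integral over \<open>]s, t]\<close>. The path lives on \<open>[0, \<infinity>[\<close> and is
  extended by its value at 0, because \<^const>\<open>interval_measure\<close> expects a function on the whole line.\<close>

definition IL ::
  "(real \<Rightarrow> 'a \<Rightarrow> real) \<Rightarrow> real ^ 'n ^ 'n \<Rightarrow> real ^ 'n ^ 'n \<Rightarrow> real \<Rightarrow> real \<Rightarrow> 'a \<Rightarrow> real ^ 'n ^ 'n" where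
  "IL L A Q s t \<omega> =
     (LINT r:{s<..t}|interval_measure (\<lambda>r. L (max 0 r) \<omega>). mexp ((2 * (t - r)) *\<^sub>R A) ** Q)"

text \<open>\<open>Z s x t \<omega>\<close> is the value at time \<open>t\<close> of the solution started at time \<open>s\<close> from \<open>x\<close>.\<close>

definition Rop ::
  "'a measure \<Rightarrow> (real \<Rightarrow> real ^ 'n \<Rightarrow> real \<Rightarrow> 'a \<Rightarrow> real ^ 'n) \<Rightarrow> real \<Rightarrow> real \<Rightarrow>
   (real ^ 'n \<Rightarrow> real) \<Rightarrow> real ^ 'n \<Rightarrow> real" where
  "Rop M Z s t \<phi> x = (LINT \<omega>|M. \<phi> (Z s x t \<omega>))"

primrec viter ::
  "'a measure \<Rightarrow> (real \<Rightarrow> real ^ 'n \<Rightarrow> real \<Rightarrow> 'a \<Rightarrow> real ^ 'n) \<Rightarrow> (real \<Rightarrow> real ^ 'n \<Rightarrow> real ^ 'n) \<Rightarrow>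
   (real ^ 'n \<Rightarrow> real) \<Rightarrow> nat \<Rightarrow> real \<Rightarrow> real \<Rightarrow> real ^ 'n \<Rightarrow> real" where
  "viter M Z B u0 0 s t x = Rop M Z s t u0 x"
| "viter M Z B u0 (Suc n) s t x =
     (LINT u:{s..<t}|lborel.
        Rop M Z s u (\<lambda>y. B u y \<bullet> gradient (\<lambda>z. viter M Z B u0 n u t z) y) x)"

text \<open>\<open>simplex_integral m s t G\<close> is the iterated integral of \<open>G [s\<^sub>1, \<dots>, s\<^sub>m]\<close> with
  \<open>s\<^sub>1\<close> ranging (outermost) over \<open>[s, t]\<close> and each \<open>s\<^sub>k\<^sub>+\<^sub>1\<close> over \<open>[s\<^sub>k, t]\<close>.\<close>

primrec simplex_integral :: "nat \<Rightarrow> real \<Rightarrow> real \<Rightarrow> (real list \<Rightarrow> real) \<Rightarrow> real" where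
  "simplex_integral 0 s t G = G []"
| "simplex_integral (Suc m) s t G =
     (LINT r:{s..t}|lborel. simplex_integral m r t (\<lambda>rs. G (r # rs)))"

end

theory Submission
  imports Defs
begin

text \<open>Given the path of \<open>L\<close>, variation of constants turns the noise of the equation over a block of
  time into a centred Gaussian vector whose covariance is the random diagonal matrix \<open>I\<^sup>L\<close>, and disjoint
  blocks are conditionally independent; after normalisation the noise is standard Gaussian and
  independent of \<open>L\<close>. This is read off from characteristic functions of Riemann sums. Hence \<open>R\<close> is
  a kernel that averages a Gaussian law over its random covariance, and integration by parts (Cameron--Martin)
  moves the gradient of \<open>R \<phi>\<close> from \<open>\<phi>\<close> to a weight that is linear in the normalised noise. The negative
  half moment of a stable subordinator bounds this weight by a multiple of \<open>h powr (-1/(2\<alpha>))\<close> for a time step \<open>h\<close>,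
  which is integrable because \<open>\<alpha> > 1/2\<close>, so that the recursion for \<open>v\<close> can be unfolded by Fubini.
  In the resulting iterated integral the covariance of each block has an independent copy of \<open>L\<close> while the
  normalised noises of all blocks may be taken from a single copy of the process.\<close>

section \<open>Laws determined by characteristic functions\<close>

text \<open>Conditioning on \<open>L\<close> is never a conditional expectation here but an equality
  of joint laws: the covariances and noises of all blocks are distributed like \<open>etaL\<close>
  together with \<open>vscale etaL xi\<close>, the Gaussian \<open>xi\<close> living on a further
  factor. The obstacle is that a chain of kernels draws a fresh path of \<open>L\<close> and a fresh
  Gaussian for every block, whereas on the original space all blocks share one path and their
  covariances and noises are entangled. Only the Gaussian parts can be merged: divided by the random
  square root they are independent of \<open>L\<close>, so one copy of the process supplies all of
  them, and the covariances that scale them must come from elsewhere. The block from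
  \<open>s\<close> to the first intermediate time carries no gradient, hence no weight; its noise
  stays unnormalised and its covariance stays on the same copy. This explains the number of copies
  and the special role of index 0 throughout. The estimates survive the recursion because
  singularities of order b = 1/(2 \<alpha>) at both ends of a time interval integrate to one of the
  same order in its length: the constants change from step to step, the exponent does not.\<close>

lemma char_distr_density:
  fixes g :: "'a \<Rightarrow> real"
  assumes "prob_space M" and [measurable]: "g \<in> borel_measurable M" "U \<in> borel_measurable M"
    and g: "\<And>\<omega>. 0 \<le> g \<omega>" and ig: "integrable M g" and cc: "(LINT \<omega>|M. g \<omega>) = c" and c: "0 < c"
    and A: "A \<in> sets borel"
  defines "D \<equiv> distr (density M (\<lambda>\<omega>. ennreal (g \<omega> / c))) borel U"
  shows "real_distribution D"
    and "char D p = (CLINT \<omega>|M. complex_of_real (g \<omega>) * iexp (p * U \<omega>)) / c"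
    and "measure D A = (LINT \<omega>|M. g \<omega> * indicator A (U \<omega>)) / c"
proof -
  interpret M: prob_space M by fact
  have "(\<integral>\<^sup>+\<omega>. ennreal (g \<omega> / c) \<partial>M) = ennreal (LINT \<omega>|M. g \<omega> / c)"
    using ig g c by (intro nn_integral_eq_integral) auto
  also have "\<dots> = 1" using cc c by simp
  finally have ps: "prob_space (density M (\<lambda>\<omega>. ennreal (g \<omega> / c)))"
    by (intro prob_spaceI) (simp add: emeasure_density cong: nn_integral_cong_simp)
  interpret ps: prob_space "density M (\<lambda>\<omega>. ennreal (g \<omega> / c))" by (rule ps)
  show "real_distribution D"
    unfolding D_def by (intro ps.real_distribution_distr) simp
  have "char D p = (CLINT \<omega>|M. (g \<omega> / c) *\<^sub>R iexp (p * U \<omega>))"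
    unfolding D_def char_def using g c
    by (subst integral_distr, simp, simp) (subst integral_density, auto)
  also have "\<dots> = (CLINT \<omega>|M. (complex_of_real (g \<omega>) * iexp (p * U \<omega>)) / c)"
    by (intro Bochner_Integration.integral_cong) (auto simp: scaleR_conv_of_real)
  finally show "char D p = (CLINT \<omega>|M. complex_of_real (g \<omega>) * iexp (p * U \<omega>)) / c" by simp
  have "measure D A = (LINT x|D. indicator A x)"
    using A by (simp add: D_def)
  also have "\<dots> = (LINT \<omega>|M. (g \<omega> / c) *\<^sub>R indicator A (U \<omega>))"
    unfolding D_def using g c A
    by (subst integral_distr, simp, simp) (subst integral_density, auto)
  also have "\<dots> = (LINT \<omega>|M. (g \<omega> * indicator A (U \<omega>)) / c)"
    by (intro Bochner_Integration.integral_cong) auto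
  finally show "measure D A = (LINT \<omega>|M. g \<omega> * indicator A (U \<omega>)) / c" by simp
qed

lemma emeasure_distr_PiM_rectangle:
  fixes Z :: "'i \<Rightarrow> 'a \<Rightarrow> 'b::topological_space"
  assumes "prob_space M" and I: "finite I" and [measurable]: "\<And>i. Z i \<in> borel_measurable M"
    and A: "\<And>i. i \<in> I \<Longrightarrow> A i \<in> sets borel"
  shows "emeasure (distr M (PiM I (\<lambda>_. borel)) (\<lambda>\<omega>. \<lambda>i\<in>I. Z i \<omega>)) (Pi\<^sub>E I A) =
    ennreal (LINT \<omega>|M. (\<Prod>j\<in>I. indicator (A j) (Z j \<omega>)))"
proof -
  interpret prob_space M by fact
  let ?S = "(\<lambda>\<omega>. \<lambda>i\<in>I. Z i \<omega>) -` (Pi\<^sub>E I A) \<inter> space M"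
  have "emeasure (distr M (PiM I (\<lambda>_. borel)) (\<lambda>\<omega>. \<lambda>i\<in>I. Z i \<omega>)) (Pi\<^sub>E I A) = emeasure M ?S"
    using A I by (subst emeasure_distr) (auto intro!: sets_PiM_I_finite)
  also have "\<dots> = ennreal (LINT \<omega>|M. indicator ?S \<omega>)"
  proof -
    have "?S \<in> sets M"
      by (rule measurable_sets[where A="PiM I (\<lambda>_. borel)"]) (use A I in \<open>auto intro!: sets_PiM_I_finite\<close>)
    then show ?thesis by (simp add: emeasure_eq_measure)
  qed
  also have "(LINT \<omega>|M. indicator ?S \<omega> :: real) = (LINT \<omega>|M. (\<Prod>j\<in>I. indicator (A j) (Z j \<omega>)))"
  proof (intro Bochner_Integration.integral_cong refl)
    fix \<omega> assume "\<omega> \<in> space M"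
    then show "(indicator ?S \<omega>::real) = (\<Prod>j\<in>I. indicator (A j) (Z j \<omega>))"
      using I by (auto simp: indicator_def Pi_iff prod_zero_iff intro!: prod.neutral[symmetric])
  qed
  finally show ?thesis .
qed

lemma integral_lin3:
  fixes a b e :: "'a \<Rightarrow> complex"
  assumes "integrable M a" "integrable M b" "integrable M e"
  shows "(LINT x|M. a x + c * b x + d * e x) = (LINT x|M. a x) + c * (LINT x|M. b x) + d * (LINT x|M. e x)"
  using assms by simp

text \<open>Taking \<open>p = 0\<close> shows that both weights have the same total mass
  \<open>c\<close>. If it is positive, dividing by it gives two probability laws with equal
  characteristic functions, to which one-dimensional Levy uniqueness applies; if it is zero, both
  weights vanish almost surely.\<close>

lemma weighted_char_unique:
  fixes g :: "'a \<Rightarrow> real" and h :: "'b \<Rightarrow> real"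
  assumes M: "prob_space M" and N: "prob_space N"
    and [measurable]: "g \<in> borel_measurable M" "U \<in> borel_measurable M"
      "h \<in> borel_measurable N" "V \<in> borel_measurable N"
    and g: "\<And>\<omega>. 0 \<le> g \<omega>" "\<And>\<omega>. g \<omega> \<le> C" and h: "\<And>\<omega>. 0 \<le> h \<omega>" "\<And>\<omega>. h \<omega> \<le> C"
    and eq: "\<And>p. (CLINT \<omega>|M. complex_of_real (g \<omega>) * iexp (p * U \<omega>)) =
                 (CLINT \<omega>|N. complex_of_real (h \<omega>) * iexp (p * V \<omega>))"
    and A: "A \<in> sets borel"
  shows "(LINT \<omega>|M. g \<omega> * indicator A (U \<omega>)) = (LINT \<omega>|N. h \<omega> * indicator A (V \<omega>))"
proof -
  interpret M: prob_space M by fact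
  interpret N: prob_space N by fact
  have ig: "integrable M g"
    by (rule M.integrable_const_bound[of _ C]) (use g in auto)
  have ih: "integrable N h"
    by (rule N.integrable_const_bound[of _ C]) (use h in auto)
  define c where "c = (LINT \<omega>|M. g \<omega>)"
  have "complex_of_real c = complex_of_real (LINT \<omega>|N. h \<omega>)"
    using eq[of 0] by (simp add: c_def)
  then have c2: "c = (LINT \<omega>|N. h \<omega>)" by (simp only: of_real_eq_iff)
  have c0: "0 \<le> c" unfolding c_def by (intro Bochner_Integration.integral_nonneg g)
  show ?thesis
  proof (cases "c = 0")
    case True
    have "AE \<omega> in M. g \<omega> = 0"
      using integral_nonneg_eq_0_iff_AE[OF ig] g True c_def by auto
    then have 1: "(LINT \<omega>|M. g \<omega> * indicator A (U \<omega>)) = (LINT \<omega>|M. 0)"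
      using A by (intro integral_cong_AE) auto
    have "AE \<omega> in N. h \<omega> = 0"
      using integral_nonneg_eq_0_iff_AE[OF ih] h True c2 by auto
    then have 2: "(LINT \<omega>|N. h \<omega> * indicator A (V \<omega>)) = (LINT \<omega>|N. 0)"
      using A by (intro integral_cong_AE) auto
    show ?thesis using 1 2 by simp
  next
    case False
    then have c: "0 < c" using c0 by simp
    note D1 = char_distr_density[OF M \<open>g \<in> _\<close> \<open>U \<in> _\<close> g(1) ig c_def[symmetric] c A]
      and D2 = char_distr_density[OF N \<open>h \<in> _\<close> \<open>V \<in> _\<close> h(1) ih c2[symmetric] c A]
    have "distr (density M (\<lambda>\<omega>. ennreal (g \<omega> / c))) borel U = distr (density N (\<lambda>\<omega>. ennreal (h \<omega> / c))) borel V"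
      by (rule Levy_uniqueness[OF D1(1) D2(1)], rule ext) (simp only: D1(2) D2(2) eq)
    with D1(3) D2(3) c show ?thesis by simp
  qed
qed

text \<open>Uniqueness in several dimensions is reduced to the line. One coordinate at a time is
  taken out of the exponential and tested with the indicator of a Borel set instead, the indicators
  obtained so far acting as a weight. Once all coordinates are exchanged, the laws agree on
  rectangles.\<close>

lemma char_unique_finite:
  fixes X :: "'i \<Rightarrow> 'a \<Rightarrow> real" and Y :: "'i \<Rightarrow> 'b \<Rightarrow> real"
  assumes M: "prob_space M" and N: "prob_space N" and I: "finite I"
    and X[measurable]: "\<And>i. X i \<in> borel_measurable M"
    and Y[measurable]: "\<And>i. Y i \<in> borel_measurable N"
    and char: "\<And>v. (CLINT \<omega>|M. iexp (\<Sum>i\<in>I. v i * X i \<omega>)) = (CLINT \<omega>|N. iexp (\<Sum>i\<in>I. v i * Y i \<omega>))"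
  shows "distr M (PiM I (\<lambda>_. borel)) (\<lambda>\<omega>. \<lambda>i\<in>I. X i \<omega>) = distr N (PiM I (\<lambda>_. borel)) (\<lambda>\<omega>. \<lambda>i\<in>I. Y i \<omega>)"
proof -
  interpret M: prob_space M by fact
  interpret N: prob_space N by fact
  define wX where "wX J A \<omega> = (\<Prod>j\<in>J. indicator (A j) (X j \<omega>) :: real)" for J A \<omega>
  define wY where "wY J A \<omega> = (\<Prod>j\<in>J. indicator (A j) (Y j \<omega>) :: real)" for J A \<omega>
  have w01: "0 \<le> wX J A \<omega>" "wX J A \<omega> \<le> 1" "0 \<le> wY J A \<omega>'" "wY J A \<omega>' \<le> 1" for J A \<omega> \<omega>'
    unfolding wX_def wY_def by (auto intro!: prod_nonneg prod_le_1)
  have main: "\<forall>v. (CLINT \<omega>|M. complex_of_real (wX J A \<omega>) * iexp (\<Sum>i\<in>I - J. v i * X i \<omega>)) =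
                  (CLINT \<omega>|N. complex_of_real (wY J A \<omega>) * iexp (\<Sum>i\<in>I - J. v i * Y i \<omega>))"
    if "finite J" "J \<subseteq> I" and A: "\<And>j. A j \<in> sets borel" for J and A :: "'i \<Rightarrow> real set"
    using that(1,2)
  proof (induction J rule: finite_induct)
    case empty
    then show ?case using char by (simp add: wX_def wY_def)
  next
    case (insert k J)
    note A[measurable]
    have [measurable]: "wX J A \<in> borel_measurable M" "wY J A \<in> borel_measurable N"
      unfolding wX_def wY_def by measurable
    have kI: "k \<in> I" "J \<subseteq> I" "k \<in> I - J" using insert by auto
    have fin: "finite (I - J)" using I by auto
    show ?case
    proof
      fix v :: "'i \<Rightarrow> real"
      define SX where "SX \<omega> = (\<Sum>i\<in>I - insert k J. v i * X i \<omega>)" for \<omega>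
      define SY where "SY \<omega> = (\<Sum>i\<in>I - insert k J. v i * Y i \<omega>)" for \<omega>
      have [measurable]: "SX \<in> borel_measurable M" "SY \<in> borel_measurable N"
        unfolding SX_def SY_def by measurable
      \<comment> \<open>The frequency of coordinate \<open>k\<close> and a common factor
        \<open>q\<close> of all the others vary independently; below only \<open>q\<close> = 0, 1
        and -1 occur.\<close>
      have IH: "(CLINT \<omega>|M. complex_of_real (wX J A \<omega>) * iexp (p * X k \<omega> + q * SX \<omega>)) =
                (CLINT \<omega>|N. complex_of_real (wY J A \<omega>) * iexp (p * Y k \<omega> + q * SY \<omega>))" for p q
      proof -
        define v' where "v' i = (if i = k then p else q * v i)" for i
        have eqI: "I - J = insert k (I - insert k J)" using kI by auto
        have "(\<Sum>i\<in>I - J. v' i * Z i) = p * Z k + q * (\<Sum>i\<in>I - insert k J. v i * Z i)" for Z :: "'i \<Rightarrow> real"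
        proof -
          have "(\<Sum>i\<in>I - J. v' i * Z i) = v' k * Z k + (\<Sum>i\<in>I - insert k J. v' i * Z i)"
            unfolding eqI by (rule sum.insert) (use I in auto)
          also have "(\<Sum>i\<in>I - insert k J. v' i * Z i) = (\<Sum>i\<in>I - insert k J. q * (v i * Z i))"
            by (rule sum.cong) (auto simp: v'_def)
          finally show ?thesis by (simp add: v'_def sum_distrib_left)
        qed
        then show ?thesis
          using spec[OF insert.IH[OF kI(2)], of v'] unfolding SX_def SY_def by (simp only:)
      qed
      have b: "integrable M (\<lambda>\<omega>. complex_of_real (wX J A \<omega>) * iexp (f \<omega>))"
        if [measurable]: "f \<in> borel_measurable M" for f :: "'a \<Rightarrow> real"
        by (rule M.integrable_const_bound[of _ 1]) (use w01 in \<open>auto simp: norm_mult\<close>)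
      have b': "integrable N (\<lambda>\<omega>. complex_of_real (wY J A \<omega>) * iexp (f \<omega>))"
        if [measurable]: "f \<in> borel_measurable N" for f :: "'b \<Rightarrow> real"
        by (rule N.integrable_const_bound[of _ 1]) (use w01 in \<open>auto simp: norm_mult\<close>)
      \<comment> \<open>Levy uniqueness wants a nonnegative weight, but the remaining exponential is
        complex. The weight \<open>1 + cos (S + \<theta>)\<close> is nonnegative, and expanding the
        cosine into exponentials produces only terms covered by \<open>IH\<close>.\<close>
      have expand: "complex_of_real (w * (1 + cos (S + \<theta>))) * iexp (p * x) =
          complex_of_real w * iexp (p * x + 0 * S) + (iexp \<theta> / 2) * (complex_of_real w * iexp (p * x + 1 * S))
          + (iexp (-\<theta>) / 2) * (complex_of_real w * iexp (p * x + (-1) * S))" for w S \<theta> p x :: real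
        by (simp add: cos_exp_eq cos_of_real[symmetric] ring_distribs exp_add[symmetric]
            exp_minus[symmetric] add_divide_distrib mult_ac add_ac diff_divide_distrib)
           (simp add: algebra_simps)
      define C where "C = A k"
      have C[measurable]: "C \<in> sets borel" using A by (simp add: C_def)
      have plain: "(LINT \<omega>|M. wX J A \<omega> * indicator C (X k \<omega>)) = (LINT \<omega>|N. wY J A \<omega> * indicator C (Y k \<omega>))"
        by (rule weighted_char_unique[OF M N, where C=1]) (use w01 IH[of _ 0] C in auto)
      have wt: "(LINT \<omega>|M. (wX J A \<omega> * (1 + cos (SX \<omega> + \<theta>))) * indicator C (X k \<omega>))
             = (LINT \<omega>|N. (wY J A \<omega> * (1 + cos (SY \<omega> + \<theta>))) * indicator C (Y k \<omega>))" for \<theta>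
      proof (rule weighted_char_unique[OF M N, where C=2])
        have c1: "0 \<le> 1 + cos z" for z :: real using cos_ge_minus_one[of z] by linarith
        show "0 \<le> wX J A \<omega> * (1 + cos (SX \<omega> + \<theta>))" "0 \<le> wY J A \<omega>' * (1 + cos (SY \<omega>' + \<theta>))" for \<omega> \<omega>'
          by (intro mult_nonneg_nonneg w01 c1)+
        have "a * (1 + cos b) \<le> 2" if "0 \<le> a" "a \<le> 1" for a b :: real
          using mult_mono[of a 1 "1 + cos b" 2] that cos_le_one[of b] cos_ge_minus_one[of b] by auto
        then show "wX J A \<omega> * (1 + cos (SX \<omega> + \<theta>)) \<le> 2" "wY J A \<omega>' * (1 + cos (SY \<omega>' + \<theta>)) \<le> 2" for \<omega> \<omega>'
          using w01 by auto
        show "(CLINT \<omega>|M. complex_of_real (wX J A \<omega> * (1 + cos (SX \<omega> + \<theta>))) * iexp (p * X k \<omega>)) =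
              (CLINT \<omega>|N. complex_of_real (wY J A \<omega> * (1 + cos (SY \<omega> + \<theta>))) * iexp (p * Y k \<omega>))" for p
          unfolding expand
          by (subst integral_lin3, (rule b, simp)+, subst integral_lin3, (rule b', simp)+, simp only: IH)
      qed (use C in measurable)
      have bi: "integrable M (\<lambda>\<omega>. wX J A \<omega> * indicator C (X k \<omega>) * f \<omega>)"
        if [measurable]: "f \<in> borel_measurable M" and "\<And>x. \<bar>f x\<bar> \<le> 1" for f :: "'a \<Rightarrow> real"
        by (rule M.integrable_const_bound[of _ 1]) (use w01 that(2) in \<open>auto simp: abs_mult indicator_def intro!: mult_le_one\<close>)
      have bi': "integrable N (\<lambda>\<omega>. wY J A \<omega> * indicator C (Y k \<omega>) * f \<omega>)"
        if [measurable]: "f \<in> borel_measurable N" and "\<And>x. \<bar>f x\<bar> \<le> 1" for f :: "'b \<Rightarrow> real"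
        by (rule N.integrable_const_bound[of _ 1]) (use w01 that(2) in \<open>auto simp: abs_mult indicator_def intro!: mult_le_one\<close>)
      have tr: "(LINT \<omega>|M. wX J A \<omega> * indicator C (X k \<omega>) * cos (SX \<omega> + \<theta>))
             = (LINT \<omega>|N. wY J A \<omega> * indicator C (Y k \<omega>) * cos (SY \<omega> + \<theta>))" for \<theta>
      proof -
        have e1: "(LINT \<omega>|M. (wX J A \<omega> * (1 + cos (SX \<omega> + \<theta>))) * indicator C (X k \<omega>)) =
            (LINT \<omega>|M. wX J A \<omega> * indicator C (X k \<omega>) * 1) + (LINT \<omega>|M. wX J A \<omega> * indicator C (X k \<omega>) * cos (SX \<omega> + \<theta>))"
          by (subst Bochner_Integration.integral_add[symmetric], (intro bi, simp, simp)+)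
             (auto intro!: Bochner_Integration.integral_cong simp: algebra_simps)
        have e2: "(LINT \<omega>|N. (wY J A \<omega> * (1 + cos (SY \<omega> + \<theta>))) * indicator C (Y k \<omega>)) =
            (LINT \<omega>|N. wY J A \<omega> * indicator C (Y k \<omega>) * 1) + (LINT \<omega>|N. wY J A \<omega> * indicator C (Y k \<omega>) * cos (SY \<omega> + \<theta>))"
          by (subst Bochner_Integration.integral_add[symmetric], (intro bi', simp, simp)+)
             (auto intro!: Bochner_Integration.integral_cong simp: algebra_simps)
        show ?thesis using wt[of \<theta>] plain e1 e2 by simp
      qed
      have wins: "wX (insert k J) A \<omega> = wX J A \<omega> * indicator C (X k \<omega>)"
           "wY (insert k J) A \<omega>' = wY J A \<omega>' * indicator C (Y k \<omega>')" for \<omega> \<omega>'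
        using insert by (auto simp: wX_def wY_def C_def)
      \<comment> \<open>The phases 0 and \<open>- pi / 2\<close> of the shifted cosine recover the
        real and the imaginary part of the exponential.\<close>
      have ie: "complex_of_real a * iexp S = complex_of_real (a * cos (S + 0)) + \<i> * complex_of_real (a * cos (S + (- (pi/2))))" for a S
      proof -
        have "cos (S + (- (pi/2))) = sin S" by (simp add: cos_diff)
        then show ?thesis by (simp add: cis_conv_exp[symmetric] complex_eq_iff)
      qed
      show "(CLINT \<omega>|M. complex_of_real (wX (insert k J) A \<omega>) * iexp (\<Sum>i\<in>I - insert k J. v i * X i \<omega>)) =
            (CLINT \<omega>|N. complex_of_real (wY (insert k J) A \<omega>) * iexp (\<Sum>i\<in>I - insert k J. v i * Y i \<omega>))"
        unfolding wins SX_def[symmetric] SY_def[symmetric] ie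
        by (subst (1 2) Bochner_Integration.integral_add,
            (intro integrable_mult_right integrable_of_real bi bi', simp, simp)+)
           (simp only: integral_mult_right_zero integral_complex_of_real tr)
    qed
  qed
  show ?thesis
  proof (rule measure_eqI_PiM_finite[OF I])
    fix A :: "'i \<Rightarrow> real set" assume A: "\<And>i. i \<in> I \<Longrightarrow> A i \<in> sets borel"
    define A' where "A' i = (if i \<in> I then A i else {})" for i
    have A': "A' i \<in> sets borel" for i using A by (auto simp: A'_def)
    have "complex_of_real (LINT \<omega>|M. wX I A' \<omega>) = complex_of_real (LINT \<omega>|N. wY I A' \<omega>)"
      using main[OF I subset_refl A'] by simp
    then have eq: "(LINT \<omega>|M. wX I A' \<omega>) = (LINT \<omega>|N. wY I A' \<omega>)" by (simp only: of_real_eq_iff)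
    show "emeasure (distr M (PiM I (\<lambda>_. borel)) (\<lambda>\<omega>. \<lambda>i\<in>I. X i \<omega>)) (Pi\<^sub>E I A) =
          emeasure (distr N (PiM I (\<lambda>_. borel)) (\<lambda>\<omega>. \<lambda>i\<in>I. Y i \<omega>)) (Pi\<^sub>E I A)"
      using eq A emeasure_distr_PiM_rectangle[OF M I X, of A] emeasure_distr_PiM_rectangle[OF N I Y, of A]
      by (simp add: wX_def wY_def A'_def cong: prod.cong)
  next
    show "range (\<lambda>_. Pi\<^sub>E I (\<lambda>_. UNIV)) \<subseteq> prod_algebra I (\<lambda>_. borel :: real measure)"
      using I by (auto intro!: prod_algebraI_finite)
    show "(\<Union>i::nat. Pi\<^sub>E I (\<lambda>_. UNIV)) = space (PiM I (\<lambda>_. borel :: real measure))"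
      by (simp add: space_PiM)
    have "prob_space (distr M (PiM I (\<lambda>_. borel)) (\<lambda>\<omega>. \<lambda>i\<in>I. X i \<omega>))"
      by (intro M.prob_space_distr) measurable
    then interpret d: prob_space "distr M (PiM I (\<lambda>_. borel)) (\<lambda>\<omega>. \<lambda>i\<in>I. X i \<omega>)" .
    show "emeasure (distr M (PiM I (\<lambda>_. borel)) (\<lambda>\<omega>. \<lambda>i\<in>I. X i \<omega>)) (Pi\<^sub>E I (\<lambda>_. UNIV)) \<noteq> \<infinity>"
      by (rule d.emeasure_finite[unfolded infinity_ennreal_def[symmetric]])
  qed simp_all
qed

section \<open>The standard Gaussian law\<close>

lemma measurable_vec_lambda [measurable]:
  "vec_lambda \<in> measurable (PiM UNIV (\<lambda>_::'n::finite. borel)) (borel :: (real ^ 'n) measure)"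
proof (subst borel_measurable_euclidean_space, intro ballI)
  fix b :: "real ^ 'n" assume "b \<in> Basis"
  then obtain i where b: "b = axis i 1" by (auto simp: Basis_vec_def)
  show "(\<lambda>x. vec_lambda x \<bullet> b) \<in> borel_measurable (PiM UNIV (\<lambda>_::'n. borel))"
    unfolding b by (simp add: inner_axis)
qed

lemma measurable_vec_nth [measurable (raw)]:
  fixes f :: "'a \<Rightarrow> real ^ 'n::finite"
  assumes "f \<in> borel_measurable M"
  shows "(\<lambda>x. f x $ i) \<in> borel_measurable M"
  using borel_measurable_inner[OF assms borel_measurable_const[of "axis i 1"]] by (simp add: inner_axis)

lemma borel_measurable_vecI:
  fixes f :: "'a \<Rightarrow> real ^ 'n::finite"
  assumes "\<And>i. (\<lambda>x. f x $ i) \<in> borel_measurable M"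
  shows "f \<in> borel_measurable M"
proof (subst borel_measurable_euclidean_space, intro ballI)
  fix b :: "real ^ 'n" assume "b \<in> Basis"
  then obtain i where b: "b = axis i 1" by (auto simp: Basis_vec_def)
  show "(\<lambda>x. f x \<bullet> b) \<in> borel_measurable M"
    unfolding b using assms by (simp add: inner_axis)
qed

text \<open>Boxes determine Lebesgue measure, and on a box both sides are the product of the side
  lengths. This makes Fubini for product measures available for integrals over vectors.\<close>

lemma lborel_vec:
  "(lborel :: (real ^ 'n::finite) measure) = distr (PiM UNIV (\<lambda>_. lborel)) borel vec_lambda"
proof (rule lborel_eqI)
  interpret product_sigma_finite "\<lambda>_::'n. lborel :: real measure" ..
  fix l u :: "real ^ 'n" assume le: "\<And>b. b \<in> Basis \<Longrightarrow> l \<bullet> b \<le> u \<bullet> b"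
  have le': "l $ i \<le> u $ i" for i
    using le[of "axis i 1"] by (simp add: inner_axis axis_in_Basis_iff)
  have m: "vec_lambda \<in> measurable (PiM UNIV (\<lambda>_::'n. lborel)) (borel :: (real ^ 'n) measure)"
    using measurable_vec_lambda by (simp cong: measurable_cong_sets sets_PiM_cong)
  have "emeasure (distr (PiM UNIV (\<lambda>_. lborel)) borel vec_lambda) (box l u) =
      emeasure (PiM UNIV (\<lambda>_::'n. lborel)) (Pi\<^sub>E UNIV (\<lambda>i. {l $ i <..< u $ i}))"
    by (subst emeasure_distr[OF m])
       (auto intro!: arg_cong[where f="emeasure _"] simp: mem_box_cart space_PiM PiE_iff)
  also have "\<dots> = (\<Prod>i\<in>UNIV. emeasure lborel {l $ i <..< u $ i})"
    by (subst emeasure_PiM) auto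
  also have "\<dots> = (\<Prod>i\<in>UNIV. ennreal (u $ i - l $ i))"
    using le' by simp
  also have "\<dots> = ennreal (\<Prod>i\<in>UNIV. u $ i - l $ i)"
    using le' by (intro prod_ennreal) (simp add: algebra_simps)
  also have "(\<Prod>i\<in>UNIV. u $ i - l $ i) = (\<Prod>b\<in>Basis. (u - l) \<bullet> b)"
  proof -
    have B: "(Basis :: (real ^ 'n) set) = range (\<lambda>i. axis i 1)" by (auto simp: Basis_vec_def)
    show ?thesis unfolding B
      by (subst prod.reindex) (auto simp: inner_axis inj_on_def axis_eq_axis)
  qed
  finally show "emeasure (distr (PiM UNIV (\<lambda>_. lborel)) borel vec_lambda) (box l u) = (\<Prod>b\<in>Basis. (u - l) \<bullet> b)"
    by simp
qed simp

lemma lborel_vec_prod: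
  fixes f :: "'n::finite \<Rightarrow> real \<Rightarrow> 'b::{real_normed_field,banach,second_countable_topology}"
  assumes f: "\<And>i. integrable lborel (f i)"
  shows "integrable (lborel :: (real ^ 'n) measure) (\<lambda>x. \<Prod>i\<in>UNIV. f i (x $ i))"
    and "(LINT x|(lborel :: (real ^ 'n) measure). (\<Prod>i\<in>UNIV. f i (x $ i))) = (\<Prod>i\<in>UNIV. LINT x|lborel. f i x)"
proof -
  interpret product_sigma_finite "\<lambda>_::'n. lborel :: real measure" ..
  have m: "vec_lambda \<in> measurable (PiM UNIV (\<lambda>_::'n. lborel)) (borel :: (real ^ 'n) measure)"
    using measurable_vec_lambda by (simp cong: measurable_cong_sets sets_PiM_cong)
  have [measurable]: "f i \<in> borel_measurable borel" for i
    using borel_measurable_integrable[OF f] by simp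
  show "integrable (lborel :: (real ^ 'n) measure) (\<lambda>x. \<Prod>i\<in>UNIV. f i (x $ i))"
    unfolding lborel_vec
    by (subst integrable_distr_eq[OF m]) (auto intro!: product_integrable_prod f)
  show "(LINT x|(lborel :: (real ^ 'n) measure). (\<Prod>i\<in>UNIV. f i (x $ i))) = (\<Prod>i\<in>UNIV. LINT x|lborel. f i x)"
    unfolding lborel_vec
    by (subst integral_distr[OF m]) (auto intro!: product_integral_prod f)
qed

definition gauss :: "(real ^ 'n::finite) measure" where
  "gauss = density lborel (\<lambda>x. ennreal (\<Prod>i\<in>UNIV. std_normal_density (x $ i)))"

lemma sets_gauss [simp, measurable_cong]: "sets gauss = sets borel"
  and space_gauss [simp]: "space gauss = UNIV"
  by (simp_all add: gauss_def)

lemma std_prod_nonneg: "0 \<le> (\<Prod>i\<in>UNIV. std_normal_density (x $ i))" for x :: "real ^ 'n::finite"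
  by (intro prod_nonneg) simp

lemma gauss_prod:
  fixes f :: "'n::finite \<Rightarrow> real \<Rightarrow> 'b::{real_normed_field,banach,second_countable_topology}"
  assumes f: "\<And>i. integrable std_normal_distribution (f i)"
  shows "integrable (gauss :: (real ^ 'n) measure) (\<lambda>x. \<Prod>i\<in>UNIV. f i (x $ i))"
    and "(LINT x|(gauss :: (real ^ 'n) measure). (\<Prod>i\<in>UNIV. f i (x $ i))) = (\<Prod>i\<in>UNIV. LINT x|std_normal_distribution. f i x)"
proof -
  have [measurable]: "f i \<in> borel_measurable borel" for i
    using borel_measurable_integrable[OF f] by simp
  have f': "integrable lborel (\<lambda>x. of_real (std_normal_density x) * f i x)" for i
    using f[of i] by (subst (asm) integrable_density) (auto simp: scaleR_conv_of_real)
  have eq: "(\<Prod>i\<in>UNIV. std_normal_density (x $ i)) *\<^sub>R (\<Prod>i\<in>UNIV. f i (x $ i)) =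
      (\<Prod>i\<in>UNIV. of_real (std_normal_density (x $ i)) * f i (x $ i))" for x :: "real ^ 'n"
    by (simp add: scaleR_conv_of_real prod.distrib of_real_prod)
  show "integrable (gauss :: (real ^ 'n) measure) (\<lambda>x. \<Prod>i\<in>UNIV. f i (x $ i))"
    unfolding gauss_def using lborel_vec_prod(1)[OF f']
    by (subst integrable_density) (auto simp: eq std_prod_nonneg simp del: scaleR_conv_of_real)
  show "(LINT x|(gauss :: (real ^ 'n) measure). (\<Prod>i\<in>UNIV. f i (x $ i))) = (\<Prod>i\<in>UNIV. LINT x|std_normal_distribution. f i x)"
    unfolding gauss_def using lborel_vec_prod(2)[of "\<lambda>i x. of_real (std_normal_density x) * f i x", OF f']
    by (subst integral_density, simp, simp, simp add: std_prod_nonneg)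
       (simp only: eq, simp add: integral_density scaleR_conv_of_real)
qed

lemma prob_space_gauss: "prob_space (gauss :: (real ^ 'n::finite) measure)"
proof (rule prob_spaceI)
  have i: "integrable lborel std_normal_density" by simp
  have "(\<integral>\<^sup>+x. ennreal (\<Prod>i\<in>UNIV. std_normal_density (x $ i)) \<partial>(lborel :: (real ^ 'n) measure)) =
      ennreal (LINT x|(lborel :: (real ^ 'n) measure). (\<Prod>i\<in>UNIV. std_normal_density (x $ i)))"
    by (intro nn_integral_eq_integral lborel_vec_prod i) (simp add: std_prod_nonneg)
  also have "\<dots> = 1"
    by (subst lborel_vec_prod(2)[OF i]) simp
  finally show "emeasure (gauss :: (real ^ 'n) measure) (space gauss) = 1"
    by (simp add: gauss_def emeasure_density cong: nn_integral_cong_simp)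
qed

interpretation gauss: prob_space "gauss :: (real ^ 'n::finite) measure" by (rule prob_space_gauss)

lemma char_gauss: "(CLINT \<xi>|(gauss :: (real ^ 'n::finite) measure). iexp (c \<bullet> \<xi>)) = exp (- (c \<bullet> c) / 2)"
proof -
  have "(CLINT \<xi>|(gauss :: (real ^ 'n) measure). iexp (c \<bullet> \<xi>)) =
     (CLINT \<xi>|(gauss :: (real ^ 'n) measure). (\<Prod>i\<in>UNIV. iexp (c $ i * \<xi> $ i)))"
    by (simp add: inner_vec_def exp_sum sum_distrib_left)
  also have "\<dots> = (\<Prod>i\<in>UNIV. CLINT x|std_normal_distribution. iexp (c $ i * x))"
  proof (rule gauss_prod(2))
    interpret s: prob_space std_normal_distribution by (rule prob_space_normal_density) simp
    show "complex_integrable std_normal_distribution (\<lambda>x. iexp (c $ i * x))" for i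
      by (rule s.integrable_iexp) (auto simp: distr_def)
  qed
  also have "\<dots> = (\<Prod>i\<in>UNIV. complex_of_real (exp (- (c $ i)\<^sup>2 / 2)))"
    using char_std_normal_distribution by (simp add: char_def fun_eq_iff)
  also have "\<dots> = exp (\<Sum>i\<in>UNIV. complex_of_real (- (c $ i)\<^sup>2 / 2))"
    by (simp only: exp_sum finite_class.finite_UNIV exp_of_real)
  also have "(\<Sum>i\<in>UNIV. complex_of_real (- (c $ i)\<^sup>2 / 2)) = complex_of_real (- (c \<bullet> c) / 2)"
    unfolding of_real_sum[symmetric] by (simp add: inner_vec_def power2_eq_square sum_negf sum_divide_distrib)
  finally show ?thesis by (simp only: exp_of_real)
qed

section \<open>Exponential moments, shifts and integration by parts for the Gaussian law\<close>

lemma std_normal_exp_abs_integrable: "integrable std_normal_distribution (\<lambda>x. exp (k * \<bar>x\<bar>))"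
proof -
  have e: "integrable std_normal_distribution (\<lambda>x. exp (k * x))" for k :: real
  proof (subst integrable_density)
    \<comment> \<open>Completing the square leaves a constant times the normal density with mean
      \<open>k\<close>.\<close>
    have "std_normal_density x *\<^sub>R exp (k * x) = exp (k\<^sup>2 / 2) * normal_density k 1 x" for x
      by (simp add: normal_density_def exp_add[symmetric] exp_diff[symmetric] power2_eq_square field_simps)
    then show "integrable lborel (\<lambda>x. std_normal_density x *\<^sub>R exp (k * x))" by simp
  qed auto
  show ?thesis
    by (rule Bochner_Integration.integrable_bound[OF Bochner_Integration.integrable_add[OF e[of k] e[of "- k"]]])
       (simp, intro AE_I2, simp add: abs_of_pos[OF add_pos_pos], simp add: abs_if)
qed

lemma gauss_exp_norm_integrable:
  "integrable (gauss :: (real ^ 'n::finite) measure) (\<lambda>\<xi>. exp (k * norm \<xi>))"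
proof (rule Bochner_Integration.integrable_bound)
  show "integrable (gauss :: (real ^ 'n) measure) (\<lambda>\<xi>. \<Prod>i\<in>UNIV. exp (\<bar>k\<bar> * \<bar>\<xi> $ i\<bar>))"
    by (intro gauss_prod std_normal_exp_abs_integrable)
  show "AE \<xi> in (gauss :: (real ^ 'n) measure). norm (exp (k * norm \<xi>)) \<le> norm (\<Prod>i\<in>UNIV. exp (\<bar>k\<bar> * \<bar>\<xi> $ i\<bar>))"
  proof (intro AE_I2)
    fix \<xi> :: "real ^ 'n"
    have "k * norm \<xi> \<le> \<bar>k\<bar> * norm \<xi>" by (intro mult_right_mono) auto
    also have "\<dots> \<le> \<bar>k\<bar> * (\<Sum>i\<in>UNIV. \<bar>\<xi> $ i\<bar>)"
      by (intro mult_left_mono norm_le_l1_cart) auto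
    finally show "norm (exp (k * norm \<xi>)) \<le> norm (\<Prod>i\<in>UNIV. exp (\<bar>k\<bar> * \<bar>\<xi> $ i\<bar>))"
      by (simp add: exp_sum[symmetric] sum_distrib_left)
  qed
qed simp

lemma gauss_norm_integrable: "integrable (gauss :: (real ^ 'n::finite) measure) norm"
proof (rule Bochner_Integration.integrable_bound[OF gauss_exp_norm_integrable[of 1]])
  have "norm \<xi> \<le> exp (norm \<xi>)" for \<xi> :: "real ^ 'n"
    using exp_ge_add_one_self[of "norm \<xi>"] by linarith
  then show "AE \<xi> in (gauss :: (real ^ 'n) measure). norm (norm \<xi>) \<le> norm (exp (1 * norm \<xi>))"
    by auto
qed simp

text \<open>Translation invariance of Lebesgue measure moves the shift from the argument of
  \<open>\<phi>\<close> into the density, and the quotient of the shifted and the original density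
  is the exponential. The dependence on \<open>h\<close> is thereby smooth although
  \<open>\<phi>\<close> is merely measurable.\<close>

lemma gauss_cameron_martin:
  fixes \<phi> :: "real ^ 'n::finite \<Rightarrow> real"
  assumes [measurable]: "\<phi> \<in> borel_measurable borel"
  shows "(LINT \<xi>|gauss. \<phi> (\<xi> + h)) = (LINT \<xi>|gauss. \<phi> \<xi> * exp (\<xi> \<bullet> h - (h \<bullet> h) / 2))"
proof -
  let ?p = "\<lambda>x :: real ^ 'n. \<Prod>i\<in>UNIV. std_normal_density (x $ i)"
  have p: "?p (x - h) = ?p x * exp (x \<bullet> h - (h \<bullet> h) / 2)" for x
  proof -
    have "std_normal_density (x $ i - h $ i) = std_normal_density (x $ i) * exp (x $ i * h $ i - (h $ i * h $ i) / 2)" for i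
      by (simp add: std_normal_density_def exp_add[symmetric] power2_eq_square field_simps)
    then have "?p (x - h) = ?p x * exp (\<Sum>i\<in>UNIV. x $ i * h $ i - (h $ i * h $ i) / 2)"
      by (simp add: prod.distrib exp_sum)
    then show ?thesis by (simp add: inner_vec_def sum_subtractf sum_divide_distrib)
  qed
  have "(LINT \<xi>|gauss. \<phi> (\<xi> + h)) = (LINT x|lborel. ?p x * \<phi> (x + h))"
    unfolding gauss_def by (subst integral_density) (auto simp: std_prod_nonneg)
  also have "\<dots> = (LINT x|distr lborel borel ((+) h). ?p (x - h) * \<phi> x)"
    by (subst integral_distr) (auto simp: add.commute)
  also have "\<dots> = (LINT x|lborel. ?p x * (\<phi> x * exp (x \<bullet> h - (h \<bullet> h) / 2)))"
    unfolding lborel_distr_plus p by (simp add: mult_ac)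
  also have "\<dots> = (LINT \<xi>|gauss. \<phi> \<xi> * exp (\<xi> \<bullet> h - (h \<bullet> h) / 2))"
    unfolding gauss_def by (subst integral_density) (auto simp: std_prod_nonneg)
  finally show ?thesis .
qed

text \<open>Both bounds come from \<open>1 + u \<le> exp u\<close>: applied to \<open>u\<close> it
  makes the remainder nonnegative, applied to \<open>- u\<close> it gives
  \<open>exp u - 1 \<le> u * exp u\<close>.\<close>

lemma exp_remainder_le: "\<bar>exp u - 1 - u\<bar> \<le> u\<^sup>2 * exp \<bar>u\<bar>" for u :: real
proof -
  have 1: "0 \<le> exp u - 1 - u" using exp_ge_add_one_self[of u] by linarith
  have "exp u * (1 - u) \<le> exp u * exp (- u)"
    using exp_ge_add_one_self[of "- u"] by (intro mult_left_mono) auto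
  also have "\<dots> = 1" by (simp add: exp_add[symmetric])
  finally have 2: "exp u - 1 \<le> u * exp u" by (simp add: algebra_simps)
  have 3: "exp u - 1 - u \<le> u * (exp u - 1)" using 2 by (simp add: algebra_simps)
  have "u * (exp u - 1) \<le> u\<^sup>2 * exp \<bar>u\<bar>"
  proof (cases "0 \<le> u")
    case True
    then have "u * (exp u - 1) \<le> u * (u * exp u)" using 2 by (intro mult_left_mono)
    with True show ?thesis by (simp add: power2_eq_square mult_ac)
  next
    case False
    then have "u * (exp u - 1) = \<bar>u\<bar> * (1 - exp u)" by (simp add: algebra_simps)
    also have "\<dots> \<le> \<bar>u\<bar> * \<bar>u\<bar>" using exp_ge_add_one_self[of u] False by (intro mult_left_mono) linarith+
    also have "\<dots> = u\<^sup>2 * 1" by (simp add: power2_eq_square)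
    also have "\<dots> \<le> u\<^sup>2 * exp \<bar>u\<bar>" by (intro mult_left_mono) auto
    finally show ?thesis .
  qed
  with 1 3 show ?thesis by linarith
qed

text \<open>After the Cameron--Martin shift only the exponential density depends on
  \<open>h\<close>. Its first order term is the inner product of \<open>\<xi>\<close> and
  \<open>h\<close>, and the remainder is quadratic in \<open>h\<close> with a factor that is
  integrable because all exponential moments of the Gaussian norm are finite.\<close>

lemma gauss_has_derivative:
  fixes \<phi> :: "real ^ 'n::finite \<Rightarrow> real"
  assumes \<phi>[measurable]: "\<phi> \<in> borel_measurable borel" and K: "\<And>x. \<bar>\<phi> x\<bar> \<le> K"
  shows "((\<lambda>b. LINT \<xi>|gauss. \<phi> (\<xi> + b)) has_derivative (\<lambda>h. h \<bullet> (LINT \<xi>|gauss. \<phi> (\<xi> + b) *\<^sub>R \<xi>))) (at b)"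
proof -
  have K0: "0 \<le> K" using K[of 0] by linarith
  define C where "C = (LINT \<xi>|(gauss :: (real ^ 'n) measure). 2 * exp (3 * (1 + norm \<xi>)))"
  have Ci: "integrable (gauss :: (real ^ 'n) measure) (\<lambda>\<xi>. 2 * exp (3 * (1 + norm \<xi>)))"
    using gauss_exp_norm_integrable[of 3, where 'n='n] by (simp add: distrib_left exp_add)
  have i1: "integrable gauss (\<lambda>\<xi>. \<phi> (\<xi> + b) *\<^sub>R \<xi>)"
    by (rule Bochner_Integration.integrable_bound[OF integrable_mult_right[OF gauss_norm_integrable, of K]])
       (use K K0 in \<open>auto intro!: mult_right_mono\<close>)
  have i0: "integrable gauss (\<lambda>\<xi>. \<phi> (\<xi> + b))"
    by (rule gauss.integrable_const_bound[of _ K]) (use K in auto)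
  \<comment> \<open>Origin of the constants: \<open>exp \<bar>u\<bar>\<close> contributes
    \<open>1 + norm \<xi>\<close> once to the exponent and the square of
    \<open>1 + norm \<xi>\<close> contributes it twice, hence 3; the outer factor 2 also absorbs the
    term with \<open>h \<bullet> h / 2\<close>.\<close>
  have pt: "\<bar>exp (\<xi> \<bullet> h - (h \<bullet> h) / 2) - 1 - \<xi> \<bullet> h\<bar> \<le> (norm h)\<^sup>2 * (2 * exp (3 * (1 + norm \<xi>)))"
    if h: "norm h \<le> 1" for \<xi> h :: "real ^ 'n"
  proof -
    define u where "u = \<xi> \<bullet> h - (h \<bullet> h) / 2"
    have hh: "h \<bullet> h = (norm h)\<^sup>2" by (simp add: power2_norm_eq_inner)
    have "\<bar>u\<bar> \<le> \<bar>\<xi> \<bullet> h\<bar> + (norm h)\<^sup>2" unfolding u_def hh using zero_le_power2[of "norm h"] by arith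
    also have "\<dots> \<le> norm \<xi> * norm h + norm h * 1"
      unfolding power2_eq_square by (intro add_mono Cauchy_Schwarz_ineq2 mult_left_mono h) auto
    finally have u: "\<bar>u\<bar> \<le> norm h * (1 + norm \<xi>)" by (simp add: algebra_simps)
    have u1: "\<bar>u\<bar> \<le> 1 + norm \<xi>"
      using mult_right_mono[OF h, of "1 + norm \<xi>"] u by simp
    have z: "(1 + norm \<xi>)\<^sup>2 \<le> exp (2 * (1 + norm \<xi>))"
    proof -
      have "1 + norm \<xi> \<le> exp (1 + norm \<xi>)" using exp_ge_add_one_self[of "1 + norm \<xi>"] by linarith
      then have "(1 + norm \<xi>)\<^sup>2 \<le> (exp (1 + norm \<xi>))\<^sup>2" by (intro power_mono) auto
      then show ?thesis by (simp add: power2_eq_square exp_add[symmetric])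
    qed
    have "u\<^sup>2 * exp \<bar>u\<bar> \<le> (norm h * (1 + norm \<xi>))\<^sup>2 * exp (1 + norm \<xi>)"
      using u u1 by (intro mult_mono) (auto simp: abs_le_square_iff[symmetric])
    also have "\<dots> = (norm h)\<^sup>2 * ((1 + norm \<xi>)\<^sup>2 * exp (1 + norm \<xi>))"
      by (simp add: power_mult_distrib)
    also have "\<dots> \<le> (norm h)\<^sup>2 * (exp (2 * (1 + norm \<xi>)) * exp (1 + norm \<xi>))"
      using z by (intro mult_left_mono mult_right_mono) auto
    finally have a: "u\<^sup>2 * exp \<bar>u\<bar> \<le> (norm h)\<^sup>2 * exp (3 * (1 + norm \<xi>))"
      by (simp add: exp_add[symmetric])
    have "(norm h)\<^sup>2 * 1 \<le> (norm h)\<^sup>2 * exp (3 * (1 + norm \<xi>))" by (intro mult_left_mono) auto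
    then have b: "(norm h)\<^sup>2 / 2 \<le> (norm h)\<^sup>2 * exp (3 * (1 + norm \<xi>))"
      using zero_le_power2[of "norm h"] by linarith
    have "exp (\<xi> \<bullet> h - (h \<bullet> h) / 2) - 1 - \<xi> \<bullet> h = (exp u - 1 - u) - (norm h)\<^sup>2 / 2"
      unfolding u_def hh by simp
    then have "\<bar>exp (\<xi> \<bullet> h - (h \<bullet> h) / 2) - 1 - \<xi> \<bullet> h\<bar> \<le> u\<^sup>2 * exp \<bar>u\<bar> + (norm h)\<^sup>2 / 2"
      using exp_remainder_le[of u] zero_le_power2[of "norm h"] by linarith
    with a b show ?thesis by linarith
  qed
  have main: "\<bar>(LINT \<xi>|gauss. \<phi> (\<xi> + (b + h))) - (LINT \<xi>|gauss. \<phi> (\<xi> + b)) - h \<bullet> (LINT \<xi>|gauss. \<phi> (\<xi> + b) *\<^sub>R \<xi>)\<bar>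
      \<le> K * C * (norm h)\<^sup>2" if h: "norm h \<le> 1" for h
  proof -
    let ?r = "\<lambda>\<xi>. exp (\<xi> \<bullet> h - (h \<bullet> h) / 2) - 1 - \<xi> \<bullet> h"
    have ir: "integrable gauss (\<lambda>\<xi>. \<phi> (\<xi> + b) * ?r \<xi>)"
    proof (rule Bochner_Integration.integrable_bound[OF integrable_mult_right[OF Ci, of "K * (norm h)\<^sup>2"]])
      show "AE \<xi> in gauss. norm (\<phi> (\<xi> + b) * ?r \<xi>) \<le> norm (K * (norm h)\<^sup>2 * (2 * exp (3 * (1 + norm \<xi>))))"
      proof (intro AE_I2)
        fix \<xi>
        have "\<bar>\<phi> (\<xi> + b)\<bar> * \<bar>?r \<xi>\<bar> \<le> K * ((norm h)\<^sup>2 * (2 * exp (3 * (1 + norm \<xi>))))"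
          by (intro mult_mono K pt h) (auto simp: K0)
        then show "norm (\<phi> (\<xi> + b) * ?r \<xi>) \<le> norm (K * (norm h)\<^sup>2 * (2 * exp (3 * (1 + norm \<xi>))))"
          using K0 by (simp add: abs_mult mult_ac)
      qed
    qed simp
    have ih: "integrable gauss (\<lambda>\<xi>. \<phi> (\<xi> + b) * (\<xi> \<bullet> h))"
      using integrable_inner_left[OF i1, of h] by simp
    have ie: "integrable gauss (\<lambda>\<xi>. \<phi> (\<xi> + b) * exp (\<xi> \<bullet> h - (h \<bullet> h) / 2))"
      using Bochner_Integration.integrable_add[OF Bochner_Integration.integrable_add[OF ir ih] i0] by (simp add: algebra_simps)
    have "(LINT \<xi>|gauss. \<phi> (\<xi> + (b + h))) = (LINT \<xi>|gauss. \<phi> (\<xi> + b) * exp (\<xi> \<bullet> h - (h \<bullet> h) / 2))"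
      using gauss_cameron_martin[of "\<lambda>x. \<phi> (x + b)" h] by (simp add: add_ac)
    moreover have "h \<bullet> (LINT \<xi>|gauss. \<phi> (\<xi> + b) *\<^sub>R \<xi>) = (LINT \<xi>|gauss. \<phi> (\<xi> + b) * (\<xi> \<bullet> h))"
      using i1 by (subst inner_commute, subst integral_inner_left[symmetric]) auto
    ultimately have "(LINT \<xi>|gauss. \<phi> (\<xi> + (b + h))) - (LINT \<xi>|gauss. \<phi> (\<xi> + b)) - h \<bullet> (LINT \<xi>|gauss. \<phi> (\<xi> + b) *\<^sub>R \<xi>)
        = (LINT \<xi>|gauss. \<phi> (\<xi> + b) * ?r \<xi>)"
      using i0 ih ie by (simp add: algebra_simps)
    then have "\<bar>(LINT \<xi>|gauss. \<phi> (\<xi> + (b + h))) - (LINT \<xi>|gauss. \<phi> (\<xi> + b)) - h \<bullet> (LINT \<xi>|gauss. \<phi> (\<xi> + b) *\<^sub>R \<xi>)\<bar>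
        = \<bar>LINT \<xi>|gauss. \<phi> (\<xi> + b) * ?r \<xi>\<bar>" by simp
    also have "\<dots> \<le> (LINT \<xi>|gauss. norm (\<phi> (\<xi> + b) * ?r \<xi>))"
      using integral_norm_bound[of gauss "\<lambda>\<xi>. \<phi> (\<xi> + b) * ?r \<xi>"] by simp
    also have "\<dots> \<le> (LINT \<xi>|(gauss :: (real ^ 'n) measure). K * (norm h)\<^sup>2 * (2 * exp (3 * (1 + norm \<xi>))))"
    proof (rule integral_mono)
      fix \<xi> :: "real ^ 'n"
      have "\<bar>\<phi> (\<xi> + b)\<bar> * \<bar>?r \<xi>\<bar> \<le> K * ((norm h)\<^sup>2 * (2 * exp (3 * (1 + norm \<xi>))))"
        by (intro mult_mono K pt h) (auto simp: K0)
      then show "norm (\<phi> (\<xi> + b) * ?r \<xi>) \<le> K * (norm h)\<^sup>2 * (2 * exp (3 * (1 + norm \<xi>)))"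
        by (simp add: abs_mult mult_ac)
    qed (use integrable_norm[OF ir] Ci in auto)
    also have "\<dots> = K * C * (norm h)\<^sup>2" unfolding C_def by (simp only: integral_mult_right_zero mult_ac)
    finally show ?thesis .
  qed
  show ?thesis
  proof (rule has_derivativeI_sandwich[where e=1 and H="\<lambda>y. K * C * norm (y - b)"])
    show "bounded_linear (\<lambda>h. h \<bullet> (LINT \<xi>|gauss. \<phi> (\<xi> + b) *\<^sub>R \<xi>))" by (rule bounded_linear_inner_left)
    show "((\<lambda>y. K * C * norm (y - b)) \<longlongrightarrow> 0) (at b)"
      by (auto intro!: tendsto_eq_intros)
    fix y assume "y \<noteq> b" "dist y b < 1"
    then show "norm ((LINT \<xi>|gauss. \<phi> (\<xi> + y)) - (LINT \<xi>|gauss. \<phi> (\<xi> + b)) - (y - b) \<bullet> (LINT \<xi>|gauss. \<phi> (\<xi> + b) *\<^sub>R \<xi>)) / norm (y - b) \<le> K * C * norm (y - b)"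
      using main[of "y - b"] by (simp add: divide_le_eq power2_eq_square dist_norm mult_ac)
  qed simp
qed

lemma gauss_derivative_bound:
  fixes \<phi> :: "real ^ 'n::finite \<Rightarrow> real"
  assumes \<phi>[measurable]: "\<phi> \<in> borel_measurable borel" and K: "\<And>x. \<bar>\<phi> x\<bar> \<le> K"
  shows "integrable gauss (\<lambda>\<xi>. \<phi> (\<xi> + b) *\<^sub>R \<xi>)"
    and "norm (LINT \<xi>|gauss. \<phi> (\<xi> + b) *\<^sub>R \<xi>) \<le> K * (LINT \<xi>|(gauss :: (real ^ 'n) measure). norm \<xi>)"
proof -
  have K0: "0 \<le> K" using K[of 0] by linarith
  show i1: "integrable gauss (\<lambda>\<xi>. \<phi> (\<xi> + b) *\<^sub>R \<xi>)"
    by (rule Bochner_Integration.integrable_bound[OF integrable_mult_right[OF gauss_norm_integrable, of K]])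
       (use K K0 in \<open>auto intro!: mult_right_mono\<close>)
  have "norm (LINT \<xi>|gauss. \<phi> (\<xi> + b) *\<^sub>R \<xi>) \<le> (LINT \<xi>|(gauss :: (real ^ 'n) measure). K * norm \<xi>)"
    by (rule order_trans[OF integral_norm_bound], rule integral_mono[OF integrable_norm[OF i1]])
       (use K in \<open>auto intro!: mult_right_mono integrable_mult_right gauss_norm_integrable\<close>)
  then show "norm (LINT \<xi>|gauss. \<phi> (\<xi> + b) *\<^sub>R \<xi>) \<le> K * (LINT \<xi>|(gauss :: (real ^ 'n) measure). norm \<xi>)"
    by simp
qed

text \<open>The derivative is bounded uniformly in the position, so the mean value inequality
  applies. The resulting global constant is the domination needed when these Gaussian averages are
  averaged once more over a random covariance.\<close>

lemma gauss_lipschitz: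
  fixes \<phi> :: "real ^ 'n::finite \<Rightarrow> real"
  assumes \<phi>[measurable]: "\<phi> \<in> borel_measurable borel" and K: "\<And>x. \<bar>\<phi> x\<bar> \<le> K"
  shows "\<bar>(LINT \<xi>|gauss. \<phi> (\<xi> + b')) - (LINT \<xi>|gauss. \<phi> (\<xi> + b))\<bar>
    \<le> K * (LINT \<xi>|(gauss :: (real ^ 'n) measure). norm \<xi>) * norm (b' - b)"
proof -
  have "onorm (\<lambda>h. h \<bullet> (LINT \<xi>|gauss. \<phi> (\<xi> + x) *\<^sub>R \<xi>)) \<le> K * (LINT \<xi>|(gauss :: (real ^ 'n) measure). norm \<xi>)" for x
  proof (rule onorm_le)
    fix h :: "real ^ 'n"
    have "norm (h \<bullet> (LINT \<xi>|gauss. \<phi> (\<xi> + x) *\<^sub>R \<xi>)) \<le> norm h * norm (LINT \<xi>|gauss. \<phi> (\<xi> + x) *\<^sub>R \<xi>)"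
      by (simp add: Cauchy_Schwarz_ineq2)
    also have "\<dots> \<le> norm h * (K * (LINT \<xi>|(gauss :: (real ^ 'n) measure). norm \<xi>))"
      by (intro mult_left_mono gauss_derivative_bound assms) auto
    finally show "norm (h \<bullet> (LINT \<xi>|gauss. \<phi> (\<xi> + x) *\<^sub>R \<xi>)) \<le> K * (LINT \<xi>|(gauss :: (real ^ 'n) measure). norm \<xi>) * norm h"
      by (simp add: mult_ac)
  qed
  then have "norm ((LINT \<xi>|gauss. \<phi> (\<xi> + b')) - (LINT \<xi>|gauss. \<phi> (\<xi> + b))) \<le> K * (LINT \<xi>|(gauss :: (real ^ 'n) measure). norm \<xi>) * norm (b' - b)"
    by (intro differentiable_bound[OF convex_UNIV gauss_has_derivative[OF assms]]) auto
  then show ?thesis by simp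
qed

section \<open>Singular integrals and Riemann sums\<close>

text \<open>Dominated convergence for the remainders of the difference quotients, with majorant
  \<open>c\<close> plus the norm of \<open>g\<close>. It serves for the average over the random
  covariance as well as for the integral over time, where the derivatives exist only almost
  everywhere in the parameter.\<close>

lemma has_derivative_integral_lipschitz:
  fixes F :: "'a \<Rightarrow> 'b::euclidean_space \<Rightarrow> real" and g :: "'a \<Rightarrow> 'b"
  assumes int: "\<And>y. integrable M (\<lambda>\<zeta>. F \<zeta> y)"
    and der: "AE \<zeta> in M. (F \<zeta> has_derivative (\<lambda>h. h \<bullet> g \<zeta>)) (at y)"
    and lip: "AE \<zeta> in M. \<forall>y'. \<bar>F \<zeta> y' - F \<zeta> y\<bar> \<le> c \<zeta> * norm (y' - y)"
    and c: "integrable M c" and g: "integrable M g"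
  shows "((\<lambda>y. LINT \<zeta>|M. F \<zeta> y) has_derivative (\<lambda>h. h \<bullet> (LINT \<zeta>|M. g \<zeta>))) (at y)"
  unfolding has_derivative_iff_norm
proof
  show "bounded_linear (\<lambda>h. h \<bullet> (LINT \<zeta>|M. g \<zeta>))" by (rule bounded_linear_inner_left)
  show "(\<lambda>y'. norm ((LINT \<zeta>|M. F \<zeta> y') - (LINT \<zeta>|M. F \<zeta> y) - (y' - y) \<bullet> (LINT \<zeta>|M. g \<zeta>)) / norm (y' - y)) \<midarrow>y\<rightarrow> 0"
    unfolding tendsto_at_iff_sequentially comp_def
  proof (intro allI impI)
    fix X :: "nat \<Rightarrow> 'b" assume X: "\<forall>i. X i \<in> UNIV - {y}" and lim: "X \<longlonglongrightarrow> y"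
    define q where "q n \<zeta> = (F \<zeta> (X n) - F \<zeta> y - (X n - y) \<bullet> g \<zeta>) / norm (X n - y)" for n \<zeta>
    have qi: "integrable M (q n)" for n
      unfolding q_def using int g by auto
    have eq: "norm ((LINT \<zeta>|M. F \<zeta> (X n)) - (LINT \<zeta>|M. F \<zeta> y) - (X n - y) \<bullet> (LINT \<zeta>|M. g \<zeta>)) / norm (X n - y)
        = \<bar>LINT \<zeta>|M. q n \<zeta>\<bar>" for n
      unfolding q_def using int g by (simp add: abs_divide)
    have "(\<lambda>n. LINT \<zeta>|M. q n \<zeta>) \<longlonglongrightarrow> (LINT \<zeta>|M. 0)"
    proof (rule integral_dominated_convergence[where w="\<lambda>\<zeta>. c \<zeta> + norm (g \<zeta>)"])
      show "AE \<zeta> in M. (\<lambda>n. q n \<zeta>) \<longlonglongrightarrow> 0"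
        using der
      proof eventually_elim
        case (elim \<zeta>)
        then have "(\<lambda>n. norm (F \<zeta> (X n) - F \<zeta> y - (X n - y) \<bullet> g \<zeta>) / norm (X n - y)) \<longlonglongrightarrow> 0"
          using X lim unfolding has_derivative_iff_norm tendsto_at_iff_sequentially comp_def by blast
        then have "(\<lambda>n. norm (q n \<zeta>)) \<longlonglongrightarrow> 0" by (simp add: q_def abs_divide)
        then show ?case by (rule tendsto_norm_zero_cancel)
      qed
      show "AE \<zeta> in M. norm (q n \<zeta>) \<le> c \<zeta> + norm (g \<zeta>)" for n
        using lip
      proof eventually_elim
        case (elim \<zeta>)
        have n0: "0 < norm (X n - y)" using X by simp
        have "\<bar>F \<zeta> (X n) - F \<zeta> y - (X n - y) \<bullet> g \<zeta>\<bar> \<le> \<bar>F \<zeta> (X n) - F \<zeta> y\<bar> + \<bar>(X n - y) \<bullet> g \<zeta>\<bar>"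
          by (rule abs_triangle_ineq4)
        also have "\<dots> \<le> c \<zeta> * norm (X n - y) + norm (X n - y) * norm (g \<zeta>)"
          using elim by (intro add_mono Cauchy_Schwarz_ineq2) auto
        finally show ?case using n0 by (simp add: q_def abs_divide divide_le_eq algebra_simps)
      qed
    qed (use qi c g in auto)
    then show "(\<lambda>n. norm ((LINT \<zeta>|M. F \<zeta> (X n)) - (LINT \<zeta>|M. F \<zeta> y) - (X n - y) \<bullet> (LINT \<zeta>|M. g \<zeta>)) / norm (X n - y)) \<longlonglongrightarrow> 0"
      unfolding eq by (simp add: tendsto_rabs_zero)
  qed
qed

section \<open>Power singularities in time\<close>

lemma powr_integrable_0:
  fixes b c :: real
  assumes "b < 1" "0 \<le> c"
  shows "integrable lborel (\<lambda>x. indicator {0..c} x * x powr - b)"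
    and "(LINT x|lborel. indicator {0..c} x * x powr - b) = c powr (1 - b) / (1 - b)"
proof -
  have "((\<lambda>x. x powr - b) has_integral c powr (- b + 1) / (- b + 1)) {0..c}"
    using assms by (intro has_integral_powr_from_0) auto
  then have "(\<integral>\<^sup>+x. ennreal (indicator {0..c} x * x powr - b) \<partial>lborel) = ennreal (c powr (- b + 1) / (- b + 1))"
    by (intro nn_integral_has_integral_lebesgue) auto
  then have "(\<integral>\<^sup>+x. ennreal (indicator {0..c} x * x powr - b) \<partial>lborel) = ennreal (c powr (1 - b) / (1 - b))"
    by (simp add: add.commute)
  then have "has_bochner_integral lborel (\<lambda>x. indicator {0..c} x * x powr - b) (c powr (1 - b) / (1 - b))"
    using assms by (intro has_bochner_integral_nn_integral) auto
  then show "integrable lborel (\<lambda>x. indicator {0..c} x * x powr - b)"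
    and "(LINT x|lborel. indicator {0..c} x * x powr - b) = c powr (1 - b) / (1 - b)"
    by (auto simp: has_bochner_integral_iff)
qed

lemma powr_integrable_left:
  fixes b u t :: real
  assumes "b < 1" "u \<le> t"
  shows "integrable lborel (\<lambda>r. indicator {u..t} r * (r - u) powr - b)"
    and "(LINT r|lborel. indicator {u..t} r * (r - u) powr - b) = (t - u) powr (1 - b) / (1 - b)"
proof -
  have eq: "indicator {0..t - u} (- u + 1 * r) * (- u + 1 * r) powr - b = indicator {u..t} r * (r - u) powr - b" for r
    by (auto simp: indicator_def)
  show "integrable lborel (\<lambda>r. indicator {u..t} r * (r - u) powr - b)"
    using lborel_integrable_real_affine[OF powr_integrable_0(1)[of b "t - u"], of 1 "- u"] assms by (simp only: eq)
  show "(LINT r|lborel. indicator {u..t} r * (r - u) powr - b) = (t - u) powr (1 - b) / (1 - b)"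
    using lborel_integral_real_affine[of 1 "\<lambda>x. indicator {0..t - u} x * x powr - b" "- u"] powr_integrable_0(2)[of b "t - u"] assms
    by (simp only: eq) simp
qed

lemma powr_integrable_right:
  fixes b u t :: real
  assumes "b < 1" "u \<le> t"
  shows "integrable lborel (\<lambda>r. indicator {u..t} r * (t - r) powr - b)"
    and "(LINT r|lborel. indicator {u..t} r * (t - r) powr - b) = (t - u) powr (1 - b) / (1 - b)"
proof -
  have eq: "indicator {0..t - u} (t + (- 1) * r) * (t + (- 1) * r) powr - b = indicator {u..t} r * (t - r) powr - b" for r
    by (auto simp: indicator_def)
  show "integrable lborel (\<lambda>r. indicator {u..t} r * (t - r) powr - b)"
    using lborel_integrable_real_affine[OF powr_integrable_0(1)[of b "t - u"], of "- 1" t] assms by (simp only: eq)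
  show "(LINT r|lborel. indicator {u..t} r * (t - r) powr - b) = (t - u) powr (1 - b) / (1 - b)"
    using lborel_integral_real_affine[of "- 1" "\<lambda>x. indicator {0..t - u} x * x powr - b" t] powr_integrable_0(2)[of b "t - u"] assms
    by (simp only: eq) simp
qed

text \<open>The larger of \<open>a\<close> and \<open>c\<close> is at least their mean, and the
  power is decreasing; so one factor is bounded by its value at the mean and the other is kept. A
  product of singularities at two ends thus splits into two one-sided ones.\<close>

lemma powr_mult_le_add:
  fixes a c b :: real
  assumes "0 \<le> a" "0 \<le> c" "0 \<le> b"
  shows "a powr - b * c powr - b \<le> ((a + c) / 2) powr - b * (a powr - b + c powr - b)"
proof (cases "a = 0 \<or> c = 0")
  case True
  then show ?thesis by auto
next
  case False
  then have ac: "0 < a" "0 < c" using assms by auto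
  have *: "x powr - b \<le> ((a + c) / 2) powr - b" if "(a + c) / 2 \<le> x" for x
    using that ac assms by (intro powr_mono2') auto
  show ?thesis
  proof (cases "a \<le> c")
    case True
    then have "a powr - b * c powr - b \<le> a powr - b * ((a + c) / 2) powr - b"
      by (intro mult_left_mono *) auto
    also have "\<dots> \<le> ((a + c) / 2) powr - b * (a powr - b + c powr - b)"
      by (simp add: algebra_simps)
    finally show ?thesis .
  next
    case False
    then have "a powr - b * c powr - b \<le> ((a + c) / 2) powr - b * c powr - b"
      by (intro mult_right_mono *) auto
    also have "\<dots> \<le> ((a + c) / 2) powr - b * (a powr - b + c powr - b)"
      by (simp add: algebra_simps)
    finally show ?thesis .
  qed
qed

text \<open>A substitute for the beta function constant: \<open>2 powr b\<close> comes from
  evaluating at half the length, the next factor 2 from the two one-sided integrals, and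
  \<open>T powr (1 - b)\<close> bounds the surplus power of the length.\<close>

definition beta_const :: "real \<Rightarrow> real \<Rightarrow> real" where
  "beta_const b T = 2 powr b * (2 * T powr (1 - b) / (1 - b))"

text \<open>The bound is again a multiple of the length to the power \<open>- b\<close>, the form in
  which it enters. This closure under iteration is what the estimates of the recursion rest on; it
  costs only a power of \<open>T\<close>.\<close>

lemma powr_beta_integral:
  fixes b u t T :: real
  assumes b: "0 < b" "b < 1" and ut: "u < t" "t - u \<le> T"
  shows "integrable lborel (\<lambda>r. indicator {u..t} r * ((r - u) powr - b * (t - r) powr - b))"
    and "(LINT r|lborel. indicator {u..t} r * ((r - u) powr - b * (t - r) powr - b)) \<le> beta_const b T * (t - u) powr - b"
proof -
  let ?h = "\<lambda>r. ((t - u) / 2) powr - b * (indicator {u..t} r * (r - u) powr - b + indicator {u..t} r * (t - r) powr - b)"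
  have hi: "integrable lborel ?h"
    using powr_integrable_left[of b u t] powr_integrable_right[of b u t] b ut
    by (intro integrable_mult_right Bochner_Integration.integrable_add) auto
  have le: "indicator {u..t} r * ((r - u) powr - b * (t - r) powr - b) \<le> ?h r" for r
    using powr_mult_le_add[of "r - u" "t - r" b] b by (auto simp: indicator_def)
  show i: "integrable lborel (\<lambda>r. indicator {u..t} r * ((r - u) powr - b * (t - r) powr - b))"
  proof (rule Bochner_Integration.integrable_bound[OF hi])
    show "AE r in lborel. norm (indicator {u..t} r * ((r - u) powr - b * (t - r) powr - b)) \<le> norm (?h r)"
      using le by (intro AE_I2) (simp add: abs_mult order_trans[OF le abs_ge_self])
  qed simp
  have "(LINT r|lborel. indicator {u..t} r * ((r - u) powr - b * (t - r) powr - b)) \<le> (LINT r|lborel. ?h r)"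
    by (rule integral_mono[OF i hi le])
  also have "\<dots> = ((t - u) / 2) powr - b * (2 * (t - u) powr (1 - b) / (1 - b))"
    using powr_integrable_left[of b u t] powr_integrable_right[of b u t] b ut by simp
  also have "\<dots> = 2 powr b * (2 * (t - u) powr (1 - b) / (1 - b)) * (t - u) powr - b"
    using ut by (simp add: powr_divide powr_minus field_simps)
  also have "\<dots> \<le> beta_const b T * (t - u) powr - b"
    unfolding beta_const_def using ut b
    by (intro mult_right_mono mult_left_mono divide_right_mono powr_mono2) auto
  finally show "(LINT r|lborel. indicator {u..t} r * ((r - u) powr - b * (t - r) powr - b)) \<le> beta_const b T * (t - u) powr - b" .
qed

section \<open>Time integrals up to finitely many points\<close>

lemma integral_lborel_cong_cofinite:
  fixes f g :: "real \<Rightarrow> 'b::{banach, second_countable_topology}"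
  assumes "finite X" "\<And>x. x \<notin> X \<Longrightarrow> f x = g x"
  shows "(LINT x|lborel. f x) = (LINT x|lborel. g x)"
  using assms by (intro integral_discrete_difference[where X=X]) (auto intro: countable_finite)

text \<open>Dropping the two end points at every level loses only null sets, so that integrands need
  to be compared at strictly increasing times alone, where no block of time is degenerate.\<close>

lemma simplex_integral_cong:
  assumes "\<And>rs. length rs = m \<Longrightarrow> sorted_wrt (<) (s # rs @ [t]) \<Longrightarrow> G rs = H rs" and "s < t"
  shows "simplex_integral m s t G = simplex_integral m s t H"
  using assms
proof (induction m arbitrary: s G H)
  case 0
  then show ?case by simp
next
  case (Suc m)
  have "simplex_integral m r t (\<lambda>rs. G (r # rs)) = simplex_integral m r t (\<lambda>rs. H (r # rs))" if r: "s < r" "r < t" for r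
  proof (rule Suc.IH)
    fix rs assume "length rs = m" "sorted_wrt (<) (r # rs @ [t])"
    with r show "G (r # rs) = H (r # rs)" by (intro Suc.prems) auto
  qed (use r in auto)
  then show ?case
    unfolding simplex_integral.simps set_lebesgue_integral_def
    by (intro integral_lborel_cong_cofinite[of "{s, t}"]) (auto simp: indicator_def)
qed

section \<open>Convolution with an exponential as a limit of Riemann sums\<close>

text \<open>The integral of \<open>exp (- c * (t - q))\<close> with respect to \<open>dg\<close>
  over the interval from \<open>u\<close> to \<open>t\<close>, integrated by parts. In this form it
  makes pathwise sense also for paths of unbounded variation, so it serves both the subordinator and
  the subordinated Brownian motion.\<close>

definition conv :: "real \<Rightarrow> (real \<Rightarrow> real) \<Rightarrow> real \<Rightarrow> real \<Rightarrow> real" where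
  "conv c g u t = g t - exp (- c * (t - u)) * g u - c * (LINT q:{u..t}|lborel. exp (- c * (t - q)) * g q)"

definition grid :: "real \<Rightarrow> real \<Rightarrow> nat \<Rightarrow> nat \<Rightarrow> real" where
  "grid u t m k = u + real k / real m * (t - u)"

lemma grid_0 [simp]: "grid u t m 0 = u" and grid_m [simp]: "0 < m \<Longrightarrow> grid u t m m = t"
  by (auto simp: grid_def)

lemma grid_mono: "u \<le> t \<Longrightarrow> k \<le> l \<Longrightarrow> grid u t m k \<le> grid u t m l"
  by (auto simp: grid_def intro!: mult_right_mono divide_right_mono)

lemma grid_mem: "u \<le> t \<Longrightarrow> k \<le> m \<Longrightarrow> 0 < m \<Longrightarrow> grid u t m k \<in> {u..t}"
  using grid_mono[of u t 0 k m] grid_mono[of u t k m m] by auto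

lemma grid_cell:
  assumes "u < t" "0 < m" "q \<in> {u<..t}"
  obtains k where "k < m" "grid u t m k < q" "q \<le> grid u t m (Suc k)"
    "\<And>k'. indicator {grid u t m k'<..grid u t m (Suc k')} q = (if k' = k then 1 else (0::real))"
proof -
  define x where "x = (q - u) * real m / (t - u)"
  have x0: "0 < x" "x \<le> real m" using assms by (auto simp: x_def field_simps)
  define k where "k = nat (\<lceil>x\<rceil> - 1)"
  have c1: "1 \<le> \<lceil>x\<rceil>" using x0 by linarith
  have cx: "real k = of_int \<lceil>x\<rceil> - 1" using c1 by (simp add: k_def)
  have iff: "q \<in> {grid u t m k'<..grid u t m (Suc k')} \<longleftrightarrow> real k' < x \<and> x \<le> real k' + 1" for k'
    using assms by (auto simp: grid_def x_def field_simps)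
  have mem: "real k < x \<and> x \<le> real k + 1" using cx by linarith
  have "real k < real m" using mem x0 by linarith
  then have km: "k < m" by simp
  have uniq: "k' = k" if "real k' < x \<and> x \<le> real k' + 1" for k'
    using that mem by linarith
  have "indicator {grid u t m k'<..grid u t m (Suc k')} q = (if k' = k then 1 else (0::real))" for k'
    using iff[of k'] mem uniq[of k'] by (auto simp: indicator_def simp del: greaterThanAtMost_iff)
  with km iff[of k] mem show ?thesis by (intro that) auto
qed

lemma grid_step: "grid u t m (Suc k) - grid u t m k = (t - u) / real m"
  by (simp add: grid_def field_simps add_divide_distrib)

text \<open>The value at the right end point is used because it converges under right continuity
  alone, and because it is the value that summation by parts pairs with the increments of the
  exponential.\<close>

definition right_step :: "(real \<Rightarrow> real) \<Rightarrow> real \<Rightarrow> real \<Rightarrow> nat \<Rightarrow> real \<Rightarrow> real" where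
  "right_step g u t m q = (\<Sum>k<m. indicator {grid u t m k<..grid u t m (Suc k)} q * g (grid u t m (Suc k)))"

lemma right_step_cell:
  assumes "u < t" "0 < m" "q \<in> {u<..t}"
  obtains p where "right_step g u t m q = g p" "q \<le> p" "p \<le> t" "p < q + (t - u) / m"
proof -
  obtain k where k: "k < m" "grid u t m k < q" "q \<le> grid u t m (Suc k)"
    "\<And>k'. indicator {grid u t m k'<..grid u t m (Suc k')} q = (if k' = k then 1 else (0::real))"
    using grid_cell[OF assms] by blast
  have "right_step g u t m q = g (grid u t m (Suc k))"
    unfolding right_step_def k(4) using k(1) by (simp add: if_distrib[of "\<lambda>x. x * _"] cong: if_cong)
  moreover have "grid u t m (Suc k) \<le> t" using grid_mem[of u t "Suc k" m] k(1) assms by auto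
  ultimately show ?thesis using k(2,3) grid_step[of u t m k] by (intro that[of "grid u t m (Suc k)"]) auto
qed

lemma right_step_outside: "u \<le> t \<Longrightarrow> q \<notin> {u<..t} \<Longrightarrow> right_step g u t m q = 0"
proof -
  assume ut: "u \<le> t" and q: "q \<notin> {u<..t}"
  have "q \<notin> {grid u t m k<..grid u t m (Suc k)}" if "k < m" for k
    using grid_mem[of u t k m] grid_mem[of u t "Suc k" m] that ut q by auto
  then show ?thesis unfolding right_step_def by (auto intro!: sum.neutral)
qed

lemma right_step_tendsto:
  assumes ut: "u < t" and rc: "\<And>q. q \<in> {u..<t} \<Longrightarrow> (g \<longlongrightarrow> g q) (at_right q)" and q: "q \<in> {u<..t}"
  shows "(\<lambda>m. right_step g u t m q) \<longlonglongrightarrow> g q"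
proof (cases "q = t")
  \<comment> \<open>Right continuity is not assumed at \<open>t\<close>, but the cell containing
    \<open>t\<close> has \<open>t\<close> as its right end point, so the approximation is exact
    there.\<close>
  case True
  have "right_step g u t m q = g t" if "0 < m" for m
    by (rule right_step_cell[OF ut that q, of g]) (use True in auto)
  then show ?thesis using True
    by (intro tendsto_eventually) (auto simp: eventually_sequentially intro!: exI[of _ 1])
next
  case False
  have lim: "(g \<longlongrightarrow> g q) (at_right q)" using rc q False by auto
  show ?thesis
  proof (rule LIMSEQ_I)
    fix r :: real assume "0 < r"
    then have "eventually (\<lambda>p. dist (g p) (g q) < r) (at_right q)" using tendstoD[OF lim] by blast
    then obtain b where b: "b > q" "\<And>p. q < p \<Longrightarrow> p < b \<Longrightarrow> dist (g p) (g q) < r"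
      unfolding eventually_at_right_field by blast
    obtain n :: nat where n: "(t - u) / (b - q) < real n" using reals_Archimedean2 by blast
    have "norm (right_step g u t m q - g q) < r" if "m \<ge> Suc n" for m
    proof -
      have m: "0 < m" "(t - u) / real m < b - q"
      proof -
        show "0 < m" using that by simp
        have "(t - u) / (b - q) < real m" using n that by linarith
        then show "(t - u) / real m < b - q" using b(1) \<open>0 < m\<close> by (simp add: field_simps)
      qed
      obtain p where p: "right_step g u t m q = g p" "q \<le> p" "p < q + (t - u) / m"
        using right_step_cell[OF ut m(1) q] by metis
      have "p < b" using p m by linarith
      then show ?thesis using b(2)[of p] p \<open>0 < r\<close> by (cases "p = q") (auto simp: dist_norm)
    qed
    then show "\<exists>no. \<forall>m\<ge>no. norm (right_step g u t m q - g q) < r" by blast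
  qed
qed

lemma right_step_measurable [measurable]: "right_step g u t m \<in> borel_measurable borel"
  unfolding right_step_def by measurable

text \<open>A pointwise limit of the step functions. The cells are open on the left, hence the value
  at \<open>u\<close> is added separately.\<close>

lemma right_continuous_measurable:
  fixes g :: "real \<Rightarrow> real"
  assumes ut: "u < t" and rc: "\<And>q. q \<in> {u..<t} \<Longrightarrow> (g \<longlongrightarrow> g q) (at_right q)"
  shows "(\<lambda>q. indicator {u..t} q * g q) \<in> borel_measurable borel"
proof -
  have "(\<lambda>q. indicator {u<..t} q * g q) \<in> borel_measurable borel"
  proof (rule borel_measurable_LIMSEQ_real)
    show "(\<lambda>m. right_step g u t m q) \<longlonglongrightarrow> indicator {u<..t} q * g q" for q
      using right_step_tendsto[OF ut rc, of q] right_step_outside[of u t q g] ut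
      by (cases "q \<in> {u<..t}") auto
  qed measurable
  then have "(\<lambda>q. indicator {u<..t} q * g q + indicator {u} q * g u) \<in> borel_measurable borel" by measurable
  also have "(\<lambda>q. indicator {u<..t} q * g q + indicator {u} q * g u) = (\<lambda>q. indicator {u..t} q * g q)"
    using ut by (auto simp: indicator_def fun_eq_iff)
  finally show ?thesis .
qed

lemma set_integrable_bounded_interval:
  fixes g :: "real \<Rightarrow> real"
  assumes "(\<lambda>q. indicator {u..t} q * g q) \<in> borel_measurable borel" "\<And>q. q \<in> {u..t} \<Longrightarrow> \<bar>g q\<bar> \<le> K"
  shows "set_integrable lborel {u..t} g"
  unfolding set_integrable_def
proof (rule Bochner_Integration.integrable_bound)
  show "integrable lborel (\<lambda>x. indicator {u..t} x *\<^sub>R K)"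
    using borel_integrable_compact[of "{u..t}" "\<lambda>_. K"] by (simp add: indicator_scaleR_eq_if)
  show "AE x in lborel. norm (indicator {u..t} x *\<^sub>R g x) \<le> norm (indicator {u..t} x *\<^sub>R K)"
    using assms(2) by (intro AE_I2) (force simp: indicator_def)
qed (use assms(1) in auto)

text \<open>Summation by parts turns the increments of \<open>g\<close> into increments of the
  exponential, which are integrals of its derivative over the cells. What remains is a Lebesgue
  integral of \<open>right_step\<close>, and dominated convergence applies because \<open>g\<close>
  is bounded.\<close>

lemma riemann_sum_tendsto_conv:
  assumes ut: "u < t" and rc: "\<And>q. q \<in> {u..<t} \<Longrightarrow> (g \<longlongrightarrow> g q) (at_right q)"
    and K: "\<And>q. q \<in> {u..t} \<Longrightarrow> \<bar>g q\<bar> \<le> K"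
  shows "(\<lambda>m. \<Sum>k<m. exp (- c * (t - grid u t m k)) * (g (grid u t m (Suc k)) - g (grid u t m k))) \<longlonglongrightarrow> conv c g u t"
proof -
  define S where "S m = (\<Sum>k<m. exp (- c * (t - grid u t m k)) * (g (grid u t m (Suc k)) - g (grid u t m k)))" for m
  define J where "J m = (LINT q|lborel. indicator {u..t} q * (c * exp (- c * (t - q))) * right_step g u t m q)" for m
  have Seq: "S m = g t - exp (- c * (t - u)) * g u - J m" if m: "0 < m" for m
  proof -
    let ?r = "grid u t m" and ?e = "\<lambda>q. exp (- c * (t - q))"
    have abel: "(\<Sum>k<n. ?e (?r k) * (g (?r (Suc k)) - g (?r k))) =
        ?e (?r n) * g (?r n) - ?e (?r 0) * g (?r 0) - (\<Sum>k<n. g (?r (Suc k)) * (?e (?r (Suc k)) - ?e (?r k)))" for n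
      by (induction n) (simp_all add: algebra_simps)
    have fb: "has_bochner_integral lborel (\<lambda>q. (c * ?e q) * indicator {a..b} q) (?e b - ?e a)" if "a \<le> b" for a b
      by (rule has_bochner_integral_FTC_Icc_real[OF that])
         (auto intro!: derivative_eq_intros continuous_intros)
    have fb': "has_bochner_integral lborel (\<lambda>q. (c * ?e q) * indicator {a<..b} q) (?e b - ?e a)" if "a \<le> b" for a b
      using fb[OF that] by (subst has_bochner_integral_discrete_difference[where X="{a}" and g="\<lambda>q. (c * ?e q) * indicator {a..b} q"])
         (auto simp: indicator_def)
    have sub: "indicator {u..t} q * (c * ?e q) * right_step g u t m q =
        (\<Sum>k<m. g (?r (Suc k)) * ((c * ?e q) * indicator {?r k<..?r (Suc k)} q))" for q
    proof (cases "q \<in> {u<..t}")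
      case True
      then show ?thesis unfolding right_step_def sum_distrib_left by (intro sum.cong) (auto simp: mult_ac)
    next
      case False
      then have "q \<notin> {?r k<..?r (Suc k)}" if "k < m" for k
        using grid_mem[of u t k m] grid_mem[of u t "Suc k" m] that ut by auto
      then show ?thesis using right_step_outside[of u t q g m] False ut by simp
    qed
    have "has_bochner_integral lborel (\<lambda>q. indicator {u..t} q * (c * ?e q) * right_step g u t m q)
       (\<Sum>k<m. g (?r (Suc k)) * (?e (?r (Suc k)) - ?e (?r k)))"
      unfolding sub using grid_mono[of u t _ _ m] ut
      by (intro has_bochner_integral_sum has_bochner_integral_mult_right fb') auto
    then have "J m = (\<Sum>k<m. g (?r (Suc k)) * (?e (?r (Suc k)) - ?e (?r k)))"
      unfolding J_def by (simp add: has_bochner_integral_iff)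
    then show ?thesis unfolding S_def abel using m by simp
  qed
  have meas: "(\<lambda>q. indicator {u..t} q * g q) \<in> borel_measurable borel"
    by (rule right_continuous_measurable[OF ut rc])
  have "J \<longlonglongrightarrow> (LINT q|lborel. c * exp (- c * (t - q)) * (indicator {u..t} q * g q))"
    unfolding J_def
  proof (rule integral_dominated_convergence[where w="\<lambda>q. indicator {u..t} q * (\<bar>c * exp (- c * (t - q))\<bar> * K)"])
    have "AE q in lborel. q \<noteq> u" by (rule AE_lborel_singleton)
    then show "AE q in lborel. (\<lambda>m. indicator {u..t} q * (c * exp (- c * (t - q))) * right_step g u t m q) \<longlonglongrightarrow> c * exp (- c * (t - q)) * (indicator {u..t} q * g q)"
    proof eventually_elim
      case (elim q)
      show ?case
      proof (cases "q \<in> {u..t}")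
        case True
        then have "q \<in> {u<..t}" using elim by auto
        from right_step_tendsto[OF ut rc this] show ?thesis using True by (auto intro!: tendsto_mult_left)
      qed auto
    qed
    show "AE q in lborel. norm (indicator {u..t} q * (c * exp (- c * (t - q))) * right_step g u t m q) \<le> indicator {u..t} q * (\<bar>c * exp (- c * (t - q))\<bar> * K)" for m
    proof (intro AE_I2)
      fix q
      have K0: "0 \<le> K" using K[of u] ut by force
      have "\<bar>right_step g u t m q\<bar> \<le> K" if "q \<in> {u..t}"
      proof (cases "q \<in> {u<..t} \<and> 0 < m")
        case True
        then show ?thesis using right_step_cell[OF ut, of m q g] K by (metis atLeastAtMost_iff greaterThanAtMost_iff less_imp_le order.trans)
      next
        case False
        then show ?thesis using right_step_outside[of u t q g m] ut K0 by (auto simp: right_step_def)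
      qed
      then show "norm (indicator {u..t} q * (c * exp (- c * (t - q))) * right_step g u t m q) \<le> indicator {u..t} q * (\<bar>c * exp (- c * (t - q))\<bar> * K)"
        by (auto simp: indicator_def abs_mult intro!: mult_left_mono)
    qed
    have "integrable lborel (\<lambda>q. indicator {u..t} q *\<^sub>R (\<bar>c * exp (- c * (t - q))\<bar> * K))"
      by (rule borel_integrable_compact) (auto intro!: continuous_intros)
    then show "integrable lborel (\<lambda>q. indicator {u..t} q * (\<bar>c * exp (- c * (t - q))\<bar> * K))" by simp
  qed (use meas in measurable)
  moreover have "(LINT q|lborel. c * exp (- c * (t - q)) * (indicator {u..t} q * g q)) = c * (LINT q:{u..t}|lborel. exp (- c * (t - q)) * g q)"
    unfolding set_lebesgue_integral_def by (simp add: mult_ac flip: integral_mult_right_zero)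
  ultimately have J: "J \<longlonglongrightarrow> c * (LINT q:{u..t}|lborel. exp (- c * (t - q)) * g q)" by simp
  have "S \<longlonglongrightarrow> conv c g u t"
    unfolding conv_def
    by (rule Lim_transform_eventually[OF tendsto_diff[OF tendsto_const J]])
       (auto simp: eventually_sequentially Seq intro!: exI[of _ 1])
  then show ?thesis unfolding S_def .
qed

section \<open>Variation of constants\<close>

text \<open>The one-sided limits bound \<open>g\<close> on a neighbourhood of every point, and
  finitely many such neighbourhoods cover the compact interval.\<close>

lemma cadlag_on_bounded:
  fixes g :: "real \<Rightarrow> 'b::real_normed_vector"
  assumes "cadlag_on {s..T} g"
  shows "bounded (g ` {s..T})"
proof -
  have "\<exists>d>0. bounded (g ` (ball t d \<inter> {s..T}))" if t: "t \<in> {s..T}" for t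
  proof -
    from assms t obtain l where R: "(g \<longlongrightarrow> g t) (at t within {s..T} \<inter> {t<..})"
      and L: "(g \<longlongrightarrow> l) (at t within {s..T} \<inter> {..<t})" unfolding cadlag_on_def by blast
    obtain d1 where d1: "d1 > 0" "\<And>x. x \<in> {s..T} \<inter> {t<..} \<Longrightarrow> x \<noteq> t \<and> dist x t < d1 \<Longrightarrow> dist (g x) (g t) < 1"
      using tendstoD[OF R, of 1] unfolding eventually_at by auto
    obtain d2 where d2: "d2 > 0" "\<And>x. x \<in> {s..T} \<inter> {..<t} \<Longrightarrow> x \<noteq> t \<and> dist x t < d2 \<Longrightarrow> dist (g x) l < 1"
      using tendstoD[OF L, of 1] unfolding eventually_at by auto
    have "g ` (ball t (min d1 d2) \<inter> {s..T}) \<subseteq> ball (g t) 1 \<union> ball l 1"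
    proof
      fix y assume "y \<in> g ` (ball t (min d1 d2) \<inter> {s..T})"
      then obtain x where x: "y = g x" "x \<in> {s..T}" "dist x t < d1" "dist x t < d2" by (auto simp: dist_commute)
      show "y \<in> ball (g t) 1 \<union> ball l 1"
        using d1(2)[of x] d2(2)[of x] x by (cases x t rule: linorder_cases) (auto simp: dist_commute)
    qed
    then have "bounded (g ` (ball t (min d1 d2) \<inter> {s..T}))"
      by (rule bounded_subset[rotated]) auto
    then show ?thesis using d1(1) d2(1) by (intro exI[of _ "min d1 d2"]) auto
  qed
  then obtain d where d: "\<And>t. t \<in> {s..T} \<Longrightarrow> d t > 0 \<and> bounded (g ` (ball t (d t) \<inter> {s..T}))" by metis
  have cov: "{s..T} \<subseteq> (\<Union>c\<in>{s..T}. ball c (d c))" using d by force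
  obtain C where C: "C \<subseteq> {s..T}" "finite C" "{s..T} \<subseteq> (\<Union>c\<in>C. ball c (d c))"
    by (rule compactE_image[OF compact_Icc _ cov]) auto
  have "g ` {s..T} \<subseteq> (\<Union>c\<in>C. g ` (ball c (d c) \<inter> {s..T}))"
  proof
    fix y assume "y \<in> g ` {s..T}"
    then obtain x where x: "y = g x" "x \<in> {s..T}" by auto
    then obtain c where "c \<in> C" "x \<in> ball c (d c)" using C(3) by blast
    with x show "y \<in> (\<Union>c\<in>C. g ` (ball c (d c) \<inter> {s..T}))" by blast
  qed
  moreover have "bounded (\<Union>c\<in>C. g ` (ball c (d c) \<inter> {s..T}))" using C d by (intro bounded_UN) auto
  ultimately show ?thesis by (rule bounded_subset[rotated])
qed

lemma cadlag_on_at_right: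
  fixes g :: "real \<Rightarrow> 'b::topological_space"
  assumes "cadlag_on {s..T} g" "q \<in> {s..<T}"
  shows "(g \<longlongrightarrow> g q) (at_right q)"
proof -
  have "at q within ({s..T} \<inter> {q<..}) = at_right q"
    by (rule at_within_nhd[of _ "{..<T}"]) (use assms(2) in auto)
  moreover have "(g \<longlongrightarrow> g q) (at q within ({s..T} \<inter> {q<..}))"
    using assms unfolding cadlag_on_def by auto
  ultimately show ?thesis by simp
qed

lemma cadlag_on_atLeast_at_right:
  fixes g :: "real \<Rightarrow> 'b::topological_space"
  assumes "cadlag_on {0..} g" "0 \<le> q"
  shows "(g \<longlongrightarrow> g q) (at_right q)"
proof -
  have "{0..} \<inter> {q<..} = {q<..}" using assms(2) by auto
  moreover have "(g \<longlongrightarrow> g q) (at q within ({0..} \<inter> {q<..}))"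
    using assms unfolding cadlag_on_def by auto
  ultimately show ?thesis by simp
qed

text \<open>Variation of constants. As \<open>G\<close> need not be differentiable, the equation is integrated
  against \<open>l * exp (l * r)\<close> and the double integral is evaluated by Fubini's theorem.\<close>

lemma variation_of_constants:
  fixes X \<phi> G :: "real \<Rightarrow> real"
  assumes ut: "u \<le> t"
    and iX: "set_integrable lborel {u..t} X" and i\<phi>: "set_integrable lborel {u..t} \<phi>" and iG: "set_integrable lborel {u..t} G"
    and eq: "\<And>r. r \<in> {u..t} \<Longrightarrow> X r = X u + (LINT q:{u..r}|lborel. - l * X q + \<phi> q) + (G r - G u)"
  shows "X t - exp (- l * (t - u)) * X u - (LINT q:{u..t}|lborel. exp (- l * (t - q)) * \<phi> q) = conv l G u t"
proof -
  define h where "h q = indicator {u..t} q * (- l * X q + \<phi> q)" for q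
  have hi: "integrable lborel h"
  proof -
    have "set_integrable lborel {u..t} (\<lambda>q. - l * X q + \<phi> q)"
      by (intro set_integral_add set_integrable_mult_right iX i\<phi>)
    then show ?thesis unfolding set_integrable_def h_def by simp
  qed
  then have [measurable]: "h \<in> borel_measurable borel" by auto
  have ei: "set_integrable lborel {u..t} (\<lambda>q. exp (l * q) * Y q)" if "set_integrable lborel {u..t} Y" for Y
    unfolding set_integrable_def
  proof (rule Bochner_Integration.integrable_bound)
    show "integrable lborel (\<lambda>q. exp (\<bar>l\<bar> * (\<bar>u\<bar> + \<bar>t\<bar>)) * (indicator {u..t} q *\<^sub>R Y q))"
      using that unfolding set_integrable_def by (rule integrable_mult_right)
    have "(\<lambda>q. indicator {u..t} q *\<^sub>R Y q) \<in> borel_measurable lborel"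
      using that unfolding set_integrable_def by auto
    then have "(\<lambda>q. exp (l * q) * (indicator {u..t} q *\<^sub>R Y q)) \<in> borel_measurable lborel" by measurable
    then show "(\<lambda>q. indicator {u..t} q *\<^sub>R (exp (l * q) * Y q)) \<in> borel_measurable lborel" by (simp add: mult_ac)
    have "exp (l * q) \<le> exp (\<bar>l\<bar> * (\<bar>u\<bar> + \<bar>t\<bar>))" if "q \<in> {u..t}" for q
    proof -
      have "l * q \<le> \<bar>l\<bar> * \<bar>q\<bar>" by (metis abs_ge_self abs_mult)
      also have "\<dots> \<le> \<bar>l\<bar> * (\<bar>u\<bar> + \<bar>t\<bar>)" using that by (intro mult_left_mono) auto
      finally show ?thesis by simp
    qed
    then show "AE q in lborel. norm (indicator {u..t} q *\<^sub>R (exp (l * q) * Y q)) \<le> norm (exp (\<bar>l\<bar> * (\<bar>u\<bar> + \<bar>t\<bar>)) * (indicator {u..t} q *\<^sub>R Y q))"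
      by (intro AE_I2) (auto simp: indicator_def abs_mult intro!: mult_right_mono)
  qed
  have e0: "set_integrable lborel {u..t} (\<lambda>q. exp (l * q))"
    unfolding set_integrable_def by (rule borel_integrable_compact) (auto intro!: continuous_intros)
  have FTC: "(LINT r|lborel. (l * exp (l * r)) * indicator {a..t} r) = exp (l * t) - exp (l * a)"
    and FTCi: "integrable lborel (\<lambda>r. (l * exp (l * r)) * indicator {a..t} r)" if "a \<le> t" for a
  proof -
    have "has_bochner_integral lborel (\<lambda>r. (l * exp (l * r)) * indicator {a..t} r) (exp (l * t) - exp (l * a))"
      by (rule has_bochner_integral_FTC_Icc_real[OF that]) (auto intro!: derivative_eq_intros continuous_intros)
    then show "(LINT r|lborel. (l * exp (l * r)) * indicator {a..t} r) = exp (l * t) - exp (l * a)"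
      "integrable lborel (\<lambda>r. (l * exp (l * r)) * indicator {a..t} r)"
      by (auto simp: has_bochner_integral_iff)
  qed
  \<comment> \<open>The integrand lives on the triangle of pairs with \<open>q\<close> before
    \<open>r\<close>. Integration in \<open>r\<close> first produces
    \<open>exp (l * t) - exp (l * q)\<close>; integration in \<open>q\<close> first produces the
    drift integral, which the equation expresses through \<open>X\<close> and
    \<open>G\<close>.\<close>
  define f where "f r q = (l * exp (l * r)) * indicator {u..t} r * (h q * (if q \<le> r then 1 else 0))" for r q
  have fi: "integrable (lborel \<Otimes>\<^sub>M lborel) (case_prod f)"
  proof (rule lborel_pair.Fubini_integrable)
    show "case_prod f \<in> borel_measurable (lborel \<Otimes>\<^sub>M lborel)" unfolding f_def by measurable
    have i2: "integrable lborel (\<lambda>q. h q * (if q \<le> r then 1 else 0))" for r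
      by (rule Bochner_Integration.integrable_bound[OF hi]) auto
    then show "AE r in lborel. integrable lborel (\<lambda>q. (case_prod f) (r, q))"
      unfolding f_def by auto
    show "integrable lborel (\<lambda>r. LINT q|lborel. norm ((case_prod f) (r, q)))"
    proof (rule Bochner_Integration.integrable_bound[OF integrable_mult_right[OF FTCi[OF ut], of "LINT q|lborel. \<bar>h q\<bar>"]])
      show "(\<lambda>r. LINT q|lborel. norm ((case_prod f) (r, q))) \<in> borel_measurable lborel"
        unfolding f_def by measurable
      show "AE r in lborel. norm (LINT q|lborel. norm ((case_prod f) (r, q))) \<le> norm ((LINT q|lborel. \<bar>h q\<bar>) * (l * exp (l * r) * indicator {u..t} r))"
      proof (intro AE_I2)
        fix r
        have "(LINT q|lborel. norm ((case_prod f) (r, q))) = \<bar>l * exp (l * r) * indicator {u..t} r\<bar> * (LINT q|lborel. \<bar>h q * (if q \<le> r then 1 else 0)\<bar>)"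
          unfolding f_def by (simp add: abs_mult)
        also have "\<dots> \<le> \<bar>l * exp (l * r) * indicator {u..t} r\<bar> * (LINT q|lborel. \<bar>h q\<bar>)"
          using i2 hi by (intro mult_left_mono integral_mono) auto
        finally show "norm (LINT q|lborel. norm ((case_prod f) (r, q))) \<le> norm ((LINT q|lborel. \<bar>h q\<bar>) * (l * exp (l * r) * indicator {u..t} r))"
          by (simp add: abs_mult mult_ac)
      qed
    qed
  qed
  have "(LINT q|lborel. LINT r|lborel. f r q) = (LINT r|lborel. LINT q|lborel. f r q)"
    by (rule lborel_pair.Fubini_integral[OF fi])
  moreover have "(LINT q|lborel. LINT r|lborel. f r q) = (LINT q:{u..t}|lborel. (exp (l * t) - exp (l * q)) * (- l * X q + \<phi> q))"
    unfolding set_lebesgue_integral_def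
  proof (intro Bochner_Integration.integral_cong refl)
    fix q
    show "(LINT r|lborel. f r q) = indicator {u..t} q *\<^sub>R ((exp (l * t) - exp (l * q)) * (- l * X q + \<phi> q))"
    proof (cases "q \<in> {u..t}")
      case True
      then have "f r q = h q * ((l * exp (l * r)) * indicator {q..t} r)" for r
        by (auto simp: f_def indicator_def)
      then have "(LINT r|lborel. f r q) = h q * (exp (l * t) - exp (l * q))"
        using FTC[of q] True by simp
      then show ?thesis using True by (simp add: h_def)
    qed (simp add: f_def h_def)
  qed
  moreover have "(LINT r|lborel. LINT q|lborel. f r q) = (LINT r:{u..t}|lborel. (l * exp (l * r)) * (X r - X u - (G r - G u)))"
    unfolding set_lebesgue_integral_def
  proof (intro Bochner_Integration.integral_cong refl)
    fix r
    show "(LINT q|lborel. f r q) = indicator {u..t} r *\<^sub>R ((l * exp (l * r)) * (X r - X u - (G r - G u)))"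
    proof (cases "r \<in> {u..t}")
      case True
      have "(LINT q|lborel. h q * (if q \<le> r then 1 else 0)) = (LINT q:{u..r}|lborel. - l * X q + \<phi> q)"
        unfolding set_lebesgue_integral_def using True
        by (intro Bochner_Integration.integral_cong refl) (auto simp: h_def indicator_def)
      then show ?thesis using True eq[OF True] by (simp add: f_def)
    qed (simp add: f_def)
  qed
  ultimately have A: "(LINT q:{u..t}|lborel. (exp (l * t) - exp (l * q)) * (- l * X q + \<phi> q)) =
      (LINT r:{u..t}|lborel. (l * exp (l * r)) * (X r - X u - (G r - G u)))" by simp
  define IX where "IX = (LINT q:{u..t}|lborel. exp (l * q) * X q)"
  define IG where "IG = (LINT q:{u..t}|lborel. exp (l * q) * G q)"
  define IP where "IP = (LINT q:{u..t}|lborel. exp (l * q) * \<phi> q)"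
  have L1: "(LINT q:{u..t}|lborel. (exp (l * t) - exp (l * q)) * (- l * X q + \<phi> q)) =
      exp (l * t) * (X t - X u - (G t - G u)) + l * IX - IP"
  proof -
    have "(LINT q:{u..t}|lborel. (exp (l * t) - exp (l * q)) * (- l * X q + \<phi> q)) =
      (LINT q:{u..t}|lborel. exp (l * t) * (- l * X q + \<phi> q) + (l * (exp (l * q) * X q) - exp (l * q) * \<phi> q))"
      by (intro arg_cong[where f="set_lebesgue_integral lborel {u..t}"]) (auto simp: algebra_simps)
    also have "\<dots> = (LINT q:{u..t}|lborel. exp (l * t) * (- l * X q + \<phi> q)) + (LINT q:{u..t}|lborel. l * (exp (l * q) * X q) - exp (l * q) * \<phi> q)"
      by (intro set_integral_add(2) set_integrable_mult_right set_integral_add(1) set_integral_diff(1) iX i\<phi> ei)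
    also have "(LINT q:{u..t}|lborel. l * (exp (l * q) * X q) - exp (l * q) * \<phi> q) = (LINT q:{u..t}|lborel. l * (exp (l * q) * X q)) - IP"
      unfolding IP_def by (intro set_integral_diff(2) set_integrable_mult_right iX i\<phi> ei)
    also have "(LINT q:{u..t}|lborel. l * (exp (l * q) * X q)) = l * IX"
      unfolding IX_def by (rule set_integral_mult_right)
    also have "(LINT q:{u..t}|lborel. exp (l * t) * (- l * X q + \<phi> q)) = exp (l * t) * (LINT q:{u..t}|lborel. - l * X q + \<phi> q)"
      by (rule set_integral_mult_right)
    also have "(LINT q:{u..t}|lborel. - l * X q + \<phi> q) = X t - X u - (G t - G u)"
      using eq[of t] ut by simp
    finally show ?thesis by simp
  qed
  have R1: "(LINT r:{u..t}|lborel. (l * exp (l * r)) * (X r - X u - (G r - G u))) =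
     l * IX - l * IG - (X u - G u) * (exp (l * t) - exp (l * u))"
  proof -
    have "(LINT r:{u..t}|lborel. (l * exp (l * r)) * (X r - X u - (G r - G u))) =
       (LINT r:{u..t}|lborel. (l * (exp (l * r) * X r) - l * (exp (l * r) * G r)) - (X u - G u) * (l * exp (l * r)))"
      by (intro arg_cong[where f="set_lebesgue_integral lborel {u..t}"]) (auto simp: algebra_simps)
    also have "\<dots> = (LINT r:{u..t}|lborel. l * (exp (l * r) * X r) - l * (exp (l * r) * G r)) - (LINT r:{u..t}|lborel. (X u - G u) * (l * exp (l * r)))"
      by (intro set_integral_diff(2) set_integral_diff(1) set_integrable_mult_right iX iG ei e0)
    also have "(LINT r:{u..t}|lborel. l * (exp (l * r) * X r) - l * (exp (l * r) * G r)) =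
        (LINT r:{u..t}|lborel. l * (exp (l * r) * X r)) - (LINT r:{u..t}|lborel. l * (exp (l * r) * G r))"
      by (intro set_integral_diff(2) set_integrable_mult_right iX iG ei)
    also have "(LINT r:{u..t}|lborel. l * (exp (l * r) * X r)) = l * IX"
      unfolding IX_def by (rule set_integral_mult_right)
    also have "(LINT r:{u..t}|lborel. l * (exp (l * r) * G r)) = l * IG"
      unfolding IG_def by (rule set_integral_mult_right)
    also have "(LINT r:{u..t}|lborel. (X u - G u) * (l * exp (l * r))) = (X u - G u) * (LINT r:{u..t}|lborel. l * exp (l * r))"
      by (rule set_integral_mult_right)
    also have "(LINT r:{u..t}|lborel. l * exp (l * r)) = exp (l * t) - exp (l * u)"
      using FTC[OF ut] by (simp add: set_lebesgue_integral_def mult_ac)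
    finally show ?thesis .
  qed
  have ex: "(LINT q:{u..t}|lborel. exp (- l * (t - q)) * Y q) = exp (- l * t) * (LINT q:{u..t}|lborel. exp (l * q) * Y q)" for Y
  proof -
    have "exp (- l * (t - q)) = exp (- l * t) * exp (l * q)" for q
      by (simp add: exp_add[symmetric] algebra_simps)
    then show ?thesis by (simp only: mult.assoc set_integral_mult_right)
  qed
  have "exp (l * t) * (X t - G t) = IP - l * IG + (X u - G u) * exp (l * u)"
    using A L1 R1 by (simp add: algebra_simps)
  then have "exp (- l * t) * (exp (l * t) * (X t - G t)) = exp (- l * t) * (IP - l * IG + (X u - G u) * exp (l * u))"
    by simp
  moreover have "exp (- l * t) * exp (l * t) = 1" by (simp add: exp_add[symmetric])
  ultimately have "X t - G t = exp (- l * t) * IP - l * (exp (- l * t) * IG) + (X u - G u) * (exp (- l * t) * exp (l * u))"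
    by (simp add: algebra_simps)
  moreover have "exp (- l * t) * exp (l * u) = exp (- l * (t - u))" by (simp add: exp_add[symmetric] algebra_simps)
  ultimately show ?thesis
    unfolding conv_def ex IP_def[symmetric] IG_def[symmetric] by (simp add: algebra_simps)
qed

text \<open>The same Riemann sums, with the exponential at left end points, are computed in two
  ways: as Stieltjes integrals of step functions they converge to the left side by dominated
  convergence, and \<open>riemann_sum_tendsto_conv\<close> gives the right side as their
  limit.\<close>

lemma interval_measure_conv:
  fixes F :: "real \<Rightarrow> real"
  assumes ut: "u < t" and mono: "mono F" and rc: "\<And>q. (F \<longlongrightarrow> F q) (at_right q)"
  shows "set_integrable (interval_measure F) {u<..t} (\<lambda>r. exp (- c * (t - r)))"
    and "(LINT r:{u<..t}|interval_measure F. exp (- c * (t - r))) = conv c F u t"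
proof -
  let ?M = "interval_measure F" and ?e = "\<lambda>q. exp (- c * (t - q))" and ?r = "\<lambda>m. grid u t m"
  have em: "emeasure ?M {a<..b} = ennreal (F b - F a)" if "a \<le> b" for a b
    using that mono rc by (intro emeasure_interval_measure_Ioc) (auto simp: mono_def continuous_within)
  have me: "measure ?M {a<..b} = F b - F a" if "a \<le> b" for a b
    using em[OF that] monoD[OF mono that] by (simp add: measure_def)
  define K where "K = exp (\<bar>c\<bar> * (t - u))"
  have K0: "0 \<le> K" by (simp add: K_def)
  have K: "\<bar>?e q\<bar> \<le> K" if "q \<in> {u..t}" for q
  proof -
    have "- c * (t - q) \<le> \<bar>c\<bar> * (t - q)" using that by (intro mult_right_mono) auto
    also have "\<dots> \<le> \<bar>c\<bar> * (t - u)" using that by (intro mult_left_mono) auto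
    finally show ?thesis by (simp add: K_def)
  qed
  have Ki: "integrable ?M (\<lambda>q. indicator {u<..t} q * K)"
    using em[of u t] ut by (intro integrable_mult_left) (simp add: less_top[symmetric])
  show "set_integrable ?M {u<..t} ?e"
    unfolding set_integrable_def
    by (rule Bochner_Integration.integrable_bound[OF Ki]) (use K K0 in \<open>auto simp: indicator_def\<close>)
  define S where "S m q = (\<Sum>k<m. indicator {?r m k<..?r m (Suc k)} q * ?e (?r m k))" for m q
  have S_out: "S m q = 0" if "q \<notin> {u<..t}" for m q
  proof -
    have "q \<notin> {?r m k<..?r m (Suc k)}" if "k < m" for k
      using grid_mem[of u t k m] grid_mem[of u t "Suc k" m] that ut \<open>q \<notin> {u<..t}\<close> by auto
    then show ?thesis unfolding S_def by (auto intro!: sum.neutral)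
  qed
  have S_in: "\<exists>p. S m q = ?e p \<and> p \<in> {u..t} \<and> p < q \<and> q \<le> p + (t - u) / m" if q: "q \<in> {u<..t}" and m: "0 < m" for m q
  proof -
    obtain k where k: "k < m" "?r m k < q" "q \<le> ?r m (Suc k)"
      "\<And>k'. indicator {?r m k'<..?r m (Suc k')} q = (if k' = k then 1 else (0::real))"
      using grid_cell[OF ut m q] by blast
    have "S m q = ?e (?r m k)"
      unfolding S_def k(4) using k(1) by (simp add: if_distrib[of "\<lambda>x. x * _"] cong: if_cong)
    then show ?thesis using k(2,3) grid_step[of u t m k] grid_mem[of u t k m] k(1) ut
      by (intro exI[of _ "?r m k"]) auto
  qed
  have [measurable]: "S m \<in> borel_measurable borel" for m unfolding S_def by measurable
  have ri: "has_bochner_integral ?M (S m) (\<Sum>k<m. (F (?r m (Suc k)) - F (?r m k)) * ?e (?r m k))" for m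
  proof -
    have "has_bochner_integral ?M (\<lambda>q. indicator {?r m k<..?r m (Suc k)} q * ?e (?r m k)) ((F (?r m (Suc k)) - F (?r m k)) * ?e (?r m k))" for k
    proof -
      have le: "?r m k \<le> ?r m (Suc k)" using ut by (intro grid_mono) auto
      have "has_bochner_integral ?M (indicator {?r m k<..?r m (Suc k)} :: real \<Rightarrow> real) (measure ?M {?r m k<..?r m (Suc k)})"
        using em[OF le] by (intro has_bochner_integral_real_indicator) auto
      then show ?thesis unfolding me[OF le] by (intro has_bochner_integral_mult_left) auto
    qed
    then show ?thesis unfolding S_def by (intro has_bochner_integral_sum) auto
  qed
  have "(\<lambda>m. LINT q|?M. S m q) \<longlonglongrightarrow> (LINT q|?M. indicator {u<..t} q * ?e q)"
  proof (rule integral_dominated_convergence[where w="\<lambda>q. indicator {u<..t} q * K"])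
    show "AE q in ?M. (\<lambda>m. S m q) \<longlonglongrightarrow> indicator {u<..t} q * ?e q"
    proof (intro AE_I2)
      fix q
      show "(\<lambda>m. S m q) \<longlonglongrightarrow> indicator {u<..t} q * ?e q"
      proof (cases "q \<in> {u<..t}")
        case True
        then obtain p where p: "\<And>m. 0 < m \<Longrightarrow> S m q = ?e (p m) \<and> p m \<in> {u..t} \<and> p m < q \<and> q \<le> p m + (t - u) / m"
          using S_in by metis
        have "(\<lambda>m. (t - u) / real m) \<longlonglongrightarrow> 0" by (rule lim_const_over_n)
        then have lo: "(\<lambda>m. q - (t - u) / real m) \<longlonglongrightarrow> q" using tendsto_diff[OF tendsto_const[of q]] by fastforce
        have "q - (t - u) / real m \<le> p m" "p m \<le> q" if "0 < m" for m
          using p[OF that] by auto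
        then have "p \<longlonglongrightarrow> q"
          by (intro tendsto_sandwich[OF _ _ lo tendsto_const] eventually_sequentiallyI[of 1]) simp_all
        then have "(\<lambda>m. ?e (p m)) \<longlonglongrightarrow> ?e q" by (intro tendsto_intros)
        then have "(\<lambda>m. S m q) \<longlonglongrightarrow> ?e q"
          by (rule Lim_transform_eventually) (use p in \<open>auto simp: eventually_sequentially intro!: exI[of _ 1]\<close>)
        then show ?thesis using True by simp
      qed (simp add: S_out)
    qed
    show "AE q in ?M. norm (S m q) \<le> indicator {u<..t} q * K" for m
    proof (intro AE_I2)
      fix q
      show "norm (S m q) \<le> indicator {u<..t} q * K"
      proof (cases "q \<in> {u<..t} \<and> 0 < m")
        case True
        then show ?thesis using S_in[of q m] K by force
      next
        case False
        then show ?thesis using K0 by (cases "m = 0") (auto simp: S_out S_def[of 0])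
      qed
    qed
  qed (use Ki in auto)
  moreover have "(LINT q|?M. S m q) = (\<Sum>k<m. ?e (?r m k) * (F (?r m (Suc k)) - F (?r m k)))" for m
    using ri[of m] by (simp add: has_bochner_integral_iff mult.commute)
  ultimately have "(\<lambda>m. \<Sum>k<m. ?e (?r m k) * (F (?r m (Suc k)) - F (?r m k))) \<longlonglongrightarrow> (LINT q|?M. indicator {u<..t} q * ?e q)"
    by simp
  moreover have "(\<lambda>m. \<Sum>k<m. ?e (?r m k) * (F (?r m (Suc k)) - F (?r m k))) \<longlonglongrightarrow> conv c F u t"
  proof (rule riemann_sum_tendsto_conv[OF ut rc])
    show "\<bar>F q\<bar> \<le> \<bar>F u\<bar> + \<bar>F t\<bar>" if "q \<in> {u..t}" for q
      using monoD[OF mono, of u q] monoD[OF mono, of q t] that by auto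
  qed
  ultimately show "(LINT r:{u<..t}|?M. ?e r) = conv c F u t"
    unfolding set_lebesgue_integral_def by (simp add: LIMSEQ_unique)
qed

section \<open>Brownian motion at random times\<close>

text \<open>Continuity and monotonicity of paths hold only almost surely, so a limit of measurable
  approximations equals the wanted variable off a null set only. Completeness of the measure absorbs
  that set.\<close>

lemma complete_measurable_AE_eq:
  assumes "complete_measure M" and g: "g \<in> measurable M N" and eq: "AE x in M. f x = g x"
    and f: "f \<in> space M \<rightarrow> space N"
  shows "f \<in> measurable M N"
proof (rule measurableI)
  interpret complete_measure M by fact
  fix A assume A: "A \<in> sets N"
  obtain Z where Z: "{x \<in> space M. f x \<noteq> g x} \<subseteq> Z" "Z \<in> null_sets M"
    using AE_E3[OF eq] by (metis (mono_tags, lifting) Diff_iff mem_Collect_eq subsetI)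
  have "f -` A \<inter> space M = (g -` A \<inter> space M - Z) \<union> (f -` A \<inter> space M \<inter> Z)"
    using Z(1) by auto
  moreover have "g -` A \<inter> space M - Z \<in> sets M"
    using measurable_sets[OF g A] Z(2) by auto
  moreover have "f -` A \<inter> space M \<inter> Z \<in> sets M"
    using Z(2) by (intro complete[of _ Z]) auto
  ultimately show "f -` A \<inter> space M \<in> sets M" by (metis sets.Un)
qed (use f in auto)

lemma char_normal:
  assumes "0 < \<sigma>"
  shows "integrable lborel (\<lambda>x. complex_of_real (normal_density 0 \<sigma> x) * iexp (c * x))"
    and "(CLINT x|lborel. complex_of_real (normal_density 0 \<sigma> x) * iexp (c * x)) = complex_of_real (exp (- (c * \<sigma>)\<^sup>2 / 2))"
proof -
  show "integrable lborel (\<lambda>x. complex_of_real (normal_density 0 \<sigma> x) * iexp (c * x))"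
    by (rule Bochner_Integration.integrable_bound[of _ "normal_density 0 \<sigma>"])
       (use assms in \<open>auto simp: norm_mult\<close>)
  have e: "normal_density 0 \<sigma> (0 + \<sigma> * y) = std_normal_density y / \<sigma>" for y
  proof -
    have 1: "(\<sigma> * y)\<^sup>2 / (2 * \<sigma>\<^sup>2) = y\<^sup>2 / 2" using assms by (simp add: power_mult_distrib)
    have 2: "sqrt (2 * pi * \<sigma>\<^sup>2) = sqrt (2 * pi) * \<sigma>" using assms by (simp only: real_sqrt_mult) simp
    have "normal_density 0 \<sigma> (0 + \<sigma> * y) = 1 / sqrt (2 * pi * \<sigma>\<^sup>2) * exp (- ((\<sigma> * y)\<^sup>2 / (2 * \<sigma>\<^sup>2)))"
      by (simp add: normal_density_def)
    also have "\<dots> = (1 / (sqrt (2 * pi) * \<sigma>)) * exp (- (y\<^sup>2 / 2))" by (simp only: 1 2)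
    also have "\<dots> = std_normal_density y / \<sigma>" by (simp add: normal_density_def)
    finally show ?thesis .
  qed
  have "(CLINT x|lborel. complex_of_real (normal_density 0 \<sigma> x) * iexp (c * x)) =
      \<bar>\<sigma>\<bar> *\<^sub>R (CLINT y|lborel. complex_of_real (normal_density 0 \<sigma> (0 + \<sigma> * y)) * iexp (c * (0 + \<sigma> * y)))"
    using assms by (intro lborel_integral_real_affine) auto
  also have "\<dots> = \<bar>\<sigma>\<bar> *\<^sub>R (CLINT y|lborel. (complex_of_real (std_normal_density y) * iexp ((c * \<sigma>) * y)) / \<sigma>)"
    unfolding e by (simp add: mult_ac)
  also have "\<dots> = (CLINT y|lborel. std_normal_density y *\<^sub>R iexp ((c * \<sigma>) * y))"
    using assms by (simp add: scaleR_conv_of_real)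
  also have "\<dots> = char std_normal_distribution (c * \<sigma>)"
    unfolding char_def by (subst integral_density) auto
  finally show "(CLINT x|lborel. complex_of_real (normal_density 0 \<sigma> x) * iexp (c * x)) = complex_of_real (exp (- (c * \<sigma>)\<^sup>2 / 2))"
    by (simp add: char_std_normal_distribution)
qed

lemma brownian_increment_char:
  fixes W :: "real \<Rightarrow> 'a \<Rightarrow> real ^ 'n::finite"
  assumes W: "brownian_motion M W" and M: "prob_space M" and ab: "0 \<le> a" "a \<le> b"
  shows "(CLINT \<omega>|M. iexp (c \<bullet> (W b \<omega> - W a \<omega>))) = complex_of_real (exp (- ((c \<bullet> c) * (b - a)) / 2))"
proof (cases "a = b")
  case True
  interpret prob_space M by fact
  show ?thesis using True by (simp add: prob_space)
next
  case False
  then have ab': "a < b" using ab by simp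
  let ?s = "sqrt (b - a)"
  have s: "0 < ?s" using ab' by simp
  have D: "distributed M lborel (\<lambda>\<omega>. W b \<omega> - W a \<omega>) (\<lambda>x. ennreal (\<Prod>i\<in>UNIV. normal_density 0 ?s (x $ i)))"
    using W ab' ab unfolding brownian_motion_def by blast
  have m: "(\<lambda>\<omega>. W b \<omega> - W a \<omega>) \<in> measurable M lborel" using D by (auto dest: distributed_measurable)
  have "(CLINT \<omega>|M. iexp (c \<bullet> (W b \<omega> - W a \<omega>))) = (CLINT x|distr M lborel (\<lambda>\<omega>. W b \<omega> - W a \<omega>). iexp (c \<bullet> x))"
    by (subst integral_distr[OF m]) auto
  also have "\<dots> = (CLINT x|lborel. (\<Prod>i\<in>UNIV. normal_density 0 ?s (x $ i)) *\<^sub>R iexp (c \<bullet> x))"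
    unfolding distributed_distr_eq_density[OF D]
    by (subst integral_density) (auto intro!: prod_nonneg)
  also have "\<dots> = (CLINT x|(lborel :: (real ^ 'n) measure). (\<Prod>i\<in>UNIV. complex_of_real (normal_density 0 ?s (x $ i)) * iexp (c $ i * x $ i)))"
    by (simp add: inner_vec_def exp_sum sum_distrib_left prod.distrib scaleR_conv_of_real)
  also have "\<dots> = (\<Prod>i\<in>UNIV. complex_of_real (exp (- (c $ i * ?s)\<^sup>2 / 2)))"
    using lborel_vec_prod(2)[of "\<lambda>i x. complex_of_real (normal_density 0 ?s x) * iexp (c $ i * x)"] char_normal[OF s] by simp
  also have "\<dots> = complex_of_real (exp (\<Sum>i\<in>UNIV. - (c $ i * ?s)\<^sup>2 / 2))"
    by (simp only: exp_sum finite_class.finite_UNIV of_real_prod)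
  also have "(\<Sum>i\<in>UNIV. - (c $ i * ?s)\<^sup>2 / 2) = - ((c \<bullet> c) * (b - a)) / 2"
    using ab' by (simp add: inner_vec_def power_mult_distrib power2_eq_square[symmetric] sum_distrib_right sum_divide_distrib sum_negf)
  finally show ?thesis .
qed

lemma brownian_increments_char:
  fixes W :: "real \<Rightarrow> 'a \<Rightarrow> real ^ 'n::finite"
  assumes W: "brownian_motion M W" and M: "prob_space M" and d: "mono_on {..m} d" "0 \<le> d 0"
  shows "(CLINT \<omega>|M. iexp (\<Sum>k<m. c k \<bullet> (W (d (Suc k)) \<omega> - W (d k) \<omega>))) =
    complex_of_real (exp (- (\<Sum>k<m. (c k \<bullet> c k) * (d (Suc k) - d k)) / 2))"
proof -
  interpret prob_space M by fact
  have d0: "0 \<le> d k" if "k \<le> m" for k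
    using mono_onD[OF d(1), of 0 k] d(2) that by auto
  have dm: "d k \<le> d (Suc k)" if "k < m" for k
    using mono_onD[OF d(1), of k "Suc k"] that by auto
  have ind: "indep_vars (\<lambda>_. borel) (\<lambda>k \<omega>. W (d (Suc k)) \<omega> - W (d k) \<omega>) {..<m}"
    using W d unfolding brownian_motion_def indep_increments_def by blast
  then have ind': "indep_vars (\<lambda>_. borel) (\<lambda>k \<omega>. iexp (c k \<bullet> (W (d (Suc k)) \<omega> - W (d k) \<omega>))) {..<m}"
    by (rule indep_vars_compose2) auto
  have "(CLINT \<omega>|M. iexp (\<Sum>k<m. c k \<bullet> (W (d (Suc k)) \<omega> - W (d k) \<omega>))) =
      (CLINT \<omega>|M. (\<Prod>k<m. iexp (c k \<bullet> (W (d (Suc k)) \<omega> - W (d k) \<omega>))))"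
    by (simp add: exp_sum sum_distrib_left)
  also have "\<dots> = (\<Prod>k<m. CLINT \<omega>|M. iexp (c k \<bullet> (W (d (Suc k)) \<omega> - W (d k) \<omega>)))"
  proof (rule indep_vars_lebesgue_integral[OF _ ind'])
    fix k assume k: "k \<in> {..<m}"
    have [measurable]: "W (d (Suc k)) \<in> borel_measurable M" "W (d k) \<in> borel_measurable M"
      using W d0[of k] d0[of "Suc k"] k unfolding brownian_motion_def by auto
    show "complex_integrable M (\<lambda>\<omega>. iexp (c k \<bullet> (W (d (Suc k)) \<omega> - W (d k) \<omega>)))"
      by (rule integrable_const_bound[of _ 1]) auto
  qed simp
  also have "\<dots> = (\<Prod>k<m. complex_of_real (exp (- ((c k \<bullet> c k) * (d (Suc k) - d k)) / 2)))"
    by (intro prod.cong refl brownian_increment_char[OF W M]) (use d0 dm in auto)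
  also have "\<dots> = complex_of_real (exp (\<Sum>k<m. - ((c k \<bullet> c k) * (d (Suc k) - d k)) / 2))"
    by (simp only: exp_sum finite_lessThan of_real_prod)
  finally show ?thesis by (simp add: sum_divide_distrib sum_negf)
qed

lemma measurable_sub_sigma:
  "f \<in> measurable F N \<Longrightarrow> sets F \<subseteq> sets M \<Longrightarrow> space F = space M \<Longrightarrow> f \<in> measurable M N"
  by (auto simp: measurable_def)

lemma indep_sigma_integral_mult:
  fixes X Y :: "'a \<Rightarrow> complex"
  assumes M: "prob_space M" and ind: "prob_space.indep_set M A C"
    and A: "sigma_algebra (space M) A" and C: "sigma_algebra (space M) C"
    and X: "X \<in> borel_measurable (sigma (space M) A)" and Y: "Y \<in> borel_measurable (sigma (space M) C)"
    and bX: "\<And>\<omega>. norm (X \<omega>) \<le> KX" and bY: "\<And>\<omega>. norm (Y \<omega>) \<le> KY"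
  shows "(CLINT \<omega>|M. X \<omega> * Y \<omega>) = (CLINT \<omega>|M. X \<omega>) * (CLINT \<omega>|M. Y \<omega>)"
proof -
  interpret prob_space M by fact
  interpret A: sigma_algebra "space M" A by fact
  interpret C: sigma_algebra "space M" C by fact
  have ev: "A \<subseteq> events" "C \<subseteq> events"
    using ind unfolding indep_set_def indep_sets_def by (auto split: bool.splits)
  have sA: "sets (sigma (space M) A) = A" and sC: "sets (sigma (space M) C) = C"
    using A.space_closed C.space_closed by (simp_all add: A.sigma_sets_eq C.sigma_sets_eq)
  have [simp]: "space (sigma (space M) A) = space M" "space (sigma (space M) C) = space M"
    using A.space_closed C.space_closed by auto
  have mX: "random_variable borel X"
    by (rule measurable_sub_sigma[OF X]) (simp_all add: sA ev)
  have mY: "random_variable borel Y"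
    by (rule measurable_sub_sigma[OF Y]) (simp_all add: sC ev)
  have "indep_var borel X borel Y"
    unfolding indep_var_eq
  proof (intro conjI mX mY)
    have "sigma_sets (space M) {X -` B \<inter> space M |B. B \<in> sets borel} \<subseteq> A"
      using measurable_sets[OF X] sA by (intro A.sigma_sets_subset) auto
    moreover have "sigma_sets (space M) {Y -` B \<inter> space M |B. B \<in> sets borel} \<subseteq> C"
      using measurable_sets[OF Y] sC by (intro C.sigma_sets_subset) auto
    ultimately show "indep_set (sigma_sets (space M) {X -` B \<inter> space M |B. B \<in> sets borel})
      (sigma_sets (space M) {Y -` B \<inter> space M |B. B \<in> sets borel})"
      unfolding indep_set_def
      by (intro indep_sets_mono_sets[OF ind[unfolded indep_set_def]]) (simp split: bool.split)
  qed
  moreover have "integrable M X" by (rule integrable_const_bound[of _ KX]) (auto simp: mX bX)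
  moreover have "integrable M Y" by (rule integrable_const_bound[of _ KY]) (auto simp: mY bY)
  ultimately show ?thesis by (rule indep_var_lebesgue_integral)
qed

text \<open>Numerator of the approximation of \<open>y\<close> from below with denominator
  \<open>2 ^ p\<close>. The cap makes it take finitely many values; it corresponds to
  \<open>y = 2 ^ p\<close> and is therefore inactive for large \<open>p\<close>.\<close>

definition dyad :: "nat \<Rightarrow> real \<Rightarrow> nat" where
  "dyad p y = min (nat \<lfloor>2 ^ p * y\<rfloor>) (4 ^ p)"

lemma dyad_mono: "y \<le> z \<Longrightarrow> dyad p y \<le> dyad p z"
  unfolding dyad_def by (intro min.mono nat_mono floor_mono mult_left_mono) auto

lemma dyad_tendsto:
  assumes "0 \<le> y"
  shows "(\<lambda>p. real (dyad p y) / 2 ^ p) \<longlonglongrightarrow> y"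
proof -
  obtain n :: nat where n: "y < 2 ^ n" using real_arch_pow[of 2 y] by auto
  have bound: "y - (1/2) ^ p \<le> real (dyad p y) / 2 ^ p \<and> real (dyad p y) / 2 ^ p \<le> y" if "n \<le> p" for p
  proof -
    have "y \<le> 2 ^ p" using n power_increasing[OF that, of "2::real"] by linarith
    then have "2 ^ p * y \<le> 2 ^ p * 2 ^ p" by (intro mult_left_mono) auto
    also have "\<dots> = real (4 ^ p)" by (simp add: power_mult_distrib[symmetric])
    finally have "2 ^ p * y \<le> of_int (4 ^ p)" by simp
    then have "\<lfloor>2 ^ p * y\<rfloor> \<le> 4 ^ p" by linarith
    then have "nat \<lfloor>2 ^ p * y\<rfloor> \<le> 4 ^ p" by (simp add: nat_le_iff)
    then have eq: "real (dyad p y) = of_int \<lfloor>2 ^ p * y\<rfloor>" unfolding dyad_def using assms by (simp add: min_absorb1)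
    have "2 ^ p * y - 1 \<le> of_int \<lfloor>2 ^ p * y\<rfloor>" "of_int \<lfloor>2 ^ p * y\<rfloor> \<le> 2 ^ p * y" by linarith+
    then have "(2 ^ p * y - 1) / 2 ^ p \<le> real (dyad p y) / 2 ^ p" "real (dyad p y) / 2 ^ p \<le> (2 ^ p * y) / 2 ^ p"
      unfolding eq by (intro divide_right_mono; simp)+
    then show ?thesis by (simp add: diff_divide_distrib power_one_over)
  qed
  have "(\<lambda>p. (1/2) ^ p) \<longlonglongrightarrow> (0::real)" by (intro LIMSEQ_realpow_zero) auto
  then have lo: "(\<lambda>p. y - (1/2) ^ p) \<longlonglongrightarrow> y" using tendsto_diff[OF tendsto_const[of y]] by fastforce
  show ?thesis
    by (rule tendsto_sandwich[OF _ _ lo tendsto_const])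
       (use bound in \<open>auto intro: eventually_sequentiallyI[of n]\<close>)
qed

lemma brownian_at_dyad_tendsto:
  fixes W :: "real \<Rightarrow> 'a \<Rightarrow> real ^ 'n::finite"
  assumes "continuous_on {0..} (\<lambda>t. W t \<omega>)" "0 \<le> y"
  shows "(\<lambda>p. W (real (dyad p y) / 2 ^ p) \<omega>) \<longlonglongrightarrow> W y \<omega>"
  using continuous_on_tendsto_compose[OF assms(1) dyad_tendsto[OF assms(2)]] assms(2) by simp

lemma measurable_dyad [measurable]: "dyad p \<in> measurable borel (count_space UNIV)"
  unfolding dyad_def by measurable

lemma brownian_at_measurable:
  fixes W :: "real \<Rightarrow> 'a \<Rightarrow> real ^ 'n::finite"
  assumes M: "complete_measure M" and W: "brownian_motion M W"
    and [measurable]: "Y \<in> borel_measurable M" and Y: "AE \<omega> in M. 0 \<le> Y \<omega>"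
  shows "(\<lambda>\<omega>. W (Y \<omega>) \<omega>) \<in> borel_measurable M"
proof (rule complete_measurable_AE_eq[OF M])
  have [measurable]: "W (real k / 2 ^ p) \<in> borel_measurable M" for k p :: nat
    using W unfolding brownian_motion_def by auto
  have "(\<lambda>\<omega>. W (real (dyad p (Y \<omega>)) / 2 ^ p) \<omega>) \<in> borel_measurable M" for p
    by (rule measurable_compose_countable[of "\<lambda>k \<omega>. W (real k / 2 ^ p) \<omega>" _ _ "\<lambda>\<omega>. dyad p (Y \<omega>)"]) measurable
  then show "(\<lambda>\<omega>. lim (\<lambda>p. W (real (dyad p (Y \<omega>)) / 2 ^ p) \<omega>)) \<in> borel_measurable M"
    by measurable
  have "AE \<omega> in M. continuous_on {0..} (\<lambda>t. W t \<omega>)" using W unfolding brownian_motion_def by auto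
  with Y show "AE \<omega> in M. W (Y \<omega>) \<omega> = lim (\<lambda>p. W (real (dyad p (Y \<omega>)) / 2 ^ p) \<omega>)"
  proof eventually_elim
    case (elim \<omega>)
    show ?case using limI[OF brownian_at_dyad_tendsto[of W \<omega>, OF elim(2,1)]] by simp
  qed
qed simp

text \<open>Conditionally on the random times \<open>Y k\<close> the increments are independent centred Gaussian.
  The times are first discretised to finitely many values, where independence applies directly.\<close>

lemma subordinated_char:
  fixes W :: "real \<Rightarrow> 'a \<Rightarrow> real ^ 'n::finite" and g :: "'a \<Rightarrow> complex"
  assumes M: "prob_space M" and cM: "complete_measure M" and W: "brownian_motion M W"
    and ind: "prob_space.indep_set M A (process_sigma M W)" and A: "sigma_algebra (space M) A"
    and Y: "\<And>k. Y k \<in> borel_measurable (sigma (space M) A)"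
    and Y0: "AE \<omega> in M. 0 \<le> Y 0 \<omega>" and Ym: "AE \<omega> in M. mono_on {..m} (\<lambda>k. Y k \<omega>)"
    and g: "g \<in> borel_measurable (sigma (space M) A)" "\<And>\<omega>. norm (g \<omega>) \<le> 1"
  shows "(CLINT \<omega>|M. g \<omega> * iexp (\<Sum>k<m. c k \<bullet> (W (Y (Suc k) \<omega>) \<omega> - W (Y k \<omega>) \<omega>))) =
    (CLINT \<omega>|M. g \<omega> * complex_of_real (exp (- (\<Sum>k<m. (c k \<bullet> c k) * (Y (Suc k) \<omega> - Y k \<omega>)) / 2)))"
proof -
  interpret prob_space M by fact
  interpret A: sigma_algebra "space M" A by fact
  have evA: "A \<subseteq> events"
    using ind unfolding indep_set_def indep_sets_def by (auto split: bool.splits)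
  have sA: "sets (sigma (space M) A) = A"
    using A.space_closed by (simp_all add: A.sigma_sets_eq)
  have [simp]: "space (sigma (space M) A) = space M" using A.space_closed by auto
  have gM[measurable]: "g \<in> borel_measurable M" by (rule measurable_sub_sigma[OF g(1)]) (simp_all add: sA evA)
  have YM[measurable]: "Y k \<in> borel_measurable M" for k by (rule measurable_sub_sigma[OF Y]) (simp_all add: sA evA)
  have nn: "AE \<omega> in M. \<forall>k\<le>m. 0 \<le> Y k \<omega>"
    using Y0 Ym
  proof eventually_elim
    case (elim \<omega>)
    show ?case using mono_onD[OF elim(2), of 0] elim(1) by force
  qed
  have incr: "AE \<omega> in M. \<forall>k<m. 0 \<le> Y (Suc k) \<omega> - Y k \<omega>"
    using Ym
  proof eventually_elim
    case (elim \<omega>)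
    show ?case
    proof (intro allI impI)
      fix k assume "k < m"
      then show "0 \<le> Y (Suc k) \<omega> - Y k \<omega>" using mono_onD[OF elim, of k "Suc k"] by simp
    qed
  qed
  have cont: "AE \<omega> in M. continuous_on {0..} (\<lambda>t. W t \<omega>)" using W unfolding brownian_motion_def by auto
  have WYM: "(\<lambda>\<omega>. W (Y k \<omega>) \<omega>) \<in> borel_measurable M" if "k \<le> m" for k
    by (rule brownian_at_measurable[OF cM W]) (use nn that in auto)
  have Wm[measurable]: "W (real k / 2 ^ p) \<in> borel_measurable M" for k p :: nat
    using W unfolding brownian_motion_def by auto
  define D where "D p \<nu> k = real (\<nu> k) / 2 ^ p" for p :: nat and \<nu> :: "nat \<Rightarrow> nat" and k :: nat
  define N where "N p \<omega> = (\<lambda>k\<in>{..m}. dyad p (Y k \<omega>))" for p \<omega>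
  define V where "V p = Pi\<^sub>E {..m} (\<lambda>_. {..4 ^ p :: nat})" for p
  have finV: "finite (V p)" for p unfolding V_def by (intro finite_PiE) auto
  have NV: "N p \<omega> \<in> V p" for p \<omega> unfolding N_def V_def dyad_def by auto
  define S where "S p \<nu> \<omega> = (\<Sum>k<m. c k \<bullet> (W (D p \<nu> (Suc k)) \<omega> - W (D p \<nu> k) \<omega>))" for p \<nu> \<omega>
  define q where "q p \<nu> = exp (- (\<Sum>k<m. (c k \<bullet> c k) * (D p \<nu> (Suc k) - D p \<nu> k)) / 2)" for p \<nu>
  define e where "e p \<nu> \<omega> = (if \<forall>k\<in>{..m}. dyad p (Y k \<omega>) = \<nu> k then 1 else 0 :: complex)" for p \<nu> \<omega>
  have Ne: "e p \<nu> \<omega> = (if N p \<omega> = \<nu> then 1 else 0)" if "\<nu> \<in> V p" for p \<nu> \<omega>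
  proof -
    have "(\<forall>k\<in>{..m}. dyad p (Y k \<omega>) = \<nu> k) \<longleftrightarrow> N p \<omega> = \<nu>"
      using that unfolding N_def V_def by (auto simp: fun_eq_iff PiE_iff extensional_def)
    then show ?thesis by (simp add: e_def)
  qed
  have expand: "F (N p \<omega>) = (\<Sum>\<nu>\<in>V p. e p \<nu> \<omega> * F \<nu>)" for F :: "(nat \<Rightarrow> nat) \<Rightarrow> complex" and p \<omega>
  proof -
    have "(\<Sum>\<nu>\<in>V p. e p \<nu> \<omega> * F \<nu>) = (\<Sum>\<nu>\<in>V p. if N p \<omega> = \<nu> then F \<nu> else 0)"
      by (intro sum.cong refl) (simp add: Ne)
    then show ?thesis using finV NV by simp
  qed
  have eA: "e p \<nu> \<in> borel_measurable (sigma (space M) A)" for p \<nu>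
    unfolding e_def using Y by measurable
  have eM[measurable]: "e p \<nu> \<in> borel_measurable M" for p \<nu> by (rule measurable_sub_sigma[OF eA]) (simp_all add: sA evA)
  have SM[measurable]: "S p \<nu> \<in> borel_measurable M" for p \<nu> unfolding S_def D_def by measurable
  have e1: "norm (e p \<nu> \<omega>) \<le> 1" for p \<nu> \<omega> by (simp add: e_def)
  have ge1: "norm (g \<omega> * e p \<nu> \<omega>) \<le> 1" for p \<nu> \<omega>
    using g(2)[of \<omega>] by (simp add: e_def)
  have cW: "sigma_algebra (space M) (process_sigma M W)"
    unfolding process_sigma_def by (intro sigma_algebra_sigma_sets) auto
  interpret CW: sigma_algebra "space M" "process_sigma M W" by (rule cW)
  have WW: "W t \<in> borel_measurable (sigma (space M) (process_sigma M W))" if "0 \<le> t" for t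
  proof (rule measurableI)
    fix B :: "(real ^ 'n) set" assume B: "B \<in> sets borel"
    have "W t -` B \<inter> space M \<in> process_sigma M W"
      unfolding process_sigma_def using B that by (intro sigma_sets.Basic) auto
    then show "W t -` B \<inter> space (sigma (space M) (process_sigma M W)) \<in> sets (sigma (space M) (process_sigma M W))"
      using CW.space_closed by (simp add: CW.sigma_sets_eq)
  qed auto
  \<comment> \<open>On the event that the discretised times equal \<open>\<nu>\<close>, the
    increments of \<open>W\<close> are taken at fixed times and are independent of the event and of
    \<open>g\<close>. A family \<open>\<nu>\<close> that is not monotone corresponds to a null
    event, and both sides vanish.\<close>
  have fact: "(CLINT \<omega>|M. g \<omega> * e p \<nu> \<omega> * iexp (S p \<nu> \<omega>)) = (CLINT \<omega>|M. g \<omega> * e p \<nu> \<omega>) * q p \<nu>" for p \<nu>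
  proof (cases "mono_on {..m} (D p \<nu>)")
    case True
    have "(CLINT \<omega>|M. g \<omega> * e p \<nu> \<omega> * iexp (S p \<nu> \<omega>)) = (CLINT \<omega>|M. g \<omega> * e p \<nu> \<omega>) * (CLINT \<omega>|M. iexp (S p \<nu> \<omega>))"
    proof (rule indep_sigma_integral_mult[OF M ind A cW _ _ ge1, where KY=1])
      show "(\<lambda>\<omega>. g \<omega> * e p \<nu> \<omega>) \<in> borel_measurable (sigma (space M) A)"
        using g(1) eA by measurable
      have [measurable]: "W (D p \<nu> k) \<in> borel_measurable (sigma (space M) (process_sigma M W))" for k
        by (rule WW) (simp add: D_def)
      show "(\<lambda>\<omega>. iexp (S p \<nu> \<omega>)) \<in> borel_measurable (sigma (space M) (process_sigma M W))"
        unfolding S_def by measurable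
    qed simp
    also have "(CLINT \<omega>|M. iexp (S p \<nu> \<omega>)) = q p \<nu>"
      unfolding S_def q_def by (rule brownian_increments_char[OF W M True]) (simp add: D_def)
    finally show ?thesis .
  next
    case False
    have "AE \<omega> in M. e p \<nu> \<omega> = 0"
      using Ym
    proof eventually_elim
      case (elim \<omega>)
      show ?case
      proof (rule ccontr)
        assume "e p \<nu> \<omega> \<noteq> 0"
        then have *: "\<forall>k\<in>{..m}. dyad p (Y k \<omega>) = \<nu> k" by (auto simp: e_def split: if_splits)
        have "mono_on {..m} (D p \<nu>)"
          unfolding D_def
        proof (intro mono_onI divide_right_mono)
          fix k l assume "k \<in> {..m}" "l \<in> {..m}" "k \<le> l"
          then show "real (\<nu> k) \<le> real (\<nu> l)"
            using * dyad_mono[OF mono_onD[OF elim, of k l], of p] by simp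
        qed simp
        with False show False by simp
      qed
    qed
    then have "AE \<omega> in M. g \<omega> * e p \<nu> \<omega> * iexp (S p \<nu> \<omega>) = 0" "AE \<omega> in M. g \<omega> * e p \<nu> \<omega> = 0"
      by auto
    then have "(CLINT \<omega>|M. g \<omega> * e p \<nu> \<omega> * iexp (S p \<nu> \<omega>)) = (CLINT \<omega>|M. 0)"
      "(CLINT \<omega>|M. g \<omega> * e p \<nu> \<omega>) = (CLINT \<omega>|M. 0)"
      by (intro integral_cong_AE; simp)+
    then show ?thesis by simp
  qed
  have ige: "integrable M (\<lambda>\<omega>. g \<omega> * e p \<nu> \<omega>)" for p \<nu>
    by (rule integrable_const_bound[of _ 1]) (use ge1 in auto)
  have igS: "integrable M (\<lambda>\<omega>. g \<omega> * e p \<nu> \<omega> * iexp (S p \<nu> \<omega>))" for p \<nu>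
    by (rule integrable_const_bound[of _ 1]) (use ge1 in \<open>auto simp: norm_mult\<close>)
  have disc: "(CLINT \<omega>|M. g \<omega> * iexp (S p (N p \<omega>) \<omega>)) = (CLINT \<omega>|M. g \<omega> * complex_of_real (q p (N p \<omega>)))" for p
  proof -
    have "(CLINT \<omega>|M. g \<omega> * iexp (S p (N p \<omega>) \<omega>)) = (CLINT \<omega>|M. (\<Sum>\<nu>\<in>V p. g \<omega> * e p \<nu> \<omega> * iexp (S p \<nu> \<omega>)))"
    proof (intro Bochner_Integration.integral_cong refl)
      fix \<omega>
      show "g \<omega> * iexp (S p (N p \<omega>) \<omega>) = (\<Sum>\<nu>\<in>V p. g \<omega> * e p \<nu> \<omega> * iexp (S p \<nu> \<omega>))"
        using expand[of "\<lambda>\<nu>. iexp (S p \<nu> \<omega>)" p \<omega>] by (simp add: sum_distrib_left mult.assoc)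
    qed
    also have "\<dots> = (\<Sum>\<nu>\<in>V p. (CLINT \<omega>|M. g \<omega> * e p \<nu> \<omega>) * q p \<nu>)"
      using igS by (subst Bochner_Integration.integral_sum) (auto simp: fact)
    also have "\<dots> = (CLINT \<omega>|M. (\<Sum>\<nu>\<in>V p. g \<omega> * e p \<nu> \<omega> * q p \<nu>))"
      using ige by (subst Bochner_Integration.integral_sum) auto
    also have "\<dots> = (CLINT \<omega>|M. g \<omega> * complex_of_real (q p (N p \<omega>)))"
    proof (intro Bochner_Integration.integral_cong refl)
      fix \<omega>
      show "(\<Sum>\<nu>\<in>V p. g \<omega> * e p \<nu> \<omega> * q p \<nu>) = g \<omega> * complex_of_real (q p (N p \<omega>))"
        using expand[of "\<lambda>\<nu>. complex_of_real (q p \<nu>)" p \<omega>] by (simp add: sum_distrib_left mult.assoc)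
    qed
    finally show ?thesis .
  qed
  have Nk: "N p \<omega> k = dyad p (Y k \<omega>)" if "k \<le> m" for p \<omega> k using that by (simp add: N_def)
  have NS: "S p (N p \<omega>) \<omega> = (\<Sum>k<m. c k \<bullet> (W (real (dyad p (Y (Suc k) \<omega>)) / 2 ^ p) \<omega> - W (real (dyad p (Y k \<omega>)) / 2 ^ p) \<omega>))" for p \<omega>
    unfolding S_def D_def by (intro sum.cong refl) (auto simp: Nk)
  have Nq: "q p (N p \<omega>) = exp (- (\<Sum>k<m. (c k \<bullet> c k) * (real (dyad p (Y (Suc k) \<omega>)) / 2 ^ p - real (dyad p (Y k \<omega>)) / 2 ^ p)) / 2)" for p \<omega>
    unfolding q_def D_def by (auto intro!: arg_cong[where f=exp] sum.cong simp: Nk)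
  have [measurable]: "(\<lambda>\<omega>. W (real (dyad p (Y k \<omega>)) / 2 ^ p) \<omega>) \<in> borel_measurable M" for p k
    by (rule measurable_compose_countable[of "\<lambda>k \<omega>. W (real k / 2 ^ p) \<omega>" _ _ "\<lambda>\<omega>. dyad p (Y k \<omega>)"]) measurable
  have "(\<lambda>p. CLINT \<omega>|M. g \<omega> * iexp (S p (N p \<omega>) \<omega>)) \<longlonglongrightarrow>
      (CLINT \<omega>|M. g \<omega> * iexp (\<Sum>k<m. c k \<bullet> (W (Y (Suc k) \<omega>) \<omega> - W (Y k \<omega>) \<omega>)))"
  proof (rule integral_dominated_convergence[where w="\<lambda>_. 1" and s="\<lambda>p \<omega>. g \<omega> * iexp (S p (N p \<omega>) \<omega>)"])
    show "AE \<omega> in M. (\<lambda>p. g \<omega> * iexp (S p (N p \<omega>) \<omega>)) \<longlonglongrightarrow> g \<omega> * iexp (\<Sum>k<m. c k \<bullet> (W (Y (Suc k) \<omega>) \<omega> - W (Y k \<omega>) \<omega>))"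
      using nn cont
    proof eventually_elim
      case (elim \<omega>)
      have "(\<lambda>p. c k \<bullet> (W (real (dyad p (Y (Suc k) \<omega>)) / 2 ^ p) \<omega> - W (real (dyad p (Y k \<omega>)) / 2 ^ p) \<omega>)) \<longlonglongrightarrow>
        c k \<bullet> (W (Y (Suc k) \<omega>) \<omega> - W (Y k \<omega>) \<omega>)" if "k < m" for k
        by (intro tendsto_inner tendsto_const tendsto_diff brownian_at_dyad_tendsto[of W] elim(2) elim(1)[rule_format]) (use that in auto)
      then have "(\<lambda>p. S p (N p \<omega>) \<omega>) \<longlonglongrightarrow> (\<Sum>k<m. c k \<bullet> (W (Y (Suc k) \<omega>) \<omega> - W (Y k \<omega>) \<omega>))"
        unfolding NS by (intro tendsto_sum) simp
      then show ?case by (intro tendsto_mult tendsto_const tendsto_exp tendsto_of_real)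
    qed
    show "AE \<omega> in M. norm (g \<omega> * iexp (S p (N p \<omega>) \<omega>)) \<le> 1" for p
      using g(2) by (auto simp: norm_mult)
    show "(\<lambda>\<omega>. g \<omega> * iexp (S p (N p \<omega>) \<omega>)) \<in> borel_measurable M" for p
      unfolding NS by measurable
    have [measurable]: "(\<lambda>\<omega>. \<Sum>k<m. c k \<bullet> (W (Y (Suc k) \<omega>) \<omega> - W (Y k \<omega>) \<omega>)) \<in> borel_measurable M"
      by (intro borel_measurable_sum borel_measurable_inner borel_measurable_diff borel_measurable_const WYM) auto
    show "(\<lambda>\<omega>. g \<omega> * iexp (\<Sum>k<m. c k \<bullet> (W (Y (Suc k) \<omega>) \<omega> - W (Y k \<omega>) \<omega>))) \<in> borel_measurable M"
      by measurable
  qed simp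
  moreover have "(\<lambda>p. CLINT \<omega>|M. g \<omega> * complex_of_real (q p (N p \<omega>))) \<longlonglongrightarrow>
      (CLINT \<omega>|M. g \<omega> * complex_of_real (exp (- (\<Sum>k<m. (c k \<bullet> c k) * (Y (Suc k) \<omega> - Y k \<omega>)) / 2)))"
  proof (rule integral_dominated_convergence[where w="\<lambda>_. 1" and s="\<lambda>p \<omega>. g \<omega> * complex_of_real (q p (N p \<omega>))"])
    show "AE \<omega> in M. (\<lambda>p. g \<omega> * complex_of_real (q p (N p \<omega>))) \<longlonglongrightarrow> g \<omega> * complex_of_real (exp (- (\<Sum>k<m. (c k \<bullet> c k) * (Y (Suc k) \<omega> - Y k \<omega>)) / 2))"
      using nn
    proof eventually_elim
      case (elim \<omega>)
      have "(\<lambda>p. (c k \<bullet> c k) * (real (dyad p (Y (Suc k) \<omega>)) / 2 ^ p - real (dyad p (Y k \<omega>)) / 2 ^ p)) \<longlonglongrightarrow>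
        (c k \<bullet> c k) * (Y (Suc k) \<omega> - Y k \<omega>)" if "k < m" for k
        by (intro tendsto_mult tendsto_const tendsto_diff dyad_tendsto elim[rule_format]) (use that in auto)
      then have "(\<lambda>p. \<Sum>k<m. (c k \<bullet> c k) * (real (dyad p (Y (Suc k) \<omega>)) / 2 ^ p - real (dyad p (Y k \<omega>)) / 2 ^ p)) \<longlonglongrightarrow>
        (\<Sum>k<m. (c k \<bullet> c k) * (Y (Suc k) \<omega> - Y k \<omega>))"
        by (intro tendsto_sum) simp
      from tendsto_divide[OF tendsto_minus[OF this] tendsto_const[of "2::real"]]
      have "(\<lambda>p. q p (N p \<omega>)) \<longlonglongrightarrow> exp (- (\<Sum>k<m. (c k \<bullet> c k) * (Y (Suc k) \<omega> - Y k \<omega>)) / 2)"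
        unfolding Nq by (intro tendsto_exp) simp
      then show ?case by (intro tendsto_mult[OF tendsto_const] tendsto_of_real)
    qed
    show "AE \<omega> in M. norm (g \<omega> * complex_of_real (q p (N p \<omega>))) \<le> 1" for p
      using Ym
    proof eventually_elim
      case (elim \<omega>)
      have "0 \<le> (\<Sum>k<m. (c k \<bullet> c k) * (real (dyad p (Y (Suc k) \<omega>)) / 2 ^ p - real (dyad p (Y k \<omega>)) / 2 ^ p))"
      proof (intro sum_nonneg mult_nonneg_nonneg inner_ge_zero)
        fix k assume "k \<in> {..<m}"
        then have "Y k \<omega> \<le> Y (Suc k) \<omega>" by (intro mono_onD[OF elim]) auto
        from dyad_mono[OF this, of p] show "0 \<le> real (dyad p (Y (Suc k) \<omega>)) / 2 ^ p - real (dyad p (Y k \<omega>)) / 2 ^ p"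
          by (simp add: divide_right_mono)
      qed
      then have "q p (N p \<omega>) \<le> 1" unfolding Nq by simp
      then show ?case
        using g(2)[of \<omega>] by (simp add: norm_mult q_def mult_le_one)
    qed
    show "(\<lambda>\<omega>. g \<omega> * complex_of_real (q p (N p \<omega>))) \<in> borel_measurable M" for p
      unfolding Nq by measurable
    show "(\<lambda>\<omega>. g \<omega> * complex_of_real (exp (- (\<Sum>k<m. (c k \<bullet> c k) * (Y (Suc k) \<omega> - Y k \<omega>)) / 2))) \<in> borel_measurable M"
      by measurable
  qed simp
  ultimately show ?thesis unfolding disc by (rule LIMSEQ_unique)
qed

section \<open>The law of the noise over blocks of time\<close>

lemma sum_lessThan_add: "(\<Sum>l<a + m. h l) = (\<Sum>l<a. h l) + (\<Sum>k<m. h (a + k))"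
  for h :: "nat \<Rightarrow> 'a::comm_monoid_add"
  by (induction m) (auto simp: add.assoc)

lemma sum_blocks: "(\<Sum>l<K * m. h l) = (\<Sum>j<K. \<Sum>k<m. h (j * m + k))"
  for h :: "nat \<Rightarrow> 'a::comm_monoid_add"
proof (induction K)
  case (Suc K)
  have "Suc K * m = K * m + m" by simp
  then show ?case by (simp only: sum_lessThan_add Suc.IH sum.lessThan_Suc)
qed simp


locale subordinated_bm =
  fixes M :: "'a measure" and W :: "real \<Rightarrow> 'a \<Rightarrow> real ^ 'n::finite" and L :: "real \<Rightarrow> 'a \<Rightarrow> real"
    and lam sg :: "real ^ 'n"
  assumes prob: "prob_space M" and compl: "complete_measure M" and bm: "brownian_motion M W"
    and sub: "subordinator M L" and ind: "prob_space.indep_set M (process_sigma M L) (process_sigma M W)"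
begin

sublocale prob_space M by (rule prob)

text \<open>The diagonal of the random covariance \<open>IL\<close>, written through
  \<open>conv\<close>; the identification holds on good paths and is \<open>IL_eq\<close>.\<close>

definition etaL :: "real \<Rightarrow> real \<Rightarrow> 'a \<Rightarrow> real ^ 'n" where
  "etaL u t \<omega> = (\<chi> i. (sg $ i)\<^sup>2 * conv (2 * lam $ i) (\<lambda>r. L r \<omega>) u t)"

text \<open>The stochastic convolution: the integral of \<open>exp (- lam * (t - r)) * sg\<close>
  against the subordinated Brownian motion, component by component. It is the part of the increment
  of the solution that is due to noise.\<close>

definition DW :: "real \<Rightarrow> real \<Rightarrow> 'a \<Rightarrow> real ^ 'n" where
  "DW u t \<omega> = (\<chi> i. sg $ i * conv (lam $ i) (\<lambda>r. W (L r \<omega>) \<omega> $ i) u t)"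

definition good :: "'a \<Rightarrow> bool" where
  "good \<omega> \<longleftrightarrow> L 0 \<omega> = 0 \<and> mono_on {0..} (\<lambda>t. L t \<omega>) \<and> (\<forall>q\<ge>0. ((\<lambda>t. L t \<omega>) \<longlongrightarrow> L q \<omega>) (at_right q)) \<and>
     continuous_on {0..} (\<lambda>t. W t \<omega>)"

lemma AE_good: "AE \<omega> in M. good \<omega>"
proof -
  have "AE \<omega> in M. L 0 \<omega> = 0" "AE \<omega> in M. mono_on {0..} (\<lambda>t. L t \<omega>)" "AE \<omega> in M. cadlag_on {0..} (\<lambda>t. L t \<omega>)"
    using sub unfolding subordinator_def levy_process_def by auto
  moreover have "AE \<omega> in M. continuous_on {0..} (\<lambda>t. W t \<omega>)"
    using bm unfolding brownian_motion_def by auto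
  ultimately show ?thesis
    by eventually_elim (auto simp: good_def intro!: cadlag_on_atLeast_at_right)
qed

lemma L_measurable: "0 \<le> t \<Longrightarrow> L t \<in> borel_measurable M"
  using sub unfolding subordinator_def levy_process_def by auto

lemma good_mono: "good \<omega> \<Longrightarrow> 0 \<le> u \<Longrightarrow> u \<le> t \<Longrightarrow> L u \<omega> \<le> L t \<omega>"
  unfolding good_def using mono_onD[of "{0..}" "\<lambda>t. L t \<omega>" u t] by auto

lemma good_nonneg: "good \<omega> \<Longrightarrow> 0 \<le> t \<Longrightarrow> 0 \<le> L t \<omega>"
  using good_mono[of \<omega> 0 t] by (auto simp: good_def)

lemma good_right_L: "good \<omega> \<Longrightarrow> 0 \<le> q \<Longrightarrow> ((\<lambda>t. L t \<omega>) \<longlongrightarrow> L q \<omega>) (at_right q)"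
  unfolding good_def by auto

lemma good_right_W:
  assumes g: "good \<omega>" and q: "0 \<le> q"
  shows "((\<lambda>t. W (L t \<omega>) \<omega>) \<longlongrightarrow> W (L q \<omega>) \<omega>) (at_right q)"
proof (rule continuous_on_tendsto_compose[where f="\<lambda>t. W t \<omega>" and s="{0..}"])
  show "continuous_on {0..} (\<lambda>t. W t \<omega>)" using g by (simp add: good_def)
  show "\<forall>\<^sub>F t in at_right q. L t \<omega> \<in> {0..}"
    using eventually_at_right_less[of q]
  proof eventually_elim
    case (elim t)
    then have "0 \<le> t" using q by simp
    from good_nonneg[OF g this] show ?case by simp
  qed
  show "((\<lambda>t. L t \<omega>) \<longlongrightarrow> L q \<omega>) (at_right q)" by (rule good_right_L[OF g q])
  show "L q \<omega> \<in> {0..}" using good_nonneg[OF g q] by simp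
qed

text \<open>Until time \<open>t\<close> the subordinated path stays in the image of the compact
  interval from 0 to \<open>L t\<close> under a continuous path.\<close>

lemma good_bounded_W:
  assumes g: "good \<omega>" and u: "0 \<le> u" "u \<le> t"
  obtains K where "\<And>q i. q \<in> {u..t} \<Longrightarrow> \<bar>W (L q \<omega>) \<omega> $ i\<bar> \<le> K"
proof -
  have "compact ((\<lambda>y. W y \<omega>) ` {0..L t \<omega>})"
    using g by (intro compact_continuous_image) (auto simp: good_def intro: continuous_on_subset)
  then have "bounded ((\<lambda>y. W y \<omega>) ` {0..L t \<omega>})" by (rule compact_imp_bounded)
  then obtain K where K: "\<And>z. z \<in> (\<lambda>y. W y \<omega>) ` {0..L t \<omega>} \<Longrightarrow> norm z \<le> K"
    unfolding bounded_iff by blast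
  show ?thesis
  proof (rule that)
    fix q i assume q: "q \<in> {u..t}"
    then have "W (L q \<omega>) \<omega> \<in> (\<lambda>y. W y \<omega>) ` {0..L t \<omega>}"
      using good_nonneg[OF g, of q] good_mono[OF g, of q t] u by auto
    from K[OF this] show "\<bar>W (L q \<omega>) \<omega> $ i\<bar> \<le> K"
      using component_le_norm_cart[of "W (L q \<omega>) \<omega>" i] by linarith
  qed
qed

text \<open>Riemann sums for \<open>etaL\<close> and, in \<open>Dm\<close>, for \<open>DW\<close>.
  They use the same grid and the weights of \<open>etam\<close> are the squares of those of
  \<open>Dm\<close>, so that given \<open>L\<close> the components of \<open>etam\<close> are
  exactly the variances of those of \<open>Dm\<close>, before any limit is taken.\<close>

definition etam :: "nat \<Rightarrow> real \<Rightarrow> real \<Rightarrow> 'a \<Rightarrow> real ^ 'n" where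
  "etam m u t \<omega> = (\<chi> i. (sg $ i)\<^sup>2 * (\<Sum>k<m. exp (- (2 * lam $ i) * (t - grid u t m k)) * (L (grid u t m (Suc k)) \<omega> - L (grid u t m k) \<omega>)))"

definition Dm :: "nat \<Rightarrow> real \<Rightarrow> real \<Rightarrow> 'a \<Rightarrow> real ^ 'n" where
  "Dm m u t \<omega> = (\<chi> i. sg $ i * (\<Sum>k<m. exp (- (lam $ i) * (t - grid u t m k)) * (W (L (grid u t m (Suc k)) \<omega>) \<omega> $ i - W (L (grid u t m k) \<omega>) \<omega> $ i)))"

lemma etam_tendsto:
  assumes g: "good \<omega>" and u: "0 \<le> u" "u < t"
  shows "(\<lambda>m. etam m u t \<omega>) \<longlonglongrightarrow> etaL u t \<omega>"
proof (rule vec_tendstoI)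
  fix i
  have "\<bar>L q \<omega>\<bar> \<le> L t \<omega>" if "q \<in> {u..t}" for q
    using good_nonneg[OF g, of q] good_mono[OF g, of q t] that u by auto
  then show "(\<lambda>m. etam m u t \<omega> $ i) \<longlonglongrightarrow> etaL u t \<omega> $ i"
    unfolding etam_def etaL_def vec_lambda_beta using u good_right_L[OF g]
    by (intro tendsto_mult tendsto_const riemann_sum_tendsto_conv[where K="L t \<omega>"]) auto
qed

lemma Dm_tendsto:
  assumes g: "good \<omega>" and u: "0 \<le> u" "u < t"
  shows "(\<lambda>m. Dm m u t \<omega>) \<longlonglongrightarrow> DW u t \<omega>"
proof (rule vec_tendstoI)
  fix i
  obtain K where K: "\<And>q i. q \<in> {u..t} \<Longrightarrow> \<bar>W (L q \<omega>) \<omega> $ i\<bar> \<le> K"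
    using good_bounded_W[OF g u(1) less_imp_le[OF u(2)]] by blast
  show "(\<lambda>m. Dm m u t \<omega> $ i) \<longlonglongrightarrow> DW u t \<omega> $ i"
    unfolding Dm_def DW_def vec_lambda_beta
  proof (intro tendsto_mult tendsto_const riemann_sum_tendsto_conv[where K=K] u K)
    fix q assume "q \<in> {u..<t}"
    then show "((\<lambda>r. W (L r \<omega>) \<omega> $ i) \<longlongrightarrow> W (L q \<omega>) \<omega> $ i) (at_right q)"
      using u by (intro tendsto_vec_nth good_right_W[OF g]) auto
  qed
qed

lemma grid_nonneg: "0 \<le> u \<Longrightarrow> u \<le> t \<Longrightarrow> 0 \<le> grid u t m k"
  by (auto simp: grid_def)

lemma WL_measurable:
  assumes "0 \<le> t"
  shows "(\<lambda>\<omega>. W (L t \<omega>) \<omega>) \<in> borel_measurable M"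
proof (rule brownian_at_measurable[OF compl bm L_measurable[OF assms]])
  show "AE \<omega> in M. 0 \<le> L t \<omega>"
    using AE_good by eventually_elim (use assms good_nonneg in auto)
qed

lemma etam_measurable: "0 \<le> u \<Longrightarrow> u \<le> t \<Longrightarrow> etam m u t \<in> borel_measurable M"
  unfolding etam_def
  by (intro borel_measurable_vecI, unfold vec_lambda_beta,
      intro borel_measurable_times borel_measurable_const borel_measurable_sum borel_measurable_diff L_measurable grid_nonneg)

lemma Dm_measurable: "0 \<le> u \<Longrightarrow> u \<le> t \<Longrightarrow> Dm m u t \<in> borel_measurable M"
  unfolding Dm_def
  by (intro borel_measurable_vecI, unfold vec_lambda_beta,
      intro borel_measurable_times borel_measurable_const borel_measurable_sum borel_measurable_diff
        measurable_vec_nth WL_measurable grid_nonneg)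

lemma etaL_measurable:
  assumes "0 \<le> u" "u < t"
  shows "etaL u t \<in> borel_measurable M"
proof (rule complete_measurable_AE_eq[OF compl])
  have [measurable]: "\<And>m. etam m u t \<in> borel_measurable M" using assms by (intro etam_measurable) auto
  show "(\<lambda>\<omega>. lim (\<lambda>m. etam m u t \<omega>)) \<in> borel_measurable M" by measurable
  show "AE \<omega> in M. etaL u t \<omega> = lim (\<lambda>m. etam m u t \<omega>)"
    using AE_good by eventually_elim (simp add: limI[OF etam_tendsto[OF _ assms]])
qed simp

lemma DW_measurable:
  assumes "0 \<le> u" "u < t"
  shows "DW u t \<in> borel_measurable M"
proof (rule complete_measurable_AE_eq[OF compl])
  have [measurable]: "\<And>m. Dm m u t \<in> borel_measurable M" using assms by (intro Dm_measurable) auto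
  show "(\<lambda>\<omega>. lim (\<lambda>m. Dm m u t \<omega>)) \<in> borel_measurable M" by measurable
  show "AE \<omega> in M. DW u t \<omega> = lim (\<lambda>m. Dm m u t \<omega>)"
    using AE_good by eventually_elim (simp add: limI[OF Dm_tendsto[OF _ assms]])
qed simp

lemma etam_nonneg:
  assumes g: "good \<omega>" and u: "0 \<le> u" "u \<le> t"
  shows "0 \<le> etam m u t \<omega> $ i"
proof -
  have "0 \<le> L (grid u t m (Suc k)) \<omega> - L (grid u t m k) \<omega>" for k
    using good_mono[OF g grid_nonneg[OF u] grid_mono[OF u(2), of k "Suc k"]] by simp
  then show ?thesis unfolding etam_def by (auto intro!: mult_nonneg_nonneg sum_nonneg)
qed

lemma etaL_nonneg:
  assumes g: "good \<omega>" and u: "0 \<le> u" "u < t"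
  shows "0 \<le> etaL u t \<omega> $ i"
proof (rule LIMSEQ_le_const)
  show "(\<lambda>m. etam m u t \<omega> $ i) \<longlonglongrightarrow> etaL u t \<omega> $ i" by (intro tendsto_vec_nth etam_tendsto assms)
  show "\<exists>N. \<forall>m\<ge>N. 0 \<le> etam m u t \<omega> $ i" using etam_nonneg[OF g] u by auto
qed

text \<open>On the time grid refined by \<open>m\<close> points in every block, conditioning on \<open>L\<close> gives Gaussian sums.\<close>

lemma block_char_discrete:
  assumes m: "0 < m" and t0: "\<And>j. 0 \<le> \<tau> j" and t1: "\<And>j. j < K \<Longrightarrow> \<tau> j < \<tau> (Suc j)"
  shows "(CLINT \<omega>|M. iexp (\<Sum>j<K. q j \<bullet> etam m (\<tau> j) (\<tau> (Suc j)) \<omega>) * iexp (\<Sum>j<K. p j \<bullet> Dm m (\<tau> j) (\<tau> (Suc j)) \<omega>)) =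
    (CLINT \<omega>|M. iexp (\<Sum>j<K. q j \<bullet> etam m (\<tau> j) (\<tau> (Suc j)) \<omega>) *
       complex_of_real (exp (- (\<Sum>j<K. \<Sum>i\<in>UNIV. (p j $ i)\<^sup>2 * etam m (\<tau> j) (\<tau> (Suc j)) \<omega> $ i) / 2)))"
proof -
  \<comment> \<open>The grids of the \<open>K\<close> blocks are strung together into one sequence
    of times: index \<open>j * m + k\<close> is point \<open>k\<close> of block \<open>j\<close>.
    The last point of a block is the first point of the next one, which is the case
    \<open>Suc k = m\<close> below.\<close>
  define r where "r l = grid (\<tau> (l div m)) (\<tau> (Suc (l div m))) m (l mod m)" for l
  define G where "G j k = grid (\<tau> j) (\<tau> (Suc j)) m k" for j k
  have rG: "r (j * m + k) = G j k" and rGS: "r (Suc (j * m + k)) = G j (Suc k)" if "k < m" for j k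
  proof -
    have gen: "(j * m + a) div m = j" "(j * m + a) mod m = a" if "a < m" for a using that m by auto
    show "r (j * m + k) = G j k" using gen[OF that] by (simp add: r_def G_def)
    show "r (Suc (j * m + k)) = G j (Suc k)"
    proof (cases "Suc k = m")
      case True
      then have eq: "Suc (j * m + k) = Suc j * m" by simp
      have "Suc (j * m + k) div m = Suc j" "Suc (j * m + k) mod m = 0"
        unfolding eq using m nonzero_mult_div_cancel_right[of m "Suc j"] by simp_all
      then show ?thesis using True m by (simp add: r_def G_def)
    next
      case False
      then have "Suc k < m" using that by simp
      then show ?thesis using gen[of "Suc k"] by (simp add: r_def G_def)
    qed
  qed
  have r0: "0 \<le> r l" for l
  proof -
    have "grid (\<tau> (l div m)) (\<tau> (Suc (l div m))) m (l mod m) =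
      (1 - real (l mod m) / real m) * \<tau> (l div m) + real (l mod m) / real m * \<tau> (Suc (l div m))"
      by (simp add: grid_def algebra_simps)
    moreover have "real (l mod m) / real m \<le> 1" using m by (simp add: less_imp_le)
    ultimately show ?thesis unfolding r_def using t0 by (auto intro!: add_nonneg_nonneg mult_nonneg_nonneg)
  qed
  have rS: "r l \<le> r (Suc l)" if "l < K * m" for l
  proof -
    have l: "l = (l div m) * m + l mod m" by simp
    have "l div m < K" using that m by (simp add: less_mult_imp_div_less)
    then have "G (l div m) (l mod m) \<le> G (l div m) (Suc (l mod m))"
      unfolding G_def using t1 by (intro grid_mono) (auto intro: less_imp_le)
    then show ?thesis using rG[of "l mod m" "l div m"] rGS[of "l mod m" "l div m"] m l by simp
  qed
  have rmono: "mono_on {..K * m} r"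
  proof (rule mono_onI)
    fix a b assume "a \<in> {..K * m}" "b \<in> {..K * m}" "a \<le> b"
    then show "r a \<le> r b"
    proof (induction b)
      case (Suc b)
      show ?case
      proof (cases "a = Suc b")
        case False
        then have "r a \<le> r b" using Suc by simp
        also have "\<dots> \<le> r (Suc b)" using rS[of b] Suc.prems by simp
        finally show ?thesis .
      qed simp
    qed simp
  qed
  define E where "E l i = exp (- (lam $ i) * (\<tau> (Suc (l div m)) - r l))" for l i
  define b where "b l = (\<Sum>i\<in>UNIV. q (l div m) $ i * ((sg $ i)\<^sup>2 * exp (- (2 * lam $ i) * (\<tau> (Suc (l div m)) - r l))))" for l
  define c where "c l = (\<chi> i. p (l div m) $ i * (sg $ i * exp (- (lam $ i) * (\<tau> (Suc (l div m)) - r l))))" for l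
  define dL where "dL l \<omega> = L (r (Suc l)) \<omega> - L (r l) \<omega>" for l \<omega>
  have jm: "(j * m + k) div m = j" if "k < m" for j k using that m by auto
  have q_eq: "(\<Sum>l<K * m. b l * dL l \<omega>) = (\<Sum>j<K. q j \<bullet> etam m (\<tau> j) (\<tau> (Suc j)) \<omega>)" for \<omega>
    unfolding sum_blocks
  proof (intro sum.cong refl)
    fix j assume "j \<in> {..<K}"
    have "(\<Sum>k<m. b (j * m + k) * dL (j * m + k) \<omega>) =
      (\<Sum>k<m. \<Sum>i\<in>UNIV. q j $ i * ((sg $ i)\<^sup>2 * (exp (- (2 * lam $ i) * (\<tau> (Suc j) - G j k)) * (L (G j (Suc k)) \<omega> - L (G j k) \<omega>))))"
      by (intro sum.cong refl) (simp add: b_def dL_def jm rG rGS sum_distrib_right mult.assoc)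
    also have "\<dots> = q j \<bullet> etam m (\<tau> j) (\<tau> (Suc j)) \<omega>"
      unfolding etam_def inner_vec_def by (subst sum.swap) (simp add: sum_distrib_left G_def mult.assoc)
    finally show "(\<Sum>k<m. b (j * m + k) * dL (j * m + k) \<omega>) = q j \<bullet> etam m (\<tau> j) (\<tau> (Suc j)) \<omega>" .
  qed
  have p_eq: "(\<Sum>l<K * m. c l \<bullet> (W (L (r (Suc l)) \<omega>) \<omega> - W (L (r l) \<omega>) \<omega>)) = (\<Sum>j<K. p j \<bullet> Dm m (\<tau> j) (\<tau> (Suc j)) \<omega>)" for \<omega>
    unfolding sum_blocks
  proof (intro sum.cong refl)
    fix j assume "j \<in> {..<K}"
    have "(\<Sum>k<m. c (j * m + k) \<bullet> (W (L (r (Suc (j * m + k))) \<omega>) \<omega> - W (L (r (j * m + k)) \<omega>) \<omega>)) =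
      (\<Sum>k<m. \<Sum>i\<in>UNIV. p j $ i * (sg $ i * (exp (- (lam $ i) * (\<tau> (Suc j) - G j k)) * (W (L (G j (Suc k)) \<omega>) \<omega> $ i - W (L (G j k) \<omega>) \<omega> $ i))))"
      by (intro sum.cong refl) (simp add: c_def jm rG rGS inner_vec_def mult.assoc)
    also have "\<dots> = p j \<bullet> Dm m (\<tau> j) (\<tau> (Suc j)) \<omega>"
      unfolding Dm_def inner_vec_def by (subst sum.swap) (simp add: sum_distrib_left G_def mult.assoc)
    finally show "(\<Sum>k<m. c (j * m + k) \<bullet> (W (L (r (Suc (j * m + k))) \<omega>) \<omega> - W (L (r (j * m + k)) \<omega>) \<omega>)) = p j \<bullet> Dm m (\<tau> j) (\<tau> (Suc j)) \<omega>" .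
  qed
  have v_eq: "(\<Sum>l<K * m. (c l \<bullet> c l) * dL l \<omega>) = (\<Sum>j<K. \<Sum>i\<in>UNIV. (p j $ i)\<^sup>2 * etam m (\<tau> j) (\<tau> (Suc j)) \<omega> $ i)" for \<omega>
    unfolding sum_blocks
  proof (intro sum.cong refl)
    fix j assume "j \<in> {..<K}"
    \<comment> \<open>Squaring the weight of the noise doubles the rate in the exponent; this is the
      origin of the factor 2 in \<open>etaL\<close>.\<close>
    have ee: "exp (- l * z) * exp (- l * z) = exp (- (2 * l) * z)" for l z :: real
      by (simp add: exp_add[symmetric])
    have "(p j $ i * (sg $ i * exp (- lam $ i * z))) * (p j $ i * (sg $ i * exp (- lam $ i * z))) =
      (p j $ i)\<^sup>2 * ((sg $ i)\<^sup>2 * exp (- (2 * lam $ i) * z))" for i z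
      unfolding ee[symmetric] by (simp add: power2_eq_square mult_ac)
    then have "(\<Sum>k<m. (c (j * m + k) \<bullet> c (j * m + k)) * dL (j * m + k) \<omega>) =
      (\<Sum>k<m. \<Sum>i\<in>UNIV. (p j $ i)\<^sup>2 * ((sg $ i)\<^sup>2 * (exp (- (2 * lam $ i) * (\<tau> (Suc j) - G j k)) * (L (G j (Suc k)) \<omega> - L (G j k) \<omega>))))"
      by (intro sum.cong refl) (simp add: c_def dL_def jm rG rGS inner_vec_def sum_distrib_right mult.assoc)
    also have "\<dots> = (\<Sum>i\<in>UNIV. (p j $ i)\<^sup>2 * etam m (\<tau> j) (\<tau> (Suc j)) \<omega> $ i)"
      unfolding etam_def by (subst sum.swap) (simp add: sum_distrib_left G_def mult.assoc)
    finally show "(\<Sum>k<m. (c (j * m + k) \<bullet> c (j * m + k)) * dL (j * m + k) \<omega>) = (\<Sum>i\<in>UNIV. (p j $ i)\<^sup>2 * etam m (\<tau> j) (\<tau> (Suc j)) \<omega> $ i)" .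
  qed
  have A: "sigma_algebra (space M) (process_sigma M L)"
    unfolding process_sigma_def by (intro sigma_algebra_sigma_sets) auto
  interpret A: sigma_algebra "space M" "process_sigma M L" by (rule A)
  have LA: "L (r l) \<in> borel_measurable (sigma (space M) (process_sigma M L))" for l
  proof (rule measurableI)
    fix B :: "real set" assume B: "B \<in> sets borel"
    have "L (r l) -` B \<inter> space M \<in> process_sigma M L"
      unfolding process_sigma_def using B r0 by (intro sigma_sets.Basic) auto
    then show "L (r l) -` B \<inter> space (sigma (space M) (process_sigma M L)) \<in> sets (sigma (space M) (process_sigma M L))"
      using A.space_closed by (simp add: A.sigma_sets_eq)
  qed auto
  have "(CLINT \<omega>|M. iexp (\<Sum>l<K * m. b l * dL l \<omega>) * iexp (\<Sum>l<K * m. c l \<bullet> (W (L (r (Suc l)) \<omega>) \<omega> - W (L (r l) \<omega>) \<omega>))) =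
    (CLINT \<omega>|M. iexp (\<Sum>l<K * m. b l * dL l \<omega>) * complex_of_real (exp (- (\<Sum>l<K * m. (c l \<bullet> c l) * (L (r (Suc l)) \<omega> - L (r l) \<omega>)) / 2)))"
  proof (rule subordinated_char[OF prob compl bm ind A, where Y="\<lambda>l. L (r l)"])
    show "L (r l) \<in> borel_measurable (sigma (space M) (process_sigma M L))" for l by (rule LA)
    show "AE \<omega> in M. 0 \<le> L (r 0) \<omega>"
      using AE_good by eventually_elim (rule good_nonneg[OF _ r0])
    show "AE \<omega> in M. mono_on {..K * m} (\<lambda>k. L (r k) \<omega>)"
      using AE_good
    proof eventually_elim
      case (elim \<omega>)
      show ?case by (intro mono_onI good_mono[OF elim r0] mono_onD[OF rmono])
    qed
    have [measurable]: "dL l \<in> borel_measurable (sigma (space M) (process_sigma M L))" for l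
      unfolding dL_def by (intro borel_measurable_diff LA)
    show "(\<lambda>\<omega>. iexp (\<Sum>l<K * m. b l * dL l \<omega>)) \<in> borel_measurable (sigma (space M) (process_sigma M L))"
      by measurable
  qed simp
  then show ?thesis
    unfolding dL_def[symmetric] q_eq p_eq v_eq .
qed

text \<open>Limit of the discrete identity as the grids are refined. Both integrands have modulus at
  most 1, on the right because the variances are nonnegative on good paths. The identity encodes
  that, given \<open>L\<close>, the noises of the blocks are independent centred Gaussian vectors
  with variances \<open>etaL\<close>.\<close>

lemma block_char:
  assumes t0: "\<And>j. 0 \<le> \<tau> j" and t1: "\<And>j. j < K \<Longrightarrow> \<tau> j < \<tau> (Suc j)"
  shows "(CLINT \<omega>|M. iexp (\<Sum>j<K. q j \<bullet> etaL (\<tau> j) (\<tau> (Suc j)) \<omega>) * iexp (\<Sum>j<K. p j \<bullet> DW (\<tau> j) (\<tau> (Suc j)) \<omega>)) =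
    (CLINT \<omega>|M. iexp (\<Sum>j<K. q j \<bullet> etaL (\<tau> j) (\<tau> (Suc j)) \<omega>) *
       complex_of_real (exp (- (\<Sum>j<K. \<Sum>i\<in>UNIV. (p j $ i)\<^sup>2 * etaL (\<tau> j) (\<tau> (Suc j)) \<omega> $ i) / 2)))"
proof -
  define e where "e m \<omega> = (\<Sum>j<K. q j \<bullet> etam m (\<tau> j) (\<tau> (Suc j)) \<omega>)" for m \<omega>
  define d where "d m \<omega> = (\<Sum>j<K. p j \<bullet> Dm m (\<tau> j) (\<tau> (Suc j)) \<omega>)" for m \<omega>
  define v where "v m \<omega> = (\<Sum>j<K. \<Sum>i\<in>UNIV. (p j $ i)\<^sup>2 * etam m (\<tau> j) (\<tau> (Suc j)) \<omega> $ i)" for m \<omega>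
  define e' where "e' \<omega> = (\<Sum>j<K. q j \<bullet> etaL (\<tau> j) (\<tau> (Suc j)) \<omega>)" for \<omega>
  define d' where "d' \<omega> = (\<Sum>j<K. p j \<bullet> DW (\<tau> j) (\<tau> (Suc j)) \<omega>)" for \<omega>
  define v' where "v' \<omega> = (\<Sum>j<K. \<Sum>i\<in>UNIV. (p j $ i)\<^sup>2 * etaL (\<tau> j) (\<tau> (Suc j)) \<omega> $ i)" for \<omega>
  note t1' = less_imp_le[OF t1]
  have me[measurable]: "e m \<in> borel_measurable M" for m
    unfolding e_def by (intro borel_measurable_sum borel_measurable_inner borel_measurable_const etam_measurable t0 t1') auto
  have md[measurable]: "d m \<in> borel_measurable M" for m
    unfolding d_def by (intro borel_measurable_sum borel_measurable_inner borel_measurable_const Dm_measurable t0 t1') auto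
  have mv[measurable]: "v m \<in> borel_measurable M" for m
    unfolding v_def by (intro borel_measurable_sum borel_measurable_times borel_measurable_const measurable_vec_nth etam_measurable t0 t1') auto
  have me'[measurable]: "e' \<in> borel_measurable M"
    unfolding e'_def by (intro borel_measurable_sum borel_measurable_inner borel_measurable_const etaL_measurable t0 t1) auto
  have md'[measurable]: "d' \<in> borel_measurable M"
    unfolding d'_def by (intro borel_measurable_sum borel_measurable_inner borel_measurable_const DW_measurable t0 t1) auto
  have mv'[measurable]: "v' \<in> borel_measurable M"
    unfolding v'_def by (intro borel_measurable_sum borel_measurable_times borel_measurable_const measurable_vec_nth etaL_measurable t0 t1) auto
  have lims: "(\<lambda>m. e m \<omega>) \<longlonglongrightarrow> e' \<omega>" "(\<lambda>m. d m \<omega>) \<longlonglongrightarrow> d' \<omega>" "(\<lambda>m. v m \<omega>) \<longlonglongrightarrow> v' \<omega>" if g: "good \<omega>" for \<omega>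
  proof -
    have E: "(\<lambda>m. etam m (\<tau> j) (\<tau> (Suc j)) \<omega>) \<longlonglongrightarrow> etaL (\<tau> j) (\<tau> (Suc j)) \<omega>" if "j \<in> {..<K}" for j
      using that by (intro etam_tendsto g t0 t1) auto
    have D: "(\<lambda>m. Dm m (\<tau> j) (\<tau> (Suc j)) \<omega>) \<longlonglongrightarrow> DW (\<tau> j) (\<tau> (Suc j)) \<omega>" if "j \<in> {..<K}" for j
      using that by (intro Dm_tendsto g t0 t1) auto
    show "(\<lambda>m. e m \<omega>) \<longlonglongrightarrow> e' \<omega>" unfolding e_def e'_def
      by (rule tendsto_sum, rule tendsto_inner[OF tendsto_const], rule E)
    show "(\<lambda>m. d m \<omega>) \<longlonglongrightarrow> d' \<omega>" unfolding d_def d'_def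
      by (rule tendsto_sum, rule tendsto_inner[OF tendsto_const], rule D)
    show "(\<lambda>m. v m \<omega>) \<longlonglongrightarrow> v' \<omega>" unfolding v_def v'_def
      by (rule tendsto_sum, rule tendsto_sum, rule tendsto_mult[OF tendsto_const], rule tendsto_vec_nth, rule E)
  qed
  have 1: "(\<lambda>m. CLINT \<omega>|M. iexp (e m \<omega>) * iexp (d m \<omega>)) \<longlonglongrightarrow> (CLINT \<omega>|M. iexp (e' \<omega>) * iexp (d' \<omega>))"
  proof (rule integral_dominated_convergence[where w="\<lambda>_. 1" and s="\<lambda>m \<omega>. iexp (e m \<omega>) * iexp (d m \<omega>)"])
    show "AE \<omega> in M. (\<lambda>m. iexp (e m \<omega>) * iexp (d m \<omega>)) \<longlonglongrightarrow> iexp (e' \<omega>) * iexp (d' \<omega>)"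
      using AE_good
    proof eventually_elim
      case (elim \<omega>)
      show ?case by (intro tendsto_mult tendsto_exp tendsto_const tendsto_of_real lims elim)
    qed
  qed (auto simp: norm_mult)
  have 2: "(\<lambda>m. CLINT \<omega>|M. iexp (e m \<omega>) * complex_of_real (exp (- v m \<omega> / 2))) \<longlonglongrightarrow> (CLINT \<omega>|M. iexp (e' \<omega>) * complex_of_real (exp (- v' \<omega> / 2)))"
  proof (rule integral_dominated_convergence[where w="\<lambda>_. 1" and s="\<lambda>m \<omega>. iexp (e m \<omega>) * complex_of_real (exp (- v m \<omega> / 2))"])
    show "AE \<omega> in M. (\<lambda>m. iexp (e m \<omega>) * complex_of_real (exp (- v m \<omega> / 2))) \<longlonglongrightarrow> iexp (e' \<omega>) * complex_of_real (exp (- v' \<omega> / 2))"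
      using AE_good
    proof eventually_elim
      case (elim \<omega>)
      have "(\<lambda>m. - v m \<omega> / 2) \<longlonglongrightarrow> - v' \<omega> / 2" by (intro tendsto_divide tendsto_minus lims elim tendsto_const) simp
      then show ?case by (intro tendsto_mult tendsto_exp tendsto_const tendsto_of_real lims elim)
    qed
    show "AE \<omega> in M. norm (iexp (e m \<omega>) * complex_of_real (exp (- v m \<omega> / 2))) \<le> 1" for m
      using AE_good
    proof eventually_elim
      case (elim \<omega>)
      have "0 \<le> v m \<omega>" unfolding v_def
        by (intro sum_nonneg mult_nonneg_nonneg etam_nonneg[OF elim] t0 t1') auto
      then show ?case by (simp add: norm_mult)
    qed
  qed auto
  have eq: "(CLINT \<omega>|M. iexp (e m \<omega>) * iexp (d m \<omega>)) = (CLINT \<omega>|M. iexp (e m \<omega>) * complex_of_real (exp (- v m \<omega> / 2)))" if "0 < m" for m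
    unfolding e_def d_def v_def by (rule block_char_discrete[of m \<tau> K q p]) (use that t0 t1 in auto)
  have "(\<lambda>m. CLINT \<omega>|M. iexp (e m \<omega>) * iexp (d m \<omega>)) \<longlonglongrightarrow> (CLINT \<omega>|M. iexp (e' \<omega>) * complex_of_real (exp (- v' \<omega> / 2)))"
    by (rule Lim_transform_eventually[OF 2]) (auto simp: eq intro!: eventually_sequentiallyI[of 1])
  from LIMSEQ_unique[OF 1 this] show ?thesis unfolding e'_def d'_def v'_def .
qed

end

section \<open>The negative half moment\<close>

lemma nn_integral_powr_to_inf:
  fixes e :: real
  assumes "e < - 1"
  shows "(\<integral>\<^sup>+v. ennreal (indicator {1..} v * v powr e) \<partial>lborel) = ennreal (- 1 / (e + 1))"
  using has_integral_powr_to_inf[of e 1] assms by (subst nn_integral_has_integral_lebesgue) auto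

text \<open>The fourth power of \<open>y / 4 \<le> exp (y / 4)\<close> gives
  \<open>exp (- y) \<le> 256 / y ^ 4\<close>, so the function decays at least like the power
  \<open>- 4 * \<alpha>\<close>, which is integrable at infinity since the exponent is below
  -2.\<close>

lemma integrable_exp_minus_powr:
  fixes a \<alpha> :: real
  assumes a: "0 < a" and \<alpha>: "1 / 2 < \<alpha>"
  shows "integrable lborel (\<lambda>u. exp (- (a * \<bar>u\<bar> powr \<alpha>)))"
proof -
  define g where "g v = indicator {1..} v * v powr (- 4 * \<alpha>)" for v :: real
  have gi: "integrable lborel g"
    unfolding g_def using nn_integral_powr_to_inf[of "- 4 * \<alpha>"] \<alpha>
    by (intro integrableI_nonneg) auto
  have gi': "integrable lborel (\<lambda>v. g (- v))"
    using lborel_integrable_real_affine[OF gi, of "- 1" 0] by simp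
  have ii: "integrable lborel (\<lambda>v::real. indicator {-1..1} v *\<^sub>R (1::real))"
    by (rule borel_integrable_compact) auto
  define K where "K = 256 / a ^ 4"
  have K0: "0 \<le> K" using a by (simp add: K_def)
  have b: "exp (- (a * \<bar>u\<bar> powr \<alpha>)) \<le> K * g \<bar>u\<bar>" if "1 \<le> \<bar>u\<bar>" for u
  proof -
    define y where "y = a * \<bar>u\<bar> powr \<alpha>"
    have y: "0 < y" using a that by (auto simp: y_def)
    have "y / 4 \<le> exp (y / 4)" using exp_ge_add_one_self[of "y / 4"] by linarith
    then have "(y / 4) ^ 4 \<le> exp (y / 4) ^ 4" using y by (intro power_mono) auto
    also have "\<dots> = exp y" by (simp add: exp_of_nat_mult[symmetric])
    finally have "exp (- y) \<le> 256 / y ^ 4" using y by (simp add: exp_minus field_simps power_divide)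
    also have "y ^ 4 = a ^ 4 * \<bar>u\<bar> powr (4 * \<alpha>)"
      using that by (simp add: y_def power_mult_distrib powr_power)
    also have "256 / (a ^ 4 * \<bar>u\<bar> powr (4 * \<alpha>)) = K * g \<bar>u\<bar>"
      using that by (simp add: K_def g_def powr_minus_divide)
    finally show ?thesis by (simp add: y_def)
  qed
  show ?thesis
  proof (rule Bochner_Integration.integrable_bound)
    show "integrable lborel (\<lambda>v. indicator {-1..1} v *\<^sub>R (1::real) + (K * g v + K * g (- v)))"
      by (intro Bochner_Integration.integrable_add ii integrable_mult_right gi gi')
    show "AE u in lborel. norm (exp (- (a * \<bar>u\<bar> powr \<alpha>))) \<le> norm (indicator {-1..1} u *\<^sub>R (1::real) + (K * g u + K * g (- u)))"
    proof (intro AE_I2)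
      fix u :: real
      have g0: "0 \<le> K * g v" for v using K0 by (simp add: g_def)
      show "norm (exp (- (a * \<bar>u\<bar> powr \<alpha>))) \<le> norm (indicator {-1..1} u *\<^sub>R (1::real) + (K * g u + K * g (- u)))"
      proof (cases "\<bar>u\<bar> \<le> 1")
        case True
        have "exp (- (a * \<bar>u\<bar> powr \<alpha>)) \<le> 1" using a by simp
        then have "exp (- (a * \<bar>u\<bar> powr \<alpha>)) \<le> 1 + (K * g u + K * g (- u))" using g0[of u] g0[of "- u"] by linarith
        moreover have "(indicator {-1..1} u :: real) = 1" using True by (auto simp: indicator_def)
        ultimately show ?thesis using g0[of u] g0[of "- u"] by simp
      next
        case False
        then have "exp (- (a * \<bar>u\<bar> powr \<alpha>)) \<le> K * g u + K * g (- u)"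
          using b[of u] g0[of u] g0[of "- u"] by (cases "0 \<le> u") auto
        then show ?thesis using g0[of u] g0[of "- u"] by (auto simp: indicator_def)
      qed
    qed
  qed simp
qed

text \<open>A Gaussian average of the characteristic function controls the mass near the origin.\<close>

lemma (in real_distribution) gauss_average_le:
  assumes \<phi>: "integrable lborel (\<lambda>u. norm (char M u))" and v: "0 < v"
  shows "(LINT x|M. exp (- (x * v)\<^sup>2 / 2)) \<le> (LINT u|lborel. norm (char M u)) / v"
proof -
  let ?n = std_normal_distribution
  interpret n: prob_space ?n by (rule prob_space_normal_density) simp
  interpret P: pair_prob_space M ?n ..
  have [measurable]: "(\<lambda>x. x) \<in> borel_measurable M" by simp
  have fi: "integrable (M \<Otimes>\<^sub>M ?n) (\<lambda>(x, z). iexp (v * z * x))"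
    by (rule P.P.integrable_const_bound[of _ 1]) auto
  \<comment> \<open>The Gaussian function of \<open>x * v\<close> is itself a characteristic
    function, that of the standard normal law; exchanging the two integrations brings in the
    characteristic function of \<open>M\<close>.\<close>
  have "complex_of_real (LINT x|M. exp (- (x * v)\<^sup>2 / 2)) = (CLINT x|M. char ?n (x * v))"
    by (simp add: char_std_normal_distribution)
  also have "\<dots> = (CLINT x|M. CLINT z|?n. iexp (v * z * x))"
    by (simp add: char_def mult_ac)
  also have "\<dots> = (CLINT z|?n. CLINT x|M. iexp (v * z * x))"
    using P.Fubini_integral[OF fi] by simp
  also have "\<dots> = (CLINT z|?n. char M (v * z))" by (simp add: char_def mult_ac)
  finally have "(LINT x|M. exp (- (x * v)\<^sup>2 / 2)) = norm (CLINT z|?n. char M (v * z))"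
    by (metis abs_of_nonneg norm_of_real Bochner_Integration.integral_nonneg exp_ge_zero)
  also have "\<dots> \<le> (LINT z|?n. norm (char M (v * z)))" by (rule integral_norm_bound)
  also have "\<dots> = (LINT z|lborel. std_normal_density z * norm (char M (v * z)))"
    by (subst integral_density) auto
  also have "\<dots> \<le> (LINT z|lborel. norm (char M (0 + v * z)))"
  proof (rule integral_mono)
    have i: "integrable lborel (\<lambda>z. norm (char M (0 + v * z)))"
      using lborel_integrable_real_affine[OF \<phi>, of v 0] v by simp
    then show "integrable lborel (\<lambda>z. norm (char M (0 + v * z)))" .
    have le1: "std_normal_density z \<le> 1" for z
    proof -
      have "1 \<le> sqrt (2 * pi)" using pi_gt3 by (simp add: real_le_rsqrt)
      then have "1 / sqrt (2 * pi) \<le> 1" by simp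
      moreover have "exp (- z\<^sup>2 / 2) \<le> 1" by simp
      ultimately have "1 / sqrt (2 * pi) * exp (- z\<^sup>2 / 2) \<le> 1 * 1" by (intro mult_mono) auto
      then show ?thesis by (simp add: std_normal_density_def)
    qed
    then show "std_normal_density z * norm (char M (v * z)) \<le> norm (char M (0 + v * z))" for z
      using mult_right_mono[of "std_normal_density z" 1 "norm (char M (v * z))"] by simp
    then show "integrable lborel (\<lambda>z. std_normal_density z * norm (char M (v * z)))"
      by (intro Bochner_Integration.integrable_bound[OF i]) (auto simp: abs_mult)
  qed
  also have "\<dots> = (LINT u|lborel. norm (char M u)) / v"
    using lborel_integral_real_affine[of v "\<lambda>u. norm (char M u)" 0] v by (simp add: field_simps)
  finally show ?thesis .
qed

text \<open>The Gaussian function equals 1 at the origin, so its average dominates the atom there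
  for every \<open>v\<close>; the bound on the average tends to 0 as \<open>v\<close> grows.\<close>

lemma (in real_distribution) char_integrable_no_atom:
  assumes \<phi>: "integrable lborel (\<lambda>u. norm (char M u))"
  shows "AE x in M. x \<noteq> 0"
proof -
  have "measure M {0} \<le> (LINT u|lborel. norm (char M u)) / real n" if "0 < n" for n :: nat
  proof -
    have "measure M {0} = (LINT x|M. indicator {0} x)" by simp
    also have "\<dots> \<le> (LINT x|M. exp (- (x * real n)\<^sup>2 / 2))"
      by (intro integral_mono integrable_const_bound[of _ 1]) (auto simp: indicator_def)
    also have "\<dots> \<le> (LINT u|lborel. norm (char M u)) / real n"
      by (rule gauss_average_le[OF \<phi>]) (use that in simp)
    finally show ?thesis .
  qed
  then have "measure M {0} \<le> 0"
    by (intro LIMSEQ_le_const[OF lim_const_over_n[of "LINT u|lborel. norm (char M u)"]] exI[of _ 1]) auto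
  then have "measure M {0} = 0" using measure_nonneg[of M "{0}"] by linarith
  then have "{0} \<in> null_sets M" by (auto simp: emeasure_eq_measure)
  then show ?thesis by (rule AE_I'[of "{0}"]) auto
qed

text \<open>Up to a constant, \<open>\<bar>x\<bar> powr (-1/2)\<close> is the integral of \<open>v powr (-1/2) * exp (-(x v)^2/2)\<close> over \<open>v > 0\<close>.\<close>

lemma (in real_distribution) neg_half_moment_finite:
  assumes \<phi>: "integrable lborel (\<lambda>u. norm (char M u))"
  shows "integrable M (\<lambda>x. \<bar>x\<bar> powr - (1 / 2))"
proof -
  define C where "C = (LINT u|lborel. norm (char M u))"
  have C0: "0 \<le> C" unfolding C_def by (intro Bochner_Integration.integral_nonneg) simp
  define h where "h x v = indicator {0<..} v * v powr - (1 / 2) * exp (- (x * v)\<^sup>2 / 2)" for x v :: real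
  have h0: "0 \<le> h x v" for x v by (simp add: h_def)
  have hm[measurable]: "(\<lambda>(x, v). h x v) \<in> borel_measurable (borel \<Otimes>\<^sub>M borel)"
    unfolding h_def by measurable
  \<comment> \<open>The constant of proportionality between the power of \<open>x\<close> and the
    integral over \<open>v\<close>; since it is positive, finiteness of the product at the end
    yields finiteness of the moment.\<close>
  define c where "c = (\<integral>\<^sup>+v. ennreal (h 1 v) \<partial>lborel)"
  have cpos: "0 < c"
  proof -
    have "0 < ennreal (2 powr - (1 / 2) * exp (- 2)) * emeasure lborel {1..2::real}"
      by (simp add: ennreal_zero_less_mult_iff)
    also have "\<dots> = (\<integral>\<^sup>+v. ennreal (2 powr - (1 / 2) * exp (- 2)) * indicator {1..2::real} v \<partial>lborel)"
      by (simp add: nn_integral_cmult_indicator)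
    also have "\<dots> \<le> c" unfolding c_def
    proof (intro nn_integral_mono)
      fix v :: real
      have "2 powr - (1 / 2) * exp (- 2) \<le> h 1 v" if "v \<in> {1..2}"
      proof -
        have "2 powr - (1 / 2) \<le> v powr - (1 / 2)" using that by (intro powr_mono2') auto
        moreover have "v\<^sup>2 \<le> 2\<^sup>2" using that by (intro power_mono) auto
        then have "exp (- 2) \<le> exp (- (1 * v)\<^sup>2 / 2)" by simp
        ultimately have "2 powr - (1 / 2) * exp (- 2) \<le> v powr - (1 / 2) * exp (- (1 * v)\<^sup>2 / 2)" by (intro mult_mono) auto
        then show ?thesis using that by (simp add: h_def)
      qed
      then show "ennreal (2 powr - (1 / 2) * exp (- 2)) * indicator {1..2} v \<le> ennreal (h 1 v)"
        by (auto simp: indicator_def intro: ennreal_leI)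
    qed
    finally show ?thesis .
  qed
  \<comment> \<open>Substitution \<open>v = w / \<bar>x\<bar>\<close>. At \<open>x = 0\<close> the
    left side is 0 by the convention \<open>0 powr a = 0\<close>.\<close>
  have scale: "ennreal (\<bar>x\<bar> powr - (1 / 2)) * c \<le> (\<integral>\<^sup>+v. ennreal (h x v) \<partial>lborel)" for x
  proof (cases "x = 0")
    case False
    have e: "h x (0 + (1 / \<bar>x\<bar>) * w) = \<bar>x\<bar> powr (1 / 2) * h 1 w" for w
    proof (cases "0 < w")
      case True
      have "(x * (w / \<bar>x\<bar>))\<^sup>2 = w\<^sup>2" using False by (simp add: power_mult_distrib power_divide)
      moreover have "(w / \<bar>x\<bar>) powr - (1 / 2) = \<bar>x\<bar> powr (1 / 2) * w powr - (1 / 2)"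
        using True False by (simp add: powr_divide powr_minus field_simps)
      moreover have "0 < w / \<bar>x\<bar>" using True False by simp
      ultimately show ?thesis using True unfolding h_def by (simp add: indicator_def)
    next
      case f: False
      then have "\<not> 0 < w / \<bar>x\<bar>" using False by (simp add: zero_less_divide_iff)
      then show ?thesis using f unfolding h_def by (simp add: indicator_def)
    qed
    have "(\<integral>\<^sup>+v. ennreal (h x v) \<partial>lborel) = ennreal \<bar>1 / \<bar>x\<bar>\<bar> * (\<integral>\<^sup>+w. ennreal (h x (0 + (1 / \<bar>x\<bar>) * w)) \<partial>lborel)"
      using False by (intro nn_integral_real_affine) auto
    also have "\<dots> = ennreal \<bar>1 / \<bar>x\<bar>\<bar> * (ennreal (\<bar>x\<bar> powr (1 / 2)) * c)"
      unfolding e c_def by (simp add: ennreal_mult' nn_integral_cmult h0)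
    also have "\<dots> = ennreal (\<bar>1 / \<bar>x\<bar>\<bar> * \<bar>x\<bar> powr (1 / 2)) * c" by (subst ennreal_mult') (auto simp: mult.assoc)
    also have "\<bar>1 / \<bar>x\<bar>\<bar> * \<bar>x\<bar> powr (1 / 2) = \<bar>x\<bar> powr - (1 / 2)"
    proof -
      have "\<bar>1 / \<bar>x\<bar>\<bar> = \<bar>x\<bar> powr - 1" using False by (simp add: powr_minus_divide)
      then have "\<bar>1 / \<bar>x\<bar>\<bar> * \<bar>x\<bar> powr (1 / 2) = \<bar>x\<bar> powr (- 1 + 1 / 2)" by (simp only: powr_add)
      then show ?thesis by simp
    qed
    finally show ?thesis by simp
  qed simp
  \<comment> \<open>Near \<open>v = 0\<close> the Gaussian average is bounded by 1 and the power
    -1/2 is integrable; for large \<open>v\<close> the bound by a multiple of \<open>1 / v\<close>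
    improves the exponent to -3/2.\<close>
  have inner: "(\<integral>\<^sup>+x. ennreal (h x v) \<partial>M) \<le> ennreal (indicator {0..1} v * v powr - (1 / 2)) + ennreal C * ennreal (indicator {1..} v * v powr - (3 / 2))" for v
  proof (cases "0 < v")
    case True
    have i: "integrable M (\<lambda>x. exp (- (x * v)\<^sup>2 / 2))"
      by (intro integrable_const_bound[of _ 1]) auto
    have "(\<integral>\<^sup>+x. ennreal (h x v) \<partial>M) = (\<integral>\<^sup>+x. ennreal (v powr - (1 / 2) * exp (- (x * v)\<^sup>2 / 2)) \<partial>M)"
      using True by (simp add: h_def)
    also have "\<dots> = ennreal (LINT x|M. v powr - (1 / 2) * exp (- (x * v)\<^sup>2 / 2))"
      using i by (intro nn_integral_eq_integral) auto
    also have "\<dots> = ennreal (v powr - (1 / 2) * (LINT x|M. exp (- (x * v)\<^sup>2 / 2)))" by simp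
    finally have eq: "(\<integral>\<^sup>+x. ennreal (h x v) \<partial>M) = ennreal (v powr - (1 / 2) * (LINT x|M. exp (- (x * v)\<^sup>2 / 2)))" .
    show ?thesis
    proof (cases "v \<le> 1")
      case v1: True
      have "(LINT x|M. exp (- (x * v)\<^sup>2 / 2)) \<le> (LINT x|M. 1)" using i by (intro integral_mono) auto
      then have "v powr - (1 / 2) * (LINT x|M. exp (- (x * v)\<^sup>2 / 2)) \<le> v powr - (1 / 2) * 1"
        using prob_space by (intro mult_left_mono) auto
      then have "ennreal (v powr - (1 / 2) * (LINT x|M. exp (- (x * v)\<^sup>2 / 2))) \<le> ennreal (indicator {0..1} v * v powr - (1 / 2))"
        using True v1 by (intro ennreal_leI) simp
      then show ?thesis unfolding eq by (rule order_trans) simp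
    next
      case v1: False
      have "v powr - (1 / 2) * (LINT x|M. exp (- (x * v)\<^sup>2 / 2)) \<le> v powr - (1 / 2) * (C / v)"
        unfolding C_def by (intro mult_left_mono gauss_average_le[OF \<phi> True]) auto
      also have "C / v = C * v powr - 1" using True by (simp add: powr_minus_divide)
      also have "v powr - (1 / 2) * (C * v powr - 1) = C * (v powr - (1 / 2) * v powr - 1)" by simp
      also have "v powr - (1 / 2) * v powr - 1 = v powr - (3 / 2)"
        by (subst powr_add[symmetric]) simp
      finally have "ennreal (v powr - (1 / 2) * (LINT x|M. exp (- (x * v)\<^sup>2 / 2))) \<le> ennreal (C * (indicator {1..} v * v powr - (3 / 2)))"
        using v1 by (intro ennreal_leI) simp
      also have "\<dots> = ennreal C * ennreal (indicator {1..} v * v powr - (3 / 2))" using C0 by (simp add: ennreal_mult')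
      finally show ?thesis unfolding eq by (rule order_trans) simp
    qed
  qed (simp add: h_def)
  interpret P: pair_sigma_finite M lborel ..
  have "(\<integral>\<^sup>+x. ennreal (\<bar>x\<bar> powr - (1 / 2)) \<partial>M) * c = (\<integral>\<^sup>+x. ennreal (\<bar>x\<bar> powr - (1 / 2)) * c \<partial>M)"
    by (rule nn_integral_multc[symmetric]) simp
  also have "\<dots> \<le> (\<integral>\<^sup>+x. \<integral>\<^sup>+v. ennreal (h x v) \<partial>lborel \<partial>M)"
    by (intro nn_integral_mono scale)
  also have "\<dots> = (\<integral>\<^sup>+v. \<integral>\<^sup>+x. ennreal (h x v) \<partial>M \<partial>lborel)"
    by (rule P.Fubini'[symmetric]) measurable
  also have "\<dots> \<le> (\<integral>\<^sup>+v. ennreal (indicator {0..1} v * v powr - (1 / 2)) + ennreal C * ennreal (indicator {1..} v * v powr - (3 / 2)) \<partial>lborel)"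
    by (intro nn_integral_mono inner)
  also have "\<dots> = (\<integral>\<^sup>+v. ennreal (indicator {0..1} v * v powr - (1 / 2)) \<partial>lborel) + ennreal C * (\<integral>\<^sup>+v. ennreal (indicator {1..} v * v powr - (3 / 2)) \<partial>lborel)"
    by (subst nn_integral_add) (auto simp: nn_integral_cmult)
  also have "\<dots> < \<infinity>"
  proof -
    have "(\<integral>\<^sup>+v. ennreal (indicator {0..1} v * v powr - (1 / 2)) \<partial>lborel) < \<infinity>"
      using powr_integrable_0(1)[of "1/2" 1] by (subst nn_integral_eq_integral) auto
    then show ?thesis using nn_integral_powr_to_inf[of "- (3 / 2)"] by (simp add: ennreal_mult_less_top)
  qed
  finally have "(\<integral>\<^sup>+x. ennreal (\<bar>x\<bar> powr - (1 / 2)) \<partial>M) < \<infinity>"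
    using cpos by (auto simp: ennreal_mult_less_top less_top[symmetric] ennreal_mult_eq_top_iff)
  then show ?thesis by (intro integrableI_nonneg) auto
qed

section \<open>Stable subordinators\<close>

locale stable_bm = subordinated_bm M W L lam sg
  for M :: "'a measure" and W :: "real \<Rightarrow> 'a \<Rightarrow> real ^ 'n::finite" and L :: "real \<Rightarrow> 'a \<Rightarrow> real"
    and lam sg :: "real ^ 'n" +
  fixes \<alpha> \<gamma> :: real
  assumes lam: "\<And>i. 0 < lam $ i" and sg: "\<And>i. 0 < sg $ i"
    and \<alpha>: "1 / 2 < \<alpha>" "\<alpha> < 1" and \<gamma>: "0 < \<gamma>"
    and stable: "strictly_stable M \<alpha> L"
    and char: "\<And>u. char (distr M borel (L 1)) u =
           exp (- complex_of_real (\<gamma> powr \<alpha> * \<bar>u\<bar> powr \<alpha>) *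
                (1 - \<i> * complex_of_real (tan (pi * \<alpha> / 2) * sgn u)))"
begin

text \<open>The order of the singularity in time: an increment over length \<open>h\<close> is
  distributed like \<open>h powr (1 / \<alpha>) * L 1\<close>, and the moment taken is that of order
  -1/2.\<close>

definition b :: real where "b = 1 / (2 * \<alpha>)"

lemma b: "0 < b" "b < 1"
  using \<alpha> by (auto simp: b_def field_simps)

lemma rd_L1: "real_distribution (distr M borel (L 1))"
  by (rule real_distribution_distr) (simp add: L_measurable)

lemma char_integrable: "integrable lborel (\<lambda>u. norm (char (distr M borel (L 1)) u))"
proof -
  have "norm (char (distr M borel (L 1)) u) = exp (- (\<gamma> powr \<alpha> * \<bar>u\<bar> powr \<alpha>))" for u
    unfolding char norm_exp_eq_Re by simp
  then show ?thesis using integrable_exp_minus_powr[of "\<gamma> powr \<alpha>" \<alpha>] \<gamma> \<alpha> by simp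
qed

lemma L1_moment: "integrable M (\<lambda>\<omega>. \<bar>L 1 \<omega>\<bar> powr - (1 / 2))"
  using real_distribution.neg_half_moment_finite[OF rd_L1 char_integrable]
  by (subst (asm) integrable_distr_eq) (auto simp: L_measurable)

lemma L1_ne_0: "AE \<omega> in M. L 1 \<omega> \<noteq> 0"
  using real_distribution.char_integrable_no_atom[OF rd_L1 char_integrable]
  by (subst (asm) AE_distr_iff) (auto simp: L_measurable)

lemma increment_distr:
  assumes "0 \<le> u" "u < t"
  shows "distr M borel (\<lambda>\<omega>. L t \<omega> - L u \<omega>) = distr M borel (\<lambda>\<omega>. (t - u) powr (1 / \<alpha>) * L 1 \<omega>)"
proof -
  have "distr M borel (\<lambda>\<omega>. L t \<omega> - L u \<omega>) = distr M borel (L (t - u))"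
    using sub assms unfolding subordinator_def levy_process_def by auto
  also have "\<dots> = distr M borel (\<lambda>\<omega>. (t - u) powr (1 / \<alpha>) * L 1 \<omega>)"
    using stable assms unfolding strictly_stable_def by auto
  finally show ?thesis .
qed

text \<open>Stability transfers the absence of an atom at 0 from \<open>L 1\<close> to every
  increment, and monotone paths turn nonzero into positive.\<close>

lemma increment_pos:
  assumes "0 \<le> u" "u < t"
  shows "AE \<omega> in M. 0 < L t \<omega> - L u \<omega>"
proof -
  have m: "(\<lambda>\<omega>. L t \<omega> - L u \<omega>) \<in> borel_measurable M" "(\<lambda>\<omega>. (t - u) powr (1 / \<alpha>) * L 1 \<omega>) \<in> borel_measurable M"
    by (intro borel_measurable_diff borel_measurable_times borel_measurable_const L_measurable; use assms in simp)+
  have "AE \<omega> in M. (t - u) powr (1 / \<alpha>) * L 1 \<omega> \<noteq> 0"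
    using L1_ne_0 by eventually_elim (use assms in auto)
  then have "AE x in distr M borel (\<lambda>\<omega>. L t \<omega> - L u \<omega>). x \<noteq> 0"
    unfolding increment_distr[OF assms] by (subst AE_distr_iff[OF m(2)]) auto
  then have "AE \<omega> in M. L t \<omega> - L u \<omega> \<noteq> 0" by (subst (asm) AE_distr_iff[OF m(1)]) auto
  with AE_good show ?thesis
  proof eventually_elim
    case (elim \<omega>)
    then show ?case using good_mono[OF elim(1), of u t] assms by simp
  qed
qed

definition mom :: real where "mom = (LINT \<omega>|M. \<bar>L 1 \<omega>\<bar> powr - (1 / 2))"

lemma increment_moment:
  assumes "0 \<le> u" "u < t"
  shows "integrable M (\<lambda>\<omega>. \<bar>L t \<omega> - L u \<omega>\<bar> powr - (1 / 2))"
    and "(LINT \<omega>|M. \<bar>L t \<omega> - L u \<omega>\<bar> powr - (1 / 2)) = (t - u) powr - b * mom"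
proof -
  have m: "(\<lambda>\<omega>. L t \<omega> - L u \<omega>) \<in> borel_measurable M" "(\<lambda>\<omega>. (t - u) powr (1 / \<alpha>) * L 1 \<omega>) \<in> borel_measurable M"
    by (intro borel_measurable_diff borel_measurable_times borel_measurable_const L_measurable; use assms in simp)+
  have e: "\<bar>(t - u) powr (1 / \<alpha>) * y\<bar> powr - (1 / 2) = (t - u) powr - b * \<bar>y\<bar> powr - (1 / 2)" for y
    using assms by (simp add: abs_mult powr_mult powr_powr b_def mult.commute)
  have h: "(\<lambda>x::real. \<bar>x\<bar> powr - (1 / 2)) \<in> borel_measurable borel" by measurable
  have "integrable (distr M borel (\<lambda>\<omega>. L t \<omega> - L u \<omega>)) (\<lambda>x. \<bar>x\<bar> powr - (1 / 2))"
    unfolding increment_distr[OF assms] by (subst integrable_distr_eq[OF m(2) h]) (simp only: e integrable_mult_right[OF L1_moment])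
  then show "integrable M (\<lambda>\<omega>. \<bar>L t \<omega> - L u \<omega>\<bar> powr - (1 / 2))"
    by (subst (asm) integrable_distr_eq[OF m(1) h])
  have "(LINT \<omega>|M. \<bar>L t \<omega> - L u \<omega>\<bar> powr - (1 / 2)) = (LINT x|distr M borel (\<lambda>\<omega>. L t \<omega> - L u \<omega>). \<bar>x\<bar> powr - (1 / 2))"
    by (rule integral_distr[OF m(1) h, symmetric])
  also have "\<dots> = (LINT \<omega>|M. \<bar>(t - u) powr (1 / \<alpha>) * L 1 \<omega>\<bar> powr - (1 / 2))"
    unfolding increment_distr[OF assms] by (rule integral_distr[OF m(2) h])
  also have "\<dots> = (t - u) powr - b * mom" unfolding e mom_def by simp
  finally show "(LINT \<omega>|M. \<bar>L t \<omega> - L u \<omega>\<bar> powr - (1 / 2)) = (t - u) powr - b * mom" .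
qed

text \<open>True already for the Riemann sums: the exponential weight is smallest at the left end
  point \<open>u\<close>, and with this constant weight the increments telescope.\<close>

lemma etaL_lower:
  assumes g: "good \<omega>" and u: "0 \<le> u" "u < t"
  shows "(sg $ i)\<^sup>2 * exp (- (2 * lam $ i) * (t - u)) * (L t \<omega> - L u \<omega>) \<le> etaL u t \<omega> $ i"
proof (rule LIMSEQ_le_const)
  show "(\<lambda>m. etam m u t \<omega> $ i) \<longlonglongrightarrow> etaL u t \<omega> $ i" by (intro tendsto_vec_nth etam_tendsto assms)
  have "(sg $ i)\<^sup>2 * exp (- (2 * lam $ i) * (t - u)) * (L t \<omega> - L u \<omega>) \<le> etam m u t \<omega> $ i" if m: "1 \<le> m" for m
  proof -
    have inc: "0 \<le> L (grid u t m (Suc k)) \<omega> - L (grid u t m k) \<omega>" for k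
      using good_mono[OF g grid_nonneg[OF u(1)] grid_mono[of u t k "Suc k"]] u by simp
    have "exp (- (2 * lam $ i) * (t - u)) * (L t \<omega> - L u \<omega>) =
        exp (- (2 * lam $ i) * (t - u)) * (\<Sum>k<m. L (grid u t m (Suc k)) \<omega> - L (grid u t m k) \<omega>)"
      using m by (simp add: sum_lessThan_telescope[of "\<lambda>k. L (grid u t m k) \<omega>"])
    also have "\<dots> = (\<Sum>k<m. exp (- (2 * lam $ i) * (t - u)) * (L (grid u t m (Suc k)) \<omega> - L (grid u t m k) \<omega>))"
      by (rule sum_distrib_left)
    also have "\<dots> \<le> (\<Sum>k<m. exp (- (2 * lam $ i) * (t - grid u t m k)) * (L (grid u t m (Suc k)) \<omega> - L (grid u t m k) \<omega>))"
    proof (intro sum_mono mult_right_mono inc)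
      fix k assume "k \<in> {..<m}"
      then have "grid u t m k \<in> {u..t}" using u m by (intro grid_mem) auto
      then have "lam $ i * (t - grid u t m k) \<le> lam $ i * (t - u)" using lam[of i] by (intro mult_left_mono) auto
      then show "exp (- (2 * lam $ i) * (t - u)) \<le> exp (- (2 * lam $ i) * (t - grid u t m k))" by simp
    qed
    finally have "(sg $ i)\<^sup>2 * (exp (- (2 * lam $ i) * (t - u)) * (L t \<omega> - L u \<omega>)) \<le> etam m u t \<omega> $ i"
      unfolding etam_def vec_lambda_beta by (intro mult_left_mono) auto
    then show ?thesis by (simp add: mult.assoc)
  qed
  then show "\<exists>N. \<forall>m\<ge>N. (sg $ i)\<^sup>2 * exp (- (2 * lam $ i) * (t - u)) * (L t \<omega> - L u \<omega>) \<le> etam m u t \<omega> $ i" by blast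
qed

lemma etaL_pos:
  assumes u: "0 \<le> u" "u < t"
  shows "AE \<omega> in M. \<forall>i. 0 < etaL u t \<omega> $ i"
  using AE_good increment_pos[OF u]
proof eventually_elim
  case (elim \<omega>)
  show ?case
  proof
    fix i
    have "0 < (sg $ i)\<^sup>2 * exp (- (2 * lam $ i) * (t - u)) * (L t \<omega> - L u \<omega>)"
      using sg[of i] elim(2) by simp
    also have "\<dots> \<le> etaL u t \<omega> $ i" by (rule etaL_lower[OF elim(1) u])
    finally show "0 < etaL u t \<omega> $ i" .
  qed
qed

text \<open>The inverse square root of \<open>(sg $ i)\<^sup>2 * exp (- (2 * lam $ i) * T)\<close>,
  the factor in the lower bound of the variance when the length of the block is replaced by
  \<open>T\<close>.\<close>

definition etaC :: "real \<Rightarrow> 'n \<Rightarrow> real" where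
  "etaC T i = exp (lam $ i * T) / sg $ i"

lemma etaL_moment:
  assumes u: "0 \<le> u" "u < t" "t \<le> T"
  shows "integrable M (\<lambda>\<omega>. 1 / sqrt (etaL u t \<omega> $ i))"
    and "(LINT \<omega>|M. 1 / sqrt (etaL u t \<omega> $ i)) \<le> etaC T i * mom * (t - u) powr - b"
proof -
  have le: "AE \<omega> in M. 1 / sqrt (etaL u t \<omega> $ i) \<le> etaC T i * \<bar>L t \<omega> - L u \<omega>\<bar> powr - (1 / 2)"
    using AE_good increment_pos[OF u(1,2)]
  proof eventually_elim
    case (elim \<omega>)
    \<comment> \<open>The lower bound of the variance with \<open>t - u\<close> enlarged to
      \<open>T\<close> in the exponent, which makes the constant independent of the two
      times.\<close>
    define z where "z = (sg $ i)\<^sup>2 * exp (- (2 * lam $ i) * T) * (L t \<omega> - L u \<omega>)"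
    have z0: "0 < z" using sg[of i] elim(2) by (simp add: z_def)
    have "lam $ i * (t - u) \<le> lam $ i * T" using lam[of i] u by (intro mult_left_mono) auto
    then have "z \<le> (sg $ i)\<^sup>2 * exp (- (2 * lam $ i) * (t - u)) * (L t \<omega> - L u \<omega>)"
      unfolding z_def using elim(2) by (intro mult_right_mono mult_left_mono) auto
    also have "\<dots> \<le> etaL u t \<omega> $ i" by (rule etaL_lower[OF elim(1) u(1,2)])
    finally have "1 / sqrt (etaL u t \<omega> $ i) \<le> 1 / sqrt z"
      using z0 by (intro divide_left_mono) auto
    also have "sqrt z = sg $ i * exp (- (lam $ i * T)) * sqrt (L t \<omega> - L u \<omega>)"
    proof -
      have e2: "exp (- (2 * lam $ i) * T) = (exp (- (lam $ i * T)))\<^sup>2" by (simp add: power2_eq_square exp_add[symmetric])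
      have "z = (sg $ i * exp (- (lam $ i * T)))\<^sup>2 * (L t \<omega> - L u \<omega>)"
        unfolding z_def e2 by (simp only: power_mult_distrib)
      then have "sqrt z = \<bar>sg $ i * exp (- (lam $ i * T))\<bar> * sqrt (L t \<omega> - L u \<omega>)"
        by (simp only: real_sqrt_mult real_sqrt_abs)
      moreover have "\<bar>sg $ i * exp (- (lam $ i * T))\<bar> = sg $ i * exp (- (lam $ i * T))"
        using sg[of i] by (intro abs_of_nonneg) (simp add: less_imp_le)
      ultimately show ?thesis by simp
    qed
    also have "1 / (sg $ i * exp (- (lam $ i * T)) * sqrt (L t \<omega> - L u \<omega>)) = etaC T i * \<bar>L t \<omega> - L u \<omega>\<bar> powr - (1 / 2)"
    proof -
      have "\<bar>L t \<omega> - L u \<omega>\<bar> powr - (1 / 2) = 1 / sqrt (L t \<omega> - L u \<omega>)"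
        using elim(2) by (simp add: powr_minus_divide powr_half_sqrt)
      moreover have "1 / (sg $ i * exp (- (lam $ i * T))) = etaC T i"
        unfolding etaC_def by (simp add: exp_minus divide_inverse)
      ultimately show ?thesis by (metis times_divide_times_eq mult_1)
    qed
    finally show ?case .
  qed
  have pos: "AE \<omega> in M. 0 \<le> 1 / sqrt (etaL u t \<omega> $ i)"
    using etaL_pos[OF u(1,2)] by eventually_elim (auto intro: less_imp_le)
  have m: "(\<lambda>\<omega>. 1 / sqrt (etaL u t \<omega> $ i)) \<in> borel_measurable M"
    using etaL_measurable[OF u(1,2)] by measurable
  show i: "integrable M (\<lambda>\<omega>. 1 / sqrt (etaL u t \<omega> $ i))"
  proof (rule Bochner_Integration.integrable_bound[OF integrable_mult_right[OF increment_moment(1)[OF u(1,2)], of "etaC T i"] m])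
    show "AE \<omega> in M. norm (1 / sqrt (etaL u t \<omega> $ i)) \<le> norm (etaC T i * \<bar>L t \<omega> - L u \<omega>\<bar> powr - (1 / 2))"
      using le pos by eventually_elim auto
  qed
  have "(LINT \<omega>|M. 1 / sqrt (etaL u t \<omega> $ i)) \<le> (LINT \<omega>|M. etaC T i * \<bar>L t \<omega> - L u \<omega>\<bar> powr - (1 / 2))"
    by (rule integral_mono_AE[OF i integrable_mult_right[OF increment_moment(1)[OF u(1,2)]] le])
  also have "\<dots> = etaC T i * mom * (t - u) powr - b"
    by (simp add: increment_moment(2)[OF u(1,2)])
  finally show "(LINT \<omega>|M. 1 / sqrt (etaL u t \<omega> $ i)) \<le> etaC T i * mom * (t - u) powr - b" .
qed

section \<open>A version of the covariance jointly measurable in time and path\<close>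

text \<open>A version of \<open>L\<close> on all real times whose paths are right continuous for
  every \<open>\<omega>\<close>, the bad ones being replaced by a fixed increasing path. Integrals
  over the times of the blocks are exchanged with expectations later, and this needs joint
  measurability, which \<open>L\<close> itself need not have.\<close>

definition Lt :: "real \<Rightarrow> 'a \<Rightarrow> real" where
  "Lt r \<omega> = (if good \<omega> then L (max 0 r) \<omega> else max 0 r)"

lemma good_sets: "{\<omega> \<in> space M. good \<omega>} \<in> sets M"
proof -
  interpret complete_measure M by (rule compl)
  obtain Z where Z: "{x \<in> space M. \<not> good x} \<subseteq> Z" "Z \<in> null_sets M"
    using AE_E3[OF AE_good] by (metis (mono_tags, lifting) Diff_iff mem_Collect_eq subsetI)
  then have "{x \<in> space M. \<not> good x} \<in> sets M" by (intro complete)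
  then have "space M - {x \<in> space M. \<not> good x} \<in> sets M" by auto
  also have "space M - {x \<in> space M. \<not> good x} = {\<omega> \<in> space M. good \<omega>}" by auto
  finally show ?thesis .
qed

lemma Lt_measurable: "Lt r \<in> borel_measurable M"
  unfolding Lt_def
  by (intro measurable_If L_measurable good_sets borel_measurable_const) auto

lemma Lt_right: "((\<lambda>r. Lt r \<omega>) \<longlongrightarrow> Lt q \<omega>) (at_right q)"
proof (cases "good \<omega> \<and> 0 \<le> q")
  case True
  have "((\<lambda>r. L r \<omega>) \<longlongrightarrow> L q \<omega>) (at_right q)" using True by (intro good_right_L) auto
  moreover have "\<forall>\<^sub>F r in at_right q. L r \<omega> = Lt r \<omega>"
    using eventually_at_right_less[of q] by eventually_elim (use True in \<open>auto simp: Lt_def max_def\<close>)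
  ultimately show ?thesis using True by (auto simp: Lt_def max_def intro: Lim_transform_eventually)
next
  case False
  show ?thesis
  proof (cases "good \<omega>")
    case g: True
    then have q: "q < 0" using False by simp
    have "\<forall>\<^sub>F r in at_right q. r < 0" using q by (rule eventually_at_right_real[of q 0, THEN eventually_mono]) auto
    then have "\<forall>\<^sub>F r in at_right q. Lt q \<omega> = Lt r \<omega>"
      by eventually_elim (use q g in \<open>auto simp: Lt_def max_def\<close>)
    then show ?thesis by (rule Lim_transform_eventually[OF tendsto_const])
  next
    case ng: False
    then show ?thesis unfolding Lt_def by (auto intro!: tendsto_intros)
  qed
qed

text \<open>The time is approximated by dyadic points strictly to its right, so that right
  continuity suffices for convergence; each approximation takes countably many time values.\<close>

lemma Lt_joint: "(\<lambda>(r, \<omega>). Lt r \<omega>) \<in> borel_measurable (borel \<Otimes>\<^sub>M M)"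
proof (rule borel_measurable_LIMSEQ_real[where u="\<lambda>n (r :: real, \<omega>). Lt ((of_int \<lfloor>2 ^ n * r\<rfloor> + 1) / 2 ^ n) \<omega>"])
  fix n :: nat
  have "(\<lambda>x :: real \<times> 'a. Lt ((of_int \<lfloor>2 ^ n * fst x\<rfloor> + 1) / 2 ^ n) (snd x)) \<in> borel_measurable (borel \<Otimes>\<^sub>M M)"
  proof (rule measurable_compose_countable[of "\<lambda>k (x :: real \<times> 'a). Lt ((of_int k + 1) / 2 ^ n) (snd x)" _ _ "\<lambda>x :: real \<times> 'a. \<lfloor>2 ^ n * fst x\<rfloor>"])
    show "(\<lambda>x :: real \<times> 'a. Lt ((of_int k + 1) / 2 ^ n) (snd x)) \<in> borel_measurable (borel \<Otimes>\<^sub>M M)" for k :: int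
      by (rule measurable_compose[OF measurable_snd Lt_measurable])
    show "(\<lambda>x :: real \<times> 'a. \<lfloor>2 ^ n * fst x\<rfloor>) \<in> borel \<Otimes>\<^sub>M M \<rightarrow>\<^sub>M count_space UNIV"
    proof -
      have "(\<lambda>x :: real \<times> 'a. 2 ^ n * fst x) \<in> borel_measurable (borel \<Otimes>\<^sub>M M)" by measurable
      from measurable_compose[OF this measurable_real_floor] show ?thesis .
    qed
  qed
  then show "(\<lambda>(r :: real, \<omega>). Lt ((of_int \<lfloor>2 ^ n * r\<rfloor> + 1) / 2 ^ n) \<omega>) \<in> borel_measurable (borel \<Otimes>\<^sub>M M)"
    by (simp only: case_prod_unfold)
next
  fix x :: "real \<times> 'a"
  obtain r \<omega> where x: "x = (r, \<omega>)" by (cases x)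
  define z where "z n = (of_int \<lfloor>2 ^ n * r\<rfloor> + 1) / (2 ^ n :: real)" for n :: nat
  have z: "r < z n" "z n \<le> r + (1 / 2) ^ n" for n
  proof -
    have "2 ^ n * r < of_int \<lfloor>2 ^ n * r\<rfloor> + 1" "of_int \<lfloor>2 ^ n * r\<rfloor> + 1 \<le> 2 ^ n * r + 1" by linarith+
    then have "2 ^ n * r / 2 ^ n < z n" "z n \<le> (2 ^ n * r + 1) / 2 ^ n"
      unfolding z_def by (intro divide_strict_right_mono divide_right_mono; simp)+
    then show "r < z n" "z n \<le> r + (1 / 2) ^ n" by (simp_all add: add_divide_distrib power_one_over)
  qed
  have "(\<lambda>n. (1 / 2) ^ n) \<longlonglongrightarrow> (0::real)" by (intro LIMSEQ_realpow_zero) auto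
  then have hi: "(\<lambda>n. r + (1 / 2) ^ n) \<longlonglongrightarrow> r" using tendsto_add[OF tendsto_const[of r]] by fastforce
  have "z \<longlonglongrightarrow> r"
    by (rule tendsto_sandwich[OF _ _ tendsto_const hi]) (use z in \<open>auto intro!: always_eventually less_imp_le\<close>)
  then have "filterlim z (at_right r) sequentially"
    unfolding filterlim_at using z by (auto intro!: always_eventually)
  from filterlim_compose[OF Lt_right[of \<omega> r] this]
  show "(\<lambda>n. (case x of (r, \<omega>) \<Rightarrow> Lt ((of_int \<lfloor>2 ^ n * r\<rfloor> + 1) / 2 ^ n) \<omega>)) \<longlonglongrightarrow> (case x of (r, \<omega>) \<Rightarrow> Lt r \<omega>)"
    by (simp add: x z_def)
qed

text \<open>The variance built from \<open>Lt\<close>. It coincides with \<open>etaL\<close> on good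
  paths and is jointly measurable in both times and \<open>\<omega>\<close>.\<close>

definition etaT :: "real \<Rightarrow> real \<Rightarrow> 'a \<Rightarrow> real ^ 'n" where
  "etaT u t \<omega> = (\<chi> i. (sg $ i)\<^sup>2 * conv (2 * lam $ i) (\<lambda>r. Lt r \<omega>) u t)"

lemma Lt_compose [measurable (raw)]:
  assumes "f \<in> borel_measurable N" "g \<in> measurable N M"
  shows "(\<lambda>x. Lt (f x) (g x)) \<in> borel_measurable N"
  using measurable_compose[OF measurable_Pair[OF assms] Lt_joint] by simp

lemma etaT_eq:
  assumes "good \<omega>" "0 \<le> u" "u \<le> t"
  shows "etaT u t \<omega> = etaL u t \<omega>"
proof -
  have "Lt q \<omega> = L q \<omega>" if "q \<in> {u..t}" for q using assms that by (simp add: Lt_def)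
  then have "(LINT q:{u..t}|lborel. exp (- c * (t - q)) * Lt q \<omega>) = (LINT q:{u..t}|lborel. exp (- c * (t - q)) * L q \<omega>)" for c
    by (intro set_lebesgue_integral_cong) auto
  then show ?thesis using assms unfolding etaT_def etaL_def conv_def by (simp add: Lt_def)
qed

lemma etaT_joint: "(\<lambda>(u, t, \<omega>). etaT u t \<omega>) \<in> borel_measurable (borel \<Otimes>\<^sub>M borel \<Otimes>\<^sub>M M)"
proof -
  have "(\<lambda>x. etaT (fst x) (fst (snd x)) (snd (snd x))) \<in> borel_measurable (borel \<Otimes>\<^sub>M borel \<Otimes>\<^sub>M M)"
  proof (rule borel_measurable_vecI)
    fix i
    have 3: "(\<lambda>(x, q). indicator {fst x..fst (snd x)} q *\<^sub>R (exp (- (2 * lam $ i) * (fst (snd x) - q)) * Lt q (snd (snd x))))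
      \<in> borel_measurable ((borel \<Otimes>\<^sub>M borel \<Otimes>\<^sub>M M) \<Otimes>\<^sub>M lborel)"
    proof -
      have ind: "indicator {fst x..fst (snd x)} q = (if fst x \<le> q \<and> q \<le> fst (snd x) then 1 else 0 :: real)" for x :: "real \<times> real \<times> 'a" and q
        by (simp add: indicator_def)
      show ?thesis unfolding case_prod_unfold ind by measurable
    qed
    have "(\<lambda>x. LINT q:{fst x..fst (snd x)}|lborel. exp (- (2 * lam $ i) * (fst (snd x) - q)) * Lt q (snd (snd x))) \<in> borel_measurable (borel \<Otimes>\<^sub>M borel \<Otimes>\<^sub>M M)"
      unfolding set_lebesgue_integral_def using lborel.borel_measurable_lebesgue_integral[OF 3] by simp
    then show "(\<lambda>x. etaT (fst x) (fst (snd x)) (snd (snd x)) $ i) \<in> borel_measurable (borel \<Otimes>\<^sub>M borel \<Otimes>\<^sub>M M)"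
      unfolding etaT_def conv_def vec_lambda_beta by measurable
  qed
  then show ?thesis by (simp only: case_prod_unfold)
qed

end

section \<open>Normalised noise\<close>

text \<open>For a vector with positive entries this is the action of the square root of the
  covariance \<open>diag a\<close>, and \<open>vunscale\<close> that of its inverse.\<close>

definition vscale :: "real ^ 'n \<Rightarrow> real ^ 'n \<Rightarrow> real ^ 'n" where
  "vscale a x = (\<chi> i. sqrt (a $ i) * x $ i)"

definition vunscale :: "real ^ 'n \<Rightarrow> real ^ 'n \<Rightarrow> real ^ 'n" where
  "vunscale a x = (\<chi> i. x $ i / sqrt (a $ i))"

lemma vscale_measurable [measurable (raw)]:
  fixes f g :: "'a \<Rightarrow> real ^ 'n::finite"
  assumes [measurable]: "f \<in> borel_measurable M" "g \<in> borel_measurable M"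
  shows "(\<lambda>x. vscale (f x) (g x)) \<in> borel_measurable M"
  unfolding vscale_def by (rule borel_measurable_vecI) (simp, measurable)

lemma vunscale_measurable [measurable (raw)]:
  fixes f g :: "'a \<Rightarrow> real ^ 'n::finite"
  assumes [measurable]: "f \<in> borel_measurable M" "g \<in> borel_measurable M"
  shows "(\<lambda>x. vunscale (f x) (g x)) \<in> borel_measurable M"
  unfolding vunscale_def by (rule borel_measurable_vecI) (simp, measurable)

lemma vunscale_vscale: "(\<And>i. 0 < a $ i) \<Longrightarrow> vunscale a (vscale a x) = x"
  unfolding vunscale_def vscale_def by (simp add: vec_eq_iff) (metis less_irrefl)

abbreviation gauss_power :: "nat \<Rightarrow> (nat \<Rightarrow> real ^ 'n::finite) measure" where
  "gauss_power K \<equiv> PiM {..<K} (\<lambda>_. gauss)"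

lemma prob_space_gauss_power: "prob_space (gauss_power K :: (nat \<Rightarrow> real ^ 'n::finite) measure)"
  by (intro prob_space_PiM prob_space_gauss)

lemma char_gauss_power:
  "(CLINT \<xi>|(gauss_power K :: (nat \<Rightarrow> real ^ 'n::finite) measure). iexp (\<Sum>j<K. c j \<bullet> \<xi> j)) =
     complex_of_real (exp (- (\<Sum>j<K. c j \<bullet> c j) / 2))"
proof -
  interpret product_sigma_finite "\<lambda>_::nat. gauss :: (real ^ 'n) measure"
    by (intro product_sigma_finite.intro prob_space_imp_sigma_finite prob_space_gauss)
  have "(CLINT \<xi>|(gauss_power K :: (nat \<Rightarrow> real ^ 'n::finite) measure). iexp (\<Sum>j<K. c j \<bullet> \<xi> j)) =
    (CLINT \<xi>|(gauss_power K :: (nat \<Rightarrow> real ^ 'n::finite) measure). (\<Prod>j<K. iexp (c j \<bullet> \<xi> j)))"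
    by (simp add: exp_sum sum_distrib_left)
  also have "\<dots> = (\<Prod>j<K. CLINT \<xi>|(gauss :: (real ^ 'n) measure). iexp (c j \<bullet> \<xi>))"
  proof (rule product_integral_prod)
    show "complex_integrable (gauss :: (real ^ 'n) measure) (\<lambda>\<xi>. iexp (c j \<bullet> \<xi>))" for j
      by (rule gauss.integrable_const_bound[of _ 1]) auto
  qed simp
  also have "\<dots> = (\<Prod>j<K. complex_of_real (exp (- (c j \<bullet> c j) / 2)))"
    by (simp only: char_gauss)
  also have "\<dots> = complex_of_real (exp (\<Sum>j<K. - (c j \<bullet> c j) / 2))"
    by (simp only: exp_sum finite_lessThan of_real_prod)
  finally show ?thesis by (simp add: sum_divide_distrib sum_negf)
qed

context subordinated_bm
begin

text \<open>Integrating out the independent Gaussian first leaves the exponential of minus half the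
  squared norms of \<open>vscale e p\<close>, which is the right side of \<open>block_char\<close>.
  Hence both families have the same joint characteristic function.\<close>

lemma block_law:
  assumes t0: "\<And>j. 0 \<le> \<tau> j" and t1: "\<And>j. j < K \<Longrightarrow> \<tau> j < \<tau> (Suc j)"
  defines "S \<equiv> PiM {..<K} (\<lambda>_. borel \<Otimes>\<^sub>M borel) :: (nat \<Rightarrow> (real ^ 'n) \<times> (real ^ 'n)) measure"
  shows "distr M S (\<lambda>\<omega>. \<lambda>j\<in>{..<K}. (etaL (\<tau> j) (\<tau> (Suc j)) \<omega>, DW (\<tau> j) (\<tau> (Suc j)) \<omega>)) =
    distr (M \<Otimes>\<^sub>M gauss_power K) S (\<lambda>z. \<lambda>j\<in>{..<K}. (etaL (\<tau> j) (\<tau> (Suc j)) (fst z), vscale (etaL (\<tau> j) (\<tau> (Suc j)) (fst z)) (snd z j)))"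
proof -
  define e where "e j = etaL (\<tau> j) (\<tau> (Suc j))" for j
  define d where "d j = DW (\<tau> j) (\<tau> (Suc j))" for j
  have em: "e j \<in> borel_measurable M" if "j < K" for j unfolding e_def by (rule etaL_measurable[OF t0 t1[OF that]])
  have dm: "d j \<in> borel_measurable M" if "j < K" for j unfolding d_def by (rule DW_measurable[OF t0 t1[OF that]])
  let ?G = "gauss_power K :: (nat \<Rightarrow> real ^ 'n) measure"
  let ?N = "M \<Otimes>\<^sub>M ?G"
  interpret G: prob_space ?G by (rule prob_space_gauss_power)
  interpret P: pair_prob_space M ?G ..
  \<comment> \<open>All vectors are flattened into real coordinates, indexed by the block, the
    component, and a flag telling the noise from the covariance.\<close>
  define I where "I = {..<K} \<times> (UNIV :: ('n \<times> bool) set)"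
  define X where "X k \<omega> = (case k of (j, i, w) \<Rightarrow> if j < K then (if w then d j \<omega> $ i else e j \<omega> $ i) else 0)" for k \<omega>
  define Y where "Y k z = (case k of (j, i, w) \<Rightarrow> if j < K then (if w then vscale (e j (fst z)) (snd z j) $ i else e j (fst z) $ i) else 0)"
    for k and z :: "'a \<times> (nat \<Rightarrow> real ^ 'n)"
  have Xm: "X k \<in> borel_measurable M" for k
  proof (cases k)
    case (fields j i w)
    then show ?thesis using measurable_vec_nth[OF em] measurable_vec_nth[OF dm]
      by (cases "j < K"; cases w) (simp_all add: X_def[abs_def])
  qed
  have em': "(\<lambda>z. e j (fst z)) \<in> borel_measurable ?N" if "j < K" for j
    by (rule measurable_compose[OF measurable_fst em[OF that]])
  have xm: "(\<lambda>z. snd z j) \<in> borel_measurable ?N" if "j < K" for j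
    using measurable_compose[OF measurable_snd measurable_component_singleton[of j "{..<K}" "\<lambda>_. gauss"]] that
    by (simp cong: measurable_cong_sets)
  have vm: "(\<lambda>z. vscale (e j (fst z)) (snd z j)) \<in> borel_measurable ?N" if "j < K" for j
    by (rule vscale_measurable[OF em'[OF that] xm[OF that]])
  have Ym: "Y k \<in> borel_measurable ?N" for k
  proof (cases k)
    case (fields j i w)
    then show ?thesis using measurable_vec_nth[OF em'] measurable_vec_nth[OF vm]
      by (cases "j < K"; cases w) (simp_all add: Y_def[abs_def])
  qed
  define T :: "(nat \<times> 'n \<times> bool \<Rightarrow> real) \<Rightarrow> (nat \<Rightarrow> (real ^ 'n) \<times> (real ^ 'n))"
    where "T f = (\<lambda>j\<in>{..<K}. (\<chi> i. f (j, i, False), \<chi> i. f (j, i, True)))" for f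
  have Tm: "T \<in> measurable (PiM I (\<lambda>_. borel)) S"
    unfolding T_def S_def
  proof (intro measurable_restrict measurable_Pair borel_measurable_vecI)
    fix j i assume "j \<in> {..<K}"
    then show "(\<lambda>f. (\<chi> i. f (j, i, False)) $ i) \<in> borel_measurable (PiM I (\<lambda>_. borel))"
      "(\<lambda>f. (\<chi> i. f (j, i, True)) $ i) \<in> borel_measurable (PiM I (\<lambda>_. borel))"
      by (auto simp: I_def intro!: measurable_component_singleton)
  qed
  have law: "distr M (PiM I (\<lambda>_. borel)) (\<lambda>\<omega>. \<lambda>k\<in>I. X k \<omega>) = distr ?N (PiM I (\<lambda>_. borel)) (\<lambda>z. \<lambda>k\<in>I. Y k z)"
  proof (rule char_unique_finite[OF prob P.prob_space_axioms _ Xm Ym])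
    show "finite I" by (simp add: I_def)
    fix v :: "nat \<times> 'n \<times> bool \<Rightarrow> real"
    define q where "q j = (\<chi> i. v (j, i, False))" for j
    define p where "p j = (\<chi> i. v (j, i, True))" for j
    have sumI: "(\<Sum>k\<in>I. h k) = (\<Sum>j<K. (\<Sum>i\<in>UNIV. h (j, i, False)) + (\<Sum>i\<in>UNIV. h (j, i, True)))" for h :: "nat \<times> 'n \<times> bool \<Rightarrow> real"
    proof -
      have "(\<Sum>k\<in>I. h k) = (\<Sum>j<K. \<Sum>y\<in>UNIV. h (j, y))"
        by (simp add: sum.cartesian_product I_def case_prod_unfold)
      also have "\<dots> = (\<Sum>j<K. \<Sum>i\<in>UNIV. \<Sum>w\<in>UNIV. h (j, i, w))"
        by (simp add: sum.cartesian_product UNIV_Times_UNIV case_prod_unfold)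
      also have "\<dots> = (\<Sum>j<K. \<Sum>i\<in>UNIV. h (j, i, False) + h (j, i, True))"
        by (simp add: UNIV_bool)
      finally show ?thesis by (simp add: sum.distrib)
    qed
    have sX: "(\<Sum>k\<in>I. v k * X k \<omega>) = (\<Sum>j<K. q j \<bullet> e j \<omega>) + (\<Sum>j<K. p j \<bullet> d j \<omega>)" for \<omega>
      unfolding sumI sum.distrib by (simp add: X_def q_def p_def inner_vec_def)
    have sY: "(\<Sum>k\<in>I. v k * Y k z) = (\<Sum>j<K. q j \<bullet> e j (fst z)) + (\<Sum>j<K. vscale (e j (fst z)) (p j) \<bullet> snd z j)" for z
      unfolding sumI sum.distrib by (simp add: Y_def q_def p_def inner_vec_def vscale_def mult_ac)
    define A where "A \<omega> = iexp (\<Sum>j<K. q j \<bullet> e j \<omega>)" for \<omega>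
    have pm: "(\<lambda>z. iexp (\<Sum>k\<in>I. v k * Y k z)) \<in> borel_measurable ?N"
    proof -
      have [measurable]: "(\<lambda>z. \<Sum>k\<in>I. v k * Y k z) \<in> borel_measurable ?N"
        by (intro borel_measurable_sum borel_measurable_times borel_measurable_const Ym)
      show ?thesis by measurable
    qed
    have "(CLINT z|?N. iexp (\<Sum>k\<in>I. v k * Y k z)) = (CLINT \<omega>|M. CLINT \<xi>|?G. iexp (\<Sum>k\<in>I. v k * Y k (\<omega>, \<xi>)))"
      by (rule P.integral_fst'[symmetric], rule P.P.integrable_const_bound[of _ 1]) (use pm in auto)
    also have "\<dots> = (CLINT \<omega>|M. A \<omega> * (CLINT \<xi>|?G. iexp (\<Sum>j<K. vscale (e j \<omega>) (p j) \<bullet> \<xi> j)))"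
      unfolding sY fst_conv snd_conv A_def of_real_add distrib_left exp_add by (simp only: integral_mult_right_zero)
    also have "\<dots> = (CLINT \<omega>|M. A \<omega> * complex_of_real (exp (- (\<Sum>j<K. vscale (e j \<omega>) (p j) \<bullet> vscale (e j \<omega>) (p j)) / 2)))"
      unfolding char_gauss_power ..
    also have "\<dots> = (CLINT \<omega>|M. A \<omega> * complex_of_real (exp (- (\<Sum>j<K. \<Sum>i\<in>UNIV. (p j $ i)\<^sup>2 * e j \<omega> $ i) / 2)))"
    proof (rule integral_cong_AE)
      have Am[measurable]: "A \<in> borel_measurable M"
      proof -
        have [measurable]: "(\<lambda>\<omega>. \<Sum>j<K. q j \<bullet> e j \<omega>) \<in> borel_measurable M"
          by (intro borel_measurable_sum borel_measurable_inner borel_measurable_const em) auto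
        show ?thesis unfolding A_def by measurable
      qed
      have [measurable]: "(\<lambda>\<omega>. \<Sum>j<K. vscale (e j \<omega>) (p j) \<bullet> vscale (e j \<omega>) (p j)) \<in> borel_measurable M"
        by (intro borel_measurable_sum borel_measurable_inner vscale_measurable borel_measurable_const em) auto
      show "(\<lambda>\<omega>. A \<omega> * complex_of_real (exp (- (\<Sum>j<K. vscale (e j \<omega>) (p j) \<bullet> vscale (e j \<omega>) (p j)) / 2))) \<in> borel_measurable M"
        by measurable
      have [measurable]: "(\<lambda>\<omega>. \<Sum>j<K. \<Sum>i\<in>UNIV. (p j $ i)\<^sup>2 * e j \<omega> $ i) \<in> borel_measurable M"
        by (intro borel_measurable_sum borel_measurable_times borel_measurable_const measurable_vec_nth em) auto
      show "(\<lambda>\<omega>. A \<omega> * complex_of_real (exp (- (\<Sum>j<K. \<Sum>i\<in>UNIV. (p j $ i)\<^sup>2 * e j \<omega> $ i) / 2))) \<in> borel_measurable M"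
        by measurable
      show "AE \<omega> in M. A \<omega> * complex_of_real (exp (- (\<Sum>j<K. vscale (e j \<omega>) (p j) \<bullet> vscale (e j \<omega>) (p j)) / 2)) =
        A \<omega> * complex_of_real (exp (- (\<Sum>j<K. \<Sum>i\<in>UNIV. (p j $ i)\<^sup>2 * e j \<omega> $ i) / 2))"
        using AE_good
      proof eventually_elim
        case (elim \<omega>)
        have "vscale (e j \<omega>) (p j) \<bullet> vscale (e j \<omega>) (p j) = (\<Sum>i\<in>UNIV. (p j $ i)\<^sup>2 * e j \<omega> $ i)" if "j < K" for j
        proof -
          have "(sqrt (e j \<omega> $ i) * p j $ i) * (sqrt (e j \<omega> $ i) * p j $ i) = (p j $ i)\<^sup>2 * e j \<omega> $ i" for i
          proof -
            have "sqrt (e j \<omega> $ i) * sqrt (e j \<omega> $ i) = e j \<omega> $ i"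
              using etaL_nonneg[OF elim t0 t1[OF that]] unfolding e_def by (rule real_sqrt_mult_self[THEN trans, OF abs_of_nonneg])
            then show ?thesis by (simp add: power2_eq_square mult_ac)
          qed
          then show ?thesis by (simp add: vscale_def inner_vec_def)
        qed
        then show ?case by simp
      qed
    qed
    also have "\<dots> = (CLINT \<omega>|M. A \<omega> * iexp (\<Sum>j<K. p j \<bullet> d j \<omega>))"
      unfolding A_def e_def d_def by (rule block_char[symmetric]) (use t0 t1 in auto)
    also have "\<dots> = (CLINT \<omega>|M. iexp (\<Sum>k\<in>I. v k * X k \<omega>))"
      unfolding sX A_def of_real_add distrib_left exp_add ..
    finally show "(CLINT \<omega>|M. iexp (\<Sum>k\<in>I. v k * X k \<omega>)) = (CLINT z|?N. iexp (\<Sum>k\<in>I. v k * Y k z))" by simp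
  qed
  have XI: "(\<lambda>\<omega>. \<lambda>k\<in>I. X k \<omega>) \<in> measurable M (PiM I (\<lambda>_. borel))" by (intro measurable_restrict Xm)
  have YI: "(\<lambda>z. \<lambda>k\<in>I. Y k z) \<in> measurable ?N (PiM I (\<lambda>_. borel))" by (intro measurable_restrict Ym)
  have "T (\<lambda>k\<in>I. X k \<omega>) = (\<lambda>j\<in>{..<K}. (e j \<omega>, d j \<omega>))" for \<omega>
    by (auto simp: T_def I_def X_def vec_eq_iff fun_eq_iff)
  moreover have "T (\<lambda>k\<in>I. Y k z) = (\<lambda>j\<in>{..<K}. (e j (fst z), vscale (e j (fst z)) (snd z j)))" for z
    by (auto simp: T_def I_def Y_def vec_eq_iff fun_eq_iff)
  moreover have "distr (distr M (PiM I (\<lambda>_. borel)) (\<lambda>\<omega>. \<lambda>k\<in>I. X k \<omega>)) S T = distr (distr ?N (PiM I (\<lambda>_. borel)) (\<lambda>z. \<lambda>k\<in>I. Y k z)) S T"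
    unfolding law ..
  ultimately show ?thesis
    by (simp add: distr_distr[OF Tm XI] distr_distr[OF Tm YI] comp_def e_def d_def)
qed

end

context stable_bm
begin

text \<open>In the representation by an independent Gaussian, dividing the noise of a block by its
  random scale returns the Gaussian vector itself. Block 0 is left unnormalised because it enters
  only through the position of the solution at its end, so its scale survives on the right.\<close>

lemma normalised_block_law:
  fixes \<Phi> :: "(nat \<Rightarrow> real ^ 'n) \<Rightarrow> 'c::{banach, second_countable_topology}"
  assumes t0: "\<And>j. 0 \<le> \<tau> j" and t1: "\<And>j. j < K \<Longrightarrow> \<tau> j < \<tau> (Suc j)"
    and \<Phi>: "\<Phi> \<in> borel_measurable (PiM {..<K} (\<lambda>_. borel))"
  shows "(LINT \<omega>|M. \<Phi> (\<lambda>j\<in>{..<K}. if j = 0 then DW (\<tau> 0) (\<tau> 1) \<omega> else vunscale (etaL (\<tau> j) (\<tau> (Suc j)) \<omega>) (DW (\<tau> j) (\<tau> (Suc j)) \<omega>))) =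
    (LINT z|(M \<Otimes>\<^sub>M gauss_power K). \<Phi> (\<lambda>j\<in>{..<K}. if j = 0 then vscale (etaT (\<tau> 0) (\<tau> 1) (fst z)) (snd z 0) else snd z j))"
proof -
  define e where "e j = etaL (\<tau> j) (\<tau> (Suc j))" for j
  define d where "d j = DW (\<tau> j) (\<tau> (Suc j))" for j
  have em: "e j \<in> borel_measurable M" if "j < K" for j unfolding e_def by (rule etaL_measurable[OF t0 t1[OF that]])
  have dm: "d j \<in> borel_measurable M" if "j < K" for j unfolding d_def by (rule DW_measurable[OF t0 t1[OF that]])
  let ?G = "gauss_power K :: (nat \<Rightarrow> real ^ 'n) measure"
  let ?N = "M \<Otimes>\<^sub>M ?G"
  interpret G: prob_space ?G by (rule prob_space_gauss_power)
  interpret P: pair_prob_space M ?G ..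
  define S :: "(nat \<Rightarrow> (real ^ 'n) \<times> (real ^ 'n)) measure" where "S = PiM {..<K} (\<lambda>_. borel \<Otimes>\<^sub>M borel)"
  define R :: "(nat \<Rightarrow> (real ^ 'n) \<times> (real ^ 'n)) \<Rightarrow> nat \<Rightarrow> real ^ 'n"
    where "R f = (\<lambda>j\<in>{..<K}. if j = 0 then snd (f 0) else vunscale (fst (f j)) (snd (f j)))" for f
  have Rm: "R \<in> measurable S (PiM {..<K} (\<lambda>_. borel))"
    unfolding R_def S_def
  proof (intro measurable_restrict)
    fix j assume j: "j \<in> {..<K}"
    have [measurable]: "(\<lambda>f. f j) \<in> measurable (PiM {..<K} (\<lambda>_. borel \<Otimes>\<^sub>M borel :: ((real ^ 'n) \<times> (real ^ 'n)) measure)) (borel \<Otimes>\<^sub>M borel)"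
      using j by (intro measurable_component_singleton)
    show "(\<lambda>f. if j = 0 then snd (f 0) else vunscale (fst (f j)) (snd (f j))) \<in> borel_measurable (PiM {..<K} (\<lambda>_. borel \<Otimes>\<^sub>M borel :: ((real ^ 'n) \<times> (real ^ 'n)) measure))"
    proof (cases "j = 0")
      case True
      then have "(\<lambda>f. f 0) \<in> measurable (PiM {..<K} (\<lambda>_. borel \<Otimes>\<^sub>M borel :: ((real ^ 'n) \<times> (real ^ 'n)) measure)) (borel \<Otimes>\<^sub>M borel)"
        using j by (intro measurable_component_singleton) auto
      from measurable_compose[OF this measurable_snd] True show ?thesis by simp
    next
      case False
      then show ?thesis by simp measurable
    qed
  qed
  have \<Phi>R: "(\<lambda>f. \<Phi> (R f)) \<in> borel_measurable S" by (rule measurable_compose[OF Rm \<Phi>])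
  have Xm: "(\<lambda>\<omega>. \<lambda>j\<in>{..<K}. (e j \<omega>, d j \<omega>)) \<in> measurable M S"
    unfolding S_def by (intro measurable_restrict measurable_Pair em dm) auto
  have em': "(\<lambda>z. e j (fst z)) \<in> borel_measurable ?N" if "j < K" for j
    by (rule measurable_compose[OF measurable_fst em[OF that]])
  have xm: "(\<lambda>z. snd z j) \<in> borel_measurable ?N" if "j < K" for j
    using measurable_compose[OF measurable_snd measurable_component_singleton[of j "{..<K}" "\<lambda>_. gauss"]] that
    by (simp cong: measurable_cong_sets)
  have Ym: "(\<lambda>z. \<lambda>j\<in>{..<K}. (e j (fst z), vscale (e j (fst z)) (snd z j))) \<in> measurable ?N S"
    unfolding S_def by (intro measurable_restrict measurable_Pair em' vscale_measurable xm) auto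
  have etm: "etaT (\<tau> 0) (\<tau> 1) \<in> borel_measurable M"
    using measurable_compose[OF measurable_Pair[OF measurable_const[of "\<tau> 0" borel] measurable_Pair[OF measurable_const[of "\<tau> 1" borel] measurable_ident]] etaT_joint]
    by simp
  have Zm: "(\<lambda>z. \<lambda>j\<in>{..<K}. if j = 0 then vscale (etaT (\<tau> 0) (\<tau> 1) (fst z)) (snd z 0) else snd z j) \<in> measurable ?N (PiM {..<K} (\<lambda>_. borel))"
  proof (intro measurable_restrict)
    fix j assume j: "j \<in> {..<K}"
    show "(\<lambda>z. if j = 0 then vscale (etaT (\<tau> 0) (\<tau> 1) (fst z)) (snd z 0) else snd z j) \<in> borel_measurable ?N"
      using xm[of j] vscale_measurable[OF measurable_compose[OF measurable_fst etm] xm[of 0]] j by (cases "j = 0") auto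
  qed
  have "(LINT \<omega>|M. \<Phi> (\<lambda>j\<in>{..<K}. if j = 0 then d 0 \<omega> else vunscale (e j \<omega>) (d j \<omega>))) =
      (LINT \<omega>|M. \<Phi> (R (\<lambda>j\<in>{..<K}. (e j \<omega>, d j \<omega>))))"
    unfolding R_def by (intro Bochner_Integration.integral_cong refl arg_cong[where f=\<Phi>] restrict_ext) auto
  also have "\<dots> = (LINT f|distr M S (\<lambda>\<omega>. \<lambda>j\<in>{..<K}. (e j \<omega>, d j \<omega>)). \<Phi> (R f))"
    by (rule integral_distr[OF Xm \<Phi>R, symmetric])
  also have "distr M S (\<lambda>\<omega>. \<lambda>j\<in>{..<K}. (e j \<omega>, d j \<omega>)) = distr ?N S (\<lambda>z. \<lambda>j\<in>{..<K}. (e j (fst z), vscale (e j (fst z)) (snd z j)))"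
    unfolding e_def d_def S_def by (rule block_law) (use t0 t1 in auto)
  also have "(LINT f|distr ?N S (\<lambda>z. \<lambda>j\<in>{..<K}. (e j (fst z), vscale (e j (fst z)) (snd z j))). \<Phi> (R f)) = (LINT z|?N. \<Phi> (R (\<lambda>j\<in>{..<K}. (e j (fst z), vscale (e j (fst z)) (snd z j)))))"
    by (rule integral_distr[OF Ym \<Phi>R])
  also have "\<dots> = (LINT z|?N. \<Phi> (\<lambda>j\<in>{..<K}. if j = 0 then vscale (etaT (\<tau> 0) (\<tau> 1) (fst z)) (snd z 0) else snd z j))"
  proof (rule integral_cong_AE)
    show "(\<lambda>z. \<Phi> (R (\<lambda>j\<in>{..<K}. (e j (fst z), vscale (e j (fst z)) (snd z j))))) \<in> borel_measurable ?N"
      by (rule measurable_compose[OF Ym \<Phi>R])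
    show "(\<lambda>z. \<Phi> (\<lambda>j\<in>{..<K}. if j = 0 then vscale (etaT (\<tau> 0) (\<tau> 1) (fst z)) (snd z 0) else snd z j)) \<in> borel_measurable ?N"
      by (rule measurable_compose[OF Zm \<Phi>])
    have "AE \<omega> in M. \<forall>j\<in>{..<K}. \<forall>i. 0 < e j \<omega> $ i"
      unfolding e_def by (rule AE_finite_allI) (use etaL_pos t0 t1 in auto)
    with AE_good have "AE \<omega> in M. good \<omega> \<and> (\<forall>j\<in>{..<K}. \<forall>i. 0 < e j \<omega> $ i)" by eventually_elim auto
    then have "AE \<omega> in distr ?N M fst. good \<omega> \<and> (\<forall>j\<in>{..<K}. \<forall>i. 0 < e j \<omega> $ i)"
      by (simp only: G.distr_pair_fst)
    then have "AE z in ?N. good (fst z) \<and> (\<forall>j\<in>{..<K}. \<forall>i. 0 < e j (fst z) $ i)"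
      by (rule AE_distrD[OF measurable_fst])
    then show "AE z in ?N. \<Phi> (R (\<lambda>j\<in>{..<K}. (e j (fst z), vscale (e j (fst z)) (snd z j)))) =
       \<Phi> (\<lambda>j\<in>{..<K}. if j = 0 then vscale (etaT (\<tau> 0) (\<tau> 1) (fst z)) (snd z 0) else snd z j)"
    proof eventually_elim
      case (elim z)
      have "vunscale (e j (fst z)) (vscale (e j (fst z)) (snd z j)) = snd z j" if "j < K" for j
        using elim that by (intro vunscale_vscale) auto
      moreover have "etaT (\<tau> 0) (\<tau> 1) (fst z) = e 0 (fst z)" if "0 < K"
        using elim t0[of 0] t1[OF that] unfolding e_def by (simp add: etaT_eq)
      ultimately show ?case
        unfolding R_def by (intro arg_cong[where f=\<Phi>] restrict_ext) auto
    qed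
  qed
  finally show ?thesis unfolding e_def d_def One_nat_def .
qed

end

section \<open>Gaussian mixture kernels\<close>

lemma (in pair_sigma_finite) integrable_times_pair:
  fixes f :: "'a \<Rightarrow> real" and g :: "'b \<Rightarrow> real"
  assumes f: "integrable M1 f" and g: "integrable M2 g"
  shows "integrable (M1 \<Otimes>\<^sub>M M2) (\<lambda>z. f (fst z) * g (snd z))"
    and "(LINT z|(M1 \<Otimes>\<^sub>M M2). f (fst z) * g (snd z)) = (LINT x|M1. f x) * (LINT y|M2. g y)"
proof -
  have [measurable]: "f \<in> borel_measurable M1" "g \<in> borel_measurable M2" using f g by auto
  show i: "integrable (M1 \<Otimes>\<^sub>M M2) (\<lambda>z. f (fst z) * g (snd z))"
    by (rule Fubini_integrable) (use f g in \<open>auto simp: abs_mult\<close>)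
  show "(LINT z|(M1 \<Otimes>\<^sub>M M2). f (fst z) * g (snd z)) = (LINT x|M1. f x) * (LINT y|M2. g y)"
    using integral_fst'[OF i] by simp
qed

text \<open>The action of the matrix exponential of \<open>h\<close> times
  \<open>- diag lam\<close>.\<close>

definition decay :: "real ^ 'n \<Rightarrow> real \<Rightarrow> real ^ 'n \<Rightarrow> real ^ 'n" where
  "decay lam h y = (\<chi> i. exp (- (lam $ i) * h) * y $ i)"

lemma decay_measurable [measurable (raw)]:
  fixes g :: "'a \<Rightarrow> real ^ 'n::finite"
  assumes [measurable]: "f \<in> borel_measurable M" "g \<in> borel_measurable M"
  shows "(\<lambda>x. decay lam (f x) (g x)) \<in> borel_measurable M"
  unfolding decay_def by (rule borel_measurable_vecI) (simp, measurable)

lemma norm_decay_le: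
  fixes y :: "real ^ 'n::finite"
  assumes "\<And>i. 0 \<le> lam $ i" "0 \<le> h"
  shows "norm (decay lam h y) \<le> norm y"
  unfolding decay_def norm_vec_def
proof (intro L2_set_mono)
  fix i
  have "exp (- (lam $ i) * h) \<le> 1" using assms by simp
  then show "norm ((\<chi> i. exp (- (lam $ i) * h) * y $ i) $ i) \<le> norm (y $ i)"
    by (simp add: abs_mult mult_left_le_one_le)
qed simp

text \<open>A bound for the operator norm of \<open>vunscale a\<close>. Being a sum over components,
  it has an expectation that is a sum of scalar moments.\<close>

definition inv_sqrt_sum :: "real ^ 'n::finite \<Rightarrow> real" where
  "inv_sqrt_sum a = (\<Sum>i\<in>UNIV. 1 / sqrt (a $ i))"

lemma norm_vunscale_le:
  fixes a x :: "real ^ 'n::finite"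
  assumes "\<And>i. 0 < a $ i"
  shows "norm (vunscale a x) \<le> inv_sqrt_sum a * norm x"
proof -
  have "norm (vunscale a x) \<le> (\<Sum>i\<in>UNIV. \<bar>vunscale a x $ i\<bar>)" by (rule norm_le_l1_cart)
  also have "\<dots> \<le> (\<Sum>i\<in>UNIV. (1 / sqrt (a $ i)) * norm x)"
  proof (intro sum_mono)
    fix i
    have "\<bar>vunscale a x $ i\<bar> = (1 / sqrt (a $ i)) * \<bar>x $ i\<bar>"
      using assms[of i] by (simp add: vunscale_def abs_divide)
    also have "\<dots> \<le> (1 / sqrt (a $ i)) * norm x"
      using assms[of i] by (intro mult_left_mono component_le_norm_cart) (simp add: less_imp_le)
    finally show "\<bar>vunscale a x $ i\<bar> \<le> (1 / sqrt (a $ i)) * norm x" .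
  qed
  finally show ?thesis by (simp add: inv_sqrt_sum_def sum_distrib_right)
qed

lemma inv_sqrt_sum_measurable [measurable]: "inv_sqrt_sum \<in> borel_measurable borel"
  unfolding inv_sqrt_sum_def by measurable

text \<open>What the analysis of the transition kernel requires of the random covariance: joint
  measurability, positivity, and a singular bound on the expected inverse square root. The processes
  \<open>L\<close> and \<open>W\<close> are no longer mentioned.\<close>

locale mixture_kernel =
  fixes M :: "'a measure" and eta :: "real \<Rightarrow> real \<Rightarrow> 'a \<Rightarrow> real ^ 'n::finite" and F :: "real \<Rightarrow> real \<Rightarrow> real ^ 'n"
    and lam :: "real ^ 'n" and T b C :: real
  assumes prob: "prob_space M"
    and eta_joint: "(\<lambda>(u, t, \<omega>). eta u t \<omega>) \<in> borel_measurable (borel \<Otimes>\<^sub>M borel \<Otimes>\<^sub>M M)"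
    and F_joint: "(\<lambda>(u, t). F u t) \<in> borel_measurable (borel \<Otimes>\<^sub>M borel)"
    and lam0: "\<And>i. 0 \<le> lam $ i"
    and b: "0 < b" "b < 1" and C0: "0 \<le> C"
    and eta_pos: "\<And>u r. 0 \<le> u \<Longrightarrow> u < r \<Longrightarrow> r \<le> T \<Longrightarrow> AE \<omega> in M. \<forall>i. 0 < eta u r \<omega> $ i"
    and eta_int: "\<And>u r. 0 \<le> u \<Longrightarrow> u < r \<Longrightarrow> r \<le> T \<Longrightarrow> integrable M (\<lambda>\<omega>. inv_sqrt_sum (eta u r \<omega>))"
    and eta_le: "\<And>u r. 0 \<le> u \<Longrightarrow> u < r \<Longrightarrow> r \<le> T \<Longrightarrow> (LINT \<omega>|M. inv_sqrt_sum (eta u r \<omega>)) \<le> C * (r - u) powr - b"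
begin

sublocale prob_space M by (rule prob)

abbreviation N :: "('a \<times> (real ^ 'n)) measure" where "N \<equiv> M \<Otimes>\<^sub>M gauss"

sublocale N: pair_prob_space M "gauss :: (real ^ 'n) measure" ..

lemma eta_compose [measurable (raw)]:
  assumes "f \<in> borel_measurable K" "g \<in> borel_measurable K" "h \<in> measurable K M"
  shows "(\<lambda>x. eta (f x) (g x) (h x)) \<in> borel_measurable K"
  using measurable_compose[OF measurable_Pair[OF assms(1) measurable_Pair[OF assms(2,3)]] eta_joint] by simp

lemma F_compose [measurable (raw)]:
  assumes "f \<in> borel_measurable K" "g \<in> borel_measurable K"
  shows "(\<lambda>x. F (f x) (g x)) \<in> borel_measurable K"
  using measurable_compose[OF measurable_Pair[OF assms] F_joint] by simp

section \<open>Transition kernel, weight and gradient\<close>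

definition X :: "real \<Rightarrow> real \<Rightarrow> real ^ 'n \<Rightarrow> 'a \<times> (real ^ 'n) \<Rightarrow> real ^ 'n" where
  "X u r y z = decay lam (r - u) y + F u r + vscale (eta u r (fst z)) (snd z)"

text \<open>A displacement \<open>h\<close> of the starting point acts like a shift of the Gaussian
  variable by \<open>decay lam (r - u)\<close> applied to \<open>vunscale eta h\<close>. This map is
  self-adjoint, and the weight is its value at the Gaussian variable.\<close>

definition wt :: "real \<Rightarrow> real \<Rightarrow> 'a \<times> (real ^ 'n) \<Rightarrow> real ^ 'n" where
  "wt u r z = decay lam (r - u) (vunscale (eta u r (fst z)) (snd z))"

lemma snd_measurable [measurable (raw)]: "h \<in> measurable K N \<Longrightarrow> (\<lambda>x. snd (h x)) \<in> borel_measurable K"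
  using measurable_compose[OF _ measurable_snd, of h K M "gauss :: (real ^ 'n) measure"] by (simp cong: measurable_cong_sets)

lemma X_compose [measurable (raw)]:
  assumes [measurable]: "f \<in> borel_measurable K" "g \<in> borel_measurable K" "k \<in> borel_measurable K" "h \<in> measurable K N"
  shows "(\<lambda>x. X (f x) (g x) (k x) (h x)) \<in> borel_measurable K"
  unfolding X_def by measurable

lemma wt_compose [measurable (raw)]:
  assumes [measurable]: "f \<in> borel_measurable K" "g \<in> borel_measurable K" "h \<in> measurable K N"
  shows "(\<lambda>x. wt (f x) (g x) (h x)) \<in> borel_measurable K"
  unfolding wt_def by measurable

definition P :: "real \<Rightarrow> real \<Rightarrow> (real ^ 'n \<Rightarrow> real) \<Rightarrow> real ^ 'n \<Rightarrow> real" where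
  "P u r \<phi> y = (LINT z|N. \<phi> (X u r y z))"

text \<open>The gradient of \<open>P u r \<phi>\<close> after integration by parts. Being an
  integral of \<open>\<phi>\<close> against the weight, it is meaningful without any smoothness of
  \<open>\<phi>\<close>.\<close>

definition G :: "real \<Rightarrow> real \<Rightarrow> (real ^ 'n \<Rightarrow> real) \<Rightarrow> real ^ 'n \<Rightarrow> real ^ 'n" where
  "G u r \<phi> y = (LINT z|N. \<phi> (X u r y z) *\<^sub>R wt u r z)"

definition m1 :: real where "m1 = (LINT \<xi>|(gauss :: (real ^ 'n) measure). norm \<xi>)"

lemma m1_nonneg: "0 \<le> m1" unfolding m1_def by (intro Bochner_Integration.integral_nonneg) simp

definition C1 :: real where "C1 = C * m1"

lemma C1_nonneg: "0 \<le> C1" unfolding C1_def using C0 m1_nonneg by simp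

lemma AE_N: "AE \<omega> in M. Q \<omega> \<Longrightarrow> AE z in N. Q (fst z)"
proof -
  assume "AE \<omega> in M. Q \<omega>"
  then have "AE \<omega> in distr N M fst. Q \<omega>" by (simp only: gauss.distr_pair_fst)
  then show ?thesis by (rule AE_distrD[OF measurable_fst])
qed

lemma wt_bound:
  assumes u: "0 \<le> u" "u < r" "r \<le> T"
  shows "AE z in N. norm (wt u r z) \<le> inv_sqrt_sum (eta u r (fst z)) * norm (snd z)"
  using AE_N[OF eta_pos[OF u]]
proof eventually_elim
  case (elim z)
  have "norm (wt u r z) \<le> norm (vunscale (eta u r (fst z)) (snd z))"
    unfolding wt_def by (rule norm_decay_le) (use u lam0 in auto)
  also have "\<dots> \<le> inv_sqrt_sum (eta u r (fst z)) * norm (snd z)"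
    by (rule norm_vunscale_le) (use elim in simp)
  finally show ?case .
qed

lemma wt_integrable:
  assumes u: "0 \<le> u" "u < r" "r \<le> T"
  shows "integrable N (wt u r)" and "(LINT z|N. norm (wt u r z)) \<le> C1 * (r - u) powr - b"
proof -
  note prod = N.integrable_times_pair[OF eta_int[OF u] gauss_norm_integrable]
  show i: "integrable N (wt u r)"
  proof (rule Bochner_Integration.integrable_bound[OF prod(1)])
    show "wt u r \<in> borel_measurable N" by measurable
    show "AE z in N. norm (wt u r z) \<le> norm (inv_sqrt_sum (eta u r (fst z)) * norm (snd z))"
      using wt_bound[OF u] by eventually_elim (auto intro: order_trans[OF _ abs_ge_self])
  qed
  have "(LINT z|N. norm (wt u r z)) \<le> (LINT z|N. inv_sqrt_sum (eta u r (fst z)) * norm (snd z))"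
    by (rule integral_mono_AE[OF integrable_norm[OF i] prod(1) wt_bound[OF u]])
  also have "\<dots> = (LINT \<omega>|M. inv_sqrt_sum (eta u r \<omega>)) * m1" unfolding prod(2) m1_def ..
  also have "\<dots> \<le> (C * (r - u) powr - b) * m1" by (intro mult_right_mono eta_le u m1_nonneg)
  finally show "(LINT z|N. norm (wt u r z)) \<le> C1 * (r - u) powr - b" by (simp add: C1_def mult_ac)
qed

lemma G_integrable:
  assumes u: "0 \<le> u" "u < r" "r \<le> T" and \<phi>[measurable]: "\<phi> \<in> borel_measurable borel" and K: "\<And>x. \<bar>\<phi> x\<bar> \<le> K"
  shows "integrable N (\<lambda>z. \<phi> (X u r y z) *\<^sub>R wt u r z)"
proof (rule Bochner_Integration.integrable_bound[OF integrable_mult_right[OF integrable_norm[OF wt_integrable(1)[OF u]], of K]])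
  show "(\<lambda>z. \<phi> (X u r y z) *\<^sub>R wt u r z) \<in> borel_measurable N" by measurable
  have "0 \<le> K" using K[of 0] by linarith
  then show "AE z in N. norm (\<phi> (X u r y z) *\<^sub>R wt u r z) \<le> norm (K * norm (wt u r z))"
    using K by (intro AE_I2) (auto intro!: mult_right_mono)
qed

lemma G_bound:
  assumes u: "0 \<le> u" "u < r" "r \<le> T" and \<phi>: "\<phi> \<in> borel_measurable borel" and K: "\<And>x. \<bar>\<phi> x\<bar> \<le> K"
  shows "norm (G u r \<phi> y) \<le> K * (C1 * (r - u) powr - b)"
proof -
  have K0: "0 \<le> K" using K[of 0] by linarith
  have "norm (G u r \<phi> y) \<le> (LINT z|N. norm (\<phi> (X u r y z) *\<^sub>R wt u r z))"
    unfolding G_def by (rule integral_norm_bound)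
  also have "\<dots> \<le> (LINT z|N. K * norm (wt u r z))"
    using K by (intro integral_mono integrable_norm G_integrable[OF u \<phi> K] integrable_mult_right wt_integrable(1)[OF u])
      (auto intro!: mult_right_mono)
  also have "\<dots> = K * (LINT z|N. norm (wt u r z))" by simp
  also have "\<dots> \<le> K * (C1 * (r - u) powr - b)" by (intro mult_left_mono wt_integrable(2) u K0)
  finally show ?thesis .
qed

lemma P_integrable:
  fixes \<phi> :: "real ^ 'n \<Rightarrow> real"
  assumes \<phi>[measurable]: "\<phi> \<in> borel_measurable borel" and K: "\<And>x. \<bar>\<phi> x\<bar> \<le> K"
  shows "integrable N (\<lambda>z. \<phi> (X u r y z))"
  by (rule N.P.integrable_const_bound[of _ K]) (use K in auto)

lemma P_bound:
  assumes \<phi>: "\<phi> \<in> borel_measurable borel" and K: "\<And>x. \<bar>\<phi> x\<bar> \<le> K"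
  shows "\<bar>P u r \<phi> y\<bar> \<le> K"
proof -
  have "norm (P u r \<phi> y) \<le> (LINT z|N. norm (\<phi> (X u r y z)))" unfolding P_def by (rule integral_norm_bound)
  also have "\<dots> \<le> (LINT z|N. K)" using K by (intro integral_mono integrable_norm P_integrable[OF \<phi> K]) auto
  also have "\<dots> = K" using N.P.prob_space by simp
  finally show ?thesis by simp
qed

text \<open>For a fixed covariance the kernel is a Gaussian average of \<open>\<psi>\<close>, in
  which the starting point occurs only through an affine shift, so Gaussian integration by parts
  applies. The average over the covariance is then differentiated under the integral, the Lipschitz
  constants being multiples of \<open>inv_sqrt_sum\<close>.\<close>

lemma P_has_derivative:
  assumes u: "0 \<le> u" "u < r" "r \<le> T" and \<phi>[measurable]: "\<phi> \<in> borel_measurable borel" and K: "\<And>x. \<bar>\<phi> x\<bar> \<le> K"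
  shows "(P u r \<phi> has_derivative (\<lambda>h. h \<bullet> G u r \<phi> y)) (at y)"
proof -
  have K0: "0 \<le> K" using K[of 0] by linarith
  define Fi where "Fi \<omega> y = (LINT \<xi>|gauss. \<phi> (X u r y (\<omega>, \<xi>)))" for \<omega> y
  define gi where "gi \<omega> = (LINT \<xi>|gauss. \<phi> (X u r y (\<omega>, \<xi>)) *\<^sub>R wt u r (\<omega>, \<xi>))" for \<omega>
  have "P u r \<phi> y' = (LINT \<omega>|M. Fi \<omega> y')" for y'
    unfolding P_def Fi_def by (rule N.integral_fst'[symmetric, OF P_integrable[OF \<phi> K]])
  then have Peq: "P u r \<phi> = (\<lambda>y'. LINT \<omega>|M. Fi \<omega> y')" by (rule ext)
  have Geq: "G u r \<phi> y = (LINT \<omega>|M. gi \<omega>)"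
    unfolding G_def gi_def by (rule N.integral_fst'[symmetric, OF G_integrable[OF u \<phi> K]])
  have key: "(Fi \<omega> has_derivative (\<lambda>h. h \<bullet> gi \<omega>)) (at y) \<and>
      (\<forall>y'. \<bar>Fi \<omega> y' - Fi \<omega> y\<bar> \<le> (K * m1 * inv_sqrt_sum (eta u r \<omega>)) * norm (y' - y))"
    if pos: "\<And>i. 0 < eta u r \<omega> $ i" for \<omega>
  proof -
    let ?a = "eta u r \<omega>"
    define \<psi> where "\<psi> z = \<phi> (vscale ?a z)" for z
    have \<psi>m[measurable]: "\<psi> \<in> borel_measurable borel" unfolding \<psi>_def by measurable
    have \<psi>K: "\<bar>\<psi> z\<bar> \<le> K" for z unfolding \<psi>_def by (rule K)
    define S where "S h = decay lam (r - u) (vunscale ?a h)" for h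
    have S_lin: "bounded_linear S"
      unfolding S_def decay_def vunscale_def linear_conv_bounded_linear[symmetric]
      by (intro linearI) (auto simp: vec_eq_iff algebra_simps add_divide_distrib)
    have S_adj: "S h \<bullet> k = h \<bullet> S k" for h k
      unfolding S_def decay_def vunscale_def inner_vec_def by (simp add: mult_ac)
    have S_norm: "norm (S h) \<le> inv_sqrt_sum ?a * norm h" for h
      unfolding S_def using norm_decay_le[of lam "r - u" "vunscale ?a h"] norm_vunscale_le[of ?a h] lam0 u pos by fastforce
    \<comment> \<open>The mean is pulled inside the scaling: the transition is \<open>vscale\<close>
      applied to the Gaussian variable plus \<open>\<beta>\<close> of the starting point.\<close>
    define \<beta> where "\<beta> y' = S y' + vunscale ?a (F u r)" for y'
    have Xb: "X u r y' (\<omega>, \<xi>) = vscale ?a (\<xi> + \<beta> y')" for y' \<xi>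
    proof -
      have "sqrt (?a $ i) \<noteq> 0" for i using pos[of i] by (metis less_irrefl real_sqrt_eq_zero_cancel_iff)
      then show ?thesis
        unfolding X_def \<beta>_def S_def decay_def vscale_def vunscale_def by (simp add: vec_eq_iff field_simps)
    qed
    have Fi_eq: "Fi \<omega> = (\<lambda>y'. LINT \<xi>|gauss. \<psi> (\<xi> + \<beta> y'))"
      unfolding Fi_def Xb \<psi>_def ..
    have gi_eq: "gi \<omega> = S (LINT \<xi>|gauss. \<psi> (\<xi> + \<beta> y) *\<^sub>R \<xi>)"
    proof -
      have "gi \<omega> = (LINT \<xi>|gauss. S (\<psi> (\<xi> + \<beta> y) *\<^sub>R \<xi>))"
        unfolding gi_def Xb \<psi>_def wt_def S_def[symmetric] fst_conv snd_conv
        using bounded_linear.linear[OF S_lin] by (simp add: linear_scale)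
      also have "\<dots> = S (LINT \<xi>|gauss. \<psi> (\<xi> + \<beta> y) *\<^sub>R \<xi>)"
        by (rule integral_bounded_linear[OF S_lin gauss_derivative_bound(1)[OF \<psi>m \<psi>K]])
      finally show ?thesis .
    qed
    have "(\<beta> has_derivative S) (at y)"
      unfolding \<beta>_def using has_derivative_add[OF bounded_linear_imp_has_derivative[OF S_lin] has_derivative_const] by simp
    from has_derivative_compose[OF this gauss_has_derivative[OF \<psi>m \<psi>K, of "\<beta> y"]]
    have D: "(Fi \<omega> has_derivative (\<lambda>h. h \<bullet> gi \<omega>)) (at y)"
      unfolding Fi_eq gi_eq S_adj[symmetric] by simp
    have "\<bar>Fi \<omega> y' - Fi \<omega> y\<bar> \<le> (K * m1 * inv_sqrt_sum ?a) * norm (y' - y)" for y'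
    proof -
      have "\<bar>Fi \<omega> y' - Fi \<omega> y\<bar> \<le> K * m1 * norm (\<beta> y' - \<beta> y)"
        unfolding Fi_eq m1_def by (rule gauss_lipschitz[OF \<psi>m \<psi>K])
      also have "\<beta> y' - \<beta> y = S (y' - y)"
        unfolding \<beta>_def using bounded_linear.linear[OF S_lin] by (simp add: linear_diff)
      also have "K * m1 * norm (S (y' - y)) \<le> K * m1 * (inv_sqrt_sum ?a * norm (y' - y))"
        by (intro mult_left_mono S_norm mult_nonneg_nonneg K0 m1_nonneg)
      finally show ?thesis by (simp add: mult_ac)
    qed
    with D show ?thesis by blast
  qed
  show ?thesis
    unfolding Peq Geq
  proof (rule has_derivative_integral_lipschitz)
    show "integrable M (\<lambda>\<omega>. Fi \<omega> y')" for y'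
      unfolding Fi_def by (rule N.integrable_fst'[OF P_integrable[OF \<phi> K]])
    show "integrable M gi" unfolding gi_def by (rule N.integrable_fst'[OF G_integrable[OF u \<phi> K]])
    show "integrable M (\<lambda>\<omega>. K * m1 * inv_sqrt_sum (eta u r \<omega>))"
      by (intro integrable_mult_right eta_int u)
    show "AE \<omega> in M. (Fi \<omega> has_derivative (\<lambda>h. h \<bullet> gi \<omega>)) (at y)"
      using eta_pos[OF u] by eventually_elim (use key in blast)
    show "AE \<omega> in M. \<forall>y'. \<bar>Fi \<omega> y' - Fi \<omega> y\<bar> \<le> (K * m1 * inv_sqrt_sum (eta u r \<omega>)) * norm (y' - y)"
      using eta_pos[OF u] by eventually_elim (use key in blast)
  qed
qed

lemma P_lipschitz:
  assumes u: "0 \<le> u" "u < r" "r \<le> T" and \<phi>: "\<phi> \<in> borel_measurable borel" and K: "\<And>x. \<bar>\<phi> x\<bar> \<le> K"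
  shows "\<bar>P u r \<phi> y' - P u r \<phi> y\<bar> \<le> K * (C1 * (r - u) powr - b) * norm (y' - y)"
proof -
  have "onorm (\<lambda>h. h \<bullet> G u r \<phi> x) \<le> K * (C1 * (r - u) powr - b)" for x
  proof (rule onorm_le)
    fix h :: "real ^ 'n"
    have "norm (h \<bullet> G u r \<phi> x) \<le> norm h * norm (G u r \<phi> x)" by (simp add: Cauchy_Schwarz_ineq2)
    also have "\<dots> \<le> norm h * (K * (C1 * (r - u) powr - b))" by (intro mult_left_mono G_bound assms) auto
    finally show "norm (h \<bullet> G u r \<phi> x) \<le> K * (C1 * (r - u) powr - b) * norm h" by (simp add: mult_ac)
  qed
  then have "norm (P u r \<phi> y' - P u r \<phi> y) \<le> K * (C1 * (r - u) powr - b) * norm (y' - y)"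
    by (intro differentiable_bound[OF convex_UNIV P_has_derivative[OF u \<phi> K]]) auto
  then show ?thesis by simp
qed

text \<open>The function to which the operator is applied may vary with the parameter as well; in
  the recursion it depends on the time of integration.\<close>

lemma G_compose [measurable (raw)]:
  assumes [measurable]: "f \<in> borel_measurable K" "g \<in> borel_measurable K" "k \<in> borel_measurable K"
    and \<psi>: "(\<lambda>(x, y). \<psi> x y) \<in> borel_measurable (K \<Otimes>\<^sub>M borel)"
  shows "(\<lambda>x. G (f x) (g x) (\<psi> x) (k x)) \<in> borel_measurable K"
proof -
  have [measurable]: "(\<lambda>p. \<psi> (fst p) (X (f (fst p)) (g (fst p)) (k (fst p)) (snd p))) \<in> borel_measurable (K \<Otimes>\<^sub>M N)"
  proof -
    have "(\<lambda>p. (fst p, X (f (fst p)) (g (fst p)) (k (fst p)) (snd p))) \<in> measurable (K \<Otimes>\<^sub>M N) (K \<Otimes>\<^sub>M borel)"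
      by measurable
    from measurable_compose[OF this \<psi>] show ?thesis by simp
  qed
  have "(\<lambda>(x, z). \<psi> x (X (f x) (g x) (k x) z) *\<^sub>R wt (f x) (g x) z) \<in> borel_measurable (K \<Otimes>\<^sub>M N)"
    unfolding case_prod_unfold by measurable
  from N.P.borel_measurable_lebesgue_integral[OF this] show ?thesis unfolding G_def .
qed

lemma P_compose [measurable (raw)]:
  assumes [measurable]: "f \<in> borel_measurable K" "g \<in> borel_measurable K" "k \<in> borel_measurable K"
    and \<psi>: "(\<lambda>(x, y). \<psi> x y) \<in> borel_measurable (K \<Otimes>\<^sub>M borel)"
  shows "(\<lambda>x. P (f x) (g x) (\<psi> x) (k x)) \<in> borel_measurable K"
proof -
  have "(\<lambda>p. (fst p, X (f (fst p)) (g (fst p)) (k (fst p)) (snd p))) \<in> measurable (K \<Otimes>\<^sub>M N) (K \<Otimes>\<^sub>M borel)"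
    by measurable
  from measurable_compose[OF this \<psi>]
  have "(\<lambda>(x, z). \<psi> x (X (f x) (g x) (k x) z)) \<in> borel_measurable (K \<Otimes>\<^sub>M N)"
    unfolding case_prod_unfold by simp
  from N.P.borel_measurable_lebesgue_integral[OF this] show ?thesis unfolding P_def .
qed

end

section \<open>Iterated kernels\<close>

locale kernel_iteration = mixture_kernel M eta F lam T b C
  for M :: "'a measure" and eta :: "real \<Rightarrow> real \<Rightarrow> 'a \<Rightarrow> real ^ 'n::finite" and F :: "real \<Rightarrow> real \<Rightarrow> real ^ 'n"
    and lam :: "real ^ 'n" and T b C :: real +
  fixes B :: "real \<Rightarrow> real ^ 'n \<Rightarrow> real ^ 'n" and u0 :: "real ^ 'n \<Rightarrow> real" and t KB K0 :: real
  assumes B_joint: "(\<lambda>(r, y). B r y) \<in> borel_measurable (borel \<Otimes>\<^sub>M borel)"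
    and B_bound: "\<And>r y. norm (B r y) \<le> KB"
    and u0[measurable]: "u0 \<in> borel_measurable borel" and u0_bound: "\<And>y. \<bar>u0 y\<bar> \<le> K0"
    and t: "t \<le> T"
begin

lemma KB0: "0 \<le> KB" using B_bound[of 0 0] norm_ge_zero order_trans by blast

lemma B_compose [measurable (raw)]:
  assumes "f \<in> borel_measurable K" "g \<in> borel_measurable K"
  shows "(\<lambda>x. B (f x) (g x)) \<in> borel_measurable K"
  using measurable_compose[OF measurable_Pair[OF assms] B_joint] by simp

lemma B_inner_bound: "\<bar>B r y \<bullet> v\<bar> \<le> KB * norm v"
  by (rule order_trans[OF Cauchy_Schwarz_ineq2 mult_right_mono[OF B_bound norm_ge_zero]])

text \<open>The gradients of the iterates, introduced by their own recursion with the derivative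
  already moved to the weights. No differentiability is involved until
  \<open>V_has_derivative\<close> identifies them.\<close>

primrec grad :: "nat \<Rightarrow> real \<Rightarrow> real ^ 'n \<Rightarrow> real ^ 'n" where
  "grad 0 r y = G r t u0 y"
| "grad (Suc m) r y = (LINT q:{r..t}|lborel. G r q (\<lambda>z. B q z \<bullet> grad m q z) y)"

definition kap :: "nat \<Rightarrow> real \<Rightarrow> real ^ 'n \<Rightarrow> real" where
  "kap m r y = B r y \<bullet> grad m r y"

lemma grad_Suc: "grad (Suc m) r y = (LINT q:{r..t}|lborel. G r q (kap m q) y)"
  by (simp add: kap_def[abs_def])

lemma grad_joint: "(\<lambda>(r, y). grad m r y) \<in> borel_measurable (borel \<Otimes>\<^sub>M borel)"
proof (induction m)
  case 0
  have "(\<lambda>p. G (fst p) t u0 (snd p)) \<in> borel_measurable (borel \<Otimes>\<^sub>M borel)" by measurable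
  then show ?case by (simp add: case_prod_unfold)
next
  case (Suc m)
  have k: "(\<lambda>(r, y). B r y \<bullet> grad m r y) \<in> borel_measurable (borel \<Otimes>\<^sub>M borel)"
  proof -
    have [measurable]: "(\<lambda>p. grad m (fst p) (snd p)) \<in> borel_measurable (borel \<Otimes>\<^sub>M borel)"
      using Suc by (simp add: case_prod_unfold)
    show ?thesis unfolding case_prod_unfold by measurable
  qed
  have "(\<lambda>w. G (fst (fst w)) (snd w) (\<lambda>z. B (snd w) z \<bullet> grad m (snd w) z) (snd (fst w))) \<in> borel_measurable ((borel \<Otimes>\<^sub>M borel) \<Otimes>\<^sub>M lborel)"
  proof (rule G_compose)
    have "(\<lambda>p. (snd (fst p), snd p)) \<in> measurable (((borel \<Otimes>\<^sub>M borel :: (real \<times> (real ^ 'n)) measure) \<Otimes>\<^sub>M lborel) \<Otimes>\<^sub>M borel) (borel \<Otimes>\<^sub>M borel)"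
      by measurable
    from measurable_compose[OF this k]
    show "(\<lambda>(w, z). B (snd w) z \<bullet> grad m (snd w) z) \<in> borel_measurable (((borel \<Otimes>\<^sub>M borel :: (real \<times> (real ^ 'n)) measure) \<Otimes>\<^sub>M lborel) \<Otimes>\<^sub>M borel)"
      by (simp add: case_prod_unfold)
  qed measurable
  note [measurable] = this
  have ind: "indicator {fst p..t} q = (if fst p \<le> q \<and> q \<le> t then 1 else 0 :: real)" for p :: "real \<times> (real ^ 'n)" and q
    by (simp add: indicator_def)
  have "(\<lambda>(p, q). indicator {fst p..t} q *\<^sub>R G (fst p) q (\<lambda>z. B q z \<bullet> grad m q z) (snd p)) \<in> borel_measurable ((borel \<Otimes>\<^sub>M borel) \<Otimes>\<^sub>M lborel)"
    unfolding case_prod_unfold ind by measurable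
  from lborel.borel_measurable_lebesgue_integral[OF this]
  show ?case unfolding grad.simps set_lebesgue_integral_def case_prod_unfold .
qed

lemma kap_joint: "(\<lambda>(r, y). kap m r y) \<in> borel_measurable (borel \<Otimes>\<^sub>M borel)"
proof -
  have [measurable]: "(\<lambda>p. grad m (fst p) (snd p)) \<in> borel_measurable (borel \<Otimes>\<^sub>M borel)"
    using grad_joint[of m] by (simp add: case_prod_unfold)
  show ?thesis unfolding case_prod_unfold kap_def by measurable
qed

lemma kap_compose [measurable (raw)]:
  assumes "f \<in> borel_measurable K" "g \<in> borel_measurable K"
  shows "(\<lambda>x. kap m (f x) (g x)) \<in> borel_measurable K"
  using measurable_compose[OF measurable_Pair[OF assms] kap_joint] by simp

lemma kap_measurable [measurable]: "kap m r \<in> borel_measurable borel"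
  using kap_compose[of "\<lambda>_. r" borel "\<lambda>y. y" m] by simp

text \<open>Each iteration contributes the bound of \<open>B\<close>, the constant of the gradient
  estimate, and the constant of the beta integral.\<close>

primrec Kk :: "nat \<Rightarrow> real" where
  "Kk 0 = KB * (K0 * C1)"
| "Kk (Suc m) = KB * (Kk m * C1 * beta_const b T)"

lemma K0_nonneg: "0 \<le> K0" using u0_bound[of 0] by linarith

lemma beta_nonneg: "0 \<le> beta_const b T" using b by (simp add: beta_const_def)

lemma Kk_nonneg: "0 \<le> Kk m"
  by (induction m) (auto intro!: mult_nonneg_nonneg simp: KB0 K0_nonneg C1_nonneg beta_nonneg)

lemma integrable_beta:
  assumes r: "0 \<le> r" "r < t"
  shows "integrable lborel (\<lambda>q. indicator {r..t} q * (c * ((q - r) powr - b * (t - q) powr - b)))"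
  using integrable_mult_right[OF powr_beta_integral(1)[OF b r(2), of T], of c] r t by (simp add: mult_ac)

lemma kap_bound_imp_G_bound:
  assumes K: "\<And>q y. 0 \<le> q \<Longrightarrow> q < t \<Longrightarrow> \<bar>kap m q y\<bar> \<le> Kk m * (t - q) powr - b"
    and r: "0 \<le> r" "r < q" "q < t"
  shows "norm (G r q (kap m q) y) \<le> Kk m * C1 * ((q - r) powr - b * (t - q) powr - b)"
  using G_bound[of r q "kap m q" "Kk m * (t - q) powr - b" y] K r t by (simp add: mult_ac)

text \<open>The gradient operator is singular at the earlier time, the induction hypothesis at the
  terminal time, and the integral of the product over the time between is again of order
  \<open>- b\<close> in the whole length. The integrand is estimated off the two end points
  only.\<close>

lemma kap_bound: "0 \<le> r \<Longrightarrow> r < t \<Longrightarrow> \<bar>kap m r y\<bar> \<le> Kk m * (t - r) powr - b"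
proof (induction m arbitrary: r y)
  case 0
  have "\<bar>kap 0 r y\<bar> \<le> KB * norm (G r t u0 y)" unfolding kap_def grad.simps by (rule B_inner_bound)
  also have "\<dots> \<le> KB * (K0 * (C1 * (t - r) powr - b))"
    by (intro mult_left_mono G_bound KB0 u0 u0_bound t 0)
  finally show ?case by (simp add: mult_ac)
next
  case (Suc m)
  let ?h = "\<lambda>q. indicator {r..t} q * (Kk m * C1 * ((q - r) powr - b * (t - q) powr - b))"
  have "norm (grad (Suc m) r y) \<le> (LINT q|lborel. norm (indicator {r..t} q *\<^sub>R G r q (kap m q) y))"
    unfolding grad_Suc set_lebesgue_integral_def by (rule integral_norm_bound)
  also have "\<dots> \<le> (LINT q|lborel. ?h q)"
  proof (rule integral_mono_AE)
    have AE: "AE q in lborel. norm (indicator {r..t} q *\<^sub>R G r q (kap m q) y) \<le> ?h q"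
      using AE_lborel_singleton[of r] AE_lborel_singleton[of t]
    proof eventually_elim
      case (elim q)
      then show ?case using kap_bound_imp_G_bound[of m r q y, OF Suc.IH] Suc.prems by (auto simp: indicator_def)
    qed
    then show "AE q in lborel. norm (indicator {r..t} q *\<^sub>R G r q (kap m q) y) \<le> ?h q" .
    show hi: "integrable lborel ?h" by (rule integrable_beta[OF Suc.prems])
    show "integrable lborel (\<lambda>q. norm (indicator {r..t} q *\<^sub>R G r q (kap m q) y))"
    proof (rule Bochner_Integration.integrable_bound[OF hi])
      show "AE q in lborel. norm (norm (indicator {r..t} q *\<^sub>R G r q (kap m q) y)) \<le> norm (?h q)"
        using AE by eventually_elim (auto intro: order_trans[OF _ abs_ge_self])
    qed measurable
  qed
  also have "\<dots> = Kk m * C1 * (LINT q|lborel. indicator {r..t} q * ((q - r) powr - b * (t - q) powr - b))"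
    unfolding mult.left_commute[of "indicator _ _"] by (rule integral_mult_right_zero)
  also have "\<dots> \<le> Kk m * C1 * (beta_const b T * (t - r) powr - b)"
    using Suc.prems t by (intro mult_left_mono powr_beta_integral(2) b mult_nonneg_nonneg Kk_nonneg C1_nonneg) auto
  finally have "norm (grad (Suc m) r y) \<le> Kk m * C1 * (beta_const b T * (t - r) powr - b)" .
  then have "KB * norm (grad (Suc m) r y) \<le> KB * (Kk m * C1 * (beta_const b T * (t - r) powr - b))"
    by (rule mult_left_mono[OF _ KB0])
  with B_inner_bound[of r y "grad (Suc m) r y"] show ?case
    unfolding kap_def by (simp add: mult_ac)
qed

lemma G_kap_bound:
  "0 \<le> r \<Longrightarrow> r < q \<Longrightarrow> q < t \<Longrightarrow> norm (G r q (kap m q) y) \<le> Kk m * C1 * ((q - r) powr - b * (t - q) powr - b)"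
  by (rule kap_bound_imp_G_bound[OF kap_bound])

lemma integrable_G_kap:
  assumes r: "0 \<le> r" "r < t"
  shows "integrable lborel (\<lambda>q. indicator {r..t} q *\<^sub>R G r q (kap m q) y)"
proof (rule Bochner_Integration.integrable_bound[OF integrable_beta[OF r, of "Kk m * C1"]])
  show "AE q in lborel. norm (indicator {r..t} q *\<^sub>R G r q (kap m q) y) \<le> norm (indicator {r..t} q * (Kk m * C1 * ((q - r) powr - b * (t - q) powr - b)))"
    using AE_lborel_singleton[of r] AE_lborel_singleton[of t]
  proof eventually_elim
    case (elim q)
    then show ?case using G_kap_bound[of r q m y] r by (auto simp: indicator_def intro: order_trans[OF _ abs_ge_self])
  qed
qed measurable

section \<open>The iterates and their gradients\<close>

primrec V :: "nat \<Rightarrow> real \<Rightarrow> real ^ 'n \<Rightarrow> real" where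
  "V 0 u y = P u t u0 y"
| "V (Suc m) u y = (LINT r:{u..<t}|lborel. P u r (kap m r) y)"

text \<open>Differentiation under the time integral. The Lipschitz constant of the kernel applied to
  \<open>kap k r\<close> is the beta integrand, integrable although it is singular at both
  ends.\<close>

lemma V_has_derivative:
  assumes u: "0 \<le> u" "u < t"
  shows "(V m u has_derivative (\<lambda>h. h \<bullet> grad m u y)) (at y)"
proof (cases m)
  case 0
  have "V 0 u = P u t u0" by (simp add: fun_eq_iff)
  then show ?thesis using P_has_derivative[OF u t u0 u0_bound] 0 by simp
next
  case (Suc k)
  have Veq: "V (Suc k) u = (\<lambda>y. LINT r|lborel. indicator {u..<t} r *\<^sub>R P u r (kap k r) y)"
    by (simp add: fun_eq_iff set_lebesgue_integral_def)
  have "((\<lambda>y. LINT r|lborel. indicator {u..<t} r *\<^sub>R P u r (kap k r) y) has_derivative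
      (\<lambda>h. h \<bullet> (LINT q|lborel. indicator {u..t} q *\<^sub>R G u q (kap k q) y))) (at y)"
  proof (rule has_derivative_integral_lipschitz[where c="\<lambda>r. indicator {u..t} r * (Kk k * C1 * ((r - u) powr - b * (t - r) powr - b))"])
    show "integrable lborel (\<lambda>q. indicator {u..t} q *\<^sub>R G u q (kap k q) y)" by (rule integrable_G_kap[OF u])
    show "integrable lborel (\<lambda>r. indicator {u..t} r * (Kk k * C1 * ((r - u) powr - b * (t - r) powr - b)))" by (rule integrable_beta[OF u])
    have i: "integrable lborel (\<lambda>r. Kk k * (indicator {u..t} r * (t - r) powr - b))"
      using powr_integrable_right(1)[of b u t] b u by (intro integrable_mult_right) auto
    show "integrable lborel (\<lambda>r. indicator {u..<t} r *\<^sub>R P u r (kap k r) y')" for y'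
    proof (rule Bochner_Integration.integrable_bound[OF i])
      show "AE r in lborel. norm (indicator {u..<t} r *\<^sub>R P u r (kap k r) y') \<le> norm (Kk k * (indicator {u..t} r * (t - r) powr - b))"
      proof (intro AE_I2)
        fix r
        show "norm (indicator {u..<t} r *\<^sub>R P u r (kap k r) y') \<le> norm (Kk k * (indicator {u..t} r * (t - r) powr - b))"
          using P_bound[of "kap k r" "Kk k * (t - r) powr - b" u r y'] kap_bound[of r k] u Kk_nonneg[of k]
          by (auto simp: indicator_def abs_mult)
      qed
    qed measurable
    show "AE r in lborel. ((\<lambda>y. indicator {u..<t} r *\<^sub>R P u r (kap k r) y) has_derivative (\<lambda>h. h \<bullet> indicator {u..t} r *\<^sub>R G u r (kap k r) y)) (at y)"
      using AE_lborel_singleton[of u] AE_lborel_singleton[of t]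
    proof eventually_elim
      case (elim r)
      show ?case
      proof (cases "r \<in> {u..t}")
        case True
        then have "((P u r (kap k r)) has_derivative (\<lambda>h. h \<bullet> G u r (kap k r) y)) (at y)"
          using elim u t kap_bound[of r k] by (intro P_has_derivative[where K="Kk k * (t - r) powr - b"]) auto
        then show ?thesis using True elim by simp
      next
        case False
        then have "indicator {u..<t} r = (0::real)" "indicator {u..t} r = (0::real)" by (auto simp: indicator_def)
        then show ?thesis by simp
      qed
    qed
    show "AE r in lborel. \<forall>y'. \<bar>indicator {u..<t} r *\<^sub>R P u r (kap k r) y' - indicator {u..<t} r *\<^sub>R P u r (kap k r) y\<bar> \<le>
       indicator {u..t} r * (Kk k * C1 * ((r - u) powr - b * (t - r) powr - b)) * norm (y' - y)"
      using AE_lborel_singleton[of u] AE_lborel_singleton[of t]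
    proof eventually_elim
      case (elim r)
      show ?case
      proof (cases "r \<in> {u..t}")
        case True
        then have "\<bar>P u r (kap k r) y' - P u r (kap k r) y\<bar> \<le> (Kk k * (t - r) powr - b) * (C1 * (r - u) powr - b) * norm (y' - y)" for y'
          using elim u t kap_bound[of r k] by (intro P_lipschitz) auto
        then show ?thesis using True elim by (simp add: mult_ac)
      next
        case False
        then have "indicator {u..<t} r = (0::real)" "indicator {u..t} r = (0::real)" by (auto simp: indicator_def)
        then show ?thesis by simp
      qed
    qed
  qed
  then show ?thesis unfolding Suc Veq grad_Suc set_lebesgue_integral_def .
qed

lemma gradient_V: "0 \<le> u \<Longrightarrow> u < t \<Longrightarrow> gradient (V m u) y = grad m u y"
  unfolding gradient_def
proof (rule the_equality)
  assume u: "0 \<le> u" "u < t"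
  show D: "GDERIV (V m u) y :> grad m u y"
    unfolding gderiv_def by (rule V_has_derivative[OF u])
  show "D' = grad m u y" if "GDERIV (V m u) y :> D'" for D'
  proof -
    have "(\<lambda>h. h \<bullet> D') = (\<lambda>h. h \<bullet> grad m u y)"
      by (rule has_derivative_unique[OF that[unfolded gderiv_def] D[unfolded gderiv_def]])
    then have "(D' - grad m u y) \<bullet> (D' - grad m u y) = 0"
      unfolding fun_eq_iff by (simp add: inner_diff_right)
    then show ?thesis by simp
  qed
qed

end

section \<open>Unfolding the recursion\<close>

context kernel_iteration
begin

text \<open>Along a chain \<open>ts\<close> of times, \<open>pos\<close> is the position of the particle started at \<open>x\<close> and \<open>wgt\<close> the
  product of the weights attached to its interior times; block \<open>k\<close> is driven by the noise \<open>z k\<close>.\<close>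

primrec pos :: "real list \<Rightarrow> real ^ 'n \<Rightarrow> (nat \<Rightarrow> 'a \<times> (real ^ 'n)) \<Rightarrow> nat \<Rightarrow> real ^ 'n" where
  "pos ts x z 0 = x"
| "pos ts x z (Suc k) = X (ts ! k) (ts ! Suc k) (pos ts x z k) (z k)"

definition wgt1 :: "real list \<Rightarrow> real ^ 'n \<Rightarrow> (nat \<Rightarrow> 'a \<times> (real ^ 'n)) \<Rightarrow> nat \<Rightarrow> real" where
  "wgt1 ts x z k = (if k = 0 then 1 else B (ts ! k) (pos ts x z k) \<bullet> wt (ts ! k) (ts ! Suc k) (z k))"

definition wgt :: "real list \<Rightarrow> real ^ 'n \<Rightarrow> (nat \<Rightarrow> 'a \<times> (real ^ 'n)) \<Rightarrow> nat \<Rightarrow> real" where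
  "wgt ts x z k = (\<Prod>c<k. wgt1 ts x z c)"

text \<open>The expectation of the weighted terminal value when every block has its own independent
  path and its own independent Gaussian vector, as composition of kernels produces it.\<close>

definition chain_op :: "real list \<Rightarrow> real ^ 'n \<Rightarrow> (real ^ 'n \<Rightarrow> real) \<Rightarrow> real" where
  "chain_op ts x \<phi> = (let k = length ts - 1 in LINT z|PiM {..<k} (\<lambda>_. N). \<phi> (pos ts x z k) * wgt ts x z k)"

text \<open>Strict order keeps every block nondegenerate, so that its covariance is almost surely
  positive.\<close>

definition chain :: "real list \<Rightarrow> bool" where
  "chain ts \<longleftrightarrow> sorted_wrt (<) ts \<and> (\<forall>r\<in>set ts. 0 \<le> r \<and> r \<le> T)"

lemma chain_nth:
  assumes "chain ts" "Suc k < length ts"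
  shows "0 \<le> ts ! k" "ts ! k < ts ! Suc k" "ts ! Suc k \<le> T"
  using assms sorted_wrt_nth_less[of "(<)" ts k "Suc k"] unfolding chain_def
  by (auto simp: nth_mem less_imp_le)

sublocale NP: product_sigma_finite "\<lambda>_::nat. N"
  by (intro product_sigma_finite.intro N.P.sigma_finite_measure_axioms)

lemma component_measurable: "c < k \<Longrightarrow> (\<lambda>z. z c) \<in> measurable (PiM {..<k} (\<lambda>_. N)) N"
  by (rule measurable_component_singleton) simp

lemma pos_measurable: "c \<le> k \<Longrightarrow> (\<lambda>z. pos ts x z c) \<in> borel_measurable (PiM {..<k} (\<lambda>_. N))"
proof (induction c)
  case (Suc c)
  then have [measurable]: "(\<lambda>z. pos ts x z c) \<in> borel_measurable (PiM {..<k} (\<lambda>_. N))"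
    "(\<lambda>z. z c) \<in> measurable (PiM {..<k} (\<lambda>_. N)) N"
    using component_measurable[of c k] by auto
  show ?case unfolding pos.simps by measurable
qed simp

lemma wgt1_measurable: "c < k \<Longrightarrow> (\<lambda>z. wgt1 ts x z c) \<in> borel_measurable (PiM {..<k} (\<lambda>_. N))"
proof -
  assume c: "c < k"
  have [measurable]: "(\<lambda>z. pos ts x z c) \<in> borel_measurable (PiM {..<k} (\<lambda>_. N))"
    "(\<lambda>z. z c) \<in> measurable (PiM {..<k} (\<lambda>_. N)) N"
    using c component_measurable[of c k] pos_measurable[of c k] by auto
  show ?thesis unfolding wgt1_def by measurable
qed

lemma wgt_measurable: "(\<lambda>z. wgt ts x z k) \<in> borel_measurable (PiM {..<k} (\<lambda>_. N))"
  unfolding wgt_def by (intro borel_measurable_prod wgt1_measurable) auto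

lemma pos_cong: "(\<And>c. c < k \<Longrightarrow> z c = z' c) \<Longrightarrow> (\<And>c. c \<le> k \<Longrightarrow> ts ! c = ts' ! c) \<Longrightarrow> pos ts x z k = pos ts' x z' k"
  by (induction k) auto

lemma wgt_cong:
  assumes "\<And>c. c < k \<Longrightarrow> z c = z' c" "\<And>c. c \<le> k \<Longrightarrow> ts ! c = ts' ! c"
  shows "wgt ts x z k = wgt ts' x z' k"
  unfolding wgt_def
proof (intro prod.cong refl)
  fix c assume "c \<in> {..<k}"
  then show "wgt1 ts x z c = wgt1 ts' x z' c"
    using pos_cong[of c z z' ts ts' x] assms unfolding wgt1_def by auto
qed

text \<open>A majorant of each weight that no longer depends on the position of the particle. The
  majorant of the whole product therefore factorises over the independent blocks.\<close>

definition wdom :: "real list \<Rightarrow> nat \<Rightarrow> 'a \<times> (real ^ 'n) \<Rightarrow> real" where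
  "wdom ts c y = (if c = 0 then 1 else KB * norm (wt (ts ! c) (ts ! Suc c) y))"

lemma wgt_le: "\<bar>wgt ts x z k\<bar> \<le> (\<Prod>c<k. wdom ts c (z c))"
  unfolding wgt_def abs_prod
  by (intro prod_mono) (auto simp: wgt1_def wdom_def B_inner_bound)

lemma wdom_integrable:
  assumes "chain ts" "k < length ts"
  shows "integrable (PiM {..<k} (\<lambda>_. N)) (\<lambda>z. \<Prod>c<k. wdom ts c (z c))"
proof (rule NP.product_integrable_prod)
  fix c assume "c \<in> {..<k}"
  then have "Suc c < length ts" using assms by simp
  note ch = chain_nth[OF assms(1) this]
  show "integrable N (wdom ts c)"
  proof (cases "c = 0")
    case True
    then show ?thesis by (simp add: wdom_def[abs_def])
  next
    case False
    then show ?thesis using integrable_mult_right[OF integrable_norm[OF wt_integrable(1)[OF ch]], of KB] by (simp add: wdom_def[abs_def])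
  qed
qed simp

lemma chain_integrable:
  assumes ch: "chain ts" "k < length ts" and \<phi>[measurable]: "\<phi> \<in> borel_measurable borel" and K: "\<And>y. \<bar>\<phi> y\<bar> \<le> K"
  shows "integrable (PiM {..<k} (\<lambda>_. N)) (\<lambda>z. \<phi> (pos ts x z k) * wgt ts x z k)"
proof (rule Bochner_Integration.integrable_bound[OF integrable_mult_right[OF wdom_integrable[OF ch], of K]])
  note [measurable] = pos_measurable[OF order_refl] wgt_measurable
  show "(\<lambda>z. \<phi> (pos ts x z k) * wgt ts x z k) \<in> borel_measurable (PiM {..<k} (\<lambda>_. N))" by measurable
  have "\<bar>\<phi> (pos ts x z k)\<bar> * \<bar>wgt ts x z k\<bar> \<le> K * (\<Prod>c<k. wdom ts c (z c))" for z
    using K[of 0] by (intro mult_mono K wgt_le) auto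
  then have "norm (\<phi> (pos ts x z k) * wgt ts x z k) \<le> norm (K * (\<Prod>c<k. wdom ts c (z c)))" for z
    unfolding real_norm_def abs_mult[of "\<phi> _"] by (rule order_trans[OF _ abs_ge_self])
  then show "AE z in PiM {..<k} (\<lambda>_. N). norm (\<phi> (pos ts x z k) * wgt ts x z k) \<le> norm (K * (\<Prod>c<k. wdom ts c (z c)))"
    by (intro AE_I2)
qed

lemma chain_op_pair:
  assumes "\<phi> \<in> borel_measurable borel" "\<And>y. \<bar>\<phi> y\<bar> \<le> K" "chain [s, r]"
  shows "chain_op [s, r] x \<phi> = P s r \<phi> x"
proof -
  have 1: "{..<1::nat} = insert 0 {}" by auto
  have i: "integrable (PiM (insert 0 {}) (\<lambda>_. N)) (\<lambda>z. \<phi> (pos [s, r] x z 1) * wgt [s, r] x z 1)"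
    using chain_integrable[OF assms(3) _ assms(1,2), of 1 x] unfolding 1 by simp
  have "chain_op [s, r] x \<phi> = (LINT z|PiM (insert 0 {}) (\<lambda>_. N). \<phi> (pos [s, r] x z 1) * wgt [s, r] x z 1)"
    unfolding chain_op_def Let_def 1[symmetric] by simp
  also have "\<dots> = (LINT z|PiM {} (\<lambda>_. N). LINT y|N. \<phi> (pos [s, r] x (z(0 := y)) 1) * wgt [s, r] x (z(0 := y)) 1)"
    by (rule NP.product_integral_insert[OF _ _ i]) auto
  also have "\<dots> = (LINT z|PiM {} (\<lambda>_::nat. N). P s r \<phi> x)"
    by (simp add: wgt_def wgt1_def P_def)
  also have "\<dots> = P s r \<phi> x"
  proof -
    interpret E: prob_space "PiM {} (\<lambda>_::nat. N)" by (intro prob_space_PiM N.P.prob_space_axioms)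
    show ?thesis using E.prob_space by simp
  qed
  finally show ?thesis .
qed

text \<open>Fubini in the noise of the last block: the position before it and all earlier weights do
  not depend on that noise, and integrating \<open>\<phi>\<close> against the last weight gives
  \<open>G\<close>. At least two times are required because the last time of a one-element chain has
  index 0, whose weight is set to 1.\<close>

lemma chain_op_snoc:
  assumes ch: "chain (ts @ [q])" and l: "2 \<le> length ts" and \<phi>: "\<phi> \<in> borel_measurable borel" and K: "\<And>y. \<bar>\<phi> y\<bar> \<le> K"
  shows "chain_op (ts @ [q]) x \<phi> = chain_op ts x (\<lambda>y. B (last ts) y \<bullet> G (last ts) q \<phi> y)"
proof -
  let ?ts = "ts @ [q]"
  define k where "k = length ts - 1"
  have k: "length ts = Suc k" "0 < k" using l by (auto simp: k_def)
  have lst: "last ts = ts ! k" using k by (cases ts) (auto simp: last_conv_nth k_def)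
  have ch': "0 \<le> ts ! k" "ts ! k < q" "q \<le> T"
    using chain_nth[OF ch, of k] k by (auto simp: nth_append)
  have ins: "{..<Suc k} = insert k {..<k}" by auto
  have i: "integrable (PiM (insert k {..<k}) (\<lambda>_. N)) (\<lambda>z. \<phi> (pos ?ts x z (Suc k)) * wgt ?ts x z (Suc k))"
    using chain_integrable[OF ch _ \<phi> K, of "Suc k" x] k unfolding ins by simp
  have "chain_op ?ts x \<phi> = (LINT z|PiM (insert k {..<k}) (\<lambda>_. N). \<phi> (pos ?ts x z (Suc k)) * wgt ?ts x z (Suc k))"
    unfolding chain_op_def Let_def ins[symmetric] using k by simp
  also have "\<dots> = (LINT z|PiM {..<k} (\<lambda>_. N). LINT y|N. \<phi> (pos ?ts x (z(k := y)) (Suc k)) * wgt ?ts x (z(k := y)) (Suc k))"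
    by (rule NP.product_integral_insert[OF _ _ i]) auto
  also have "\<dots> = (LINT z|PiM {..<k} (\<lambda>_. N). (B (ts ! k) (pos ts x z k) \<bullet> G (ts ! k) q \<phi> (pos ts x z k)) * wgt ts x z k)"
  proof (intro Bochner_Integration.integral_cong refl)
    fix z
    have p: "pos ?ts x (z(k := y)) k = pos ts x z k" for y
      by (rule pos_cong) (auto simp: nth_append k)
    have w: "wgt ?ts x (z(k := y)) k = wgt ts x z k" for y
      by (rule wgt_cong) (auto simp: nth_append k)
    have w1: "wgt ?ts x z' (Suc k) = wgt ?ts x z' k * wgt1 ?ts x z' k" for z'
      by (simp add: wgt_def)
    have w2: "wgt1 ?ts x (z(k := y)) k = B (ts ! k) (pos ts x z k) \<bullet> wt (ts ! k) q y" for y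
      using k p[of y] by (simp add: wgt1_def nth_append)
    have p2: "pos ?ts x (z(k := y)) (Suc k) = X (ts ! k) q (pos ts x z k) y" for y
      using k p[of y] by (simp add: nth_append)
    let ?y = "pos ts x z k"
    have "(LINT y|N. \<phi> (pos ?ts x (z(k := y)) (Suc k)) * wgt ?ts x (z(k := y)) (Suc k)) =
       (LINT y|N. wgt ts x z k * (B (ts ! k) ?y \<bullet> (\<phi> (X (ts ! k) q ?y y) *\<^sub>R wt (ts ! k) q y)))"
      unfolding p2 w1 w w2 by (simp add: mult_ac)
    also have "\<dots> = wgt ts x z k * (B (ts ! k) ?y \<bullet> G (ts ! k) q \<phi> ?y)"
      unfolding G_def integral_mult_right_zero integral_inner_right[OF G_integrable[OF ch' \<phi> K]] ..
    finally show "(LINT y|N. \<phi> (pos ?ts x (z(k := y)) (Suc k)) * wgt ?ts x (z(k := y)) (Suc k)) =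
      (B (ts ! k) ?y \<bullet> G (ts ! k) q \<phi> ?y) * wgt ts x z k" by simp
  qed
  also have "\<dots> = chain_op ts x (\<lambda>y. B (last ts) y \<bullet> G (last ts) q \<phi> y)"
    unfolding chain_op_def Let_def k_def[symmetric] lst ..
  finally show ?thesis .
qed

lemma chain_op_integral:
  fixes \<psi> :: "real \<Rightarrow> real ^ 'n \<Rightarrow> real"
  assumes ch: "chain ts" "ts \<noteq> []" and \<psi>: "(\<lambda>(q, y). \<psi> q y) \<in> borel_measurable (borel \<Otimes>\<^sub>M borel)"
    and c: "integrable lborel c" and le: "AE q in lborel. \<forall>y. \<bar>\<psi> q y\<bar> \<le> c q"
  shows "chain_op ts x (\<lambda>y. LINT q|lborel. \<psi> q y) = (LINT q|lborel. chain_op ts x (\<psi> q))"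
proof -
  define k where "k = length ts - 1"
  have k: "k < length ts" using ch(2) by (simp add: k_def)
  let ?Q = "PiM {..<k} (\<lambda>_. N)"
  interpret Q: prob_space ?Q by (intro prob_space_PiM N.P.prob_space_axioms)
  interpret QL: pair_sigma_finite ?Q lborel ..
  have \<psi>c[measurable (raw)]: "(\<lambda>w. \<psi> (f w) (g w)) \<in> borel_measurable L" if "f \<in> borel_measurable L" "g \<in> borel_measurable L" for f g and L :: "((nat \<Rightarrow> 'a \<times> (real ^ 'n)) \<times> real) measure"
    using measurable_compose[OF measurable_Pair[OF that] \<psi>] by simp
  note [measurable] = pos_measurable[OF order_refl] wgt_measurable
  have m: "(\<lambda>p. \<psi> (snd p) (pos ts x (fst p) k) * wgt ts x (fst p) k) \<in> borel_measurable (?Q \<Otimes>\<^sub>M lborel)"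
  proof -
    have 1: "(\<lambda>p. pos ts x (fst p) k) \<in> borel_measurable (?Q \<Otimes>\<^sub>M lborel)"
      by (rule measurable_compose[OF measurable_fst pos_measurable]) simp
    have 2: "(\<lambda>p. wgt ts x (fst p) k) \<in> borel_measurable (?Q \<Otimes>\<^sub>M lborel)"
      by (rule measurable_compose[OF measurable_fst wgt_measurable])
    have 3: "(\<lambda>p. snd p) \<in> borel_measurable (?Q \<Otimes>\<^sub>M lborel)"
      using measurable_snd[of ?Q lborel] by (simp cong: measurable_cong_sets)
    show ?thesis by (rule borel_measurable_times[OF \<psi>c[OF 3 1] 2])
  qed
  have dom: "integrable (?Q \<Otimes>\<^sub>M lborel) (\<lambda>p. (\<Prod>c<k. wdom ts c (fst p c)) * c (snd p))"
    by (rule QL.integrable_times_pair(1)[OF wdom_integrable[OF ch(1) k] c])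
  \<comment> \<open>The bound holds for almost every \<open>q\<close>, for all \<open>y\<close> at
    once; hence the exceptional set in the product is a null set of times, whatever the
    noise.\<close>
  have AEp: "AE p in ?Q \<Otimes>\<^sub>M lborel. \<forall>y. \<bar>\<psi> (snd p) y\<bar> \<le> c (snd p)"
  proof -
    obtain Z where Z: "\<And>q. q \<in> space lborel - Z \<Longrightarrow> \<forall>y. \<bar>\<psi> q y\<bar> \<le> c q" "Z \<in> null_sets lborel"
      using AE_E3[OF le] by blast
    have "AE q in lborel. q \<notin> Z" using Z(2) by (rule AE_not_in)
    have [measurable]: "Z \<in> sets lborel" using Z(2) by auto
    have "AE p in ?Q \<Otimes>\<^sub>M lborel. snd p \<notin> Z"
    proof (rule QL.AE_pair_measure)
      have "{p \<in> space (?Q \<Otimes>\<^sub>M lborel). snd p \<notin> Z} = snd -` (UNIV - Z) \<inter> space (?Q \<Otimes>\<^sub>M lborel)" by auto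
      also have "\<dots> \<in> sets (?Q \<Otimes>\<^sub>M lborel)"
        by (rule measurable_sets[OF measurable_snd]) (use \<open>Z \<in> sets lborel\<close> in \<open>simp add: Compl_eq_Diff_UNIV[symmetric] borel_comp\<close>)
      finally show "{p \<in> space (?Q \<Otimes>\<^sub>M lborel). snd p \<notin> Z} \<in> sets (?Q \<Otimes>\<^sub>M lborel)" .
      show "AE z in ?Q. AE q in lborel. snd (z, q) \<notin> Z" using \<open>AE q in lborel. q \<notin> Z\<close> by simp
    qed
    then show ?thesis by eventually_elim (rule Z(1), simp)
  qed
  have int: "integrable (?Q \<Otimes>\<^sub>M lborel) (\<lambda>(z, q). \<psi> q (pos ts x z k) * wgt ts x z k)"
  proof (rule Bochner_Integration.integrable_bound[OF dom])
    show "(\<lambda>(z, q). \<psi> q (pos ts x z k) * wgt ts x z k) \<in> borel_measurable (?Q \<Otimes>\<^sub>M lborel)"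
      using m by (simp add: case_prod_unfold)
    show "AE p in ?Q \<Otimes>\<^sub>M lborel. norm (case p of (z, q) \<Rightarrow> \<psi> q (pos ts x z k) * wgt ts x z k) \<le> norm ((\<Prod>c<k. wdom ts c (fst p c)) * c (snd p))"
      using AEp
    proof eventually_elim
      case (elim p)
      have "\<bar>\<psi> (snd p) (pos ts x (fst p) k)\<bar> * \<bar>wgt ts x (fst p) k\<bar> \<le> c (snd p) * (\<Prod>c<k. wdom ts c (fst p c))"
        using elim abs_ge_zero[of "\<psi> (snd p) 0"] by (intro mult_mono wgt_le) (auto intro: order_trans)
      also have "\<dots> \<le> norm ((\<Prod>c<k. wdom ts c (fst p c)) * c (snd p))"
        unfolding real_norm_def mult.commute[of "c (snd p)"] by (rule abs_ge_self)
      finally show ?case by (simp only: case_prod_unfold real_norm_def abs_mult[of "\<psi> _ _"])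
    qed
  qed
  have "chain_op ts x (\<lambda>y. LINT q|lborel. \<psi> q y) = (LINT z|?Q. LINT q|lborel. \<psi> q (pos ts x z k) * wgt ts x z k)"
    unfolding chain_op_def Let_def k_def[symmetric] by simp
  also have "\<dots> = (LINT q|lborel. LINT z|?Q. \<psi> q (pos ts x z k) * wgt ts x z k)"
    by (rule QL.Fubini_integral[OF int, symmetric])
  also have "\<dots> = (LINT q|lborel. chain_op ts x (\<psi> q))"
    unfolding chain_op_def Let_def k_def[symmetric] ..
  finally show ?thesis .
qed

lemma chain_snoc:
  assumes "chain ts" "ts \<noteq> []" "last ts < q" "q \<le> T"
  shows "chain (ts @ [q])"
proof -
  have "a \<le> last ts" if a: "a \<in> set ts" for a
  proof -
    obtain k where k: "k < length ts" "a = ts ! k" using a by (auto simp: in_set_conv_nth)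
    have "k = length ts - 1 \<or> k < length ts - 1" using k by auto
    then show ?thesis
      using assms(1) k sorted_wrt_nth_less[of "(<)" ts k "length ts - 1"] assms(2)
      unfolding chain_def by (auto simp: last_conv_nth less_imp_le)
  qed
  then show ?thesis
    using assms(1,2,4) le_less_trans[OF _ assms(3)] last_in_set[OF assms(2)] less_imp_le[OF assms(3)]
    unfolding chain_def sorted_wrt_append by (auto intro: order_trans)
qed

text \<open>By its recursion, \<open>kap (Suc m)\<close> is a time integral of inner products of
  \<open>B\<close> with \<open>G\<close>. The time integral is moved out of the expectation, and
  each inner product is one more link of the chain by \<open>chain_op_snoc\<close>.\<close>

lemma chain_op_kap_Suc:
  assumes ch: "chain ts" and l: "2 \<le> length ts" and r: "last ts < t"
  shows "chain_op ts x (kap (Suc m) (last ts)) = (LINT q:{last ts..t}|lborel. chain_op (ts @ [q]) x (kap m q))"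
proof -
  define r where "r = last ts"
  have ne: "ts \<noteq> []" using l by auto
  have r0: "0 \<le> r" "r < t" using ch ne r unfolding chain_def r_def by auto
  define \<psi> where "\<psi> q y = indicator {r..t} q * (B r y \<bullet> G r q (kap m q) y)" for q y
  have \<psi>m: "(\<lambda>(q, y). \<psi> q y) \<in> borel_measurable (borel \<Otimes>\<^sub>M borel)"
    unfolding \<psi>_def case_prod_unfold by measurable
  have kapeq: "kap (Suc m) r = (\<lambda>y. LINT q|lborel. \<psi> q y)"
  proof
    fix y
    have "kap (Suc m) r y = B r y \<bullet> (LINT q|lborel. indicator {r..t} q *\<^sub>R G r q (kap m q) y)"
      unfolding kap_def[of "Suc m"] grad_Suc set_lebesgue_integral_def ..
    also have "\<dots> = (LINT q|lborel. B r y \<bullet> (indicator {r..t} q *\<^sub>R G r q (kap m q) y))"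
      by (rule integral_inner_right[OF integrable_G_kap[OF r0], symmetric])
    finally show "kap (Suc m) r y = (LINT q|lborel. \<psi> q y)" by (simp add: \<psi>_def)
  qed
  have "chain_op ts x (kap (Suc m) r) = (LINT q|lborel. chain_op ts x (\<psi> q))"
    unfolding kapeq
  proof (rule chain_op_integral[OF ch ne \<psi>m])
    show "integrable lborel (\<lambda>q. indicator {r..t} q * (KB * Kk m * C1 * ((q - r) powr - b * (t - q) powr - b)))"
      by (rule integrable_beta[OF r0])
    show "AE q in lborel. \<forall>y. \<bar>\<psi> q y\<bar> \<le> indicator {r..t} q * (KB * Kk m * C1 * ((q - r) powr - b * (t - q) powr - b))"
      using AE_lborel_singleton[of r] AE_lborel_singleton[of t]
    proof eventually_elim
      case (elim q)
      show ?case
      proof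
        fix y
        show "\<bar>\<psi> q y\<bar> \<le> indicator {r..t} q * (KB * Kk m * C1 * ((q - r) powr - b * (t - q) powr - b))"
        proof (cases "q \<in> {r..t}")
          case True
          then have "\<bar>B r y \<bullet> G r q (kap m q) y\<bar> \<le> KB * (Kk m * C1 * ((q - r) powr - b * (t - q) powr - b))"
            using elim r0 by (intro order_trans[OF B_inner_bound mult_left_mono[OF G_kap_bound KB0]]) auto
          then show ?thesis using True by (simp add: \<psi>_def mult_ac)
        qed (simp add: \<psi>_def)
      qed
    qed
  qed
  also have "\<dots> = (LINT q:{r..t}|lborel. chain_op (ts @ [q]) x (kap m q))"
    unfolding set_lebesgue_integral_def
  proof (rule integral_lborel_cong_cofinite[of "{r, t}"])
    fix q assume q: "q \<notin> {r, t}"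
    show "chain_op ts x (\<psi> q) = indicator {r..t} q *\<^sub>R chain_op (ts @ [q]) x (kap m q)"
    proof (cases "q \<in> {r..t}")
      case True
      then have q': "r < q" "q < t" using q by auto
      have "chain (ts @ [q])" using chain_snoc[OF ch ne, of q] q' t unfolding r_def by simp
      then have "chain_op (ts @ [q]) x (kap m q) = chain_op ts x (\<lambda>y. B r y \<bullet> G r q (kap m q) y)"
        unfolding r_def using kap_bound[of q m] q' r0
        by (intro chain_op_snoc[OF _ l kap_measurable, where K="Kk m * (t - q) powr - b"]) auto
      then show ?thesis using True by (simp add: \<psi>_def[abs_def])
    next
      case False
      then show ?thesis by (simp add: \<psi>_def[abs_def] chain_op_def)
    qed
  qed simp
  finally show ?thesis unfolding r_def .
qed

text \<open>Each induction step appends one intermediate time and opens one more level of the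
  iterated integral; at the bottom the terminal time \<open>t\<close> is appended together with
  \<open>u0\<close>.\<close>

lemma chain_op_kap:
  assumes "chain ts" "2 \<le> length ts" "last ts < t"
  shows "chain_op ts x (kap m (last ts)) = simplex_integral m (last ts) t (\<lambda>rs. chain_op (ts @ rs @ [t]) x u0)"
  using assms
proof (induction m arbitrary: ts)
  case 0
  have ne: "ts \<noteq> []" using 0 by auto
  have "kap 0 (last ts) = (\<lambda>y. B (last ts) y \<bullet> G (last ts) t u0 y)"
    by (simp add: fun_eq_iff kap_def)
  then show ?case
    using chain_op_snoc[OF chain_snoc[OF 0(1) ne 0(3) t] 0(2) u0 u0_bound, of x] by simp
next
  case (Suc m)
  have ne: "ts \<noteq> []" using Suc.prems by auto
  have "chain_op ts x (kap (Suc m) (last ts)) = (LINT q:{last ts..t}|lborel. chain_op (ts @ [q]) x (kap m q))"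
    by (rule chain_op_kap_Suc[OF Suc.prems])
  also have "\<dots> = (LINT q:{last ts..t}|lborel. simplex_integral m q t (\<lambda>rs. chain_op (ts @ (q # rs) @ [t]) x u0))"
    unfolding set_lebesgue_integral_def
  proof (rule integral_lborel_cong_cofinite[of "{last ts, t}"])
    fix q assume q: "q \<notin> {last ts, t}"
    show "indicator {last ts..t} q *\<^sub>R chain_op (ts @ [q]) x (kap m q) =
      indicator {last ts..t} q *\<^sub>R simplex_integral m q t (\<lambda>rs. chain_op (ts @ (q # rs) @ [t]) x u0)"
    proof (cases "q \<in> {last ts..t}")
      case True
      then have q': "last ts < q" "q < t" using q by auto
      have "chain (ts @ [q])" using chain_snoc[OF Suc.prems(1) ne q'(1)] q' t by simp
      from Suc.IH[OF this] show ?thesis using q' Suc.prems by simp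
    qed simp
  qed simp
  finally show ?case by simp
qed

lemma V_simplex:
  assumes s: "0 \<le> s" "s < t"
  shows "V (Suc m) s x = simplex_integral (Suc m) s t (\<lambda>rs. chain_op (s # rs @ [t]) x u0)"
proof -
  have "V (Suc m) s x = (LINT r|lborel. indicator {s..t} r *\<^sub>R simplex_integral m r t (\<lambda>rs. chain_op (s # (r # rs) @ [t]) x u0))"
    unfolding V.simps set_lebesgue_integral_def
  proof (rule integral_lborel_cong_cofinite[of "{s, t}"])
    \<comment> \<open>The end point \<open>t\<close> is in the closed but not in the half-open
      interval; \<open>s\<close> is dropped so that the chain is strict.\<close>
    fix r assume r: "r \<notin> {s, t}"
    show "indicator {s..<t} r *\<^sub>R P s r (kap m r) x = indicator {s..t} r *\<^sub>R simplex_integral m r t (\<lambda>rs. chain_op (s # (r # rs) @ [t]) x u0)"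
    proof (cases "r \<in> {s..t}")
      case True
      then have r': "s < r" "r < t" using r by auto
      have ch: "chain [s, r]" using s r' t by (auto simp: chain_def)
      have "P s r (kap m r) x = chain_op [s, r] x (kap m r)"
        by (rule chain_op_pair[symmetric, OF kap_measurable _ ch, where K="Kk m * (t - r) powr - b"]) (use kap_bound s r' in auto)
      also have "\<dots> = simplex_integral m r t (\<lambda>rs. chain_op (s # (r # rs) @ [t]) x u0)"
        using chain_op_kap[OF ch, of x m] r' by simp
      finally show ?thesis using True r' by simp
    qed auto
  qed simp
  then show ?thesis by (simp add: set_lebesgue_integral_def)
qed

end

section \<open>The stochastic differential equation\<close>

lemma diag_mult_vec: "diag d *v y = (\<chi> i. d $ i * y $ i)"
  by (simp add: diag_def matrix_vector_mult_def vec_eq_iff if_distrib[where f="\<lambda>x. x * _"] cong: if_cong)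

lemma uminus_diag_mult_vec: "- diag d *v y = (\<chi> i. - d $ i * y $ i)"
proof -
  have "- diag d = diag (- d)" by (simp add: diag_def vec_eq_iff)
  then show ?thesis by (simp add: diag_mult_vec)
qed

lemma scaleR_uminus_diag: "h *\<^sub>R (- diag d) = diag (\<chi> i. - (d $ i) * h)"
  by (simp add: diag_def vec_eq_iff)

lemma mexp_decay: "mexp (h *\<^sub>R (- diag lam)) *v y = decay lam h y"
  unfolding scaleR_uminus_diag mexp_diag diag_mult_vec decay_def by (simp add: vec_eq_iff)

lemma msqrt_mult_vec: "(\<And>i. 0 \<le> a $ i) \<Longrightarrow> msqrt (diag a) *v y = vscale a y"
  by (simp add: msqrt_diag diag_mult_vec vscale_def)

lemma minvsqrt_mult_vec:
  fixes a :: "real ^ 'n::finite"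
  assumes "\<And>i. 0 < a $ i"
  shows "minvsqrt (diag a) *v y = vunscale a y"
proof -
  let ?d = "diag (\<chi> i. sqrt (a $ i))" and ?e = "diag (\<chi> i. 1 / sqrt (a $ i))"
  have one: "(\<chi> i. sqrt (a $ i)) $ i * (\<chi> i. 1 / sqrt (a $ i)) $ i = 1" for i
    using assms[of i] by simp
  have de: "?d ** ?e = mat 1" "?e ** ?d = mat 1"
    unfolding diag_mult using one by (auto simp: diag_def mat_def vec_eq_iff mult.commute)
  \<comment> \<open>\<open>matrix_inv\<close> is a choice of some two-sided inverse; the witness
    \<open>?e\<close> shows that one exists, and associativity then forces the choice to be
    \<open>?e\<close>.\<close>
  have inv: "matrix_inv ?d ** ?d = mat 1"
    unfolding matrix_inv_def by (rule someI2[of _ ?e]) (use de in auto)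
  have "matrix_inv ?d = matrix_inv ?d ** (?d ** ?e)" by (simp add: de)
  also have "\<dots> = ?e" by (simp add: matrix_mul_assoc inv)
  finally have "matrix_inv ?d = ?e" .
  then show ?thesis
    using assms by (simp add: msqrt_diag less_imp_le diag_mult_vec vunscale_def)
qed

lemma bounded_linear_diag: "bounded_linear (diag :: real ^ 'n::finite \<Rightarrow> real ^ 'n ^ 'n)"
  unfolding linear_conv_bounded_linear[symmetric]
  by (intro linearI) (auto simp: diag_def vec_eq_iff)

lemma integrable_vec:
  fixes v :: "'a \<Rightarrow> real ^ 'n::finite"
  assumes "\<And>i. integrable M (\<lambda>x. v x $ i)"
  shows "integrable M v" and "(LINT x|M. v x) $ i = (LINT x|M. v x $ i)"
proof -
  have "integrable M (\<lambda>x. \<Sum>i\<in>UNIV. v x $ i *\<^sub>R axis i 1)"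
    by (intro Bochner_Integration.integrable_sum integrable_scaleR_left assms)
  also have "(\<lambda>x. \<Sum>i\<in>UNIV. v x $ i *\<^sub>R axis i 1) = v"
    by (simp add: fun_eq_iff vec_eq_iff axis_def if_distrib[where f="\<lambda>x. _ * x"] cong: if_cong)
  finally show "integrable M v" .
  then show "(LINT x|M. v x) $ i = (LINT x|M. v x $ i)"
    by (rule integral_bounded_linear[OF bounded_linear_vec_nth, symmetric])
qed

lemma set_integrable_vec:
  fixes v :: "'a \<Rightarrow> real ^ 'n::finite"
  assumes "\<And>i. set_integrable M S (\<lambda>x. v x $ i)"
  shows "set_integrable M S v" and "(LINT x:S|M. v x) $ i = (LINT x:S|M. v x $ i)"
  using integrable_vec[of M "\<lambda>x. indicator S x *\<^sub>R v x"] assms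
  unfolding set_integrable_def set_lebesgue_integral_def by auto

lemma conv_scale: "conv c (\<lambda>r. a * g r) u t = a * conv c g u t"
  unfolding conv_def by (simp add: algebra_simps)

section \<open>Pathwise integrals and increments of the solution\<close>

lemma interval_measure_path_conv:
  assumes "0 \<le> u" "u < t" and mono: "mono_on {0..} g" and rc: "\<And>q. 0 \<le> q \<Longrightarrow> (g \<longlongrightarrow> g q) (at_right q)"
  shows "set_integrable (interval_measure (\<lambda>r. g (max 0 r))) {u<..t} (\<lambda>r. exp (- c * (t - r)))"
    and "(LINT r:{u<..t}|interval_measure (\<lambda>r. g (max 0 r)). exp (- c * (t - r))) = conv c g u t"
proof -
  let ?F = "\<lambda>r. g (max 0 r)"
  have m: "mono ?F"
  proof (rule monoI)
    fix x y :: real assume "x \<le> y"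
    then show "g (max 0 x) \<le> g (max 0 y)" by (intro mono_onD[OF mono]) auto
  qed
  have r: "(?F \<longlongrightarrow> ?F q) (at_right q)" for q
  proof (cases "0 \<le> q")
    case True
    have "\<forall>\<^sub>F r in at_right q. g r = ?F r"
      using eventually_at_right_less[of q] by eventually_elim (use True in simp)
    from Lim_transform_eventually[OF rc[OF True] this] show ?thesis using True by simp
  next
    case False
    then have "\<forall>\<^sub>F r in at_right q. ?F q = ?F r"
      using eventually_at_right_real[of q 0] by (auto elim!: eventually_mono)
    then show ?thesis by (rule Lim_transform_eventually[OF tendsto_const])
  qed
  show "set_integrable (interval_measure ?F) {u<..t} (\<lambda>r. exp (- c * (t - r)))"
    by (rule interval_measure_conv(1)[OF assms(2) m r])
  have "(LINT q:{u..t}|lborel. exp (- c * (t - q)) * g (max 0 q)) = (LINT q:{u..t}|lborel. exp (- c * (t - q)) * g q)"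
    using assms by (intro set_lebesgue_integral_cong) auto
  then show "(LINT r:{u<..t}|interval_measure ?F. exp (- c * (t - r))) = conv c g u t"
    unfolding interval_measure_conv(2)[OF assms(2) m r] conv_def using assms by simp
qed

text \<open>All matrices involved are diagonal, so the matrix valued integral reduces to scalar
  Stieltjes integrals along the path of \<open>L\<close>, and each of these equals
  \<open>conv\<close>.\<close>

lemma (in subordinated_bm) IL_eq:
  assumes g: "good \<omega>" and u: "0 \<le> u" "u < t" and Q: "Q = diag (\<chi> i. (sg $ i)\<^sup>2)"
  shows "IL L (- diag lam) Q u t \<omega> = diag (etaL u t \<omega>)"
proof -
  let ?M = "interval_measure (\<lambda>r. L (max 0 r) \<omega>)"
  define v :: "real \<Rightarrow> real ^ 'n" where "v r = (\<chi> i. exp (- (2 * lam $ i) * (t - r)) * (sg $ i)\<^sup>2)" for r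
  have pm: "mono_on {0..} (\<lambda>r. L r \<omega>)" using g by (simp add: good_def)
  note path = interval_measure_path_conv[OF u pm good_right_L[OF g]]
  have e: "mexp ((2 * (t - r)) *\<^sub>R - diag lam) ** Q = diag (v r)" for r
    unfolding scaleR_uminus_diag mexp_diag Q diag_mult v_def
    by (intro arg_cong[where f=diag]) (simp add: vec_eq_iff algebra_simps)
  have vi: "set_integrable ?M {u<..t} (\<lambda>r. v r $ i)" for i
    unfolding v_def vec_lambda_beta by (intro set_integrable_mult_left path(1))
  note vv = set_integrable_vec[of ?M "{u<..t}" v, OF vi]
  have "IL L (- diag lam) Q u t \<omega> = (LINT r:{u<..t}|?M. diag (v r))" unfolding IL_def e ..
  also have "\<dots> = diag (LINT r:{u<..t}|?M. v r)"
    using vv(1) integral_bounded_linear[OF bounded_linear_diag, of ?M "\<lambda>r. indicator {u<..t} r *\<^sub>R v r"]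
    unfolding set_integrable_def set_lebesgue_integral_def
    by (simp add: linear_scale[OF bounded_linear.linear[OF bounded_linear_diag]])
  also have "(LINT r:{u<..t}|?M. v r) = etaL u t \<omega>"
    unfolding vec_eq_iff vv(2)
  proof
    fix i
    have "(LINT r:{u<..t}|?M. v r $ i) = (LINT r:{u<..t}|?M. exp (- (2 * lam $ i) * (t - r))) * (sg $ i)\<^sup>2"
      unfolding v_def vec_lambda_beta by (rule set_integral_mult_left)
    also have "(LINT r:{u<..t}|?M. exp (- (2 * lam $ i) * (t - r))) = conv (2 * lam $ i) (\<lambda>r. L r \<omega>) u t"
      by (rule path(2))
    finally show "(LINT r:{u<..t}|?M. v r $ i) = etaL u t \<omega> $ i"
      unfolding etaL_def vec_lambda_beta by (simp only: mult.commute)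
  qed
  finally show ?thesis .
qed

definition Fvec :: "real ^ 'n::finite \<Rightarrow> (real \<Rightarrow> real ^ 'n) \<Rightarrow> real \<Rightarrow> real \<Rightarrow> real ^ 'n" where
  "Fvec lam f s t = (LINT r:{s..t}|lborel. decay lam (t - r) (f r))"

lemma Fint_eq: "Fint (- diag lam) f s t = Fvec lam f s t"
  unfolding Fint_def Fvec_def mexp_decay ..

lemma Fvec_cong: "(\<And>r. r \<in> {s..t} \<Longrightarrow> f r = g r) \<Longrightarrow> Fvec lam f s t = Fvec lam g s t"
  unfolding Fvec_def by (intro set_lebesgue_integral_cong) auto

lemma Fvec_joint:
  fixes f :: "real \<Rightarrow> real ^ 'n::finite"
  assumes [measurable]: "f \<in> borel_measurable borel"
  shows "(\<lambda>(s, t). Fvec lam f s t) \<in> borel_measurable (borel \<Otimes>\<^sub>M borel)"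
proof -
  have ind: "indicator {fst p..snd p} q = (if fst p \<le> q \<and> q \<le> snd p then 1 else 0 :: real)" for p :: "real \<times> real" and q
    by (simp add: indicator_def)
  have "(\<lambda>(p, q). indicator {fst p..snd p} q *\<^sub>R decay lam (snd p - q) (f q)) \<in> borel_measurable ((borel \<Otimes>\<^sub>M borel) \<Otimes>\<^sub>M lborel)"
    unfolding case_prod_unfold ind by measurable
  from lborel.borel_measurable_lebesgue_integral[OF this]
  show ?thesis unfolding Fvec_def set_lebesgue_integral_def case_prod_unfold .
qed

lemma set_integral_Icc_split:
  fixes h :: "real \<Rightarrow> real"
  assumes "set_integrable lborel {s..q} h" "s \<le> u" "u \<le> q"
  shows "(LINT r:{s..q}|lborel. h r) = (LINT r:{s..u}|lborel. h r) + (LINT r:{u..q}|lborel. h r)"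
proof -
  have 1: "{s..q} = {s..u} \<union> {u<..q}" using assms by auto
  have i: "set_integrable lborel {s..u} h" "set_integrable lborel {u<..q} h"
    using assms by (auto intro: set_integrable_subset)
  have "(LINT r:{s..q}|lborel. h r) = (LINT r:{s..u}|lborel. h r) + (LINT r:{u<..q}|lborel. h r)"
    unfolding 1 by (rule set_integral_Un[OF _ i]) auto
  also have "(LINT r:{u<..q}|lborel. h r) = (LINT r:{u..q}|lborel. h r)"
    unfolding set_lebesgue_integral_def by (rule integral_lborel_cong_cofinite[of "{u}"]) (auto simp: indicator_def)
  finally show ?thesis .
qed

text \<open>Subtracting the equation at \<open>u\<close> from that at later times gives scalar
  equations on the interval from \<open>u\<close> to \<open>t\<close>, driven by \<open>sg\<close>
  times the subordinated Brownian path; variation of constants solves them. The cadlag property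
  makes the paths bounded and measurable, hence integrable.\<close>

lemma (in subordinated_bm) sde_increment:
  assumes sde: "sde_solution M W L (- diag lam) Q f T s x X" and Q: "Q = diag (\<chi> i. (sg $ i)\<^sup>2)"
    and sg0: "\<And>i. 0 \<le> sg $ i" and f: "continuous_on {0..T} f"
    and s: "0 \<le> s" "s \<le> u" "u < t" "t \<le> T"
  shows "AE \<omega> in M. X t \<omega> - decay lam (t - u) (X u \<omega>) - Fvec lam f u t = DW u t \<omega>"
proof -
  have sqQ: "msqrt Q *v y = (\<chi> i. sg $ i * y $ i)" for y
    unfolding Q using sg0 by (simp add: msqrt_mult_vec vscale_def vec_eq_iff)
  have "AE \<omega> in M. cadlag_on {s..T} (\<lambda>t. X t \<omega>) \<and>
        (\<forall>t\<in>{s..T}. X t \<omega> = x + (LINT r:{s..t}|lborel. - diag lam *v X r \<omega> + f r)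
                             + msqrt Q *v (W (L t \<omega>) \<omega> - W (L s \<omega>) \<omega>))"
    using sde unfolding sde_solution_def by auto
  with AE_good show ?thesis
  proof eventually_elim
    case (elim \<omega>)
    then have cad: "cadlag_on {s..T} (\<lambda>t. X t \<omega>)" by auto
    have eqn: "X q \<omega> = x + (LINT r:{s..q}|lborel. - diag lam *v X r \<omega> + f r) + msqrt Q *v (W (L q \<omega>) \<omega> - W (L s \<omega>) \<omega>)"
      if "q \<in> {s..T}" for q using elim that by blast
    have sT: "s < T" using s by simp
    from cadlag_on_bounded[OF cad] obtain KX where "\<forall>z\<in>(\<lambda>t. X t \<omega>) ` {s..T}. norm z \<le> KX"
      unfolding bounded_iff by blast
    then have KX: "norm (X q \<omega>) \<le> KX" if "q \<in> {s..T}" for q using that by blast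
    have iX: "set_integrable lborel {s..T} (\<lambda>q. X q \<omega> $ i)" for i
    proof (rule set_integrable_bounded_interval[OF right_continuous_measurable[OF sT]])
      show "((\<lambda>q. X q \<omega> $ i) \<longlongrightarrow> X q \<omega> $ i) (at_right q)" if "q \<in> {s..<T}" for q
        by (intro tendsto_vec_nth cadlag_on_at_right[OF cad that])
      show "\<bar>X q \<omega> $ i\<bar> \<le> KX" if "q \<in> {s..T}" for q
        using KX[OF that] component_le_norm_cart[of "X q \<omega>" i] by linarith
    qed
    have if': "set_integrable lborel {s..T} (\<lambda>q. f q $ i)" for i
      unfolding set_integrable_def
      by (rule borel_integrable_compact) (use s in \<open>auto intro!: continuous_intros continuous_on_subset[OF f]\<close>)
    obtain KW where KW: "\<And>q i. q \<in> {u..t} \<Longrightarrow> \<bar>W (L q \<omega>) \<omega> $ i\<bar> \<le> KW"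
      using good_bounded_W[OF elim(1), of u t] s by auto
    have comp: "X t \<omega> $ i - exp (- (lam $ i) * (t - u)) * X u \<omega> $ i - (LINT q:{u..t}|lborel. exp (- (lam $ i) * (t - q)) * f q $ i)
        = conv (lam $ i) (\<lambda>r. sg $ i * W (L r \<omega>) \<omega> $ i) u t" for i
    proof (rule variation_of_constants)
      show "u \<le> t" using s by simp
      show "set_integrable lborel {u..t} (\<lambda>q. X q \<omega> $ i)" by (rule set_integrable_subset[OF iX]) (use s in auto)
      show "set_integrable lborel {u..t} (\<lambda>q. f q $ i)" by (rule set_integrable_subset[OF if']) (use s in auto)
      have "set_integrable lborel {u..t} (\<lambda>r. W (L r \<omega>) \<omega> $ i)"
      proof (rule set_integrable_bounded_interval[OF right_continuous_measurable[OF s(3)] KW])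
        show "((\<lambda>r. W (L r \<omega>) \<omega> $ i) \<longlongrightarrow> W (L q \<omega>) \<omega> $ i) (at_right q)" if "q \<in> {u..<t}" for q
          using that s by (intro tendsto_vec_nth good_right_W[OF elim(1)]) auto
      qed
      then show "set_integrable lborel {u..t} (\<lambda>r. sg $ i * W (L r \<omega>) \<omega> $ i)" by (rule set_integrable_mult_right)
      fix q assume q: "q \<in> {u..t}"
      have ih: "set_integrable lborel {s..T} (\<lambda>r. - lam $ i * X r \<omega> $ i + f r $ i)" for i
        by (intro set_integral_add set_integrable_mult_right iX if')
      have cmp: "X p \<omega> $ i = x $ i + (LINT r:{s..p}|lborel. - lam $ i * X r \<omega> $ i + f r $ i) + sg $ i * (W (L p \<omega>) \<omega> $ i - W (L s \<omega>) \<omega> $ i)"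
        if p: "p \<in> {s..T}" for p
      proof -
        have "(LINT r:{s..p}|lborel. - diag lam *v X r \<omega> + f r) $ i = (LINT r:{s..p}|lborel. (- diag lam *v X r \<omega> + f r) $ i)"
        proof (rule set_integrable_vec(2))
          have ceq: "(- diag lam *v X r \<omega> + f r) $ j = - lam $ j * X r \<omega> $ j + f r $ j" for r j
            by (simp add: uminus_diag_mult_vec)
          show "set_integrable lborel {s..p} (\<lambda>r. (- diag lam *v X r \<omega> + f r) $ j)" for j
            unfolding ceq by (rule set_integrable_subset[OF ih]) (use p in auto)
        qed
        then show ?thesis
          by (subst eqn[OF p]) (simp add: sqQ uminus_diag_mult_vec)
      qed
      have "set_integrable lborel {s..q} (\<lambda>r. - lam $ i * X r \<omega> $ i + f r $ i)"
        by (rule set_integrable_subset[OF ih]) (use q s in auto)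
      from set_integral_Icc_split[OF this, of u]
      show "X q \<omega> $ i = X u \<omega> $ i + (LINT q:{u..q}|lborel. - lam $ i * X q \<omega> $ i + f q $ i) + (sg $ i * W (L q \<omega>) \<omega> $ i - sg $ i * W (L u \<omega>) \<omega> $ i)"
        using cmp[of q] cmp[of u] q s by (simp add: algebra_simps)
    qed
    have Fc: "Fvec lam f u t $ i = (LINT q:{u..t}|lborel. exp (- (lam $ i) * (t - q)) * f q $ i)" for i
      unfolding Fvec_def
    proof (subst set_integrable_vec(2))
      show "set_integrable lborel {u..t} (\<lambda>r. decay lam (t - r) (f r) $ j)" for j
        unfolding set_integrable_def decay_def vec_lambda_beta
        by (rule borel_integrable_compact) (use s in \<open>auto intro!: continuous_intros continuous_on_subset[OF f]\<close>)
    qed (simp add: decay_def)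
    show ?case
      unfolding vec_eq_iff using comp by (simp add: decay_def Fc DW_def conv_scale)
  qed
qed

lemma (in subordinated_bm) sde_initial:
  assumes sde: "sde_solution M W L (- diag lam) Q f T s x X" and s: "s \<le> T"
  shows "AE \<omega> in M. X s \<omega> = x"
proof -
  have "AE \<omega> in M. \<forall>t\<in>{s..T}. X t \<omega> = x + (LINT r:{s..t}|lborel. - diag lam *v X r \<omega> + f r)
                             + msqrt Q *v (W (L t \<omega>) \<omega> - W (L s \<omega>) \<omega>)"
    using sde unfolding sde_solution_def by auto
  then show ?thesis
  proof eventually_elim
    case (elim \<omega>)
    have "(LINT r:{s..s}|lborel. - diag lam *v X r \<omega> + f r) = (LINT r|(lborel :: real measure). (0 :: real ^ 'n))"
      unfolding set_lebesgue_integral_def by (rule integral_lborel_cong_cofinite[of "{s}"]) auto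
    then show ?case using elim s by (auto simp: matrix_vector_mult_0_right)
  qed
qed

lemma gauss_power_1: "distr (gauss_power 1) gauss (\<lambda>\<xi>. \<xi> 0) = (gauss :: (real ^ 'n::finite) measure)"
  by (rule distr_PiM_component) (auto intro: prob_space_gauss)

lemma pair_gauss_power_1:
  assumes "prob_space M"
  shows "distr (M \<Otimes>\<^sub>M gauss_power 1) (M \<Otimes>\<^sub>M gauss) (\<lambda>z. (fst z, snd z 0)) = M \<Otimes>\<^sub>M (gauss :: (real ^ 'n::finite) measure)"
proof -
  interpret M: prob_space M by fact
  have comp: "(\<lambda>\<xi>. \<xi> 0) \<in> measurable (gauss_power 1 :: (nat \<Rightarrow> real ^ 'n) measure) gauss"
    by (rule measurable_component_singleton) simp
  have "distr M M (\<lambda>x. x) \<Otimes>\<^sub>M distr (gauss_power 1) gauss (\<lambda>\<xi>. \<xi> 0) =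
      distr (M \<Otimes>\<^sub>M gauss_power 1) (M \<Otimes>\<^sub>M (gauss :: (real ^ 'n) measure)) (\<lambda>(x, y). (x, y 0))"
    by (rule pair_measure_distr[OF _ comp]) (simp_all only: measurable_ident gauss_power_1 prob_space_imp_sigma_finite[OF prob_space_gauss], simp)
  then show ?thesis unfolding gauss_power_1 distr_id case_prod_unfold by simp
qed

section \<open>Kernels attached to the equation\<close>

locale ou_setting = stable_bm M W L lam sg \<alpha> \<gamma>
  for M :: "'a measure" and W :: "real \<Rightarrow> 'a \<Rightarrow> real ^ 'n::finite" and L :: "real \<Rightarrow> 'a \<Rightarrow> real"
    and lam sg :: "real ^ 'n" and \<alpha> \<gamma> :: real +
  fixes T t KB K0 :: real and f :: "real \<Rightarrow> real ^ 'n" and B :: "real \<Rightarrow> real ^ 'n \<Rightarrow> real ^ 'n"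
    and u0 :: "real ^ 'n \<Rightarrow> real" and Z :: "real \<Rightarrow> real ^ 'n \<Rightarrow> real \<Rightarrow> 'a \<Rightarrow> real ^ 'n" and Q :: "real ^ 'n ^ 'n"
  assumes Q: "Q = diag (\<chi> i. (sg $ i)\<^sup>2)"
    and sde: "\<And>r y. r \<in> {0..T} \<Longrightarrow> sde_solution M W L (- diag lam) Q f T r y (Z r y)"
    and f_cont: "continuous_on {0..T} f"
    and B_cont: "continuous_on ({0..T} \<times> UNIV) (\<lambda>(r, y). B r y)"
    and B_norm: "\<And>r y. r \<in> {0..T} \<Longrightarrow> norm (B r y) \<le> KB"
    and u0_borel: "u0 \<in> borel_measurable borel" and u0_norm: "\<And>y. \<bar>u0 y\<bar> \<le> K0"
    and t: "0 < t" "t \<le> T"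
begin

text \<open>The coefficients are extended by zero outside \<open>[0, T]\<close> to have them Borel on the whole line.\<close>

definition fx :: "real \<Rightarrow> real ^ 'n" where
  "fx r = indicator {0..T} r *\<^sub>R f r"

definition Bx :: "real \<Rightarrow> real ^ 'n \<Rightarrow> real ^ 'n" where
  "Bx r y = indicator {0..T} r *\<^sub>R B r y"

text \<open>The constant required by the kernel estimates: the componentwise bounds of
  \<open>etaL_moment\<close> added up.\<close>

definition CE :: real where
  "CE = (\<Sum>i\<in>UNIV. etaC T i) * mom"

lemma fx_measurable: "fx \<in> borel_measurable borel"
  using borel_measurable_continuous_on_indicator[OF _ f_cont] by (simp add: fx_def[abs_def])

lemma Bx_joint: "(\<lambda>(r, y). Bx r y) \<in> borel_measurable (borel \<Otimes>\<^sub>M borel)"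
proof -
  have "closed ({0..T} \<times> (UNIV :: (real ^ 'n) set))" by (intro closed_Times) auto
  then have "{0..T} \<times> (UNIV :: (real ^ 'n) set) \<in> sets borel" by simp
  from borel_measurable_continuous_on_indicator[OF this B_cont]
  have "(\<lambda>p. indicator ({0..T} \<times> UNIV) p *\<^sub>R (case p of (r, y) \<Rightarrow> B r y)) \<in> borel_measurable borel" .
  also have "(\<lambda>p. indicator ({0..T} \<times> UNIV) p *\<^sub>R (case p of (r, y) \<Rightarrow> B r y)) = (\<lambda>(r, y). Bx r y)"
    by (auto simp: Bx_def indicator_def fun_eq_iff)
  finally show ?thesis by (simp only: borel_prod)
qed

lemma etaT_measurable: "etaT u r \<in> borel_measurable M"
proof -
  have "(\<lambda>\<omega>. (u, r, \<omega>)) \<in> measurable M (borel \<Otimes>\<^sub>M borel \<Otimes>\<^sub>M M)" by measurable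
  from measurable_compose[OF this etaT_joint] show ?thesis by simp
qed

lemma etaT_AE:
  assumes "0 \<le> u" "u < r"
  shows "AE \<omega> in M. etaT u r \<omega> = etaL u r \<omega>"
  using AE_good by eventually_elim (use assms etaT_eq in auto)

text \<open>The covariance is instantiated with \<open>etaT\<close>, since the kernels are
  integrated over time and joint measurability is essential; its moments are those of
  \<open>etaL\<close> because the two agree almost surely for fixed times.\<close>

sublocale K: kernel_iteration M etaT "Fvec lam fx" lam T b CE Bx u0 t KB K0
proof
  show "(\<lambda>(u, t, \<omega>). etaT u t \<omega>) \<in> borel_measurable (borel \<Otimes>\<^sub>M borel \<Otimes>\<^sub>M M)" by (rule etaT_joint)
  show "(\<lambda>(u, t). Fvec lam fx u t) \<in> borel_measurable (borel \<Otimes>\<^sub>M borel)" by (rule Fvec_joint[OF fx_measurable])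
  show "0 \<le> lam $ i" for i using lam[of i] by simp
  show "0 < b" "b < 1" by (rule b)+
  have mom0: "0 \<le> mom" unfolding mom_def by (intro Bochner_Integration.integral_nonneg) simp
  have "0 \<le> etaC T i" for i unfolding etaC_def using sg[of i] by simp
  then show "0 \<le> CE" unfolding CE_def by (intro mult_nonneg_nonneg sum_nonneg mom0)
  fix u r :: real assume u: "0 \<le> u" "u < r" "r \<le> T"
  show "AE \<omega> in M. \<forall>i. 0 < etaT u r \<omega> $ i"
    using etaL_pos[OF u(1,2)] etaT_AE[OF u(1,2)] by eventually_elim simp
  have mL: "(\<lambda>\<omega>. inv_sqrt_sum (etaL u r \<omega>)) \<in> borel_measurable M"
    by (rule measurable_compose[OF etaL_measurable[OF u(1,2)] inv_sqrt_sum_measurable])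
  have mT: "(\<lambda>\<omega>. inv_sqrt_sum (etaT u r \<omega>)) \<in> borel_measurable M"
    by (rule measurable_compose[OF etaT_measurable inv_sqrt_sum_measurable])
  have ae: "AE \<omega> in M. inv_sqrt_sum (etaT u r \<omega>) = inv_sqrt_sum (etaL u r \<omega>)"
    using etaT_AE[OF u(1,2)] by eventually_elim simp
  have iL: "integrable M (\<lambda>\<omega>. inv_sqrt_sum (etaL u r \<omega>))"
    unfolding inv_sqrt_sum_def by (intro Bochner_Integration.integrable_sum etaL_moment(1)[OF u])
  then show "integrable M (\<lambda>\<omega>. inv_sqrt_sum (etaT u r \<omega>))"
    by (subst integrable_cong_AE[OF mT mL ae])
  have "(LINT \<omega>|M. inv_sqrt_sum (etaT u r \<omega>)) = (LINT \<omega>|M. inv_sqrt_sum (etaL u r \<omega>))"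
    by (rule integral_cong_AE[OF mT mL ae])
  also have "\<dots> = (\<Sum>i\<in>UNIV. LINT \<omega>|M. 1 / sqrt (etaL u r \<omega> $ i))"
    unfolding inv_sqrt_sum_def by (intro Bochner_Integration.integral_sum etaL_moment(1)[OF u])
  also have "\<dots> \<le> (\<Sum>i\<in>UNIV. etaC T i * mom * (r - u) powr - b)"
    by (intro sum_mono etaL_moment(2)[OF u])
  finally show "(LINT \<omega>|M. inv_sqrt_sum (etaT u r \<omega>)) \<le> CE * (r - u) powr - b"
    by (simp only: CE_def sum_distrib_right)
next
  have "0 \<le> KB" using order_trans[OF norm_ge_zero B_norm[of 0 0]] t by simp
  then show "norm (Bx r y) \<le> KB" for r y using B_norm[of r y] by (auto simp: Bx_def indicator_def)
qed (use t u0_borel u0_norm Bx_joint in auto)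

lemma Fvec_fx: "0 \<le> u \<Longrightarrow> r \<le> T \<Longrightarrow> Fvec lam f u r = Fvec lam fx u r"
  by (rule Fvec_cong) (auto simp: fx_def)

lemma solution_increment:
  assumes "0 \<le> s" "s \<le> u" "u < r" "r \<le> T"
  shows "AE \<omega> in M. Z s x r \<omega> - decay lam (r - u) (Z s x u \<omega>) - Fvec lam fx u r = DW u r \<omega>"
  using sde_increment[OF sde[of s x] Q _ f_cont assms] Fvec_fx[of u r] sg assms by (simp add: less_imp_le)

lemma solution_initial:
  assumes "0 \<le> s" "s \<le> T"
  shows "AE \<omega> in M. Z s x s \<omega> = x"
  using sde_initial[OF sde[of s x]] assms by simp

lemma solution_measurable: "0 \<le> s \<Longrightarrow> s \<le> r \<Longrightarrow> r \<le> T \<Longrightarrow> Z s x r \<in> borel_measurable M"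
  using sde[of s x] unfolding sde_solution_def by auto

text \<open>The case of a single block. Only block 0 occurs, so nothing is normalised, and the
  solution is its deterministic part plus a Gaussian vector with the random covariance.\<close>

lemma Rop_eq:
  assumes u: "0 \<le> u" "u < r" "r \<le> T" and \<phi>[measurable]: "\<phi> \<in> borel_measurable borel"
  shows "Rop M Z u r \<phi> y = K.P u r \<phi> y"
proof -
  define c where "c = decay lam (r - u) y + Fvec lam fx u r"
  define \<tau> where "\<tau> j = (if j = 0 then u else r)" for j :: nat
  define \<Phi> where "\<Phi> d = \<phi> (c + d 0)" for d :: "nat \<Rightarrow> real ^ 'n"
  have [measurable]: "(\<lambda>d. d 0) \<in> borel_measurable (PiM {..<Suc 0} (\<lambda>_. borel :: (real ^ 'n) measure))"
    by (rule measurable_component_singleton) simp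
  have \<Phi>m: "\<Phi> \<in> borel_measurable (PiM {..<Suc 0} (\<lambda>_. borel))" unfolding \<Phi>_def by measurable
  have [measurable]: "Z u y r \<in> borel_measurable M" "DW u r \<in> borel_measurable M"
    using solution_measurable DW_measurable u by auto
  have "Rop M Z u r \<phi> y = (LINT \<omega>|M. \<phi> (c + DW u r \<omega>))"
    unfolding Rop_def
  proof (rule integral_cong_AE)
    show "AE \<omega> in M. \<phi> (Z u y r \<omega>) = \<phi> (c + DW u r \<omega>)"
      using solution_increment[of u u r y] solution_initial[of u y] u
      by (auto simp: c_def elim!: eventually_elim2 AE_mp intro!: arg_cong[where f=\<phi>] simp: algebra_simps)
  qed measurable
  also have "\<dots> = (LINT z|(M \<Otimes>\<^sub>M gauss_power (Suc 0)). \<phi> (c + vscale (etaT u r (fst z)) (snd z 0)))"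
    using normalised_block_law[of \<tau> "Suc 0" \<Phi>, OF _ _ \<Phi>m] u by (simp add: \<tau>_def \<Phi>_def)
  also have "\<dots> = (LINT z|K.N. \<phi> (c + vscale (etaT u r (fst z)) (snd z)))"
  proof -
    have c1: "(\<lambda>\<xi>. \<xi> 0) \<in> measurable (gauss_power 1 :: (nat \<Rightarrow> real ^ 'n) measure) gauss"
      by (rule measurable_component_singleton) simp
    have m: "(\<lambda>z. (fst z, snd z 0)) \<in> measurable (M \<Otimes>\<^sub>M gauss_power 1) K.N"
      by (intro measurable_Pair measurable_fst measurable_compose[OF measurable_snd c1])
    have "(\<lambda>z. \<phi> (c + vscale (etaT u r (fst z)) (snd z))) \<in> borel_measurable K.N" by measurable
    from integral_distr[OF m this] show ?thesis
      unfolding pair_gauss_power_1[OF prob] by (simp add: One_nat_def)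
  qed
  finally show ?thesis by (simp add: K.P_def K.X_def c_def)
qed

text \<open>The two recursions are compared at times \<open>r\<close> strictly after
  \<open>u\<close>, the point \<open>u\<close> being negligible. The iterates agree as functions of
  the space variable, so that \<open>gradient\<close> of one is that of the other.\<close>

lemma viter_eq: "0 \<le> u \<Longrightarrow> u < t \<Longrightarrow> viter M Z B u0 m u t y = K.V m u y"
proof (induction m arbitrary: u y)
  case 0
  then show ?case using Rop_eq[of u t u0 y] t u0_borel by simp
next
  case (Suc m)
  show ?case
    unfolding viter.simps K.V.simps set_lebesgue_integral_def
  proof (rule integral_lborel_cong_cofinite[of "{u}"])
    fix r assume r: "r \<notin> {u}"
    show "indicator {u..<t} r *\<^sub>R Rop M Z u r (\<lambda>y. B r y \<bullet> gradient (viter M Z B u0 m r t) y) y =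
      indicator {u..<t} r *\<^sub>R K.P u r (K.kap m r) y"
    proof (cases "r \<in> {u..<t}")
      case True
      then have r': "0 \<le> r" "u < r" "r < t" "r \<le> T" using r Suc.prems t by auto
      have "viter M Z B u0 m r t = K.V m r" using Suc.IH[of r] r' by blast
      then have "(\<lambda>y. B r y \<bullet> gradient (viter M Z B u0 m r t) y) = K.kap m r"
        using r' by (simp add: K.gradient_V K.kap_def[abs_def] Bx_def)
      then show ?thesis using Rop_eq[OF Suc.prems(1) r'(2,4) K.kap_measurable] by simp
    qed simp
  qed simp
qed

end

section \<open>Rearranging product measures\<close>

text \<open>On rectangles the indicator is a product over the indices, so Tonelli factorises the
  measure on both levels.\<close>

lemma PiM_pair_zip:
  assumes "prob_space M" "prob_space G" "finite I"
  shows "distr (PiM I (\<lambda>_. M) \<Otimes>\<^sub>M PiM I (\<lambda>_. G)) (PiM I (\<lambda>_. M \<Otimes>\<^sub>M G)) (\<lambda>z. \<lambda>i\<in>I. (fst z i, snd z i)) = PiM I (\<lambda>_. M \<Otimes>\<^sub>M G)"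
proof -
  interpret M: prob_space M by fact
  interpret G: prob_space G by fact
  interpret MG: pair_prob_space M G ..
  interpret PM: product_sigma_finite "\<lambda>_. M" by (intro product_sigma_finite.intro M.sigma_finite_measure_axioms)
  interpret PG: product_sigma_finite "\<lambda>_. G" by (intro product_sigma_finite.intro G.sigma_finite_measure_axioms)
  interpret N: product_sigma_finite "\<lambda>_. M \<Otimes>\<^sub>M G" by (intro product_sigma_finite.intro MG.P.sigma_finite_measure_axioms)
  interpret QG: prob_space "PiM I (\<lambda>_. G)" by (intro prob_space_PiM assms)
  let ?Z = "\<lambda>z. \<lambda>i\<in>I. (fst z i, snd z i)"
  have zm: "?Z \<in> measurable (PiM I (\<lambda>_. M) \<Otimes>\<^sub>M PiM I (\<lambda>_. G)) (PiM I (\<lambda>_. M \<Otimes>\<^sub>M G))"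
    by (intro measurable_restrict measurable_Pair measurable_compose[OF measurable_fst measurable_component_singleton]
        measurable_compose[OF measurable_snd measurable_component_singleton])
  show ?thesis
  proof (rule N.PiM_eqI[OF assms(3)])
    fix A assume A: "\<And>i. i \<in> I \<Longrightarrow> A i \<in> sets (M \<Otimes>\<^sub>M G)"
    have sp: "X i \<in> space M" if "X \<in> space (PiM I (\<lambda>_. M))" "i \<in> I" for X i
      using that by (auto simp: space_PiM)
    have Am: "(\<lambda>\<xi>. indicator (A i) (x, \<xi>) :: ennreal) \<in> borel_measurable G" if "i \<in> I" "x \<in> space M" for i x
      using A[OF that(1)] that(2) by measurable
    have set: "?Z -` (Pi\<^sub>E I A) \<inter> space (PiM I (\<lambda>_. M) \<Otimes>\<^sub>M PiM I (\<lambda>_. G)) \<in> sets (PiM I (\<lambda>_. M) \<Otimes>\<^sub>M PiM I (\<lambda>_. G))"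
      by (rule measurable_sets[OF zm sets_PiM_I_finite[OF assms(3) A]])
    have ind: "indicator (?Z -` (Pi\<^sub>E I A) \<inter> space (PiM I (\<lambda>_. M) \<Otimes>\<^sub>M PiM I (\<lambda>_. G))) (X, \<xi>) = (\<Prod>i\<in>I. indicator (A i) (X i, \<xi> i) :: ennreal)"
      if "X \<in> space (PiM I (\<lambda>_. M))" "\<xi> \<in> space (PiM I (\<lambda>_. G))" for X \<xi>
    proof (cases "\<forall>i\<in>I. (X i, \<xi> i) \<in> A i")
      case True
      then show ?thesis using that by (auto simp: indicator_def space_pair_measure PiE_def)
    next
      case False
      then obtain i where i: "i \<in> I" "(X i, \<xi> i) \<notin> A i" by auto
      then have "(\<Prod>i\<in>I. indicator (A i) (X i, \<xi> i) :: ennreal) = 0"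
        using assms(3) by (intro prod_zero) (auto intro!: bexI[of _ i])
      then show ?thesis using i by (auto simp: indicator_def PiE_def Pi_def)
    qed
    have "emeasure (distr (PiM I (\<lambda>_. M) \<Otimes>\<^sub>M PiM I (\<lambda>_. G)) (PiM I (\<lambda>_. M \<Otimes>\<^sub>M G)) ?Z) (Pi\<^sub>E I A) =
      (\<integral>\<^sup>+X. \<integral>\<^sup>+\<xi>. indicator (?Z -` (Pi\<^sub>E I A) \<inter> space (PiM I (\<lambda>_. M) \<Otimes>\<^sub>M PiM I (\<lambda>_. G))) (X, \<xi>) \<partial>PiM I (\<lambda>_. G) \<partial>PiM I (\<lambda>_. M))"
      by (subst emeasure_distr[OF zm sets_PiM_I_finite[OF assms(3) A]])
         (auto simp: QG.emeasure_pair_measure[OF set])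
    also have "\<dots> = (\<integral>\<^sup>+X. \<integral>\<^sup>+\<xi>. (\<Prod>i\<in>I. indicator (A i) (X i, \<xi> i)) \<partial>PiM I (\<lambda>_. G) \<partial>PiM I (\<lambda>_. M))"
      by (intro nn_integral_cong ind)
    also have "\<dots> = (\<integral>\<^sup>+X. (\<Prod>i\<in>I. \<integral>\<^sup>+\<xi>. indicator (A i) (X i, \<xi>) \<partial>G) \<partial>PiM I (\<lambda>_. M))"
      by (intro nn_integral_cong PG.product_nn_integral_prod assms(3) Am sp)
    also have "\<dots> = (\<Prod>i\<in>I. \<integral>\<^sup>+x. \<integral>\<^sup>+\<xi>. indicator (A i) (x, \<xi>) \<partial>G \<partial>M)"
    proof (rule PM.product_nn_integral_prod[OF assms(3)])
      fix i assume i: "i \<in> I"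
      have "indicator (A i) \<in> borel_measurable (M \<Otimes>\<^sub>M G)" using A[OF i] by simp
      from G.borel_measurable_nn_integral_fst[OF this]
      show "(\<lambda>x. \<integral>\<^sup>+\<xi>. indicator (A i) (x, \<xi>) \<partial>G) \<in> borel_measurable M" .
    qed
    also have "\<dots> = (\<Prod>i\<in>I. emeasure (M \<Otimes>\<^sub>M G) (A i))"
      by (intro prod.cong refl) (simp add: G.emeasure_pair_measure[OF A])
    finally show "emeasure (distr (PiM I (\<lambda>_. M) \<Otimes>\<^sub>M PiM I (\<lambda>_. G)) (PiM I (\<lambda>_. M \<Otimes>\<^sub>M G)) ?Z) (Pi\<^sub>E I A) =
      (\<Prod>i\<in>I. emeasure (M \<Otimes>\<^sub>M G) (A i))" .
  qed simp
qed

lemma PiM_insert_0: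
  assumes "prob_space M"
  shows "distr (M \<Otimes>\<^sub>M PiM {1..<Suc m} (\<lambda>_. M)) (PiM {..<Suc m} (\<lambda>_. M)) (\<lambda>z. (snd z)(0 := fst z)) = PiM {..<Suc m} (\<lambda>_::nat. M)"
proof -
  have 1: "insert 0 {1..<Suc m} = {..<Suc m}" by auto
  have "distr (M \<Otimes>\<^sub>M PiM {1..<Suc m} (\<lambda>_. M)) (PiM (insert 0 {1..<Suc m}) (\<lambda>_. M)) (\<lambda>(x, X). X(0 := x)) = PiM (insert 0 {1..<Suc m}) (\<lambda>_::nat. M)"
    by (rule distr_pair_PiM_eq_PiM) (use assms in auto)
  then show ?thesis unfolding 1 case_prod_unfold .
qed

lemma PiM_insert_0_measurable:
  "(\<lambda>z. (snd z)(0 := fst z)) \<in> measurable (M \<Otimes>\<^sub>M PiM {1..<Suc m} (\<lambda>_. M)) (PiM {..<Suc m} (\<lambda>_::nat. M))"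
proof -
  have 1: "insert 0 {1..<Suc m} = {..<Suc m}" by auto
  show ?thesis 
    by (rule measurable_fun_upd[of _ "{1..<Suc m}"]) auto
qed

text \<open>The factor \<open>Q\<close> stands between the two factors on which \<open>g\<close>
  acts. As \<open>g\<close> does not read it, it can be split off as an independent factor.\<close>

lemma distr_pair_middle:
  assumes "prob_space M" "prob_space Q" "prob_space G" and g[measurable]: "g \<in> measurable (M \<Otimes>\<^sub>M G) S"
  shows "distr ((M \<Otimes>\<^sub>M Q) \<Otimes>\<^sub>M G) (S \<Otimes>\<^sub>M Q) (\<lambda>z. (g (fst (fst z), snd z), snd (fst z))) = distr (M \<Otimes>\<^sub>M G) S g \<Otimes>\<^sub>M Q"
proof -
  interpret M: prob_space M by fact
  interpret Q: prob_space Q by fact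
  interpret G: prob_space G by fact
  interpret MQ: pair_prob_space M Q ..
  interpret MG: pair_prob_space M G ..
  interpret D: prob_space "distr (M \<Otimes>\<^sub>M G) S g" by (rule MG.P.prob_space_distr[OF g])
  let ?h = "\<lambda>z. (g (fst (fst z), snd z), snd (fst z))"
  have hm: "?h \<in> measurable ((M \<Otimes>\<^sub>M Q) \<Otimes>\<^sub>M G) (S \<Otimes>\<^sub>M Q)" by measurable
  show ?thesis
  proof (rule pair_measure_eqI[symmetric])
    fix A B assume "A \<in> sets (distr (M \<Otimes>\<^sub>M G) S g)" and B[measurable]: "B \<in> sets Q"
    then have A[measurable]: "A \<in> sets S" by simp
    have AB: "A \<times> B \<in> sets (S \<Otimes>\<^sub>M Q)" by measurable
    let ?E = "?h -` (A \<times> B) \<inter> space ((M \<Otimes>\<^sub>M Q) \<Otimes>\<^sub>M G)" and ?A = "g -` A \<inter> space (M \<Otimes>\<^sub>M G)"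
    have E: "?E \<in> sets ((M \<Otimes>\<^sub>M Q) \<Otimes>\<^sub>M G)" by (rule measurable_sets[OF hm AB])
    have A': "?A \<in> sets (M \<Otimes>\<^sub>M G)" by (rule measurable_sets[OF g A])
    have "emeasure (distr ((M \<Otimes>\<^sub>M Q) \<Otimes>\<^sub>M G) (S \<Otimes>\<^sub>M Q) ?h) (A \<times> B) = emeasure ((M \<Otimes>\<^sub>M Q) \<Otimes>\<^sub>M G) ?E"
      by (rule emeasure_distr[OF hm AB])
    also have "\<dots> = (\<integral>\<^sup>+y. \<integral>\<^sup>+\<xi>. indicator ?E (y, \<xi>) \<partial>G \<partial>(M \<Otimes>\<^sub>M Q))"
      by (rule G.emeasure_pair_measure[OF E])
    also have "\<dots> = (\<integral>\<^sup>+y. \<integral>\<^sup>+\<xi>. indicator ?A (fst y, \<xi>) * indicator B (snd y) \<partial>G \<partial>(M \<Otimes>\<^sub>M Q))"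
      by (intro nn_integral_cong) (auto simp: indicator_def space_pair_measure)
    also have "\<dots> = (\<integral>\<^sup>+x. \<integral>\<^sup>+X. \<integral>\<^sup>+\<xi>. indicator ?A (x, \<xi>) * indicator B X \<partial>G \<partial>Q \<partial>M)"
    proof (subst Q.nn_integral_fst[symmetric])
      show "(\<lambda>y. \<integral>\<^sup>+\<xi>. indicator ?A (fst y, \<xi>) * indicator B (snd y) \<partial>G) \<in> borel_measurable (M \<Otimes>\<^sub>M Q)"
        using A' by measurable
    qed simp
    also have "\<dots> = (\<integral>\<^sup>+x. \<integral>\<^sup>+X. (\<integral>\<^sup>+\<xi>. indicator ?A (x, \<xi>) \<partial>G) * indicator B X \<partial>Q \<partial>M)"
      using A' by (intro nn_integral_cong nn_integral_multc) measurable
    also have "\<dots> = (\<integral>\<^sup>+x. (\<integral>\<^sup>+\<xi>. indicator ?A (x, \<xi>) \<partial>G) * emeasure Q B \<partial>M)"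
      by (simp add: nn_integral_cmult)
    also have "\<dots> = (\<integral>\<^sup>+x. (\<integral>\<^sup>+\<xi>. indicator ?A (x, \<xi>) \<partial>G) \<partial>M) * emeasure Q B"
      using A' by (intro nn_integral_multc) measurable
    also have "\<dots> = emeasure (distr (M \<Otimes>\<^sub>M G) S g) A * emeasure Q B"
      by (simp add: G.emeasure_pair_measure[OF A'] emeasure_distr[OF g A])
    finally show "emeasure (distr (M \<Otimes>\<^sub>M G) S g) A * emeasure Q B =
      emeasure (distr ((M \<Otimes>\<^sub>M Q) \<Otimes>\<^sub>M G) (S \<Otimes>\<^sub>M Q) ?h) (A \<times> B)" by simp
  qed (auto intro: D.sigma_finite_measure_axioms Q.sigma_finite_measure_axioms)
qed


text \<open>Copies are numbered against the order of time: block \<open>c\<close> reads copy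
  \<open>m - c\<close>. So copy \<open>m\<close> serves block 0 and, through \<open>g\<close>, all
  noises, while the remaining copies supply the covariances of the blocks 1 to
  \<open>m\<close>.\<close>

lemma distr_PiM_reverse_split:
  assumes M: "prob_space M" and g: "g \<in> measurable M S"
  shows "(\<lambda>\<omega>. (g (\<omega> m), \<lambda>c\<in>{1..<Suc m}. \<omega> (m - c))) \<in> measurable (PiM {0..m} (\<lambda>_. M)) (S \<Otimes>\<^sub>M PiM {1..<Suc m} (\<lambda>_. M))"
    and "distr (PiM {0..m} (\<lambda>_. M)) (S \<Otimes>\<^sub>M PiM {1..<Suc m} (\<lambda>_. M)) (\<lambda>\<omega>. (g (\<omega> m), \<lambda>c\<in>{1..<Suc m}. \<omega> (m - c))) =
      distr M S g \<Otimes>\<^sub>M PiM {1..<Suc m} (\<lambda>_. M)"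
proof -
  interpret M: prob_space M by fact
  let ?K = "{..<Suc m}" and ?Q = "PiM {1..<Suc m} (\<lambda>_. M)"
  interpret Q: prob_space ?Q by (intro prob_space_PiM M)
  let ?r = "\<lambda>\<omega>. \<lambda>c\<in>?K. \<omega> (m - c)" and ?a = "\<lambda>Y. (g (Y 0), \<lambda>c\<in>{1..<Suc m}. Y c)"
  have rm: "?r \<in> measurable (PiM {0..m} (\<lambda>_. M)) (PiM ?K (\<lambda>_. M))"
    by (intro measurable_restrict measurable_component_singleton) auto
  have am: "?a \<in> measurable (PiM ?K (\<lambda>_. M)) (S \<Otimes>\<^sub>M ?Q)"
    by (intro measurable_Pair measurable_restrict measurable_compose[OF _ g] measurable_component_singleton) auto
  have ar: "?a \<circ> ?r = (\<lambda>\<omega>. (g (\<omega> m), \<lambda>c\<in>{1..<Suc m}. \<omega> (m - c)))"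
    by (auto simp: fun_eq_iff)
  show "(\<lambda>\<omega>. (g (\<omega> m), \<lambda>c\<in>{1..<Suc m}. \<omega> (m - c))) \<in> measurable (PiM {0..m} (\<lambda>_. M)) (S \<Otimes>\<^sub>M ?Q)"
    using measurable_comp[OF rm am] unfolding ar .
  have inj: "inj_on (\<lambda>c. m - c) ?K" by (auto simp: inj_on_def)
  have "distr (PiM {0..m} (\<lambda>_. M)) (PiM ?K (\<lambda>_. M)) ?r = PiM ?K (\<lambda>_. M)"
    by (rule distr_PiM_reindex[OF M inj]) auto
  then have "distr (PiM {0..m} (\<lambda>_. M)) (S \<Otimes>\<^sub>M ?Q) (?a \<circ> ?r) = distr (distr (M \<Otimes>\<^sub>M ?Q) (PiM ?K (\<lambda>_. M)) (\<lambda>z. (snd z)(0 := fst z))) (S \<Otimes>\<^sub>M ?Q) ?a"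
    unfolding PiM_insert_0[OF M] by (simp only: distr_distr[OF am rm, symmetric])
  also have "\<dots> = distr (M \<Otimes>\<^sub>M ?Q) (S \<Otimes>\<^sub>M ?Q) (?a \<circ> (\<lambda>z. (snd z)(0 := fst z)))"
    by (rule distr_distr[OF am PiM_insert_0_measurable])
  also have "\<dots> = distr (M \<Otimes>\<^sub>M ?Q) (S \<Otimes>\<^sub>M ?Q) (\<lambda>(x, X). (g x, X))"
    by (intro distr_cong refl) (auto simp: space_pair_measure space_PiM PiE_def extensional_def restrict_def fun_eq_iff)
  also have "\<dots> = distr M S g \<Otimes>\<^sub>M distr ?Q ?Q (\<lambda>X. X)"
    by (rule pair_measure_distr[symmetric, OF g]) (simp_all add: Q.sigma_finite_measure_axioms del: One_nat_def)
  finally show "distr (PiM {0..m} (\<lambda>_. M)) (S \<Otimes>\<^sub>M ?Q) (\<lambda>\<omega>. (g (\<omega> m), \<lambda>c\<in>{1..<Suc m}. \<omega> (m - c))) = distr M S g \<Otimes>\<^sub>M ?Q"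
    unfolding ar by simp
qed

text \<open>The counterpart for chains of kernels. The path of block 0 and the Gaussian vectors of
  all blocks go into \<open>g\<close>; the paths of the later blocks are left over as an independent
  family, as in \<open>distr_PiM_reverse_split\<close>.\<close>

lemma distr_PiM_pair_split:
  assumes M: "prob_space M" and G: "prob_space G" and g: "g \<in> measurable (M \<Otimes>\<^sub>M PiM {..<Suc m} (\<lambda>_. G)) S"
  shows "(\<lambda>z. (g (fst (z 0), \<lambda>c\<in>{..<Suc m}. snd (z c)), \<lambda>c\<in>{1..<Suc m}. fst (z c))) \<in>
      measurable (PiM {..<Suc m} (\<lambda>_. M \<Otimes>\<^sub>M G)) (S \<Otimes>\<^sub>M PiM {1..<Suc m} (\<lambda>_. M))"
    and "distr (PiM {..<Suc m} (\<lambda>_. M \<Otimes>\<^sub>M G)) (S \<Otimes>\<^sub>M PiM {1..<Suc m} (\<lambda>_. M))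
        (\<lambda>z. (g (fst (z 0), \<lambda>c\<in>{..<Suc m}. snd (z c)), \<lambda>c\<in>{1..<Suc m}. fst (z c))) =
      distr (M \<Otimes>\<^sub>M PiM {..<Suc m} (\<lambda>_. G)) S g \<Otimes>\<^sub>M PiM {1..<Suc m} (\<lambda>_. M)"
proof -
  interpret M: prob_space M by fact
  let ?K = "{..<Suc m}" and ?Q = "PiM {1..<Suc m} (\<lambda>_. M)"
  let ?PM = "PiM ?K (\<lambda>_. M)" and ?PG = "PiM ?K (\<lambda>_. G)" and ?PN = "PiM ?K (\<lambda>_. M \<Otimes>\<^sub>M G)"
  interpret Q: prob_space ?Q by (intro prob_space_PiM M)
  interpret PG: prob_space ?PG by (intro prob_space_PiM G)
  let ?z = "\<lambda>w. \<lambda>c\<in>?K. (fst w c, snd w c)"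
  let ?c = "\<lambda>z. (g (fst (z 0), \<lambda>c\<in>?K. snd (z c)), \<lambda>c\<in>{1..<Suc m}. fst (z c))"
  let ?i = "\<lambda>(y, \<xi>). ((snd y)(0 := fst y), \<xi>)"
  have zm: "?z \<in> measurable (?PM \<Otimes>\<^sub>M ?PG) ?PN"
    by (intro measurable_restrict measurable_Pair measurable_compose[OF measurable_fst measurable_component_singleton]
        measurable_compose[OF measurable_snd measurable_component_singleton])
  have comp: "(\<lambda>z. z c) \<in> measurable ?PN (M \<Otimes>\<^sub>M G)" if "c \<in> ?K" for c
    by (rule measurable_component_singleton[OF that])
  have fs: "(\<lambda>z. fst (z c)) \<in> measurable ?PN M" "(\<lambda>z. snd (z c)) \<in> measurable ?PN G" if "c \<in> ?K" for c
    by (rule measurable_compose[OF comp[OF that] measurable_fst] measurable_compose[OF comp[OF that] measurable_snd])+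
  show cm: "?c \<in> measurable ?PN (S \<Otimes>\<^sub>M ?Q)"
    by (intro measurable_Pair measurable_compose[OF _ g] measurable_restrict fs) auto
  have im: "?i \<in> measurable ((M \<Otimes>\<^sub>M ?Q) \<Otimes>\<^sub>M ?PG) (?PM \<Otimes>\<^sub>M ?PG)"
    unfolding case_prod_unfold
    by (intro measurable_Pair measurable_compose[OF measurable_fst PiM_insert_0_measurable] measurable_snd)
  have "distr (M \<Otimes>\<^sub>M ?Q) ?PM (\<lambda>z. (snd z)(0 := fst z)) \<Otimes>\<^sub>M distr ?PG ?PG (\<lambda>\<xi>. \<xi>) = distr ((M \<Otimes>\<^sub>M ?Q) \<Otimes>\<^sub>M ?PG) (?PM \<Otimes>\<^sub>M ?PG) ?i"
    by (rule pair_measure_distr[OF PiM_insert_0_measurable]) (simp_all add: PG.sigma_finite_measure_axioms)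
  then have I: "?PM \<Otimes>\<^sub>M ?PG = distr ((M \<Otimes>\<^sub>M ?Q) \<Otimes>\<^sub>M ?PG) (?PM \<Otimes>\<^sub>M ?PG) ?i"
    unfolding PiM_insert_0[OF M] distr_id .
  have "distr ?PN (S \<Otimes>\<^sub>M ?Q) ?c = distr (distr (?PM \<Otimes>\<^sub>M ?PG) ?PN ?z) (S \<Otimes>\<^sub>M ?Q) ?c"
    by (simp only: PiM_pair_zip[OF M G finite_lessThan])
  also have "\<dots> = distr (distr ((M \<Otimes>\<^sub>M ?Q) \<Otimes>\<^sub>M ?PG) (?PM \<Otimes>\<^sub>M ?PG) ?i) (S \<Otimes>\<^sub>M ?Q) (?c \<circ> ?z)"
    unfolding I[symmetric] by (rule distr_distr[OF cm zm])
  also have "\<dots> = distr ((M \<Otimes>\<^sub>M ?Q) \<Otimes>\<^sub>M ?PG) (S \<Otimes>\<^sub>M ?Q) (?c \<circ> ?z \<circ> ?i)"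
    by (rule distr_distr[OF measurable_comp[OF zm cm] im])
  also have "\<dots> = distr ((M \<Otimes>\<^sub>M ?Q) \<Otimes>\<^sub>M ?PG) (S \<Otimes>\<^sub>M ?Q) (\<lambda>z. (g (fst (fst z), snd z), snd (fst z)))"
  proof (intro distr_cong refl)
    fix w assume "w \<in> space ((M \<Otimes>\<^sub>M ?Q) \<Otimes>\<^sub>M ?PG)"
    then obtain x X \<xi> where w: "w = ((x, X), \<xi>)" "X \<in> extensional {1..<Suc m}" "\<xi> \<in> extensional ?K"
      by (auto simp: space_pair_measure space_PiM PiE_def)
    have "(\<lambda>c\<in>?K. \<xi> c) = \<xi>" "(\<lambda>c\<in>{1..<Suc m}. X c) = X" using w by (auto intro: extensional_restrict)
    moreover have "(\<lambda>c\<in>?K. snd (?z (?i w) c)) = (\<lambda>c\<in>?K. \<xi> c)"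
      "(\<lambda>c\<in>{1..<Suc m}. fst (?z (?i w) c)) = (\<lambda>c\<in>{1..<Suc m}. X c)"
      by (auto simp: w(1) fun_eq_iff restrict_def)
    ultimately show "(?c \<circ> ?z \<circ> ?i) w = (g (fst (fst w), snd w), snd (fst w))"
      unfolding comp_def by (simp add: w(1))
  qed
  also have "\<dots> = distr (M \<Otimes>\<^sub>M ?PG) S g \<Otimes>\<^sub>M ?Q"
    by (rule distr_pair_middle[OF M Q.prob_space_axioms PG.prob_space_axioms g])
  finally show "distr ?PN (S \<Otimes>\<^sub>M ?Q) ?c = distr (M \<Otimes>\<^sub>M ?PG) S g \<Otimes>\<^sub>M ?Q" .
qed

section \<open>Chains of kernels on the product of copies\<close>

context ou_setting
begin

text \<open>The position along a chain of times and the weighted terminal value, as functions of the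
  scales \<open>e\<close> and the normalised noises \<open>d\<close> of the blocks; \<open>d 0\<close> carries its scale.\<close>

primrec ppos :: "real list \<Rightarrow> real ^ 'n \<Rightarrow> (nat \<Rightarrow> real ^ 'n) \<Rightarrow> (nat \<Rightarrow> real ^ 'n) \<Rightarrow> nat \<Rightarrow> real ^ 'n" where
  "ppos ls x e d 0 = x"
| "ppos ls x e d (Suc c) = decay lam (ls ! Suc c - ls ! c) (ppos ls x e d c) + Fvec lam fx (ls ! c) (ls ! Suc c) +
     (if c = 0 then d 0 else vscale (e c) (d c))"

definition Psi :: "real list \<Rightarrow> real ^ 'n \<Rightarrow> nat \<Rightarrow> (nat \<Rightarrow> real ^ 'n) \<Rightarrow> (nat \<Rightarrow> real ^ 'n) \<Rightarrow> real" where
  "Psi ls x k e d = u0 (ppos ls x e d k) *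
     (\<Prod>c<k. if c = 0 then 1 else Bx (ls ! c) (ppos ls x e d c) \<bullet> decay lam (ls ! Suc c - ls ! c) (vunscale (e c) (d c)))"

lemma ppos_cong:
  assumes "\<And>c. 0 < c \<Longrightarrow> c < k \<Longrightarrow> e c = e' c" "\<And>c. c < k \<Longrightarrow> d c = d' c"
  shows "c \<le> k \<Longrightarrow> ppos ls x e d c = ppos ls x e' d' c"
  by (induction c) (use assms in auto)

lemma Psi_cong:
  assumes "\<And>c. 0 < c \<Longrightarrow> c < k \<Longrightarrow> e c = e' c" "\<And>c. c < k \<Longrightarrow> d c = d' c"
  shows "Psi ls x k e d = Psi ls x k e' d'"
proof -
  have "ppos ls x e d c = ppos ls x e' d' c" if "c \<le> k" for c by (rule ppos_cong[OF assms that])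
  then show ?thesis unfolding Psi_def
    by (intro arg_cong2[where f=times] prod.cong refl arg_cong[where f=u0]) (use assms in auto)
qed

lemma Psi_measurable:
  assumes e: "\<And>c. 0 < c \<Longrightarrow> c < k \<Longrightarrow> (\<lambda>p. e c p) \<in> borel_measurable N"
    and d: "\<And>c. c < k \<Longrightarrow> (\<lambda>p. d c p) \<in> borel_measurable N"
  shows "(\<lambda>p. Psi ls x k (\<lambda>c. e c p) (\<lambda>c. d c p)) \<in> borel_measurable N"
proof -
  have pm: "(\<lambda>p. ppos ls x (\<lambda>c. e c p) (\<lambda>c. d c p) c) \<in> borel_measurable N" if "c \<le> k" for c
    using that
  proof (induction c)
    case (Suc c)
    then have "(\<lambda>p. ppos ls x (\<lambda>c. e c p) (\<lambda>c. d c p) c) \<in> borel_measurable N" "c < k" by auto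
    then show ?case using e[of c] d[of c] unfolding ppos.simps
      by (cases "c = 0") (auto intro!: borel_measurable_add decay_measurable vscale_measurable)
  qed simp
  have "(\<lambda>p. if c = 0 then 1 else Bx (ls ! c) (ppos ls x (\<lambda>c. e c p) (\<lambda>c. d c p) c) \<bullet>
      decay lam (ls ! Suc c - ls ! c) (vunscale (e c p) (d c p))) \<in> borel_measurable N" if "c < k" for c
    using pm[of c] e[of c] d[of c] that
    by (cases "c = 0") (auto intro!: borel_measurable_inner decay_measurable vunscale_measurable K.B_compose)
  then show ?thesis unfolding Psi_def
    by (intro borel_measurable_times borel_measurable_prod measurable_compose[OF pm u0_borel]) auto
qed

lemma pos_ppos:
  "K.pos ls x z k = ppos ls x (\<lambda>c. etaT (ls ! c) (ls ! Suc c) (fst (z c)))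
     (\<lambda>c. if c = 0 then vscale (etaT (ls ! 0) (ls ! 1) (fst (z 0))) (snd (z 0)) else snd (z c)) k"
  by (induction k) (simp_all add: K.X_def)

definition noise :: "real list \<Rightarrow> nat \<Rightarrow> 'a \<Rightarrow> real ^ 'n" where
  "noise ls c \<omega> = (if c = 0 then DW (ls ! 0) (ls ! 1) \<omega>
     else vunscale (etaL (ls ! c) (ls ! Suc c) \<omega>) (DW (ls ! c) (ls ! Suc c) \<omega>))"

lemma noise_measurable:
  assumes ch: "K.chain ls" and len: "Suc c < length ls"
  shows "noise ls c \<in> borel_measurable M"
proof -
  note c = K.chain_nth[OF ch len]
  have m: "DW (ls ! c) (ls ! Suc c) \<in> borel_measurable M" "etaL (ls ! c) (ls ! Suc c) \<in> borel_measurable M"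
    by (rule DW_measurable[OF c(1,2)] etaL_measurable[OF c(1,2)])+
  show ?thesis
  proof (cases "c = 0")
    case True
    then show ?thesis using m(1) unfolding noise_def[abs_def] by simp
  next
    case False
    then show ?thesis using vunscale_measurable[OF m(2,1)] unfolding noise_def[abs_def] by simp
  qed
qed

text \<open>Equality of laws follows from \<open>normalised_block_law\<close> by inserting
  indicators of measurable sets.\<close>

lemma noise_law:
  assumes ch: "K.chain ls" and len: "length ls = Suc (Suc m)"
  defines "S \<equiv> PiM {..<Suc m} (\<lambda>_. borel) :: (nat \<Rightarrow> real ^ 'n) measure"
    and "g \<equiv> (\<lambda>z. \<lambda>c\<in>{..<Suc m}. if c = 0 then vscale (etaT (ls ! 0) (ls ! 1) (fst z)) (snd z 0) else snd z c)"
  shows "(\<lambda>\<omega>. \<lambda>c\<in>{..<Suc m}. noise ls c \<omega>) \<in> measurable M S"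
    and "g \<in> measurable (M \<Otimes>\<^sub>M gauss_power (Suc m)) S"
    and "distr M S (\<lambda>\<omega>. \<lambda>c\<in>{..<Suc m}. noise ls c \<omega>) = distr (M \<Otimes>\<^sub>M gauss_power (Suc m)) S g"
proof -
  let ?G = "gauss_power (Suc m) :: (nat \<Rightarrow> real ^ 'n) measure"
  show nm: "(\<lambda>\<omega>. \<lambda>c\<in>{..<Suc m}. noise ls c \<omega>) \<in> measurable M S"
    unfolding S_def by (intro measurable_restrict noise_measurable[OF ch]) (simp add: len)
  have cm: "(\<lambda>z. snd z c) \<in> borel_measurable (M \<Otimes>\<^sub>M ?G)" if "c < Suc m" for c
    using measurable_compose[OF measurable_snd measurable_component_singleton[of c "{..<Suc m}" "\<lambda>_. gauss"]] that
    by (simp cong: measurable_cong_sets)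
  have fm: "(\<lambda>z. etaT (ls ! 0) (ls ! 1) (fst z)) \<in> borel_measurable (M \<Otimes>\<^sub>M ?G)"
    by (rule measurable_compose[OF measurable_fst etaT_measurable])
  have m0: "(\<lambda>z. vscale (etaT (ls ! 0) (ls ! 1) (fst z)) (snd z 0)) \<in> borel_measurable (M \<Otimes>\<^sub>M ?G)"
    by (rule vscale_measurable[OF fm cm]) simp
  show gm: "g \<in> measurable (M \<Otimes>\<^sub>M ?G) S"
    unfolding S_def g_def
  proof (intro measurable_restrict)
    fix c assume "c \<in> {..<Suc m}"
    then show "(\<lambda>z. if c = 0 then vscale (etaT (ls ! 0) (ls ! 1) (fst z)) (snd z 0) else snd z c) \<in> borel_measurable (M \<Otimes>\<^sub>M ?G)"
      using m0 cm[of c] by (cases "c = 0") simp_all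
  qed
  interpret G: prob_space ?G by (rule prob_space_gauss_power)
  interpret P: pair_prob_space M ?G ..
  \<comment> \<open>Extended by 0 beyond the list, because \<open>normalised_block_law\<close> asks
    for nonnegative times at all indices and for strict increase inside the blocks only.\<close>
  define \<tau> where "\<tau> c = (if c \<le> Suc m then ls ! c else 0)" for c
  have n: "ls ! c \<in> set ls" if "c \<le> Suc m" for c using that len by simp
  have t0: "0 \<le> \<tau> c" for c using n[of c] ch by (auto simp: \<tau>_def K.chain_def)
  have t1: "\<tau> c < \<tau> (Suc c)" if "c < Suc m" for c
    using K.chain_nth(2)[OF ch, of c] that len by (simp add: \<tau>_def)
  have eq1: "(\<lambda>c\<in>{..<Suc m}. noise ls c \<omega>) = (\<lambda>c\<in>{..<Suc m}. if c = 0 then DW (\<tau> 0) (\<tau> 1) \<omega> else vunscale (etaL (\<tau> c) (\<tau> (Suc c)) \<omega>) (DW (\<tau> c) (\<tau> (Suc c)) \<omega>))" for \<omega>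
    by (auto simp: noise_def \<tau>_def fun_eq_iff restrict_def)
  have \<tau>01: "\<tau> 0 = ls ! 0" "\<tau> 1 = ls ! 1" by (simp_all add: \<tau>_def)
  have eq2: "g z = (\<lambda>c\<in>{..<Suc m}. if c = 0 then vscale (etaT (\<tau> 0) (\<tau> 1) (fst z)) (snd z 0) else snd z c)" for z
    unfolding g_def \<tau>01 ..
  show "distr M S (\<lambda>\<omega>. \<lambda>c\<in>{..<Suc m}. noise ls c \<omega>) = distr (M \<Otimes>\<^sub>M ?G) S g"
  proof (rule measure_eqI)
    fix A assume "A \<in> sets (distr M S (\<lambda>\<omega>. \<lambda>c\<in>{..<Suc m}. noise ls c \<omega>))"
    then have A: "A \<in> sets S" by simp
    interpret D1: prob_space "distr M S (\<lambda>\<omega>. \<lambda>c\<in>{..<Suc m}. noise ls c \<omega>)" by (rule prob_space_distr[OF nm])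
    interpret D2: prob_space "distr (M \<Otimes>\<^sub>M ?G) S g" by (rule P.P.prob_space_distr[OF gm])
    have i: "(indicator A :: _ \<Rightarrow> real) \<in> borel_measurable S" using A by simp
    have "D1.prob A = (LINT y|distr M S (\<lambda>\<omega>. \<lambda>c\<in>{..<Suc m}. noise ls c \<omega>). indicator A y)"
      using A sets.sets_into_space[OF A] by (simp add: Int_absorb2)
    also have "\<dots> = (LINT \<omega>|M. indicator A (\<lambda>c\<in>{..<Suc m}. noise ls c \<omega>))"
      by (rule integral_distr[OF nm i])
    also have "\<dots> = (LINT z|(M \<Otimes>\<^sub>M ?G). indicator A (g z))"
      unfolding eq1 eq2 by (rule normalised_block_law[of \<tau> "Suc m" "indicator A", OF t0 t1]) (use i in \<open>auto simp: S_def\<close>)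
    also have "\<dots> = (LINT y|distr (M \<Otimes>\<^sub>M ?G) S g. indicator A y)"
      by (rule integral_distr[OF gm i, symmetric])
    also have "\<dots> = D2.prob A"
      using A sets.sets_into_space[OF A] by (simp add: Int_absorb2)
    finally show "emeasure (distr M S (\<lambda>\<omega>. \<lambda>c\<in>{..<Suc m}. noise ls c \<omega>)) A = emeasure (distr (M \<Otimes>\<^sub>M ?G) S g) A"
      by (simp add: D1.emeasure_eq_measure D2.emeasure_eq_measure)
  qed simp
qed

text \<open>Both sides are integrals of the same function \<open>H\<close> against the product of a
  joint law of noises and \<open>m\<close> further copies of \<open>M\<close>. The two splitting
  lemmas bring them into this form, and \<open>noise_law\<close> says that the joint laws of the
  noises coincide.\<close>

lemma chain_op_eq:
  assumes ch: "K.chain ls" and len: "length ls = Suc (Suc m)"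
  shows "K.chain_op ls x u0 = (LINT \<omega>|PiM {0..m} (\<lambda>_. M).
    Psi ls x (Suc m) (\<lambda>c. etaT (ls ! c) (ls ! Suc c) (\<omega> (m - c))) (\<lambda>c. noise ls c (\<omega> m)))"
proof -
  let ?K = "{..<Suc m}" and ?Q = "PiM {1..<Suc m} (\<lambda>_. M)"
  let ?G = "gauss_power (Suc m) :: (nat \<Rightarrow> real ^ 'n) measure"
  let ?S = "PiM ?K (\<lambda>_. borel) :: (nat \<Rightarrow> real ^ 'n) measure"
  let ?g = "\<lambda>z. \<lambda>c\<in>?K. if c = 0 then vscale (etaT (ls ! 0) (ls ! 1) (fst z)) (snd z 0) else snd z c"
  define H where "H p = Psi ls x (Suc m) (\<lambda>c. etaT (ls ! c) (ls ! Suc c) (snd p c)) (\<lambda>c. fst p c)"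
    for p :: "(nat \<Rightarrow> real ^ 'n) \<times> (nat \<Rightarrow> 'a)"
  have Hm: "H \<in> borel_measurable (?S \<Otimes>\<^sub>M ?Q)"
    unfolding H_def
  proof (rule Psi_measurable)
    fix c assume c: "c < Suc m"
    then have 1: "(\<lambda>d. d c) \<in> borel_measurable ?S" by (intro measurable_component_singleton) simp
    show "(\<lambda>p. fst p c) \<in> borel_measurable (?S \<Otimes>\<^sub>M ?Q)" by (rule measurable_compose[OF measurable_fst 1])
    assume "0 < c"
    then have 2: "(\<lambda>X. X c) \<in> measurable ?Q M" using c by (intro measurable_component_singleton) simp
    show "(\<lambda>p. etaT (ls ! c) (ls ! Suc c) (snd p c)) \<in> borel_measurable (?S \<Otimes>\<^sub>M ?Q)"
      by (rule measurable_compose[OF measurable_compose[OF measurable_snd 2] etaT_measurable])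
  qed
  note law = noise_law[OF ch len]
  note A = distr_PiM_reverse_split[where m=m, OF prob law(1)]
  note B = distr_PiM_pair_split[where m=m, OF prob prob_space_gauss law(2)]
  have "K.chain_op ls x u0 = (LINT z|PiM ?K (\<lambda>_. K.N). H (?g (fst (z 0), \<lambda>c\<in>?K. snd (z c)), \<lambda>c\<in>{1..<Suc m}. fst (z c)))"
    unfolding K.chain_op_def Let_def len diff_Suc_1
  proof (rule Bochner_Integration.integral_cong[OF refl])
    fix z :: "nat \<Rightarrow> 'a \<times> (real ^ 'n)"
    let ?e = "\<lambda>c. etaT (ls ! c) (ls ! Suc c) (fst (z c))"
    let ?d = "\<lambda>c. if c = 0 then vscale (etaT (ls ! 0) (ls ! 1) (fst (z 0))) (snd (z 0)) else snd (z c)"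
    have "u0 (K.pos ls x z (Suc m)) * K.wgt ls x z (Suc m) = Psi ls x (Suc m) ?e ?d"
      unfolding Psi_def K.wgt_def pos_ppos K.wgt1_def K.wt_def by (intro arg_cong2[where f=times] prod.cong refl) auto
    also have "\<dots> = H (?g (fst (z 0), \<lambda>c\<in>?K. snd (z c)), \<lambda>c\<in>{1..<Suc m}. fst (z c))"
      unfolding H_def by (rule Psi_cong) auto
    finally show "u0 (K.pos ls x z (Suc m)) * K.wgt ls x z (Suc m) =
      H (?g (fst (z 0), \<lambda>c\<in>?K. snd (z c)), \<lambda>c\<in>{1..<Suc m}. fst (z c))" .
  qed
  also have "\<dots> = (LINT p|(distr (M \<Otimes>\<^sub>M ?G) ?S ?g \<Otimes>\<^sub>M ?Q). H p)"
    unfolding B(2)[symmetric] by (rule integral_distr[OF B(1) Hm, symmetric])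
  also have "\<dots> = (LINT p|distr (PiM {0..m} (\<lambda>_. M)) (?S \<Otimes>\<^sub>M ?Q) (\<lambda>\<omega>. (\<lambda>c\<in>?K. noise ls c (\<omega> m), \<lambda>c\<in>{1..<Suc m}. \<omega> (m - c))). H p)"
    unfolding law(3)[symmetric] A(2) ..
  also have "\<dots> = (LINT \<omega>|PiM {0..m} (\<lambda>_. M). H (\<lambda>c\<in>?K. noise ls c (\<omega> m), \<lambda>c\<in>{1..<Suc m}. \<omega> (m - c)))"
    by (rule integral_distr[OF A(1) Hm])
  also have "\<dots> = (LINT \<omega>|PiM {0..m} (\<lambda>_. M). Psi ls x (Suc m) (\<lambda>c. etaT (ls ! c) (ls ! Suc c) (\<omega> (m - c))) (\<lambda>c. noise ls c (\<omega> m)))"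
    unfolding H_def by (intro Bochner_Integration.integral_cong refl Psi_cong) auto
  finally show ?thesis .
qed

end

section \<open>The integrand\<close>

lemma decay_add: "decay lam h (y + z) = decay lam h y + decay lam h z"
  by (simp add: decay_def vec_eq_iff distrib_left)

lemma decay_decay: "decay lam h (decay lam h' y) = decay lam (h + h') y"
proof -
  have "exp (- (lam $ i) * (h + h')) = exp (- (lam $ i) * h) * exp (- (lam $ i) * h')" for i
    by (simp only: distrib_left exp_add)
  then show ?thesis unfolding decay_def by (simp only: vec_eq_iff vec_lambda_beta mult.assoc) simp
qed

lemma decay_0: "decay lam 0 y = y"
  by (simp add: decay_def vec_eq_iff)

lemma decay_sum: "finite I \<Longrightarrow> decay lam h (\<Sum>c\<in>I. v c) = (\<Sum>c\<in>I. decay lam h (v c))"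
proof (induction rule: finite_induct)
  case empty
  then show ?case by (simp add: decay_def vec_eq_iff)
qed (simp add: decay_add)

text \<open>Diagonal maps are self-adjoint and commute. In the formula the exponential and the
  inverse root act on \<open>B\<close>; in the weights of the chain they act on the noise.\<close>

lemma vunscale_decay_inner:
  fixes y :: "real ^ 'n::finite"
  shows "vunscale a (decay lam h y) \<bullet> d = y \<bullet> decay lam h (vunscale a d)"
  by (simp add: vunscale_def decay_def inner_vec_def mult_ac)

lemma matrix_vector_mult_measurable [measurable (raw)]:
  fixes A :: "'a \<Rightarrow> real ^ 'n::finite ^ 'm::finite"
  assumes A: "A \<in> borel_measurable M" and v: "v \<in> borel_measurable M"
  shows "(\<lambda>x. A x *v v x) \<in> borel_measurable M"
proof (rule borel_measurable_vecI)
  fix i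
  have "(\<lambda>P :: real ^ 'n ^ 'm. P $ i) \<in> borel_measurable borel"
    by (intro borel_measurable_continuous_onI continuous_intros)
  from measurable_compose[OF A this] have [measurable]: "(\<lambda>x. A x $ i) \<in> borel_measurable M" .
  have "(\<lambda>x. \<Sum>j\<in>UNIV. A x $ i $ j * v x $ j) \<in> borel_measurable M"
    by (intro borel_measurable_sum borel_measurable_times measurable_vec_nth v) measurable
  then show "(\<lambda>x. (A x *v v x) $ i) \<in> borel_measurable M"
    by (simp add: matrix_vector_mult_def)
qed

lemma diag_measurable [measurable]: "diag \<in> borel_measurable (borel :: (real ^ 'n::finite) measure)"
  by (intro borel_measurable_continuous_onI linear_continuous_on bounded_linear_diag)

lemma minvsqrt_diag:
  fixes a :: "real ^ 'n::finite"
  assumes "\<And>i. 0 < a $ i"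
  shows "minvsqrt (diag a) = diag (\<chi> i. 1 / sqrt (a $ i))"
  unfolding matrix_eq using assms by (simp add: minvsqrt_mult_vec diag_mult_vec vunscale_def)

context ou_setting
begin

lemma ppos_Suc_sum:
  "ppos ls x e d (Suc m) = (\<Sum>c<m. decay lam (ls ! Suc m - ls ! Suc (Suc c))
      (Fvec lam fx (ls ! Suc c) (ls ! Suc (Suc c)) + vscale (e (Suc c)) (d (Suc c)))) + decay lam (ls ! Suc m - ls ! 1) (ppos ls x e d 1)"
proof (induction m)
  case 0
  then show ?case by (simp add: decay_0)
next
  case (Suc m)
  show ?case
    unfolding ppos.simps(2)[of ls x e d "Suc m"] Suc.IH
    by (simp add: decay_add decay_decay decay_0 decay_sum)
qed

text \<open>The formula counts blocks from the end: its block \<open>k\<close> runs from time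
  \<open>n + 2 - k\<close> to time \<open>n + 3 - k\<close> of the chain. The sum results from
  solving the linear recursion and substituting \<open>c = n + 1 - k\<close>.\<close>

lemma ppos_sum:
  assumes "j \<le> n + 1"
  shows "ppos ls x e d (n + 2 - j) = (\<Sum>k = j + 1..n + 1. decay lam (ls ! (n + 2 - j) - ls ! (n + 3 - k))
      (Fvec lam fx (ls ! (n + 2 - k)) (ls ! (n + 3 - k)) + vscale (e (n + 2 - k)) (d (n + 2 - k)))) +
    decay lam (ls ! (n + 2 - j) - ls ! 1) (ppos ls x e d 1)"
proof -
  have m: "n + 2 - j = Suc (n + 1 - j)" using assms by simp
  have "(\<Sum>c<n + 1 - j. decay lam (ls ! Suc (n + 1 - j) - ls ! Suc (Suc c))
      (Fvec lam fx (ls ! Suc c) (ls ! Suc (Suc c)) + vscale (e (Suc c)) (d (Suc c)))) =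
    (\<Sum>k = j + 1..n + 1. decay lam (ls ! Suc (n + 1 - j) - ls ! (n + 3 - k))
      (Fvec lam fx (ls ! (n + 2 - k)) (ls ! (n + 3 - k)) + vscale (e (n + 2 - k)) (d (n + 2 - k))))"
    by (rule sum.reindex_bij_witness[of _ "\<lambda>k. n + 1 - k" "\<lambda>c. n + 1 - c"])
      (use assms in \<open>auto simp: Suc_diff_le\<close>)
  then show ?thesis unfolding m ppos_Suc_sum by simp
qed

lemma IL_AE:
  assumes "0 \<le> u" "u < r"
  shows "AE \<omega> in M. IL L (- diag lam) Q u r \<omega> = diag (etaT u r \<omega>)"
  using AE_good
proof eventually_elim
  case (elim \<omega>)
  then show ?case using IL_eq[OF elim assms Q] etaT_eq[OF elim, of u r] assms by simp
qed

lemma IL_measurable: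
  assumes u: "0 \<le> u" "u < r" "r \<le> T"
  shows "(\<lambda>\<omega>. msqrt (IL L (- diag lam) Q u r \<omega>)) \<in> borel_measurable M"
    and "(\<lambda>\<omega>. minvsqrt (IL L (- diag lam) Q u r \<omega>)) \<in> borel_measurable M"
proof -
  note [measurable] = etaT_measurable[of u r]
  have 1: "(\<lambda>\<omega>. diag (\<chi> i. sqrt (etaT u r \<omega> $ i))) \<in> borel_measurable M"
    by (intro measurable_compose[OF _ diag_measurable] borel_measurable_vecI) (simp, measurable)
  have 2: "(\<lambda>\<omega>. diag (\<chi> i. 1 / sqrt (etaT u r \<omega> $ i))) \<in> borel_measurable M"
    by (intro measurable_compose[OF _ diag_measurable] borel_measurable_vecI) (simp, measurable)
  show "(\<lambda>\<omega>. msqrt (IL L (- diag lam) Q u r \<omega>)) \<in> borel_measurable M"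
  proof (rule complete_measurable_AE_eq[OF compl 1])
    show "AE \<omega> in M. msqrt (IL L (- diag lam) Q u r \<omega>) = diag (\<chi> i. sqrt (etaT u r \<omega> $ i))"
      using IL_AE[OF u(1,2)] K.eta_pos[OF u] by eventually_elim (simp add: msqrt_diag less_imp_le)
  qed auto
  show "(\<lambda>\<omega>. minvsqrt (IL L (- diag lam) Q u r \<omega>)) \<in> borel_measurable M"
  proof (rule complete_measurable_AE_eq[OF compl 2])
    show "AE \<omega> in M. minvsqrt (IL L (- diag lam) Q u r \<omega>) = diag (\<chi> i. 1 / sqrt (etaT u r \<omega> $ i))"
      using IL_AE[OF u(1,2)] K.eta_pos[OF u] by eventually_elim (simp add: minvsqrt_diag)
  qed auto
qed

text \<open>Off a null set, on every copy the covariance matrices are diagonal with positive entries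
  and the increments of the solution are the noises \<open>DW\<close>. Then each
  \<open>\<Delta>\<close> is a normalised noise, both sums are positions along the chain, and the
  integrand is \<open>Psi\<close>.\<close>

lemma integrand_eq:
  fixes n :: nat
  assumes ch: "K.chain ls" and len: "length ls = n + 3" and ls: "ls ! 0 = s" "ls ! (n + 2) = t"
    and A: "A = - diag lam"
    and \<tau>: "\<tau> = (\<lambda>k. ls ! k)"
    and I: "I = (\<lambda>j. IL L A Q (\<tau> (n + 2 - j)) (\<tau> (n + 3 - j)))"
    and F: "F = (\<lambda>j. Fint A f (\<tau> (n + 2 - j)) (\<tau> (n + 3 - j)))"
    and \<Delta>: "\<Delta> = (\<lambda>j \<omega>. minvsqrt (I j \<omega>) *v
                 (Z s x (\<tau> (n + 3 - j)) \<omega>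
                  - mexp ((\<tau> (n + 3 - j) - \<tau> (n + 2 - j)) *\<^sub>R A) *v Z s x (\<tau> (n + 2 - j)) \<omega>
                  - F j))"
    and Y: "Y = (\<lambda>\<omega>. (\<Sum>j = 1..n + 1. mexp ((t - \<tau> (n + 3 - j)) *\<^sub>R A) *v
                       (F j + msqrt (I j (\<omega> (j - 1))) *v \<Delta> j (\<omega> (n + 1))))
                 + mexp ((t - \<tau> 1) *\<^sub>R A) *v Z s x (\<tau> 1) (\<omega> (n + 1)))"
    and Yj: "Yj = (\<lambda>j \<omega>. (\<Sum>k = j + 1..n + 1. mexp ((\<tau> (n + 2 - j) - \<tau> (n + 3 - k)) *\<^sub>R A) *v
                       (msqrt (I k (\<omega> (k - 1))) *v \<Delta> k (\<omega> (n + 1)) + F k))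
                 + mexp ((\<tau> (n + 2 - j) - \<tau> 1) *\<^sub>R A) *v Z s x (\<tau> 1) (\<omega> (n + 1)))"
  shows "K.chain_op ls x u0 = (LINT \<omega>|Pi\<^sub>M {0..n + 1} (\<lambda>_. M).
           u0 (Y \<omega>) *
           (\<Prod>j = 1..n + 1.
              (minvsqrt (I j (\<omega> (j - 1))) *v
                 (mexp ((\<tau> (n + 3 - j) - \<tau> (n + 2 - j)) *\<^sub>R A) *v B (\<tau> (n + 2 - j)) (Yj j \<omega>)))
              \<bullet> \<Delta> j (\<omega> (n + 1))))"
proof -
  let ?PM = "Pi\<^sub>M {0..n + 1} (\<lambda>_. M)"
  let ?eta = "\<lambda>c. etaT (ls ! c) (ls ! Suc c)"
  have nth: "0 \<le> ls ! c" "ls ! c < ls ! Suc c" "ls ! Suc c \<le> T" if "c < n + 2" for c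
    using K.chain_nth[OF ch, of c] that len by auto
  have s0: "0 \<le> s" using nth(1)[of 0] ls by simp
  have s1: "s \<le> ls ! c" "ls ! c \<le> T" if "c < n + 3" for c
  proof -
    have "ls ! 0 \<le> ls ! c"
      using ch that len sorted_wrt_nth_less[of "(<)" ls 0 c] unfolding K.chain_def by (cases "c = 0") (auto simp: less_imp_le)
    then show "s \<le> ls ! c" using ls by simp
    show "ls ! c \<le> T" using ch nth_mem[of c ls] that len unfolding K.chain_def by auto
  qed
  have jn: "n + 2 - j < n + 2" "n + 3 - j = Suc (n + 2 - j)" "n + 2 - j \<noteq> 0" if "j \<in> {1..n + 1}" for j
    using that by auto
  have F': "F j = Fvec lam fx (ls ! (n + 2 - j)) (ls ! (n + 3 - j))" if "j \<in> {1..n + 1}" for j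
    using nth[OF jn(1)[OF that]] jn(2)[OF that] unfolding F A \<tau> Fint_eq by (simp add: Fvec_fx)
  have Zm: "Z s x (\<tau> c) \<in> borel_measurable M" if "c < n + 3" for c
    unfolding \<tau> by (rule solution_measurable[OF s0 s1[OF that]])
  have Im: "(\<lambda>\<omega>. msqrt (I j \<omega>)) \<in> borel_measurable M" "(\<lambda>\<omega>. minvsqrt (I j \<omega>)) \<in> borel_measurable M"
    if "j \<in> {1..n + 1}" for j
    using IL_measurable[OF nth[OF jn(1)[OF that]]] unfolding I A \<tau> jn(2)[OF that] by auto
  have \<Delta>m: "\<Delta> j \<in> borel_measurable M" if "j \<in> {1..n + 1}" for j
    unfolding \<Delta>
    by (intro matrix_vector_mult_measurable Im[OF that] borel_measurable_diff borel_measurable_const Zm) (use that in auto)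
  have cm: "(\<lambda>\<omega>. \<omega> k) \<in> measurable ?PM M" if "k \<le> n + 1" for k
    using that by (intro measurable_component_singleton) auto
  have \<Delta>m': "(\<lambda>\<omega>. \<Delta> j (\<omega> (n + 1))) \<in> borel_measurable ?PM" if "j \<in> {1..n + 1}" for j
    by (rule measurable_compose[OF cm \<Delta>m[OF that]]) simp
  have Im': "(\<lambda>\<omega>. msqrt (I j (\<omega> (j - 1)))) \<in> borel_measurable ?PM" "(\<lambda>\<omega>. minvsqrt (I j (\<omega> (j - 1)))) \<in> borel_measurable ?PM"
    if "j \<in> {1..n + 1}" for j
    by (rule measurable_compose[OF cm Im(1)[OF that]] measurable_compose[OF cm Im(2)[OF that]]; use that in auto)+
  have Zm': "(\<lambda>\<omega>. Z s x (\<tau> 1) (\<omega> (n + 1))) \<in> borel_measurable ?PM"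
    by (rule measurable_compose[OF cm Zm]) auto
  have Ym: "Y \<in> borel_measurable ?PM"
    unfolding Y by (intro borel_measurable_add borel_measurable_sum matrix_vector_mult_measurable borel_measurable_const Im' \<Delta>m' Zm')
  have Yjm: "Yj j \<in> borel_measurable ?PM" for j
    unfolding Yj by (intro borel_measurable_add borel_measurable_sum matrix_vector_mult_measurable borel_measurable_const Im' \<Delta>m' Zm') auto
  have Bm: "(\<lambda>\<omega>. B (\<tau> (n + 2 - j)) (Yj j \<omega>)) \<in> borel_measurable ?PM" if "j \<in> {1..n + 1}" for j
  proof -
    have eq: "B (\<tau> (n + 2 - j)) y = Bx (\<tau> (n + 2 - j)) y" for y
      using nth[OF jn(1)[OF that]] by (auto simp: Bx_def \<tau>)
    show ?thesis unfolding eq by (rule K.B_compose[OF borel_measurable_const Yjm])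
  qed
  define e where "e \<omega> c = ?eta c (\<omega> (n + 1 - c))" for \<omega> c
  define d where "d \<omega> c = noise ls c (\<omega> (n + 1))" for \<omega> c
  \<comment> \<open>All almost sure identities are gathered in one event of a single copy; as there
    are finitely many copies, it holds on all of them simultaneously.\<close>
  define ok where "ok \<omega> \<longleftrightarrow> Z s x s \<omega> = x \<and> (\<forall>c\<in>{..<n + 2}. IL L A Q (ls ! c) (ls ! Suc c) \<omega> = diag (?eta c \<omega>) \<and>
    (\<forall>i. 0 < ?eta c \<omega> $ i) \<and> ?eta c \<omega> = etaL (ls ! c) (ls ! Suc c) \<omega> \<and>
    Z s x (ls ! Suc c) \<omega> - decay lam (ls ! Suc c - ls ! c) (Z s x (ls ! c) \<omega>) - Fvec lam fx (ls ! c) (ls ! Suc c) =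
      DW (ls ! c) (ls ! Suc c) \<omega>)" for \<omega>
  have "AE \<omega> in M. ok \<omega>"
  proof -
    have "AE \<omega> in M. \<forall>c\<in>{..<n + 2}. IL L A Q (ls ! c) (ls ! Suc c) \<omega> = diag (?eta c \<omega>) \<and>
      (\<forall>i. 0 < ?eta c \<omega> $ i) \<and> ?eta c \<omega> = etaL (ls ! c) (ls ! Suc c) \<omega> \<and>
      Z s x (ls ! Suc c) \<omega> - decay lam (ls ! Suc c - ls ! c) (Z s x (ls ! c) \<omega>) - Fvec lam fx (ls ! c) (ls ! Suc c) =
      DW (ls ! c) (ls ! Suc c) \<omega>"
    proof (rule AE_finite_allI)
      fix c assume "c \<in> {..<n + 2}"
      then have c: "c < n + 2" by simp
      note c' = nth[OF c]
      from IL_AE[OF c'(1,2)] K.eta_pos[OF c'] etaT_AE[OF c'(1,2)] solution_increment[OF s0 s1(1) c'(2,3), of x] c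
      show "AE \<omega> in M. IL L A Q (ls ! c) (ls ! Suc c) \<omega> = diag (?eta c \<omega>) \<and>
        (\<forall>i. 0 < ?eta c \<omega> $ i) \<and> ?eta c \<omega> = etaL (ls ! c) (ls ! Suc c) \<omega> \<and>
        Z s x (ls ! Suc c) \<omega> - decay lam (ls ! Suc c - ls ! c) (Z s x (ls ! c) \<omega>) - Fvec lam fx (ls ! c) (ls ! Suc c) =
        DW (ls ! c) (ls ! Suc c) \<omega>" unfolding A by auto
    qed simp
    moreover have "AE \<omega> in M. Z s x s \<omega> = x"
      using s1[of 0] ls by (intro solution_initial[OF s0]) auto
    ultimately show ?thesis unfolding ok_def by auto
  qed
  then have "AE \<omega> in ?PM. ok (\<omega> k)" if "k \<in> {0..n + 1}" for k
    by (rule AE_PiM_component[OF prob that])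
  then have ok: "AE \<omega> in ?PM. \<forall>k\<in>{0..n + 1}. ok (\<omega> k)" by (intro AE_finite_allI) auto
  have "(LINT \<omega>|?PM. u0 (Y \<omega>) * (\<Prod>j = 1..n + 1. (minvsqrt (I j (\<omega> (j - 1))) *v
                 (mexp ((\<tau> (n + 3 - j) - \<tau> (n + 2 - j)) *\<^sub>R A) *v B (\<tau> (n + 2 - j)) (Yj j \<omega>))) \<bullet> \<Delta> j (\<omega> (n + 1)))) =
      (LINT \<omega>|?PM. Psi ls x (Suc (n + 1)) (e \<omega>) (d \<omega>))"
  proof (rule integral_cong_AE)
    show "(\<lambda>\<omega>. u0 (Y \<omega>) * (\<Prod>j = 1..n + 1. (minvsqrt (I j (\<omega> (j - 1))) *v
                 (mexp ((\<tau> (n + 3 - j) - \<tau> (n + 2 - j)) *\<^sub>R A) *v B (\<tau> (n + 2 - j)) (Yj j \<omega>))) \<bullet> \<Delta> j (\<omega> (n + 1)))) \<in> borel_measurable ?PM"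
      by (intro borel_measurable_times measurable_compose[OF Ym u0_borel] borel_measurable_prod borel_measurable_inner
          matrix_vector_mult_measurable Im' borel_measurable_const Bm \<Delta>m')
    show "(\<lambda>\<omega>. Psi ls x (Suc (n + 1)) (e \<omega>) (d \<omega>)) \<in> borel_measurable ?PM"
      unfolding e_def d_def
    proof (rule Psi_measurable)
      fix c assume c: "c < Suc (n + 1)"
      show "(\<lambda>\<omega>. ?eta c (\<omega> (n + 1 - c))) \<in> borel_measurable ?PM"
        by (rule measurable_compose[OF cm etaT_measurable]) simp
      show "(\<lambda>\<omega>. noise ls c (\<omega> (n + 1))) \<in> borel_measurable ?PM"
        by (rule measurable_compose[OF cm noise_measurable[OF ch]]) (use c len in auto)
    qed
    show "AE \<omega> in ?PM. u0 (Y \<omega>) * (\<Prod>j = 1..n + 1. (minvsqrt (I j (\<omega> (j - 1))) *v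
                 (mexp ((\<tau> (n + 3 - j) - \<tau> (n + 2 - j)) *\<^sub>R A) *v B (\<tau> (n + 2 - j)) (Yj j \<omega>))) \<bullet> \<Delta> j (\<omega> (n + 1))) =
       Psi ls x (Suc (n + 1)) (e \<omega>) (d \<omega>)"
      using ok
    proof eventually_elim
      case (elim \<omega>)
      have okk: "ok (\<omega> k)" if "k \<le> n + 1" for k using elim that by simp
      have pos: "0 < ?eta c (\<omega> k) $ i" and Ieq: "IL L A Q (ls ! c) (ls ! Suc c) (\<omega> k) = diag (?eta c (\<omega> k))"
        and eta: "?eta c (\<omega> k) = etaL (ls ! c) (ls ! Suc c) (\<omega> k)"
        and incr: "Z s x (ls ! Suc c) (\<omega> k) - decay lam (ls ! Suc c - ls ! c) (Z s x (ls ! c) (\<omega> k)) - Fvec lam fx (ls ! c) (ls ! Suc c) =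
          DW (ls ! c) (ls ! Suc c) (\<omega> k)"
        if "c < n + 2" "k \<le> n + 1" for c k i
        using okk[OF that(2)] that(1) unfolding ok_def Ball_def lessThan_iff by blast+
      have sq: "msqrt (I j (\<omega> k)) *v y = vscale (?eta (n + 2 - j) (\<omega> k)) y"
        and isq: "minvsqrt (I j (\<omega> k)) *v y = vunscale (?eta (n + 2 - j) (\<omega> k)) y"
        if "j \<in> {1..n + 1}" "k \<le> n + 1" for j k y
        using pos[OF jn(1)[OF that(1)] that(2)] unfolding I \<tau> jn(2)[OF that(1)] Ieq[OF jn(1)[OF that(1)] that(2)]
        by (simp_all add: msqrt_mult_vec minvsqrt_mult_vec less_imp_le)
      have D: "\<Delta> j (\<omega> (n + 1)) = d \<omega> (n + 2 - j)" if j: "j \<in> {1..n + 1}" for j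
        unfolding \<Delta> isq[OF j order_refl] F'[OF j] unfolding A mexp_decay \<tau> jn(2)[OF j] incr[OF jn(1)[OF j] order_refl]
          eta[OF jn(1)[OF j] order_refl] d_def noise_def
        using jn(3)[OF j] by simp
      \<comment> \<open>Block \<open>n + 2 - j\<close> of the chain reads copy
        \<open>n + 1 - (n + 2 - j)\<close>, which is \<open>j - 1\<close>, as the formula
        demands.\<close>
      have ek: "?eta (n + 2 - j) (\<omega> (j - 1)) = e \<omega> (n + 2 - j)" if "j \<in> {1..n + 1}" for j
      proof -
        have "n + 1 - (n + 2 - j) = j - 1" using that by auto
        then show ?thesis unfolding e_def by simp
      qed
      have Z1: "Z s x (ls ! 1) (\<omega> (n + 1)) = ppos ls x (e \<omega>) (d \<omega>) 1"
      proof -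
        have "Z s x s (\<omega> (n + 1)) = x" using bspec[OF elim, of "n + 1"] unfolding ok_def by simp
        then have "Z s x (ls ! 1) (\<omega> (n + 1)) - decay lam (ls ! 1 - s) x - Fvec lam fx s (ls ! 1) = DW s (ls ! 1) (\<omega> (n + 1))"
          using incr[of 0 "n + 1"] ls by simp
        then show ?thesis using ls by (simp add: d_def noise_def algebra_simps)
      qed
      have Y': "Y \<omega> = ppos ls x (e \<omega>) (d \<omega>) (Suc (n + 1))"
      proof -
        have eq: "(\<Sum>j = 1..n + 1. mexp ((t - \<tau> (n + 3 - j)) *\<^sub>R A) *v (F j + msqrt (I j (\<omega> (j - 1))) *v \<Delta> j (\<omega> (n + 1)))) =
          (\<Sum>j = 0 + 1..n + 1. decay lam (ls ! (n + 2 - 0) - ls ! (n + 3 - j))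
            (Fvec lam fx (ls ! (n + 2 - j)) (ls ! (n + 3 - j)) + vscale (e \<omega> (n + 2 - j)) (d \<omega> (n + 2 - j))))"
        proof (rule sum.cong)
          fix j assume j: "j \<in> {0 + 1..n + 1}"
          then have j': "j \<in> {1..n + 1}" "j - 1 \<le> n + 1" by auto
          show "mexp ((t - \<tau> (n + 3 - j)) *\<^sub>R A) *v (F j + msqrt (I j (\<omega> (j - 1))) *v \<Delta> j (\<omega> (n + 1))) =
            decay lam (ls ! (n + 2 - 0) - ls ! (n + 3 - j))
            (Fvec lam fx (ls ! (n + 2 - j)) (ls ! (n + 3 - j)) + vscale (e \<omega> (n + 2 - j)) (d \<omega> (n + 2 - j)))"
            unfolding sq[OF j'] D[OF j'(1)] F'[OF j'(1)] ek[OF j'(1)] unfolding A mexp_decay \<tau> diff_zero ls ..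
        qed simp
        have "Y \<omega> = ppos ls x (e \<omega>) (d \<omega>) (n + 2 - 0)"
          unfolding Y eq ppos_sum[OF le0] unfolding A mexp_decay \<tau> Z1 diff_zero ls ..
        moreover have "n + 2 - 0 = Suc (n + 1)" by simp
        ultimately show ?thesis by (simp only:)
      qed
      have Yj': "Yj j \<omega> = ppos ls x (e \<omega>) (d \<omega>) (n + 2 - j)" if j: "j \<in> {1..n + 1}" for j
      proof -
        have "(\<Sum>k = j + 1..n + 1. mexp ((\<tau> (n + 2 - j) - \<tau> (n + 3 - k)) *\<^sub>R A) *v (msqrt (I k (\<omega> (k - 1))) *v \<Delta> k (\<omega> (n + 1)) + F k)) =
          (\<Sum>k = j + 1..n + 1. decay lam (ls ! (n + 2 - j) - ls ! (n + 3 - k))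
            (Fvec lam fx (ls ! (n + 2 - k)) (ls ! (n + 3 - k)) + vscale (e \<omega> (n + 2 - k)) (d \<omega> (n + 2 - k))))"
        proof (rule sum.cong)
          fix k assume "k \<in> {j + 1..n + 1}"
          then have k': "k \<in> {1..n + 1}" "k - 1 \<le> n + 1" by auto
          show "mexp ((\<tau> (n + 2 - j) - \<tau> (n + 3 - k)) *\<^sub>R A) *v (msqrt (I k (\<omega> (k - 1))) *v \<Delta> k (\<omega> (n + 1)) + F k) =
            decay lam (ls ! (n + 2 - j) - ls ! (n + 3 - k))
            (Fvec lam fx (ls ! (n + 2 - k)) (ls ! (n + 3 - k)) + vscale (e \<omega> (n + 2 - k)) (d \<omega> (n + 2 - k)))"
            unfolding sq[OF k'] D[OF k'(1)] F'[OF k'(1)] ek[OF k'(1)] unfolding A mexp_decay \<tau> by (simp only: add.commute)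
        qed simp
        then show ?thesis
          using ppos_sum[of j n ls x "e \<omega>" "d \<omega>"] j unfolding Yj A mexp_decay \<tau> Z1 by simp
      qed
      let ?w = "\<lambda>c. Bx (ls ! c) (ppos ls x (e \<omega>) (d \<omega>) c) \<bullet> decay lam (ls ! Suc c - ls ! c) (vunscale (e \<omega> c) (d \<omega> c))"
      have "(\<Prod>j = 1..n + 1. (minvsqrt (I j (\<omega> (j - 1))) *v
          (mexp ((\<tau> (n + 3 - j) - \<tau> (n + 2 - j)) *\<^sub>R A) *v B (\<tau> (n + 2 - j)) (Yj j \<omega>))) \<bullet> \<Delta> j (\<omega> (n + 1))) =
        (\<Prod>j = 1..n + 1. ?w (n + 2 - j))"
      proof (rule prod.cong[OF refl])
        fix j assume j: "j \<in> {1..n + 1}"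
        then have j': "j - 1 \<le> n + 1" by auto
        have B': "B (ls ! (n + 2 - j)) y = Bx (ls ! (n + 2 - j)) y" for y
          using nth[OF jn(1)[OF j]] by (auto simp: Bx_def)
        show "(minvsqrt (I j (\<omega> (j - 1))) *v
          (mexp ((\<tau> (n + 3 - j) - \<tau> (n + 2 - j)) *\<^sub>R A) *v B (\<tau> (n + 2 - j)) (Yj j \<omega>))) \<bullet> \<Delta> j (\<omega> (n + 1)) = ?w (n + 2 - j)"
          unfolding isq[OF j j'] D[OF j] Yj'[OF j] ek[OF j] unfolding A mexp_decay \<tau> B' vunscale_decay_inner jn(2)[OF j] ..
      qed
      \<comment> \<open>The factors are put into the order of time; the missing factor at index 0 is
        then supplied as 1.\<close>
      also have "\<dots> = (\<Prod>c<n + 1. ?w (Suc c))"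
        by (rule prod.reindex_bij_witness[of _ "\<lambda>c. n + 1 - c" "\<lambda>j. n + 1 - j"]) (auto simp: Suc_diff_le)
      also have "\<dots> = (\<Prod>c<Suc (n + 1). if c = 0 then 1 else ?w c)"
        unfolding prod.lessThan_Suc_shift by simp
      finally show ?case unfolding Y' Psi_def by simp
    qed
  qed
  moreover have "length ls = Suc (Suc (n + 1))" by (simp add: len)
  ultimately show ?thesis unfolding e_def[abs_def] d_def[abs_def] by (simp only: chain_op_eq[OF ch])
qed

end

theorem theorem17:
  fixes M :: "'a measure"
    and W :: "real \<Rightarrow> 'a \<Rightarrow> real ^ 'n::{finite, linorder}"
    and L :: "real \<Rightarrow> 'a \<Rightarrow> real"
    and Z :: "real \<Rightarrow> real ^ 'n::{finite, linorder} \<Rightarrow> real \<Rightarrow> 'a \<Rightarrow> real ^ 'n::{finite, linorder}"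
    and A Q :: "real ^ 'n::{finite, linorder} ^ 'n::{finite, linorder}"
    and lam sig x :: "real ^ 'n::{finite, linorder}"
    and f :: "real \<Rightarrow> real ^ 'n::{finite, linorder}"
    and B B0 :: "real \<Rightarrow> real ^ 'n::{finite, linorder} \<Rightarrow> real ^ 'n::{finite, linorder}"
    and u0 :: "real ^ 'n::{finite, linorder} \<Rightarrow> real"
    and T \<alpha> \<gamma> s t :: real
    and n :: nat
  assumes "prob_space M" and "complete_measure M"
    and "0 < T"
    and "1 / 2 < \<alpha>" and "\<alpha> < 1" and "0 < \<gamma>"
    and "\<forall>i. 0 < lam $ i" and "mono (\<lambda>i. lam $ i)" and "A = - diag lam"
    and "\<forall>i. 0 < (sig $ i)\<^sup>2" and "Q = diag (\<chi> i. (sig $ i)\<^sup>2)"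
    and "brownian_motion M W"
    and "subordinator M L" and "strictly_stable M \<alpha> L"
    and "\<forall>u. char (distr M borel (L 1)) u =
           exp (- complex_of_real (\<gamma> powr \<alpha> * \<bar>u\<bar> powr \<alpha>) *
                (1 - \<i> * complex_of_real (tan (pi * \<alpha> / 2) * sgn u)))"
    and "prob_space.indep_set M (process_sigma M L) (process_sigma M W)"
    and "\<forall>r\<in>{0..T}. \<forall>y. sde_solution M W L A Q f T r y (Z r y)"
    and "bounded_borel u0"
    and "Cb0 3 T B0"
    and "continuous_on {0..T} f"
    and "B = (\<lambda>r y. B0 r y - f r)"
    and "1 \<le> n"
    and "0 \<le> s" and "s < t" and "t \<le> T"
  shows "viter M Z B u0 (n + 1) s t x =
    simplex_integral (n + 1) s t (\<lambda>rs.
      let \<tau> = (\<lambda>k. (s # rs @ [t]) ! k);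
          I = (\<lambda>j. IL L A Q (\<tau> (n + 2 - j)) (\<tau> (n + 3 - j)));
          F = (\<lambda>j. Fint A f (\<tau> (n + 2 - j)) (\<tau> (n + 3 - j)));
          \<Delta> = (\<lambda>j \<omega>. minvsqrt (I j \<omega>) *v
                 (Z s x (\<tau> (n + 3 - j)) \<omega>
                  - mexp ((\<tau> (n + 3 - j) - \<tau> (n + 2 - j)) *\<^sub>R A) *v Z s x (\<tau> (n + 2 - j)) \<omega>
                  - F j));
          Y = (\<lambda>\<omega>. (\<Sum>j = 1..n + 1. mexp ((t - \<tau> (n + 3 - j)) *\<^sub>R A) *v
                       (F j + msqrt (I j (\<omega> (j - 1))) *v \<Delta> j (\<omega> (n + 1))))
                 + mexp ((t - \<tau> 1) *\<^sub>R A) *v Z s x (\<tau> 1) (\<omega> (n + 1)));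
          Yj = (\<lambda>j \<omega>. (\<Sum>k = j + 1..n + 1. mexp ((\<tau> (n + 2 - j) - \<tau> (n + 3 - k)) *\<^sub>R A) *v
                       (msqrt (I k (\<omega> (k - 1))) *v \<Delta> k (\<omega> (n + 1)) + F k))
                 + mexp ((\<tau> (n + 2 - j) - \<tau> 1) *\<^sub>R A) *v Z s x (\<tau> 1) (\<omega> (n + 1)))
      in LINT \<omega>|Pi\<^sub>M {0..n + 1} (\<lambda>_. M).
           u0 (Y \<omega>) *
           (\<Prod>j = 1..n + 1.
              (minvsqrt (I j (\<omega> (j - 1))) *v
                 (mexp ((\<tau> (n + 3 - j) - \<tau> (n + 2 - j)) *\<^sub>R A) *v B (\<tau> (n + 2 - j)) (Yj j \<omega>)))
              \<bullet> \<Delta> j (\<omega> (n + 1))))"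
proof -
  \<comment> \<open>Only the squares of \<open>sig\<close> are positive by assumption; the square
    root of \<open>Q\<close> involves the absolute values.\<close>
  define sg where "sg = (\<chi> i. \<bar>sig $ i\<bar>)"
  have sg2: "(\<chi> i. (sg $ i)\<^sup>2) = (\<chi> i. (sig $ i)\<^sup>2)" by (simp add: sg_def vec_eq_iff)
  note asm = assms[unfolded bounded_borel_def]
  have "bounded_cont T B0" using assms(19) by (simp add: numeral_3_eq_3)
  then have cB0: "continuous_on ({0..T} \<times> UNIV) (\<lambda>(r, y). B0 r y)" and "bounded ((\<lambda>(r, y). B0 r y) ` ({0..T} \<times> UNIV))"
    unfolding bounded_cont_def by blast+
  then obtain KB0 where KB0: "norm (B0 r y) \<le> KB0" if "r \<in> {0..T}" for r y
    unfolding bounded_iff by fastforce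
  have "compact (f ` {0..T})" using assms(20) by (intro compact_continuous_image) auto
  then have "bounded (f ` {0..T})" by (rule compact_imp_bounded)
  then obtain Kf where Kf: "norm (f r) \<le> Kf" if "r \<in> {0..T}" for r
    unfolding bounded_iff by blast
  obtain Ku where Ku: "\<bar>u0 y\<bar> \<le> Ku" for y
    using asm(18) unfolding bounded_iff by (auto simp del: real_norm_def simp: real_norm_def[symmetric])
  interpret ou_setting M W L lam sg \<alpha> \<gamma> T t "KB0 + Kf" Ku f B u0 Z Q
  proof (intro ou_setting.intro stable_bm.intro subordinated_bm.intro stable_bm_axioms.intro ou_setting_axioms.intro)
    show "prob_space M" "complete_measure M" "brownian_motion M W" "subordinator M L"
      "prob_space.indep_set M (process_sigma M L) (process_sigma M W)" "strictly_stable M \<alpha> L"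
      "1 / 2 < \<alpha>" "\<alpha> < 1" "0 < \<gamma>" "t \<le> T" "continuous_on {0..T} f"
      by (fact assms)+
    show "0 < lam $ i" for i using assms(7) by blast
    show "0 < sg $ i" for i using assms(10) by (simp add: sg_def)
    show "char (distr M borel (L 1)) u = exp (- complex_of_real (\<gamma> powr \<alpha> * \<bar>u\<bar> powr \<alpha>) *
        (1 - \<i> * complex_of_real (tan (pi * \<alpha> / 2) * sgn u)))" for u using assms(15) by blast
    show "Q = diag (\<chi> i. (sg $ i)\<^sup>2)" unfolding sg2 by fact
    show "sde_solution M W L (- diag lam) Q f T r y (Z r y)" if "r \<in> {0..T}" for r y
      using assms(9,17) that by blast
    have "continuous_on ({0..T} \<times> UNIV) (\<lambda>p. (case p of (r, y) \<Rightarrow> B0 r y) - f (fst p))"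
      by (intro continuous_on_diff cB0 continuous_on_compose2[OF assms(20) continuous_on_fst[OF continuous_on_id]]) auto
    then show "continuous_on ({0..T} \<times> UNIV) (\<lambda>(r, y). B r y)"
      unfolding assms(21) case_prod_unfold .
    show "norm (B r y) \<le> KB0 + Kf" if "r \<in> {0..T}" for r y
      unfolding assms(21) using norm_triangle_ineq4[of "B0 r y" "f r"] KB0[OF that, of y] Kf[OF that] by linarith
    show "u0 \<in> borel_measurable borel" using asm(18) by blast
    show "\<bar>u0 y\<bar> \<le> Ku" for y by (rule Ku)
    show "0 < t" using assms(23,24) by simp
  qed
  have "viter M Z B u0 (n + 1) s t x = simplex_integral (n + 1) s t (\<lambda>rs. K.chain_op (s # rs @ [t]) x u0)"
    unfolding viter_eq[OF assms(23,24)] Suc_eq_plus1[symmetric] by (rule K.V_simplex[OF assms(23,24)])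
  also have "\<dots> = simplex_integral (n + 1) s t (\<lambda>rs.
      let \<tau> = (\<lambda>k. (s # rs @ [t]) ! k);
          I = (\<lambda>j. IL L A Q (\<tau> (n + 2 - j)) (\<tau> (n + 3 - j)));
          F = (\<lambda>j. Fint A f (\<tau> (n + 2 - j)) (\<tau> (n + 3 - j)));
          \<Delta> = (\<lambda>j \<omega>. minvsqrt (I j \<omega>) *v
                 (Z s x (\<tau> (n + 3 - j)) \<omega>
                  - mexp ((\<tau> (n + 3 - j) - \<tau> (n + 2 - j)) *\<^sub>R A) *v Z s x (\<tau> (n + 2 - j)) \<omega>
                  - F j));
          Y = (\<lambda>\<omega>. (\<Sum>j = 1..n + 1. mexp ((t - \<tau> (n + 3 - j)) *\<^sub>R A) *v
                       (F j + msqrt (I j (\<omega> (j - 1))) *v \<Delta> j (\<omega> (n + 1))))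
                 + mexp ((t - \<tau> 1) *\<^sub>R A) *v Z s x (\<tau> 1) (\<omega> (n + 1)));
          Yj = (\<lambda>j \<omega>. (\<Sum>k = j + 1..n + 1. mexp ((\<tau> (n + 2 - j) - \<tau> (n + 3 - k)) *\<^sub>R A) *v
                       (msqrt (I k (\<omega> (k - 1))) *v \<Delta> k (\<omega> (n + 1)) + F k))
                 + mexp ((\<tau> (n + 2 - j) - \<tau> 1) *\<^sub>R A) *v Z s x (\<tau> 1) (\<omega> (n + 1)))
      in LINT \<omega>|Pi\<^sub>M {0..n + 1} (\<lambda>_. M).
           u0 (Y \<omega>) *
           (\<Prod>j = 1..n + 1.
              (minvsqrt (I j (\<omega> (j - 1))) *v
                 (mexp ((\<tau> (n + 3 - j) - \<tau> (n + 2 - j)) *\<^sub>R A) *v B (\<tau> (n + 2 - j)) (Yj j \<omega>)))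
              \<bullet> \<Delta> j (\<omega> (n + 1))))"
    (is "_ = simplex_integral _ _ _ ?R")
  proof (rule simplex_integral_cong[OF _ assms(24)])
    \<comment> \<open>Strictly increasing times suffice here, so that the list is a chain and no
      covariance is degenerate.\<close>
    fix rs assume rs: "length rs = n + 1" "sorted_wrt (<) (s # rs @ [t])"
    have "s < r" "r < t" if "r \<in> set rs" for r
      using rs(2) that by (simp_all add: sorted_wrt_append)
    then have ch: "K.chain (s # rs @ [t])"
      unfolding K.chain_def using rs(2) assms(23-25) by (auto simp: less_imp_le) (meson less_imp_le order_trans)+
    have len: "length (s # rs @ [t]) = n + 3" using rs(1) by simp
    have nth: "(s # rs @ [t]) ! 0 = s" "(s # rs @ [t]) ! (n + 2) = t" using rs(1) by (simp_all add: nth_append)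
    show "K.chain_op (s # rs @ [t]) x u0 = ?R rs"
      unfolding Let_def by (rule integrand_eq[OF ch len nth assms(9) refl refl refl refl refl refl])
  qed
  finally show ?thesis .
qed

end
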